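(* For $G$ in any of the classical series $\Gamma_0(N),\Gamma^0(N),\Gamma_1(N),\Gamma^1(N)$, or $\Gamma(N)$ ($N\geq1$), the graph $Y_{\mathrm{comb}}(G)$ and a fundamental special polygon for the action of $G$ on $\mathbb{H}$ can be constructed in $$(\Gamma:G)\,O(P\log N)$$ operations. That is, for each of the five series there is an algorithm that, given $N$, constructs the graph $Y_{\mathrm{comb}}(G)$ and a special polygon $(P,\sigma)$ such that $P$ is a fundamental domain for $G$ acting on $\mathbb{H}$, and the number of elementary operations used is at most $(\Gamma:G)\cdot a_N$ for some sequence $(a_N)_{N\ge1}$ which is $O(P\log N)$.
   Context: $\Gamma=\mathrm{PSL}_2(\mathbb{Z})$ acts on the hyperbolic upper half-plane $\mathbb{H}$. $\Gamma_0(N),\Gamma_1(N),\Gamma^0(N),\Gamma^1(N),\Gamma(N)$ are the subgroups of $\Gamma$ such that after lifting to $\mathrm{SL}_2(\mathbb{Z})$ and reducing modulo $N$ one gets (up to sign) the groups of matrices of the form $\left(\begin{smallmatrix}a&b\\ 0&a^{-1}\end{smallmatrix}\right)$, $\left(\begin{smallmatrix}1&b\\ 0&1\end{smallmatrix}\right)$, $\left(\begin{smallmatrix}a&0\\ b&a^{-1}\end{smallmatrix}\right)$, $\left(\begin{smallmatrix}1&0\\ b&1\end{smallmatrix}\right)$, $\left(\begin{smallmatrix}1&0\\ 0&1\end{smallmatrix}\right)$ respectively, with $a,b\in\mathbb{Z}/N$, $a$ invertible. $(\Gamma:G)$ is the index. A sequence $(a_N)_{N\geq1}$ of real numbers is $O(P\log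 N)$ if there is a polynomial $p$ such that $|a_N|\leq|p(\log N)|$ for all $N\geq1$. An (elementary) operation is an integer addition, multiplication, or division with remainder. **The graph.** Let $G_0,G_1\subset\Gamma$ be the subgroups of order 2 and 3 generated by the classes of $\left(\begin{smallmatrix}0&-1\\ 1&0\end{smallmatrix}\right)$ and $u=\left(\begin{smallmatrix}0&1\\ -1&1\end{smallmatrix}\right)$. The graph $Y_{\mathrm{comb}}(G)$ has as vertices of type (0), respectively (1), the $G_0$-orbits, respectively $G_1$-orbits, in the right $\Gamma$-set $G\backslash\Gamma$; its edge set is $G\backslash\Gamma$, and the edge $x$ joins the $G_0$-orbit of $x$ with the $G_1$-orbit of $x$. Edges at a trivalent vertex of type (1) are cyclically ordered as $x,xu,xu^2$. The distinguished edge is the coset $G\in G\backslash\Gamma$. To construct $Y_{\mathrm{comb}}(G)$ means to specify: the sets of vertices of types (0) and (1); for each vertex, the vertices it is connected with and the number of connecting edges; the cyclic order of the edges at each trivalent vertex; and the distinguished edge. **Special polygon.** A special polygon is a convex hyperbolic polygon $P\subset\mathbb{H}$ with an involution $\sigma$ on the set of its edges such that (with $\rho=e^{\pi i/3}$): (1) every edge is a $\Gamma$-copy of the geodesic interval joining $\infty$ with $0$, $i$ or $\rho$; (2) every edge which is a $\Gamma$-copy of $(0,\infty)$ is paired under $\sigma$ with another such edge; (3) every edge $s$ which is a $\Gamma$-copy of $[i,\infty)$ is adjacent to another such edge $s'$, $\sigma$ interchanges $s,s'$, and the angle between them is $\pi$; (4) every edge $s$ which is a $\Gamma$-copy of $[\rho,\infty)$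 is adjacent to another such edge $s'$, $\sigma$ interchanges $s,s'$, and the internal angle between them is $2\pi/3$. To construct it means to produce its set of edges and the involution $\sigma$. *)

theory Defs
  imports
    "HOL-Analysis.Analysis"
    "HOL-Algebra.Generated_Groups"
    "HOL-Number_Theory.Cong"
    "HOL-Computational_Algebra.Polynomial"
begin

section \<open>The modular group and the classical congruence subgroups\<close>

definition mat2 :: "'a \<Rightarrow> 'a \<Rightarrow> 'a \<Rightarrow> 'a \<Rightarrow> 'a::zero ^ 2 ^ 2" where
  "mat2 a b c d = vector [vector [a, b], vector [c, d]]"

definition SL2Z :: "(int ^ 2 ^ 2) monoid" where
  "SL2Z = \<lparr>carrier = {A. det A = 1}, mult = (**), one = mat 1\<rparr>"

definition PSL2Z :: "(int ^ 2 ^ 2) set monoid" where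
  "PSL2Z = SL2Z Mod {mat 1, - mat 1}"

definition cls :: "int ^ 2 ^ 2 \<Rightarrow> (int ^ 2 ^ 2) set" where
  "cls A = {mat 1, - mat 1} #>\<^bsub>SL2Z\<^esub> A"

definition mat_cong :: "nat \<Rightarrow> int ^ 2 ^ 2 \<Rightarrow> int ^ 2 ^ 2 \<Rightarrow> bool" where
  "mat_cong N A B \<longleftrightarrow> (\<forall>i j. [A $ i $ j = B $ i $ j] (mod int N))"

text \<open>The classes of those matrices whose reduction modulo \<open>N\<close> is, up to sign, the reduction
  of a member of \<open>F\<close>. The members of \<open>F\<close> need not have determinant 1.\<close>

definition reduces_into :: "nat \<Rightarrow> (int ^ 2 ^ 2) set \<Rightarrow> (int ^ 2 ^ 2) set set" where
  "reduces_into N F =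
     cls ` {A \<in> carrier SL2Z. \<exists>B\<in>F. mat_cong N A B \<or> mat_cong N A (- B)}"

definition Gamma_lower0 :: "nat \<Rightarrow> (int ^ 2 ^ 2) set set" where
  "Gamma_lower0 N = reduces_into N {mat2 a b 0 a' | a a' b. [a * a' = 1] (mod int N)}"

definition Gamma_lower1 :: "nat \<Rightarrow> (int ^ 2 ^ 2) set set" where
  "Gamma_lower1 N = reduces_into N {mat2 1 b 0 1 | b. True}"

definition Gamma_upper0 :: "nat \<Rightarrow> (int ^ 2 ^ 2) set set" where
  "Gamma_upper0 N = reduces_into N {mat2 a 0 b a' | a a' b. [a * a' = 1] (mod int N)}"

definition Gamma_upper1 :: "nat \<Rightarrow> (int ^ 2 ^ 2) set set" where
  "Gamma_upper1 N = reduces_into N {mat2 1 0 b 1 | b. True}"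

definition Gamma_principal :: "nat \<Rightarrow> (int ^ 2 ^ 2) set set" where
  "Gamma_principal N = reduces_into N {mat2 1 0 0 1}"

definition index :: "(int ^ 2 ^ 2) set set \<Rightarrow> nat" where
  "index G = card (rcosets\<^bsub>PSL2Z\<^esub> G)"


section \<open>The graph\<close>

definition u_class :: "(int ^ 2 ^ 2) set" where
  "u_class = cls (mat2 0 1 (- 1) 1)"

definition G0 :: "(int ^ 2 ^ 2) set set" where
  "G0 = generate PSL2Z {cls (mat2 0 (- 1) 1 0)}"

definition G1 :: "(int ^ 2 ^ 2) set set" where
  "G1 = generate PSL2Z {u_class}"

definition edges :: "(int ^ 2 ^ 2) set set \<Rightarrow> (int ^ 2 ^ 2) set set set" where
  "edges G = rcosets\<^bsub>PSL2Z\<^esub> G"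

definition right_orbit ::
    "(int ^ 2 ^ 2) set set \<Rightarrow> (int ^ 2 ^ 2) set set \<Rightarrow> (int ^ 2 ^ 2) set set set" where
  "right_orbit H x = (\<lambda>h. x #>\<^bsub>PSL2Z\<^esub> h) ` H"

definition vertices0 :: "(int ^ 2 ^ 2) set set \<Rightarrow> (int ^ 2 ^ 2) set set set set" where
  "vertices0 G = right_orbit G0 ` edges G"

definition vertices1 :: "(int ^ 2 ^ 2) set set \<Rightarrow> (int ^ 2 ^ 2) set set set set" where
  "vertices1 G = right_orbit G1 ` edges G"

definition joining ::
    "(int ^ 2 ^ 2) set set \<Rightarrow> (int ^ 2 ^ 2) set set set \<Rightarrow> (int ^ 2 ^ 2) set set set
      \<Rightarrow> (int ^ 2 ^ 2) set set set" where
  "joining G v w = {x \<in> edges G. right_orbit G0 x = v \<and> right_orbit G1 x = w}"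


section \<open>Hyperbolic polygons\<close>

text \<open>The Riemann sphere, which contains the upper half-plane together with its boundary.\<close>

datatype sphere = Pt complex | Infty

fun mob :: "complex ^ 2 ^ 2 \<Rightarrow> sphere \<Rightarrow> sphere" where
  "mob M Infty = (if M $ 2 $ 1 = 0 then Infty else Pt (M $ 1 $ 1 / M $ 2 $ 1))"
| "mob M (Pt z) =
     (if M $ 2 $ 1 * z + M $ 2 $ 2 = 0 then Infty
      else Pt ((M $ 1 $ 1 * z + M $ 1 $ 2) / (M $ 2 $ 1 * z + M $ 2 $ 2)))"

definition act_SL :: "int ^ 2 ^ 2 \<Rightarrow> sphere \<Rightarrow> sphere" where
  "act_SL A = mob (map_matrix of_int A)"

definition act :: "(int ^ 2 ^ 2) set \<Rightarrow> sphere \<Rightarrow> sphere" where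
  "act g = act_SL (SOME A. A \<in> g)"

definition upper :: "complex set" where
  "upper = {z. Im z > 0}"

definition upper_closure :: "sphere set" where
  "upper_closure = insert Infty (Pt ` {z. Im z \<ge> 0})"

definition imag_axis :: "ereal \<Rightarrow> sphere" where
  "imag_axis t = (if t = \<infinity> then Infty else Pt (\<i> * of_real (real_of_ereal t)))"

text \<open>The geodesic interval joining two points of the half-plane or of its boundary; boundary
  points do not belong to it. Geodesics are the images of the imaginary half-axis under
  real Moebius transformations.\<close>

definition geod :: "sphere \<Rightarrow> sphere \<Rightarrow> complex set" where
  "geod p q = {z \<in> upper. \<exists>(M :: real ^ 2 ^ 2) s t r. det M = 1 \<and> 0 \<le> s \<and> s \<le> t \<and> t \<le> r \<and>
     mob (map_matrix of_real M) (imag_axis s) = p \<and>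
     mob (map_matrix of_real M) (imag_axis t) = Pt z \<and>
     mob (map_matrix of_real M) (imag_axis r) = q}"

text \<open>The direction at \<open>z\<close> of the geodesic towards \<open>p\<close>. The map \<open>w \<mapsto> (w - z) / (w - cnj z)\<close>
  sends the half-plane conformally onto the unit disc and \<open>z\<close> to the centre, so that geodesics
  issuing from \<open>z\<close> become radii.\<close>

fun direction :: "complex \<Rightarrow> sphere \<Rightarrow> complex" where
  "direction z Infty = 1"
| "direction z (Pt w) = (w - z) / (w - cnj z)"

definition angle :: "complex \<Rightarrow> sphere \<Rightarrow> sphere \<Rightarrow> real" where
  "angle z p q = \<bar>Arg (direction z p / direction z q)\<bar>"

text \<open>An edge is represented by the set of its two endpoints. \<open>side e\<close> is the geodesic
  interval itself.\<close>

definition side :: "sphere set \<Rightarrow> complex set" where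
  "side e = {z. \<exists>p q. e = {p, q} \<and> z \<in> geod p q}"

definition hyp_convex :: "complex set \<Rightarrow> bool" where
  "hyp_convex P \<longleftrightarrow> (\<forall>z\<in>P. \<forall>w\<in>P. geod (Pt z) (Pt w) \<subseteq> P)"

text \<open>The set of edges is part of the data, since two consecutive edges may meet at angle
  \<open>\<pi>\<close>. Because the last condition also applies to vertices at infinity, the edges form a
  closed contour.\<close>

definition convex_hyp_polygon :: "complex set \<Rightarrow> sphere set set \<Rightarrow> bool" where
  "convex_hyp_polygon P E \<longleftrightarrow>
     P \<subseteq> upper \<and> closedin (top_of_set upper) P \<and> interior P \<noteq> {} \<and> hyp_convex P \<and>
     finite E \<and>
     (\<forall>e\<in>E. \<exists>p\<in>upper_closure. \<exists>q\<in>upper_closure. p \<noteq> q \<and> e = {p, q}) \<and>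
     frontier P \<inter> upper = (\<Union>e\<in>E. side e) \<and>
     (\<forall>e\<in>E. \<forall>e'\<in>E. e \<noteq> e' \<longrightarrow> Pt ` (side e \<inter> side e') \<subseteq> e \<inter> e') \<and>
     (\<forall>v\<in>\<Union>E. card {e \<in> E. v \<in> e} = 2)"

definition copy_of :: "sphere set \<Rightarrow> sphere set \<Rightarrow> bool" where
  "copy_of b e \<longleftrightarrow> (\<exists>g\<in>carrier PSL2Z. e = act g ` b)"

definition free_base :: "sphere set" where
  "free_base = {Infty, Pt 0}"

definition even_base :: "sphere set" where
  "even_base = {Infty, Pt \<i>}"

definition odd_base :: "sphere set" where
  "odd_base = {Infty, Pt (cis (pi / 3))}"

text \<open>The edges \<open>e\<close> and \<open>e'\<close> are adjacent at a vertex in the half-plane and form the angle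
  \<open>\<alpha>\<close> there. In a convex polygon this is the internal angle, as the latter is at most \<open>\<pi>\<close>.\<close>

definition adjacent_at_angle :: "real \<Rightarrow> sphere set \<Rightarrow> sphere set \<Rightarrow> bool" where
  "adjacent_at_angle \<alpha> e e' \<longleftrightarrow>
     (\<exists>z\<in>upper. \<exists>p q. e = {Pt z, p} \<and> e' = {Pt z, q} \<and> angle z p q = \<alpha>)"

definition special_polygon ::
    "complex set \<Rightarrow> sphere set set \<Rightarrow> (sphere set \<Rightarrow> sphere set) \<Rightarrow> bool" where
  "special_polygon P E \<sigma> \<longleftrightarrow>
     convex_hyp_polygon P E \<and>
     (\<forall>e\<in>E. \<sigma> e \<in> E \<and> \<sigma> (\<sigma> e) = e) \<and>
     (\<forall>e\<in>E. copy_of free_base e \<or> copy_of even_base e \<or> copy_of odd_base e) \<and>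
     (\<forall>e\<in>E. copy_of free_base e \<longrightarrow> \<sigma> e \<noteq> e \<and> copy_of free_base (\<sigma> e)) \<and>
     (\<forall>s\<in>E. copy_of even_base s \<longrightarrow>
        (\<exists>s'\<in>E. s' \<noteq> s \<and> copy_of even_base s' \<and> \<sigma> s = s' \<and> \<sigma> s' = s \<and>
           adjacent_at_angle pi s s')) \<and>
     (\<forall>s\<in>E. copy_of odd_base s \<longrightarrow>
        (\<exists>s'\<in>E. s' \<noteq> s \<and> copy_of odd_base s' \<and> \<sigma> s = s' \<and> \<sigma> s' = s \<and>
           adjacent_at_angle (2 * pi / 3) s s'))"

definition fundamental_domain :: "(int ^ 2 ^ 2) set set \<Rightarrow> complex set \<Rightarrow> bool" where
  "fundamental_domain G P \<longleftrightarrow>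
     (\<Union>g\<in>G. act g ` Pt ` P) = Pt ` upper \<and>
     (\<forall>g\<in>G. \<forall>h\<in>G. g \<noteq> h \<longrightarrow>
        act g ` Pt ` interior P \<inter> act h ` Pt ` interior P = {})"


section \<open>Algorithms\<close>

text \<open>Programs work on finitely many unbounded arrays of integers; the cell \<open>i\<close> of the array
  \<open>a\<close> holds \<open>s a i\<close>, and a scalar variable is cell 0 of an array. Every executed step costs 1:
  each node of an evaluated expression, each assignment and each test. In particular the cost
  bounds the number of additions, multiplications and divisions with remainder; control flow and
  memory accesses are charged as well, so that no computation can be hidden in them.\<close>

type_synonym memory = "nat \<Rightarrow> int \<Rightarrow> int"

datatype aexp =
  Const int | Cell nat aexp | Add aexp aexp | Mul aexp aexp | Quot aexp aexp | Rem aexp aexp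

datatype bexp = Less aexp aexp | Equal aexp aexp | Neg bexp | Conj bexp bexp

datatype com =
  Skip | Store nat aexp aexp | Seq com com | Cond bexp com com | While bexp com

fun aval :: "aexp \<Rightarrow> memory \<Rightarrow> int" where
  "aval (Const k) s = k"
| "aval (Cell a e) s = s a (aval e s)"
| "aval (Add e f) s = aval e s + aval f s"
| "aval (Mul e f) s = aval e s * aval f s"
| "aval (Quot e f) s = aval e s div aval f s"
| "aval (Rem e f) s = aval e s mod aval f s"

fun bval :: "bexp \<Rightarrow> memory \<Rightarrow> bool" where
  "bval (Less e f) s \<longleftrightarrow> aval e s < aval f s"
| "bval (Equal e f) s \<longleftrightarrow> aval e s = aval f s"
| "bval (Neg b) s \<longleftrightarrow> \<not> bval b s"
| "bval (Conj b c) s \<longleftrightarrow> bval b s \<and> bval c s"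

fun acost :: "aexp \<Rightarrow> nat" where
  "acost (Const k) = 1"
| "acost (Cell a e) = 1 + acost e"
| "acost (Add e f) = 1 + acost e + acost f"
| "acost (Mul e f) = 1 + acost e + acost f"
| "acost (Quot e f) = 1 + acost e + acost f"
| "acost (Rem e f) = 1 + acost e + acost f"

fun bcost :: "bexp \<Rightarrow> nat" where
  "bcost (Less e f) = 1 + acost e + acost f"
| "bcost (Equal e f) = 1 + acost e + acost f"
| "bcost (Neg b) = 1 + bcost b"
| "bcost (Conj b c) = 1 + bcost b + bcost c"

text \<open>\<open>exec c s n t\<close>: started in \<open>s\<close>, the program \<open>c\<close> terminates in \<open>t\<close> at cost \<open>n\<close>.\<close>

inductive exec :: "com \<Rightarrow> memory \<Rightarrow> nat \<Rightarrow> memory \<Rightarrow> bool" where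
  Skip: "exec Skip s 1 s"
| Store: "exec (Store a i e) s (1 + acost i + acost e) (s(a := (s a)(aval i s := aval e s)))"
| Seq: "exec c1 s1 m s2 \<Longrightarrow> exec c2 s2 n s3 \<Longrightarrow> exec (Seq c1 c2) s1 (m + n) s3"
| CondTrue: "bval b s \<Longrightarrow> exec c1 s n t \<Longrightarrow> exec (Cond b c1 c2) s (1 + bcost b + n) t"
| CondFalse: "\<not> bval b s \<Longrightarrow> exec c2 s n t \<Longrightarrow> exec (Cond b c1 c2) s (1 + bcost b + n) t"
| WhileFalse: "\<not> bval b s \<Longrightarrow> exec (While b c) s (1 + bcost b) s"
| WhileTrue: "bval b s1 \<Longrightarrow> exec c s1 m s2 \<Longrightarrow> exec (While b c) s2 n s3 \<Longrightarrow>
    exec (While b c) s1 (1 + bcost b + m + n) s3"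

definition input :: "nat \<Rightarrow> memory" where
  "input N = (\<lambda>a i. if a = 0 \<and> i = 0 then int N else 0)"

text \<open>The memory describes the graph, with vertices of either type and edges numbered from 0.
  Array 1 holds the numbers of vertices of types (0) and (1), the number of edges and the
  distinguished edge. Arrays 2 to 4 hold, for the vertices of type (0), the number of neighbours,
  the neighbours (at most two for each vertex) and the numbers of connecting edges; arrays 5 to 7
  do the same for type (1) (at most three neighbours). Arrays 8 and 9 hold the endpoints of the
  edges and array 10 the successor in the cyclic order at a trivalent vertex of type (1).\<close>

definition graph_output :: "(int ^ 2 ^ 2) set set \<Rightarrow> memory \<Rightarrow> bool" where
  "graph_output G t \<longleftrightarrow>
     (\<exists>\<phi>0 \<phi>1 \<epsilon>.
        bij_betw \<phi>0 {0..<t 1 0} (vertices0 G) \<and>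
        bij_betw \<phi>1 {0..<t 1 1} (vertices1 G) \<and>
        bij_betw \<epsilon> {0..<t 1 2} (edges G) \<and>
        t 1 3 \<in> {0..<t 1 2} \<and> \<epsilon> (t 1 3) = G \<and>
        (\<forall>v\<in>{0..<t 1 0}.
           bij_betw (\<lambda>j. \<phi>1 (t 3 (2 * v + j))) {0..<t 2 v}
             {w \<in> vertices1 G. joining G (\<phi>0 v) w \<noteq> {}} \<and>
           (\<forall>j\<in>{0..<t 2 v}. t 3 (2 * v + j) \<in> {0..<t 1 1} \<and>
              t 4 (2 * v + j) = int (card (joining G (\<phi>0 v) (\<phi>1 (t 3 (2 * v + j))))))) \<and>
        (\<forall>w\<in>{0..<t 1 1}.
           bij_betw (\<lambda>j. \<phi>0 (t 6 (3 * w + j))) {0..<t 5 w}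
             {v \<in> vertices0 G. joining G v (\<phi>1 w) \<noteq> {}} \<and>
           (\<forall>j\<in>{0..<t 5 w}. t 6 (3 * w + j) \<in> {0..<t 1 0} \<and>
              t 7 (3 * w + j) = int (card (joining G (\<phi>0 (t 6 (3 * w + j))) (\<phi>1 w))))) \<and>
        (\<forall>x\<in>{0..<t 1 2}.
           t 8 x \<in> {0..<t 1 0} \<and> \<phi>0 (t 8 x) = right_orbit G0 (\<epsilon> x) \<and>
           t 9 x \<in> {0..<t 1 1} \<and> \<phi>1 (t 9 x) = right_orbit G1 (\<epsilon> x) \<and>
           (card (right_orbit G1 (\<epsilon> x)) = 3 \<longrightarrow>
              t 10 x \<in> {0..<t 1 2} \<and> \<epsilon> (t 10 x) = \<epsilon> x #>\<^bsub>PSL2Z\<^esub> u_class)))"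

text \<open>Cell 0 of array 11 holds the number of edges of the polygon. Edge \<open>k\<close> is the image
  of a base edge, of the kind given by array 12, under the matrix whose entries are in arrays 13
  to 16; its partner is in array 17.\<close>

definition edge_matrix :: "memory \<Rightarrow> int \<Rightarrow> int ^ 2 ^ 2" where
  "edge_matrix t k = mat2 (t 13 k) (t 14 k) (t 15 k) (t 16 k)"

definition polygon_edge :: "memory \<Rightarrow> int \<Rightarrow> sphere set" where
  "polygon_edge t k = act_SL (edge_matrix t k) `
     (if t 12 k = 0 then free_base else if t 12 k = 1 then even_base else odd_base)"

definition polygon_output :: "(int ^ 2 ^ 2) set set \<Rightarrow> memory \<Rightarrow> bool" where
  "polygon_output G t \<longleftrightarrow>
     (\<forall>k\<in>{0..<t 11 0}. t 12 k \<in> {0, 1, 2} \<and> edge_matrix t k \<in> carrier SL2Z \<and>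
        t 17 k \<in> {0..<t 11 0}) \<and>
     inj_on (polygon_edge t) {0..<t 11 0} \<and>
     (\<exists>P \<sigma>. special_polygon P (polygon_edge t ` {0..<t 11 0}) \<sigma> \<and>
        (\<forall>k\<in>{0..<t 11 0}. \<sigma> (polygon_edge t k) = polygon_edge t (t 17 k)) \<and>
        fundamental_domain G P)"

definition O_P_log :: "(nat \<Rightarrow> real) \<Rightarrow> bool" where
  "O_P_log a \<longleftrightarrow> (\<exists>p :: real poly. \<forall>N\<ge>1. \<bar>a N\<bar> \<le> \<bar>poly p (ln (real N))\<bar>)"

end

theory Submission
  imports Defs
begin

text \<open>The tile \<open>D = {0 \<le> Re z \<le> 1/2, \<bar>z - 1\<bar> \<ge> 1}\<close>, one of the three thirds with apex \<open>\<rho>\<close> of the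
  ideal triangle \<open>0, 1, \<infinity>\<close>, is a fundamental domain of the modular group. Representatives \<open>A\<close> of the cosets
  in \<open>G\<Gamma>\<close> are chosen so that the tiles \<open>A D\<close> form a convex polygon: starting from the identity, a tile is
  extended across its edge \<open>A(0,\<infinity>)\<close> by \<open>A S D\<close> whenever the coset of \<open>A S\<close> is new, and every new tile
  comes together with its translates under \<open>u\<close>, which are either three new cosets, filling an ideal
  triangle, or a single one, whose two sides at \<open>\<rho>\<close> become odd edges. The edges \<open>A(0,\<infinity>)\<close> left on the
  boundary are glued according to the coset of \<open>A S\<close>, and broken at \<open>A i\<close> if that is the coset of \<open>A\<close>.

  Cosets are recognized by an integer key, which serves as an address. For \<open>\<Gamma>\<^sub>1(N)\<close> and \<open>\<Gamma>(N)\<close> the key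
  is computed from residues in boundedly many operations; for \<open>\<Gamma>\<^sub>0(N)\<close> it requires Euclid's algorithm
  and hence \<open>O(log N)\<close> operations. Everything else takes boundedly many operations per coset.\<close>

section \<open>The modular group\<close>

text \<open>Convexity and the closed contour both come from one invariant: the polygon is the
  intersection of the inner sides of its boundary components, and the outer regions of these
  components, taken together with their ideal arcs, are pairwise disjoint. Whatever is added inside
  one outer region then lies on the inner side of all other components, so growth is a local matter
  and edges cannot cross. The geometry is done in the coordinates \<open>nrm z\<close> and
  \<open>Re z\<close>: geodesics are linear conditions on them, and the modular group acts linearly
  up to a positive factor, so that inclusions of regions reduce to inequalities.

  The index is not known to the program. Keys are sparse addresses, but the arrays are unbounded and
  start at 0, so a table needs neither a size nor an initialization; the search stops because
  distinct tiles have distinct cosets and there are only finitely many keys. Each coset costs a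
  constant plus a bounded number of key computations, which makes the bound affine in
  \<open>ln N\<close>.\<close>

lemma mat2_nth [simp]:
  "mat2 a b c d $ 1 $ 1 = a" "mat2 a b c d $ 1 $ 2 = b"
  "mat2 a b c d $ 2 $ 1 = c" "mat2 a b c d $ 2 $ 2 = d"
  by (simp_all add: mat2_def vector_2)

lemma mat2_eq_iff:
  fixes A B :: "'a::zero ^ 2 ^ 2"
  shows "A = B \<longleftrightarrow> A$1$1 = B$1$1 \<and> A$1$2 = B$1$2 \<and> A$2$1 = B$2$1 \<and> A$2$2 = B$2$2"
  by (auto simp: vec_eq_iff forall_2)

lemma mat2_eta: "mat2 (A$1$1) (A$1$2) (A$2$1) (A$2$2) = A"
  by (simp add: mat2_eq_iff)

lemma mat2_inject [simp]: "mat2 a b c d = mat2 a' b' c' d' \<longleftrightarrow> a = a' \<and> b = b' \<and> c = c' \<and> d = d'"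
  by (simp add: mat2_eq_iff)

lemma mat2_mult [simp]:
  fixes a :: "'a::semiring_1"
  shows "mat2 a b c d ** mat2 a' b' c' d' =
    mat2 (a*a' + b*c') (a*b' + b*d') (c*a' + d*c') (c*b' + d*d')"
  by (simp add: mat2_eq_iff matrix_matrix_mult_def sum_2)

lemma mat2_one: "mat 1 = mat2 1 0 0 (1::'a::zero_neq_one)"
  by (simp add: mat2_eq_iff mat_def)

lemma mat2_uminus [simp]: "- mat2 a b c d = mat2 (-a) (-b) (-c) (-d :: 'a::group_add)"
  by (simp add: mat2_eq_iff)

lemma mat2_det [simp]: "det (mat2 a b c d) = a * d - b * (c::'a::comm_ring_1)"
  by (simp add: det_2)

type_synonym imat = "int ^ 2 ^ 2"

lemma mat2_cases [case_names mat2, cases type]: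
  fixes A :: "'a::zero ^ 2 ^ 2"
  obtains a b c d where "A = mat2 a b c d"
  using mat2_eta[of A] by metis

abbreviation SL :: "imat set" where "SL \<equiv> carrier SL2Z"

lemma SL_iff: "A \<in> SL \<longleftrightarrow> det A = 1"
  by (simp add: SL2Z_def)

lemma mat2_SL [simp]: "mat2 a b c d \<in> SL \<longleftrightarrow> a * d - b * c = 1"
  by (simp add: SL_iff)

lemma SL_mult [simp, intro]: "A \<in> SL \<Longrightarrow> B \<in> SL \<Longrightarrow> A ** B \<in> SL"
  by (simp add: SL_iff det_mul)

lemma SL_one [simp, intro]: "mat 1 \<in> SL"
  by (simp add: SL_iff)

lemma SL_uminus [simp]: "- A \<in> SL \<longleftrightarrow> A \<in> SL"
  by (cases A rule: mat2_cases) simp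

text \<open>The adjugate. It is the inverse on \<open>SL\<close>, but being defined by a formula for
  all matrices it satisfies \<open>adj_adj\<close> and \<open>adj_mult\<close> without
  hypotheses.\<close>

definition adj :: "imat \<Rightarrow> imat" where
  "adj A = mat2 (A$2$2) (- (A$1$2)) (- (A$2$1)) (A$1$1)"

lemma adj_mat2 [simp]: "adj (mat2 a b c d) = mat2 d (-b) (-c) a"
  by (simp add: adj_def)

lemma adj_SL [simp]: "adj A \<in> SL \<longleftrightarrow> A \<in> SL"
  by (cases A rule: mat2_cases) (simp add: mult.commute)

lemma adj_adj [simp]: "adj (adj A) = A"
  by (cases A rule: mat2_cases) simp

lemma adj_mult: "adj (A ** B) = adj B ** adj A"
  by (cases A rule: mat2_cases, cases B rule: mat2_cases) (simp add: algebra_simps)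

lemma adj_right [simp]: "A \<in> SL \<Longrightarrow> A ** adj A = mat 1"
  by (cases A rule: mat2_cases) (simp add: mat2_one algebra_simps)

lemma adj_left [simp]: "A \<in> SL \<Longrightarrow> adj A ** A = mat 1"
  by (cases A rule: mat2_cases) (simp add: mat2_one algebra_simps)

lemma mat_minus_left [simp]: "(- (A::imat)) ** B = - (A ** (B::imat))"
  by (cases A rule: mat2_cases, cases B rule: mat2_cases) simp

lemma mat_minus_right [simp]: "(A::imat) ** (- B) = - (A ** (B::imat))"
  by (cases A rule: mat2_cases, cases B rule: mat2_cases) simp

lemma neg_mat_neq [simp]: "A \<in> SL \<Longrightarrow> A \<noteq> - A"
  by (cases A rule: mat2_cases) auto

section \<open>The groups SL2(Z) and PSL2(Z), with classes written as pairs of opposite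
  matrices\<close>

interpretation SL: group SL2Z
proof (rule groupI)
  fix A assume "A \<in> SL"
  then show "\<exists>B\<in>SL. B \<otimes>\<^bsub>SL2Z\<^esub> A = \<one>\<^bsub>SL2Z\<^esub>"
    using adj_left[of A] adj_SL[of A] by (intro bexI[of _ "adj A"]) (auto simp: SL2Z_def simp del: adj_SL)
qed (auto simp: SL2Z_def det_mul matrix_mul_assoc)

lemma SL_mult_eq [simp]: "A \<otimes>\<^bsub>SL2Z\<^esub> B = A ** B" and SL_one_eq [simp]: "\<one>\<^bsub>SL2Z\<^esub> = mat 1"
  by (simp_all add: SL2Z_def)

lemma SL_inv [simp]: "A \<in> SL \<Longrightarrow> inv\<^bsub>SL2Z\<^esub> A = adj A"
  by (rule SL.inv_equality) auto

lemma center_normal: "{mat 1, - mat 1} \<lhd> SL2Z"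
proof (rule SL.normal_invI)
  show "subgroup {mat 1, - mat 1} SL2Z"
    by (rule SL.subgroupI) (auto simp: mat2_one)
qed auto

interpretation PSL: group PSL2Z
  unfolding PSL2Z_def by (rule normal.factorgroup_is_group[OF center_normal])

lemma cls_eq: "cls A = {A, - A}"
  by (auto simp: cls_def r_coset_def)

lemma mem_cls: "B \<in> cls A \<longleftrightarrow> B = A \<or> B = - A"
  by (auto simp: cls_eq)

lemma cls_eq_iff: "cls A = cls B \<longleftrightarrow> A = B \<or> A = - B"
  by (auto simp: cls_eq doubleton_eq_iff)

lemma cls_minus [simp]: "cls (- A) = cls A"
  by (auto simp: cls_eq)

lemma PSL_carrier: "carrier PSL2Z = cls ` SL"
  by (auto simp: PSL2Z_def FactGroup_def RCOSETS_def cls_def)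

lemma cls_carrier [simp, intro]: "A \<in> SL \<Longrightarrow> cls A \<in> carrier PSL2Z"
  by (simp add: PSL_carrier)

lemma cls_mult [simp]: "A \<in> SL \<Longrightarrow> B \<in> SL \<Longrightarrow> cls A \<otimes>\<^bsub>PSL2Z\<^esub> cls B = cls (A ** B)"
  unfolding PSL2Z_def cls_def using normal.rcos_sum[OF center_normal] by simp

lemma cls_one: "\<one>\<^bsub>PSL2Z\<^esub> = cls (mat 1)"
  by (auto simp: PSL2Z_def FactGroup_def cls_eq)

lemma cls_inv [simp]: "A \<in> SL \<Longrightarrow> inv\<^bsub>PSL2Z\<^esub> (cls A) = cls (adj A)"
  by (rule PSL.inv_equality) (auto simp: cls_one)

text \<open>\<open>mS\<close> fixes i and exchanges 0 and infinity; \<open>mU\<close> fixes \<rho>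
  and permutes infinity, 0, 1 cyclically.\<close>

definition mS :: imat where "mS = mat2 0 (-1) 1 0"
definition mU :: imat where "mU = mat2 0 1 (-1) 1"

lemma mS_SL [simp]: "mS \<in> SL" and mU_SL [simp]: "mU \<in> SL"
  by (simp_all add: mS_def mU_def)

lemma mS_mS: "mS ** mS = - mat 1"
  by (simp add: mS_def mat2_one)

lemma mU_cube: "mU ** (mU ** mU) = - mat 1"
  by (simp add: mU_def mat2_one)

lemma mult_mS_mS [simp]: "((A::imat) ** mS) ** mS = - A"
  by (cases A rule: mat2_cases) (simp add: mS_def)

lemma mult_mU_cube [simp]: "(((A::imat) ** mU) ** mU) ** mU = - A"
  by (cases A rule: mat2_cases) (simp add: mU_def)

text \<open>Generation of the modular group, as an induction principle: \<open>mat2 1 1 0 1 = u\<^sup>2 S\<close>, and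
  right multiplication by powers of this matrix and by \<open>S\<close> performs Euclid's algorithm on the
  bottom row.\<close>

lemma SL_induct:
  assumes "A \<in> SL"
    and one: "P (mat 1)"
    and minus: "\<And>A. A \<in> SL \<Longrightarrow> P A \<Longrightarrow> P (- A)"
    and S: "\<And>A. A \<in> SL \<Longrightarrow> P A \<Longrightarrow> P (A ** mS)"
    and U: "\<And>A. A \<in> SL \<Longrightarrow> P A \<Longrightarrow> P (A ** mU)"
  shows "P A"
proof -
  have P_uminus: "P (- A) \<Longrightarrow> A \<in> SL \<Longrightarrow> P A" for A
    using minus[of "- A"] by simp
  have S_iff: "P (A ** mS) \<longleftrightarrow> P A" if "A \<in> SL" for A
    using S[OF that] S[of "A ** mS"] P_uminus that by fastforce
  \<comment> \<open>For the converse apply \<open>mU\<close> twice more: its cube is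
    \<open>- mat 1\<close>, and signs are removed by \<open>P_uminus\<close>.\<close>
  have U_iff: "P (A ** mU) \<longleftrightarrow> P A" if "A \<in> SL" for A
    using U[OF that] U[of "A ** mU"] U[of "(A ** mU) ** mU"] P_uminus that by fastforce
  define T :: "int \<Rightarrow> imat" where "T = (\<lambda>k. mat2 1 k 0 1)"
  have T_SL: "T k \<in> SL" for k by (simp add: T_def)
  have T1: "P (A ** T 1) \<longleftrightarrow> P A" if "A \<in> SL" for A
  proof -
    have "A ** T 1 = ((A ** mU) ** mU) ** mS"
      by (cases A rule: mat2_cases) (simp add: T_def mU_def mS_def)
    then show ?thesis using that by (simp add: S_iff U_iff)
  qed
  have T_nat: "P (A ** T (int k)) \<longleftrightarrow> P A" if "A \<in> SL" for A k
  proof (induction k)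
    case 0 then show ?case by (simp add: T_def flip: mat2_one)
  next
    case (Suc k)
    have "A ** T (int (Suc k)) = (A ** T (int k)) ** T 1"
      by (cases A rule: mat2_cases) (simp add: T_def algebra_simps)
    then show ?case using Suc T1[of "A ** T (int k)"] that T_SL by simp
  qed
  have T_iff: "P (A ** T k) \<longleftrightarrow> P A" if "A \<in> SL" for A k
  proof (cases "k \<ge> 0")
    case True then show ?thesis using T_nat[OF that, of "nat k"] by simp
  next
    case False
    have "(A ** T k) ** T (int (nat (- k))) = A"
      using False by (cases A rule: mat2_cases) (simp add: T_def)
    then show ?thesis using T_nat[of "A ** T k" "nat (- k)"] that T_SL by simp
  qed
  show ?thesis using \<open>A \<in> SL\<close>
  proof (induction "nat \<bar>A$2$1\<bar>" arbitrary: A rule: less_induct)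
    case less
    obtain a b c d where A: "A = mat2 a b c d" by (cases A rule: mat2_cases)
    show ?case
    proof (cases "c = 0")
      case True
      then have "a * d = 1" using less.prems A by simp
      then have "a = 1 \<and> d = 1 \<or> a = -1 \<and> d = -1" by (simp add: zmult_eq_1_iff)
      then have "A = mat 1 ** T b \<or> A = - (mat 1 ** T (-b))"
        using A True by (auto simp: T_def)
      then show ?thesis using T_iff[of "mat 1"] one minus T_SL by force
    next
      case False
      let ?B = "(A ** T (- (d div c))) ** mS"
      have "?B$2$1 = d mod c"
        by (simp add: A T_def mS_def minus_div_mult_eq_mod [symmetric] algebra_simps)
      moreover have "\<bar>d mod c\<bar> < \<bar>c\<bar>" using False by (rule abs_mod_less)
      ultimately have "P ?B" using less T_SL by (intro less.hyps) (auto simp: A)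
      then show ?thesis using less.prems T_SL by (simp add: S_iff T_iff)
    qed
  qed
qed

section \<open>The action on the sphere\<close>

text \<open>The point with homogeneous coordinates \<open>n : w\<close>. In these coordinates
  \<open>mob\<close> is linear, so the composition law \<open>mob_mult\<close> needs no cases for
  poles and infinity.\<close>

definition hom :: "complex \<Rightarrow> complex \<Rightarrow> sphere" where
  "hom n w = (if w = 0 then Infty else Pt (n / w))"

lemma mob_hom:
  assumes "det M \<noteq> 0" "n \<noteq> 0 \<or> w \<noteq> 0"
  shows "mob M (hom n w) = hom (M$1$1 * n + M$1$2 * w) (M$2$1 * n + M$2$2 * w)"
proof (cases "w = 0")
  case True
  with assms show ?thesis by (simp add: hom_def)
next
  case False
  then have "M$2$1 * (n / w) + M$2$2 = (M$2$1 * n + M$2$2 * w) / w"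
    "M$1$1 * (n / w) + M$1$2 = (M$1$1 * n + M$1$2 * w) / w"
    by (simp_all add: field_simps)
  then show ?thesis using False by (simp add: hom_def)
qed

lemma hom_cases: obtains n w where "p = hom n w" "n \<noteq> 0 \<or> w \<noteq> 0"
proof (cases p)
  case (Pt z)
  then show ?thesis by (intro that[of z 1]) (simp_all add: hom_def)
next
  case Infty
  then show ?thesis by (intro that[of 1 0]) (simp_all add: hom_def)
qed

lemma mob_mult:
  assumes "det M \<noteq> 0" "det M' \<noteq> 0"
  shows "mob (M ** M') p = mob M (mob M' p)"
proof -
  obtain a b c d where M: "M = mat2 a b c d" by (cases M rule: mat2_cases)
  obtain a' b' c' d' where M': "M' = mat2 a' b' c' d'" by (cases M' rule: mat2_cases)
  obtain n w where p: "p = hom n w" "n \<noteq> 0 \<or> w \<noteq> 0" by (rule hom_cases)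
  have det: "a' * d' - b' * c' \<noteq> 0" using assms M' by simp
  have "a' * n + b' * w \<noteq> 0 \<or> c' * n + d' * w \<noteq> 0"
  proof (rule ccontr)
    assume "\<not> ?thesis"
    then have "a' * n + b' * w = 0" "c' * n + d' * w = 0" by auto
    moreover have "(a' * d' - b' * c') * n = d' * (a' * n + b' * w) - b' * (c' * n + d' * w)"
      "(a' * d' - b' * c') * w = a' * (c' * n + d' * w) - c' * (a' * n + b' * w)"
      by (simp_all add: algebra_simps)
    ultimately show False using det p(2) by auto
  qed
  moreover have "det (M ** M') \<noteq> 0" using assms by (simp add: det_mul)
  ultimately show ?thesis using assms p(2)
    by (simp add: p(1) mob_hom M M' del: mat2_det) (simp add: algebra_simps)
qed

lemma map_matrix_mat2 [simp]: "map_matrix f (mat2 a b c d) = mat2 (f a) (f b) (f c) (f d)"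
  by (simp add: mat2_eq_iff map_matrix_def)

lemma map_matrix_of_int_mult: "map_matrix of_int (A ** B) =
    map_matrix of_int (A::imat) ** (map_matrix of_int B :: 'a::ring_1 ^ 2 ^ 2)"
  by (cases A rule: mat2_cases, cases B rule: mat2_cases) simp

lemma map_matrix_of_real_mult: "map_matrix of_real (A ** B) =
    map_matrix of_real (A :: real ^ 2 ^ 2) ** (map_matrix of_real B :: complex ^ 2 ^ 2)"
  by (cases A rule: mat2_cases, cases B rule: mat2_cases) simp

lemma det_map_of_int: "det (map_matrix of_int (A::imat) :: 'a::comm_ring_1 ^ 2 ^ 2) = of_int (det A)"
  by (cases A rule: mat2_cases) simp

lemma det_map_of_real: "det (map_matrix of_real (A :: real ^ 2 ^ 2) :: complex ^ 2 ^ 2) = of_real (det A)"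
  by (cases A rule: mat2_cases) simp

lemma act_mult: "A \<in> SL \<Longrightarrow> B \<in> SL \<Longrightarrow> act_SL (A ** B) p = act_SL A (act_SL B p)"
  by (simp add: act_SL_def map_matrix_of_int_mult mob_mult det_map_of_int SL_iff)

lemma act_one [simp]: "act_SL (mat 1) p = p"
  by (cases p) (simp_all add: act_SL_def mat2_one)

lemma act_minus [simp]: "act_SL (- A) = act_SL A"
proof
  fix p
  obtain a b c d where A: "A = mat2 a b c d" by (cases A rule: mat2_cases)
  have neg: "(- x) * z + (- y) = - (x * z + y)" for x y z :: complex by simp
  show "act_SL (- A) p = act_SL A p"
  proof (cases p)
    case (Pt z)
    have "act_SL (- A) (Pt z) = (if - (of_int c * z + of_int d) = 0 then Infty
        else Pt (- (of_int a * z + of_int b) / - (of_int c * z + of_int d)))"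
      by (simp only: A act_SL_def mat2_uminus map_matrix_mat2 mob.simps mat2_nth of_int_minus neg)
    also have "\<dots> = act_SL A (Pt z)" by (simp only: A act_SL_def map_matrix_mat2 mob.simps mat2_nth
        minus_divide_divide neg_equal_0_iff_equal)
    finally show ?thesis by (simp add: Pt)
  qed (simp add: A act_SL_def)
qed

lemma act_adj [simp]: "A \<in> SL \<Longrightarrow> act_SL A (act_SL (adj A) p) = p"
  "A \<in> SL \<Longrightarrow> act_SL (adj A) (act_SL A p) = p"
  by (simp_all flip: act_mult)

lemma act_inj: "A \<in> SL \<Longrightarrow> inj (act_SL A)"
  by (metis act_adj(2) injI)

lemma act_eq_iff [simp]: "A \<in> SL \<Longrightarrow> act_SL A p = act_SL A q \<longleftrightarrow> p = q"
  by (metis act_adj(2))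

lemma mem_act_image: "A \<in> SL \<Longrightarrow> p \<in> act_SL A ` Y \<longleftrightarrow> act_SL (adj A) p \<in> Y"
  by (metis act_adj image_iff)

lemma act_image_mult: "A \<in> SL \<Longrightarrow> B \<in> SL \<Longrightarrow> act_SL (A ** B) ` Y = act_SL A ` act_SL B ` Y"
  by (simp add: image_image act_mult)

lemma act_image_mono: "A \<in> SL \<Longrightarrow> act_SL A ` Y \<subseteq> act_SL A ` Z \<longleftrightarrow> Y \<subseteq> Z"
  by (simp add: inj_image_subset_iff act_inj)

lemma act_cls: "A \<in> SL \<Longrightarrow> act (cls A) = act_SL A"
proof -
  have "(SOME B. B \<in> cls A) \<in> cls A" by (rule someI[of _ A]) (simp add: mem_cls)
  then show "act (cls A) = act_SL A" by (auto simp: act_def mem_cls)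
qed

section \<open>The action on the open half-plane, in coordinates\<close>

definition mz :: "imat \<Rightarrow> complex \<Rightarrow> complex" where
  "mz A z = (of_int (A$1$1) * z + of_int (A$1$2)) / (of_int (A$2$1) * z + of_int (A$2$2))"

text \<open>Together with \<open>Re\<close> this replaces the usual coordinates of the half-plane. A
  matrix acts on the triple of \<open>nrm z\<close>, \<open>Re z\<close> and 1 linearly, up to
  division by \<open>den A z\<close>, the square of the modulus of c z + d.\<close>

definition nrm :: "complex \<Rightarrow> real" where "nrm z = (Re z)\<^sup>2 + (Im z)\<^sup>2"

definition den :: "imat \<Rightarrow> complex \<Rightarrow> real" where
  "den A z = (of_int (A$2$1))\<^sup>2 * nrm z + 2 * of_int (A$2$1 * A$2$2) * Re z + (of_int (A$2$2))\<^sup>2"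

lemma lin_nonzero:
  assumes "Im z > 0" "c \<noteq> 0 \<or> d \<noteq> 0"
  shows "of_real c * z + of_real d \<noteq> 0"
proof
  assume "of_real c * z + of_real d = 0"
  then have "Im (of_real c * z + of_real d) = 0" "Re (of_real c * z + of_real d) = 0" by auto
  with assms show False by auto
qed

lemma cmod_lin: "(cmod (of_real c * z + of_real d))\<^sup>2 = c\<^sup>2 * nrm z + 2 * (c * d) * Re z + d\<^sup>2"
  unfolding cmod_power2 nrm_def by (simp add: power2_eq_square algebra_simps)

lemma den_eq: "den A z = (cmod (of_int (A$2$1) * z + of_int (A$2$2)))\<^sup>2"
  using cmod_lin[of "of_int (A$2$1)" z "of_int (A$2$2)"] by (simp add: den_def)

lemma bottom_nonzero: "A \<in> SL \<Longrightarrow> A$2$1 \<noteq> 0 \<or> A$2$2 \<noteq> 0"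
  by (auto simp: SL_iff det_2)

lemma lin_int_nonzero:
  assumes "A \<in> SL" "z \<in> upper"
  shows "of_int (A$2$1) * z + of_int (A$2$2) \<noteq> 0"
  using lin_nonzero[of z "of_int (A$2$1)" "of_int (A$2$2)"] bottom_nonzero[OF assms(1)] assms(2)
  by (simp add: upper_def)

lemma den_pos: "A \<in> SL \<Longrightarrow> z \<in> upper \<Longrightarrow> den A z > 0"
  using lin_int_nonzero by (simp add: den_eq)

lemma act_Pt: "A \<in> SL \<Longrightarrow> z \<in> upper \<Longrightarrow> act_SL A (Pt z) = Pt (mz A z)"
  using lin_int_nonzero[of A z] by (simp add: act_SL_def mz_def map_matrix_def)

lemma divide_eq_cnj: "n / w = n * cnj w / of_real ((cmod w)\<^sup>2)"
  by (metis complex_div_cnj complex_norm_square)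

lemma Im_mz: "A \<in> SL \<Longrightarrow> Im (mz A z) = Im z / den A z"
proof -
  assume "A \<in> SL"
  then obtain a b c d where A: "A = mat2 a b c d" "a * d - b * c = 1"
    by (cases A rule: mat2_cases) (simp add: SL_iff)
  have "real_of_int a * real_of_int d - real_of_int b * real_of_int c = 1"
    using A(2) by (metis of_int_1 of_int_diff of_int_mult)
  then have "real_of_int d * (real_of_int a * Im z) - real_of_int b * (real_of_int c * Im z) = Im z"
    by (metis (no_types, opaque_lifting) left_diff_distrib mult.assoc mult.commute mult_1)
  then show ?thesis unfolding mz_def den_eq divide_eq_cnj[of "_ + _"]
    by (simp add: A Im_divide_of_real algebra_simps)
qed

lemma Re_mz: "Re (mz A z) =
  (of_int (A$1$1 * A$2$1) * nrm z + of_int (A$1$1 * A$2$2 + A$1$2 * A$2$1) * Re z + of_int (A$1$2 * A$2$2)) / den A z"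
  unfolding mz_def den_eq divide_eq_cnj[of "_ + _"]
  by (simp add: Re_divide_of_real nrm_def power2_eq_square algebra_simps)

lemma nrm_cmod: "nrm z = (cmod z)\<^sup>2"
  by (simp add: nrm_def cmod_power2)

lemma nrm_mz: "nrm (mz A z) =
  ((of_int (A$1$1))\<^sup>2 * nrm z + 2 * of_int (A$1$1 * A$1$2) * Re z + (of_int (A$1$2))\<^sup>2) / den A z"
  using cmod_lin[of "of_int (A$1$1)" z "of_int (A$1$2)"]
  unfolding nrm_cmod[of "mz A z"] unfolding mz_def den_eq by (simp add: norm_divide power_divide)

lemma mz_upper [simp]: "A \<in> SL \<Longrightarrow> z \<in> upper \<Longrightarrow> mz A z \<in> upper"
  using den_pos[of A z] by (simp add: upper_def Im_mz)

lemma mz_mult: "A \<in> SL \<Longrightarrow> B \<in> SL \<Longrightarrow> z \<in> upper \<Longrightarrow> mz (A ** B) z = mz A (mz B z)"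
  using act_mult[of A B "Pt z"] by (simp add: act_Pt)

lemma mz_adj [simp]: "A \<in> SL \<Longrightarrow> z \<in> upper \<Longrightarrow> mz A (mz (adj A) z) = z"
  "A \<in> SL \<Longrightarrow> z \<in> upper \<Longrightarrow> mz (adj A) (mz A z) = z"
  using act_adj[of A "Pt z"] by (simp_all add: act_Pt)

lemma nrm_pos: "z \<in> upper \<Longrightarrow> nrm z > 0"
  by (auto simp: nrm_def upper_def intro: add_nonneg_pos)

lemma continuous_mz [continuous_intros]: "A \<in> SL \<Longrightarrow> continuous_on upper (mz A)"
  unfolding mz_def using lin_int_nonzero by (intro continuous_intros) auto

lemma open_upper: "open upper"
  unfolding upper_def by (simp add: open_halfspace_Im_gt)

lemma open_mz_vimage:
  assumes "A \<in> SL" "open V" shows "open {z \<in> upper. mz A z \<in> V}"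
  using continuous_open_preimage[OF continuous_mz[OF assms(1)] open_upper assms(2)]
  by (simp add: vimage_def Int_def)

definition UpS :: "sphere set" where "UpS = Pt ` upper"
definition Bd :: "sphere set" where "Bd = insert Infty (Pt ` \<real>)"

lemma Pt_UpS [simp]: "Pt z \<in> UpS \<longleftrightarrow> z \<in> upper" and Infty_UpS [simp]: "Infty \<notin> UpS"
  by (auto simp: UpS_def)

lemma Pt_Bd [simp]: "Pt z \<in> Bd \<longleftrightarrow> z \<in> \<real>" and Infty_Bd [simp]: "Infty \<in> Bd"
  by (auto simp: Bd_def)

lemma upper_not_real: "z \<in> upper \<Longrightarrow> z \<notin> \<real>"
  by (auto simp: upper_def complex_is_Real_iff)

lemma act_UpS [simp]: "A \<in> SL \<Longrightarrow> act_SL A ` UpS = UpS"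
proof -
  assume A: "A \<in> SL"
  have "act_SL B ` UpS \<subseteq> UpS" if "B \<in> SL" for B
    using that by (auto simp: UpS_def act_Pt)
  then have "act_SL A ` UpS \<subseteq> UpS" "act_SL (adj A) ` UpS \<subseteq> UpS" using A by simp_all
  then show ?thesis using A by (auto simp: mem_act_image)
qed

lemma act_Bd: "p \<in> Bd \<Longrightarrow> act_SL A p \<in> Bd"
  by (cases p) (auto simp: act_SL_def map_matrix_def)

section \<open>Geodesics and half-planes\<close>

lemma mob_real:
  fixes M :: "real ^ 2 ^ 2"
  assumes "det M = 1" "\<tau> > 0"
  shows "mob (map_matrix of_real M) (Pt (\<i> * of_real \<tau>)) =
     Pt ((of_real (M$1$1) * (\<i> * of_real \<tau>) + of_real (M$1$2)) /
         (of_real (M$2$1) * (\<i> * of_real \<tau>) + of_real (M$2$2)))"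
proof -
  have "M$2$1 \<noteq> 0 \<or> M$2$2 \<noteq> 0" using assms by (auto simp: det_2)
  then show ?thesis
    using lin_nonzero[of "\<i> * of_real \<tau>" "M$2$1" "M$2$2"] assms by (simp add: map_matrix_def)
qed

lemma imag_axis_cases:
  assumes "0 \<le> s"
  obtains "s = 0" "imag_axis s = Pt 0" | "s = \<infinity>" "imag_axis s = Infty"
    | \<tau> where "\<tau> > 0" "s = ereal \<tau>" "imag_axis s = Pt (\<i> * of_real \<tau>)"
proof (cases s)
  case (real r)
  then show ?thesis using assms that by (cases "r = 0") (auto simp: imag_axis_def)
qed (use assms that in \<open>auto simp: imag_axis_def\<close>)

lemma imag_axis_finite:
  fixes M :: "real ^ 2 ^ 2"
  assumes "det M = 1" "0 \<le> s" "mob (map_matrix of_real M) (imag_axis s) = Pt z" "z \<in> upper"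
  obtains \<tau> where "\<tau> > 0" "s = ereal \<tau>"
    "z = (of_real (M$1$1) * (\<i> * of_real \<tau>) + of_real (M$1$2)) /
         (of_real (M$2$1) * (\<i> * of_real \<tau>) + of_real (M$2$2))"
  using assms(2)
proof (cases rule: imag_axis_cases)
  case 1
  then show ?thesis using assms by (auto simp: map_matrix_def upper_def split: if_splits)
next
  case 2
  then show ?thesis using assms by (auto simp: map_matrix_def upper_def split: if_splits)
next
  case (3 \<tau>)
  then show ?thesis using assms mob_real[of M \<tau>] that by simp
qed

text \<open>The boundary equation has no term linear in \<open>Im z\<close>, so it describes a line
  or circle orthogonal to the real axis, that is, a geodesic, unless it is degenerate.\<close>

definition halfplane :: "real \<Rightarrow> real \<Rightarrow> real \<Rightarrow> complex set" where
  "halfplane \<alpha> \<beta> \<gamma> = {z \<in> upper. \<alpha> * nrm z + \<beta> * Re z + \<gamma> \<ge> 0}"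

text \<open>In the parametrization of a geodesic by the imaginary axis, the form defining the half-plane
  becomes an affine function of \<open>\<tau>\<^sup>2\<close>, up to a positive factor.\<close>

lemma hyp_convex_halfplane: "hyp_convex (halfplane \<alpha> \<beta> \<gamma>)"
  unfolding hyp_convex_def
proof (intro ballI subsetI)
  fix z w x
  assume zw: "z \<in> halfplane \<alpha> \<beta> \<gamma>" "w \<in> halfplane \<alpha> \<beta> \<gamma>" and x: "x \<in> geod (Pt z) (Pt w)"
  then obtain M :: "real ^ 2 ^ 2" and s t r where M: "det M = 1" and le: "0 \<le> s" "s \<le> t" "t \<le> r"
    and eq: "mob (map_matrix of_real M) (imag_axis s) = Pt z"
      "mob (map_matrix of_real M) (imag_axis t) = Pt x"
      "mob (map_matrix of_real M) (imag_axis r) = Pt w" and xu: "x \<in> upper"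
    by (auto simp: geod_def)
  obtain a b c d where abcd: "M = mat2 a b c d" by (cases M rule: mat2_cases)
  have nn: "0 \<le> t" "0 \<le> r" using le by auto
  have up: "z \<in> upper" "w \<in> upper" using zw by (auto simp: halfplane_def)
  obtain \<sigma> where \<sigma>: "\<sigma> > 0" "s = ereal \<sigma>" "z = (of_real a * (\<i> * of_real \<sigma>) + of_real b) / (of_real c * (\<i> * of_real \<sigma>) + of_real d)"
    using imag_axis_finite[OF M le(1) eq(1) up(1)] by (auto simp: abcd)
  obtain \<tau> where \<tau>: "\<tau> > 0" "t = ereal \<tau>" "x = (of_real a * (\<i> * of_real \<tau>) + of_real b) / (of_real c * (\<i> * of_real \<tau>) + of_real d)"
    using imag_axis_finite[OF M nn(1) eq(2) xu] by (auto simp: abcd)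
  obtain \<rho> where \<rho>: "\<rho> > 0" "r = ereal \<rho>" "w = (of_real a * (\<i> * of_real \<rho>) + of_real b) / (of_real c * (\<i> * of_real \<rho>) + of_real d)"
    using imag_axis_finite[OF M nn(2) eq(3) up(2)] by (auto simp: abcd)
  define \<phi> where "\<phi> y = (\<alpha> * a\<^sup>2 + \<beta> * (a * c) + \<gamma> * c\<^sup>2) * y\<^sup>2 + (\<alpha> * b\<^sup>2 + \<beta> * (b * d) + \<gamma> * d\<^sup>2)" for y
  have key: "\<alpha> * nrm v + \<beta> * Re v + \<gamma> \<ge> 0 \<longleftrightarrow> \<phi> y \<ge> 0" if "y > 0"
    "v = (of_real a * (\<i> * of_real y) + of_real b) / (of_real c * (\<i> * of_real y) + of_real d)" for v y
  proof -
    let ?w = "of_real c * (\<i> * of_real y) + of_real d :: complex"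
    have "c \<noteq> 0 \<or> d \<noteq> 0" using M abcd by auto
    then have "?w \<noteq> 0" using lin_nonzero[of "\<i> * of_real y" c d] that by simp
    then have pos: "(cmod ?w)\<^sup>2 > 0" by simp
    have w2: "(cmod ?w)\<^sup>2 = c\<^sup>2 * y\<^sup>2 + d\<^sup>2" by (simp add: cmod_power2 power_mult_distrib)
    have nv: "nrm v = (a\<^sup>2 * y\<^sup>2 + b\<^sup>2) / (cmod ?w)\<^sup>2"
      unfolding nrm_cmod that norm_divide power_divide by (simp add: cmod_power2 power_mult_distrib)
    have rv: "Re v = (a * c * y\<^sup>2 + b * d) / (cmod ?w)\<^sup>2"
      unfolding that divide_eq_cnj[of "_ + _"] by (simp add: Re_divide_of_real power2_eq_square algebra_simps)
    have lin: "\<alpha> * (p / W) + \<beta> * (q / W) + \<gamma> = (\<alpha> * p + \<beta> * q + \<gamma> * W) / W" if "W > 0" for p q W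
      using that by (simp add: field_simps)
    have "\<alpha> * nrm v + \<beta> * Re v + \<gamma> =
        (\<alpha> * (a\<^sup>2 * y\<^sup>2 + b\<^sup>2) + \<beta> * (a * c * y\<^sup>2 + b * d) + \<gamma> * (cmod ?w)\<^sup>2) / (cmod ?w)\<^sup>2"
      unfolding nv rv by (rule lin[OF pos])
    also have "\<alpha> * (a\<^sup>2 * y\<^sup>2 + b\<^sup>2) + \<beta> * (a * c * y\<^sup>2 + b * d) + \<gamma> * (cmod ?w)\<^sup>2 = \<phi> y"
      unfolding w2 \<phi>_def by (simp add: algebra_simps)
    finally have "\<alpha> * nrm v + \<beta> * Re v + \<gamma> = \<phi> y / (cmod ?w)\<^sup>2" .
    then show ?thesis using pos by (simp only: zero_le_divide_iff) linarith
  qed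
  have "\<phi> \<sigma> \<ge> 0" "\<phi> \<rho> \<ge> 0" using zw key \<sigma> \<rho> by (auto simp: halfplane_def)
  moreover have "\<phi> \<tau> \<ge> min (\<phi> \<sigma>) (\<phi> \<rho>)"
  proof -
    have "\<sigma>\<^sup>2 \<le> \<tau>\<^sup>2" "\<tau>\<^sup>2 \<le> \<rho>\<^sup>2" using le \<sigma> \<tau> \<rho> by (auto intro!: power_mono)
    then have "\<phi> \<sigma> \<le> \<phi> \<tau> \<or> \<phi> \<rho> \<le> \<phi> \<tau>"
      unfolding \<phi>_def add_le_cancel_right
      by (metis linear mult_left_mono mult_left_mono_neg)
    then show ?thesis by linarith
  qed
  ultimately have "\<phi> \<tau> \<ge> 0" by simp
  then show "x \<in> halfplane \<alpha> \<beta> \<gamma>" using key \<tau> xu by (simp add: halfplane_def)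
qed

lemma hyp_convex_INT:
  assumes "\<And>i. i \<in> I \<Longrightarrow> hyp_convex (Q i)"
  shows "hyp_convex (upper \<inter> (\<Inter>i\<in>I. Q i))"
  unfolding hyp_convex_def
proof (intro ballI)
  fix z w assume zw: "z \<in> upper \<inter> (\<Inter>i\<in>I. Q i)" "w \<in> upper \<inter> (\<Inter>i\<in>I. Q i)"
  have "geod (Pt z) (Pt w) \<subseteq> upper" by (auto simp: geod_def)
  moreover have "geod (Pt z) (Pt w) \<subseteq> Q i" if "i \<in> I" for i
    using assms[OF that] zw that by (simp add: hyp_convex_def)
  ultimately show "geod (Pt z) (Pt w) \<subseteq> upper \<inter> (\<Inter>i\<in>I. Q i)" by blast
qed

lemma hyp_convex_Int: "hyp_convex Q \<Longrightarrow> hyp_convex R \<Longrightarrow> hyp_convex (Q \<inter> R)"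
  unfolding hyp_convex_def by blast

text \<open>An integral matrix is also a real one and can be multiplied onto the matrix that
  parametrizes the geodesic; the parameters stay the same.\<close>

lemma geod_act_subset:
  assumes A: "A \<in> SL"
  shows "mz A ` geod p q \<subseteq> geod (act_SL A p) (act_SL A q)"
proof
  fix x assume "x \<in> mz A ` geod p q"
  then obtain z M s t r where z: "x = mz A z" "z \<in> upper" and M: "det (M :: real ^ 2 ^ 2) = 1"
    and le: "0 \<le> s" "s \<le> t" "t \<le> r"
    and eq: "mob (map_matrix of_real M) (imag_axis s) = p"
      "mob (map_matrix of_real M) (imag_axis t) = Pt z"
      "mob (map_matrix of_real M) (imag_axis r) = q"
    by (auto simp: geod_def)
  let ?A = "map_matrix real_of_int A" and ?C = "map_matrix of_real :: real ^ 2 ^ 2 \<Rightarrow> complex ^ 2 ^ 2"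
  have "?C ?A = map_matrix of_int A" by (simp add: vec_eq_iff map_matrix_def)
  then have "mob (?C (?A ** M)) v = act_SL A (mob (?C M) v)" for v
    unfolding act_SL_def map_matrix_of_real_mult using A M
    by (subst mob_mult) (auto simp: det_map_of_int det_map_of_real SL_iff)
  moreover have "det (?A ** M) = 1" using A M by (simp add: det_mul det_map_of_int SL_iff)
  ultimately show "x \<in> geod (act_SL A p) (act_SL A q)"
    using z le eq A unfolding geod_def
    by (intro CollectI conjI exI[of _ "?A ** M"] exI[of _ s] exI[of _ t] exI[of _ r]) (simp_all add: act_Pt)
qed

lemma geod_act: "A \<in> SL \<Longrightarrow> geod (act_SL A p) (act_SL A q) = mz A ` geod p q"
proof
  assume A: "A \<in> SL"
  show "geod (act_SL A p) (act_SL A q) \<subseteq> mz A ` geod p q"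
  proof
    fix x assume x: "x \<in> geod (act_SL A p) (act_SL A q)"
    then have "mz (adj A) x \<in> geod p q"
      using geod_act_subset[of "adj A" "act_SL A p" "act_SL A q"] A by auto
    moreover have "mz A (mz (adj A) x) = x" using x A by (simp add: geod_def)
    ultimately show "x \<in> mz A ` geod p q" by (metis imageI)
  qed
qed (rule geod_act_subset)

lemma side_pair: "side {p, q} = geod p q \<union> geod q p"
  by (auto simp: side_def doubleton_eq_iff)

lemma side_act: "A \<in> SL \<Longrightarrow> side (act_SL A ` {p, q}) = mz A ` side {p, q}"
  by (simp add: side_pair geod_act image_Un)

lemma mob_upper_tri:
  assumes "a * d = 1" shows "mob (map_matrix of_real (mat2 a b 0 (d::real))) (Pt z) = Pt (of_real (a * a) * z + of_real (a * b))"
proof -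
  have "d \<noteq> 0" using assms by auto
  then have "a = inverse d" using assms by (simp add: eq_divide_eq inverse_eq_divide)
  then have "inverse (of_real d) = (of_real a :: complex)" by simp
  moreover have "mob (map_matrix of_real (mat2 a b 0 d)) (Pt z) = Pt ((of_real a * z + of_real b) / of_real d)"
    using \<open>d \<noteq> 0\<close> by simp
  ultimately show ?thesis by (simp add: divide_inverse ring_distribs ac_simps)
qed

text \<open>A matrix of determinant 1 sending an end of the imaginary axis to infinity has c = 0 or
  d = 0. Either way the axis goes to a vertical line, on which the height is an increasing function
  of the parameter in the first case and a decreasing one in the second.\<close>

lemma side_Infty:
  assumes "Im w \<ge> 0"
  shows "side {Infty, Pt w} = {z \<in> upper. Re z = Re w \<and> Im z \<ge> Im w}"
proof (intro equalityI subsetI)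
  fix z assume z: "z \<in> {z \<in> upper. Re z = Re w \<and> Im z \<ge> Im w}"
  have "z \<in> geod (Pt w) Infty"
    unfolding geod_def
  proof (intro CollectI conjI exI)
    show "det (mat2 1 (Re w) 0 (1::real)) = 1" by simp
    show "0 \<le> ereal (Im w)" "ereal (Im w) \<le> ereal (Im z)" "ereal (Im z) \<le> \<infinity>" using z assms by auto
  qed (use z in \<open>auto simp: imag_axis_def complex_eq_iff\<close>)
  then show "z \<in> side {Infty, Pt w}" by (simp add: side_pair)
next
  fix z assume "z \<in> side {Infty, Pt w}"
  then have "z \<in> upper" and "\<exists>(M :: real ^ 2 ^ 2) s t r. det M = 1 \<and> 0 \<le> s \<and> s \<le> t \<and> t \<le> r \<and>
     mob (map_matrix of_real M) (imag_axis t) = Pt z \<and>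
     (mob (map_matrix of_real M) (imag_axis s) = Infty \<and> mob (map_matrix of_real M) (imag_axis r) = Pt w \<or>
      mob (map_matrix of_real M) (imag_axis s) = Pt w \<and> mob (map_matrix of_real M) (imag_axis r) = Infty)"
    by (auto simp: side_pair geod_def)
  then obtain M s t r where M: "det (M :: real ^ 2 ^ 2) = 1" and le: "0 \<le> s" "s \<le> t" "t \<le> r"
    and t: "mob (map_matrix of_real M) (imag_axis t) = Pt z"
    and sr: "mob (map_matrix of_real M) (imag_axis s) = Infty \<and> mob (map_matrix of_real M) (imag_axis r) = Pt w \<or>
      mob (map_matrix of_real M) (imag_axis s) = Pt w \<and> mob (map_matrix of_real M) (imag_axis r) = Infty"
    by blast
  obtain a b c d where abcd: "M = mat2 a b c d" by (cases M rule: mat2_cases)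
  obtain \<tau> where \<tau>: "\<tau> > 0" "t = ereal \<tau>" "z = (of_real a * (\<i> * of_real \<tau>) + of_real b) / (of_real c * (\<i> * of_real \<tau>) + of_real d)"
    using imag_axis_finite[OF M order.trans[OF le(1,2)] t \<open>z \<in> upper\<close>] by (auto simp: abcd)
  \<comment> \<open>Points in the interior of the axis stay in the half-plane, so only one of its
    two ends can reach infinity.\<close>
  have inf_cases: "x = 0 \<and> d = 0 \<or> x = \<infinity> \<and> c = 0" if "0 \<le> x" "mob (map_matrix of_real M) (imag_axis x) = Infty" for x
    using that(1)
  proof (cases rule: imag_axis_cases)
    case (3 y)
    then show ?thesis using that mob_real[OF M, of y] by simp
  qed (use that in \<open>auto simp: abcd split: if_splits\<close>)
  show "z \<in> {z \<in> upper. Re z = Re w \<and> Im z \<ge> Im w}"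
    using sr
  proof
    assume *: "mob (map_matrix of_real M) (imag_axis s) = Pt w \<and> mob (map_matrix of_real M) (imag_axis r) = Infty"
    have "r \<noteq> 0" using le \<tau> by auto
    then have "c = 0" "r = \<infinity>" using inf_cases[of r] le * by auto
    then have ad: "a * d = 1" using M abcd by simp
    obtain \<sigma> where \<sigma>: "0 \<le> \<sigma>" "s = ereal \<sigma>" "imag_axis s = Pt (\<i> * of_real \<sigma>)" "\<sigma> \<le> \<tau>"
      using le(1) by (cases rule: imag_axis_cases) (use le \<tau> in auto)
    have "w = of_real (a * a) * (\<i> * of_real \<sigma>) + of_real (a * b)"
      using * \<sigma> mob_upper_tri[OF ad] \<open>c = 0\<close> abcd by simp
    moreover have "z = of_real (a * a) * (\<i> * of_real \<tau>) + of_real (a * b)"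
      using t \<tau> mob_upper_tri[OF ad] \<open>c = 0\<close> abcd by (simp add: imag_axis_def)
    ultimately show ?thesis using \<open>z \<in> upper\<close> \<sigma> by (auto intro!: mult_left_mono)
  next
    assume *: "mob (map_matrix of_real M) (imag_axis s) = Infty \<and> mob (map_matrix of_real M) (imag_axis r) = Pt w"
    have "s \<noteq> \<infinity>" using le \<tau> by auto
    then have "d = 0" "s = 0" using inf_cases[of s] le * by auto
    then have bc: "b * c = - 1" and c0: "c \<noteq> 0" using M abcd by auto
    then have b: "b = - (1 / c)" by (simp add: eq_divide_eq minus_divide_left del: minus_divide_left [symmetric])
    have cc: "c * c > 0" using c0 by (metis not_real_square_gt_zero)
    have form: "(of_real a * (\<i> * of_real y) + of_real b) / (of_real c * (\<i> * of_real y)) =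
       of_real (a / c) + \<i> * of_real (1 / (c * c * y))" if "y > 0" for y
      using that c0 by (simp add: b field_simps)
    show ?thesis
    proof (cases r)
      case (real \<rho>)
      have "\<tau> \<le> \<rho>" using le \<tau> real by simp
      then have "imag_axis r = Pt (\<i> * of_real \<rho>)" "\<rho> > 0" using real \<tau> by (auto simp: imag_axis_def)
      then have "w = of_real (a / c) + \<i> * of_real (1 / (c * c * \<rho>))"
        using * mob_real[OF M, of \<rho>] \<open>d = 0\<close> abcd form[of \<rho>] by simp
      moreover have "z = of_real (a / c) + \<i> * of_real (1 / (c * c * \<tau>))"
        using \<tau> form[of \<tau>] \<open>d = 0\<close> by simp
      moreover have "1 / (e * \<rho>) \<le> 1 / (e * \<tau>)" if "e > 0" for e using that \<tau>(1) \<open>\<tau> \<le> \<rho>\<close>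
        by (intro divide_left_mono mult_left_mono mult_pos_pos) simp_all
      ultimately show ?thesis using cc \<open>z \<in> upper\<close> by simp
    next
      case PInf
      then have "w = of_real (a / c)" using * abcd c0 by (simp add: imag_axis_def)
      moreover have "z = of_real (a / c) + \<i> * of_real (1 / (c * c * \<tau>))"
        using \<tau> form[of \<tau>] \<open>d = 0\<close> by simp
      ultimately show ?thesis using \<open>z \<in> upper\<close> by (simp add: upper_def)
    qed (use le \<tau> in auto)
  qed
qed

section \<open>The tile of the modular group\<close>

definition tile :: "complex set" where
  "tile = {z \<in> upper. 0 \<le> Re z \<and> Re z \<le> 1/2 \<and> 2 * Re z \<le> nrm z}"

definition Dt :: "sphere set" where "Dt = Pt ` tile"
text \<open>\<open>Tt\<close> is the ideal triangle. \<open>Hc\<close> and \<open>Kc\<close> are the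
  inner sides of the two pieces of the boundary of the tile: the line from 0 to infinity, and the
  path through \<rho>, where \<open>2 * Re z \<le> nrm z\<close> says that z has distance at least 1
  from the point 1.\<close>

definition Tt :: "sphere set" where "Tt = Pt ` {z \<in> upper. 0 \<le> Re z \<and> Re z \<le> 1 \<and> Re z \<le> nrm z}"
definition Hc :: "sphere set" where "Hc = Pt ` {z \<in> upper. 0 \<le> Re z}"
definition Kc :: "sphere set" where "Kc = Pt ` {z \<in> upper. Re z \<le> 1/2 \<and> 2 * Re z \<le> nrm z}"

text \<open>Outer regions beyond the edge from \<open>0\<close> to \<open>\<infinity>\<close> and beyond the pair of edges meeting at
  \<open>\<rho>\<close>; they include the ideal boundary arc.\<close>

definition Hp :: "sphere set" where "Hp = Pt ` {z. 0 \<le> Im z \<and> 0 \<le> Re z \<and> z \<noteq> 0}"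
definition Kp :: "sphere set" where
  "Kp = Pt ` {z. 0 \<le> Im z \<and> (1/2 \<le> Re z \<or> nrm z \<le> 2 * Re z) \<and> z \<noteq> 0}"

lemma Pt_image [simp]: "Pt z \<in> Pt ` Y \<longleftrightarrow> z \<in> Y" "Infty \<notin> Pt ` Y"
  by auto

lemma upper_iff: "z \<in> upper \<longleftrightarrow> Im z > 0" by (simp add: upper_def)

lemma nrm_nonneg [simp]: "nrm z \<ge> 0" by (simp add: nrm_def)

lemma nrm_eq_0 [simp]: "nrm z = 0 \<longleftrightarrow> z = 0"
  by (simp add: nrm_def complex_eq_iff)

lemma nrm_one_minus: "nrm (1 - z) = nrm z - 2 * Re z + 1"
  by (simp add: nrm_def power2_eq_square algebra_simps)

lemma act_US_inv:
  "act_SL (adj (mU ** mS)) (Pt z) = (if z = 1 then Infty else Pt (z / (1 - z)))"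
  "act_SL (adj (mU ** mS)) Infty = Pt (- 1)"
  by (auto simp: act_SL_def mU_def mS_def)

lemma act_UUS_inv:
  "act_SL (adj ((mU ** mU) ** mS)) (Pt z) = Pt (z - 1)"
  "act_SL (adj ((mU ** mU) ** mS)) Infty = Infty"
  by (auto simp: act_SL_def mU_def mS_def)

lemma nrm_1m_pos: "z \<noteq> 1 \<Longrightarrow> nrm (1 - z) > 0"
  using nrm_nonneg[of "1 - z"] nrm_eq_0[of "1 - z"] by (metis eq_iff_diff_eq_0 less_eq_real_def)

lemma frac_1m: "Re (z / (1 - z)) = (Re z - nrm z) / nrm (1 - z)" "Im (z / (1 - z)) = Im z / nrm (1 - z)"
  by (simp_all add: Re_divide Im_divide nrm_def power2_eq_square algebra_simps)

text \<open>The region beyond the edge of the ideal triangle from 0 to 1, a closed half-disc without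
  the two ends; \<open>mem_UUS_Hp\<close> treats the region beyond the edge from 1 to
  infinity.\<close>

lemma mem_US_Hp: "Pt z \<in> act_SL (mU ** mS) ` Hp \<longleftrightarrow> z \<noteq> 1 \<and> z \<noteq> 0 \<and> 0 \<le> Im z \<and> nrm z \<le> Re z"
  using nrm_1m_pos[of z]
  by (subst mem_act_image) (auto simp: act_US_inv Hp_def frac_1m zero_le_divide_iff)

lemma mem_UUS_Hp: "Pt z \<in> act_SL ((mU ** mU) ** mS) ` Hp \<longleftrightarrow> z \<noteq> 1 \<and> 0 \<le> Im z \<and> 1 \<le> Re z"
  by (subst mem_act_image) (auto simp: act_UUS_inv Hp_def)

lemma Infty_US: "Infty \<notin> act_SL (mU ** mS) ` Hp" "Infty \<notin> act_SL ((mU ** mU) ** mS) ` Hp"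
  by (subst mem_act_image; simp add: act_US_inv act_UUS_inv Hp_def)+

lemma sphere_subsetI: "Infty \<notin> Y \<Longrightarrow> (\<And>z. Pt z \<in> Y \<Longrightarrow> Pt z \<in> Z) \<Longrightarrow> Y \<subseteq> Z"
  by (metis sphere.exhaust subsetI)

lemma US_Hp: "act_SL (mU ** mS) ` Hp \<subseteq> Hp"
proof (rule sphere_subsetI[OF Infty_US(1)])
  fix z assume "Pt z \<in> act_SL (mU ** mS) ` Hp"
  then show "Pt z \<in> Hp" unfolding mem_US_Hp using order_trans[OF nrm_nonneg[of z]] by (auto simp: Hp_def)
qed

lemma UUS_Hp: "act_SL ((mU ** mU) ** mS) ` Hp \<subseteq> Hp"
  by (rule sphere_subsetI[OF Infty_US(2)], unfold mem_UUS_Hp) (auto simp: Hp_def)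

text \<open>The closed half-disc on the diameter from 0 to 1 and the closed half-plane to the right
  of 1 touch only at 1, and both regions omit this common end.\<close>

lemma US_UUS_disjoint: "act_SL (mU ** mS) ` Hp \<inter> act_SL ((mU ** mU) ** mS) ` Hp = {}"
proof -
  have False if "nrm z \<le> Re z" "1 \<le> Re z" "z \<noteq> 1" for z
  proof -
    have "(Re z - 1)\<^sup>2 + (Im z)\<^sup>2 + (Re z - 1) = nrm z - Re z" by (simp add: nrm_def power2_eq_square algebra_simps)
    then have "(Re z - 1)\<^sup>2 + (Im z)\<^sup>2 \<le> 0" using that by linarith
    then have "Re z = 1 \<and> Im z = 0" by (simp add: sum_power2_le_zero_iff)
    then show False using that by (simp add: complex_eq_iff)
  qed
  then have "act_SL (mU ** mS) ` Hp \<inter> act_SL ((mU ** mU) ** mS) ` Hp \<subseteq> {}"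
    using Infty_US by (intro sphere_subsetI) (auto simp: mem_US_Hp mem_UUS_Hp)
  then show ?thesis by simp
qed

lemma Kp_Hp: "Kp \<subseteq> Hp"
proof -
  have "0 \<le> Re z" if "nrm z \<le> 2 * Re z" for z using that nrm_nonneg[of z] by linarith
  then show ?thesis by (auto simp: Kp_def Hp_def)
qed

lemma one_Hp: "Pt 1 \<in> Hp" "Pt 1 \<notin> act_SL (mU ** mS) ` Hp" "Pt 1 \<notin> act_SL ((mU ** mU) ** mS) ` Hp" "Pt 1 \<in> Kp"
  by (simp_all add: mem_US_Hp mem_UUS_Hp) (simp_all add: Hp_def Kp_def)

lemma zero_Hp: "Pt 0 \<notin> Hp" "Infty \<notin> Hp"
  by (auto simp: Hp_def)

lemma act_special [simp]:
  "act_SL mU Infty = Pt 0" "act_SL mU (Pt 0) = Pt 1" "act_SL mU (Pt 1) = Infty"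
  "act_SL mS Infty = Pt 0" "act_SL mS (Pt 0) = Infty"
  by (simp_all add: act_SL_def mU_def mS_def)

lemma Re_mz_mS: "Re (mz mS z) = - Re z / nrm z" and nrm_mz_mS: "nrm (mz mS z) = 1 / nrm z"
  by (simp_all add: Re_mz nrm_mz den_def mS_def)

lemma Re_mz_mU: "Re (mz mU z) = (1 - Re z) / (nrm z - 2 * Re z + 1)"
  and nrm_mz_mU: "nrm (mz mU z) = 1 / (nrm z - 2 * Re z + 1)"
  by (simp_all add: Re_mz nrm_mz den_def mU_def)

lemma Re_mz_adjU: "Re (mz (adj mU) z) = (nrm z - Re z) / nrm z"
  and nrm_mz_adjU: "nrm (mz (adj mU) z) = (nrm z - 2 * Re z + 1) / nrm z"
  by (simp_all add: Re_mz nrm_mz den_def mU_def)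

lemma adj_UU: "adj (mU ** mU) = - mU" by (simp add: mU_def)

lemma adj_S: "adj mS = - mS" by (simp add: mS_def)

lemma nrm_1m_upper: "z \<in> upper \<Longrightarrow> nrm z - 2 * Re z + 1 > 0"
  using nrm_1m_pos[of z] by (cases "z = 1") (auto simp: nrm_one_minus upper_def)

text \<open>Pulling back by the matrix turns membership in the translates into inequalities between
  \<open>Re z\<close>, \<open>nrm z\<close> and constants. The decompositions and inclusions needed
  for growing the polygon are then arithmetic.\<close>

lemma mem_US:
  assumes "z \<in> upper"
  shows "Pt z \<in> act_SL mU ` Dt \<longleftrightarrow> Re z \<le> nrm z \<and> nrm z \<le> 2 * Re z \<and> nrm z \<le> 1"
    and "Pt z \<in> act_SL (mU ** mU) ` Dt \<longleftrightarrow> Re z \<le> 1 \<and> 1 \<le> nrm z \<and> 1/2 \<le> Re z"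
    and "Pt z \<in> act_SL mU ` Hc \<longleftrightarrow> Re z \<le> nrm z"
    and "Pt z \<in> act_SL (mU ** mU) ` Hc \<longleftrightarrow> Re z \<le> 1"
    and "Pt z \<in> act_SL mS ` Hc \<longleftrightarrow> Re z \<le> 0"
    and "Pt z \<in> act_SL mS ` Kc \<longleftrightarrow> - Re z \<le> nrm z / 2 \<and> - 2 * Re z \<le> 1"
    and "Pt z \<in> act_SL (mS ** mU) ` Hc \<longleftrightarrow> - 1 \<le> Re z"
    and "Pt z \<in> act_SL (mS ** (mU ** mU)) ` Hc \<longleftrightarrow> - Re z \<le> nrm z"
proof -
  have q: "nrm z > 0" "nrm z - 2 * Re z + 1 > 0" using assms nrm_pos nrm_1m_upper by auto
  have h: "a / r \<le> 1 / 2 \<longleftrightarrow> 2 * a \<le> r" "a / r \<le> 1 \<longleftrightarrow> a \<le> r" "a / r \<le> 0 \<longleftrightarrow> a \<le> 0"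
    "- (a / r) \<le> b / r \<longleftrightarrow> - a \<le> b" "- 1 \<le> a / r \<longleftrightarrow> - r \<le> a" "0 \<le> a / r \<longleftrightarrow> 0 \<le> a" "a / r \<le> b / r \<longleftrightarrow> a \<le> b"
    if "r > 0" for a b r :: real using that by (auto simp: field_simps zero_le_divide_iff)
  note h = h[OF q(1)] h[OF q(2)]
  have up: "mz mU z \<in> upper" "mz (adj mU) z \<in> upper" "mz mS z \<in> upper" using assms by simp_all
  have U: "act_SL (adj mU) (Pt z) = Pt (mz (adj mU) z)" "act_SL mU (Pt z) = Pt (mz mU z)" 
    "act_SL mS (Pt z) = Pt (mz mS z)" using assms by (simp_all add: act_Pt)
  show "Pt z \<in> act_SL mU ` Dt \<longleftrightarrow> Re z \<le> nrm z \<and> nrm z \<le> 2 * Re z \<and> nrm z \<le> 1"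
    using q up by (subst mem_act_image) (auto simp del: divide_le_eq_1_pos simp: Dt_def tile_def U Re_mz_adjU nrm_mz_adjU h)
  show "Pt z \<in> act_SL (mU ** mU) ` Dt \<longleftrightarrow> Re z \<le> 1 \<and> 1 \<le> nrm z \<and> 1/2 \<le> Re z"
    using q up by (subst mem_act_image) (auto simp del: divide_le_eq_1_pos simp: Dt_def tile_def adj_UU U Re_mz_mU nrm_mz_mU h)
  show "Pt z \<in> act_SL mU ` Hc \<longleftrightarrow> Re z \<le> nrm z"
    using q up by (subst mem_act_image) (auto simp del: divide_le_eq_1_pos simp: Hc_def U Re_mz_adjU h)
  show "Pt z \<in> act_SL (mU ** mU) ` Hc \<longleftrightarrow> Re z \<le> 1"
    using q up by (subst mem_act_image) (auto simp del: divide_le_eq_1_pos simp: Hc_def adj_UU U Re_mz_mU h)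
  show "Pt z \<in> act_SL mS ` Hc \<longleftrightarrow> Re z \<le> 0"
    using q up by (subst mem_act_image) (auto simp del: divide_le_eq_1_pos simp: Hc_def adj_S U Re_mz_mS h)
  show "Pt z \<in> act_SL mS ` Kc \<longleftrightarrow> - Re z \<le> nrm z / 2 \<and> - 2 * Re z \<le> 1"
    using q up by (subst mem_act_image) (auto simp del: divide_le_eq_1_pos simp: Kc_def adj_S U Re_mz_mS nrm_mz_mS h)
  have eq: "adj (mS ** mU) = mat2 1 1 0 1" "adj (mS ** (mU ** mU)) = mat2 1 0 1 1"
    by (simp_all add: mS_def mU_def)
  have SL: "mat2 1 1 0 1 \<in> SL" "mat2 1 0 1 1 \<in> SL" by simp_all
  have d: "den (mat2 1 0 1 1) z > 0" using den_pos[OF SL(2) assms] .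
  have "Re (mz (mat2 1 0 1 1) z) = (nrm z + Re z) / den (mat2 1 0 1 1) z" by (simp add: Re_mz)
  then have Re: "0 \<le> Re (mz (mat2 1 0 1 1) z) \<longleftrightarrow> - Re z \<le> nrm z" using d
    by (auto simp: zero_le_divide_iff)
  show "Pt z \<in> act_SL (mS ** mU) ` Hc \<longleftrightarrow> - 1 \<le> Re z"
    by (subst mem_act_image, simp, simp only: eq act_Pt[OF SL(1) assms] Hc_def Pt_image mem_Collect_eq
        mz_upper[OF SL(1) assms] Re_mz[of "mat2 1 1 0 1"]) (auto simp: den_def)
  show "Pt z \<in> act_SL (mS ** (mU ** mU)) ` Hc \<longleftrightarrow> - Re z \<le> nrm z"
    by (subst mem_act_image, simp, simp only: eq act_minus act_Pt[OF SL(2) assms] Hc_def Pt_image mem_Collect_eq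
        mz_upper[OF SL(2) assms] Re simp_thms)
qed

lemma UpS_subsetI: "Y \<subseteq> UpS \<Longrightarrow> (\<And>z. z \<in> upper \<Longrightarrow> Pt z \<in> Y \<Longrightarrow> Pt z \<in> Z) \<Longrightarrow> Y \<subseteq> Z"
  by (auto simp: UpS_def)

lemma Up_subsets [simp]: "Hc \<subseteq> UpS" "Kc \<subseteq> UpS" "Dt \<subseteq> UpS" "Tt \<subseteq> UpS"
  by (auto simp: Hc_def Kc_def Dt_def Tt_def tile_def)

lemma act_subset_Up [simp]: "A \<in> SL \<Longrightarrow> act_SL A ` Y \<subseteq> UpS \<longleftrightarrow> Y \<subseteq> UpS"
  using act_image_mono[of A Y UpS] by simp

lemma UpS_eqI: "Y \<subseteq> UpS \<Longrightarrow> Z \<subseteq> UpS \<Longrightarrow> (\<And>z. z \<in> upper \<Longrightarrow> Pt z \<in> Y \<longleftrightarrow> Pt z \<in> Z) \<Longrightarrow> Y = Z"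
  by (auto simp: UpS_def)

lemma mem_base:
  assumes "z \<in> upper"
  shows "Pt z \<in> Dt \<longleftrightarrow> 0 \<le> Re z \<and> Re z \<le> 1/2 \<and> 2 * Re z \<le> nrm z"
    "Pt z \<in> Tt \<longleftrightarrow> 0 \<le> Re z \<and> Re z \<le> 1 \<and> Re z \<le> nrm z"
    "Pt z \<in> Hc \<longleftrightarrow> 0 \<le> Re z" "Pt z \<in> Kc \<longleftrightarrow> Re z \<le> 1/2 \<and> 2 * Re z \<le> nrm z"
    "Pt z \<in> Hp \<longleftrightarrow> 0 \<le> Re z" "Pt z \<in> Kp \<longleftrightarrow> 1/2 \<le> Re z \<or> nrm z \<le> 2 * Re z"
  using assms by (auto simp: Dt_def Tt_def Hc_def Kc_def Hp_def Kp_def tile_def upper_def)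

lemma Tt_tiles: "Tt = Dt \<union> act_SL mU ` Dt \<union> act_SL (mU ** mU) ` Dt"
  by (rule UpS_eqI; (simp del: act_image_mult)?; (auto simp: mem_US mem_base)?)

lemma Tt_halfplanes: "Tt = Hc \<inter> act_SL mU ` Hc \<inter> act_SL (mU ** mU) ` Hc"
  by (rule UpS_eqI) (auto simp: mem_US mem_base intro: subsetD[OF Up_subsets(1)])

lemma Dt_eq: "Dt = Hc \<inter> Kc"
  by (rule UpS_eqI) (auto simp: mem_US mem_base intro: subsetD[OF Up_subsets(1)])

lemma Hc_cover: "Hc \<union> act_SL mS ` Hc = UpS"
  by (rule UpS_eqI) (auto simp: mem_US mem_base)

section \<open>The translates of the tile cover the half-plane and have disjoint interiors\<close>

lemma den_mult:
  assumes "A \<in> SL" "B \<in> SL" "z \<in> upper"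
  shows "den (B ** A) z = den B (mz A z) * den A z"
proof -
  have "Im z / den (B ** A) z = Im z / (den B (mz A z) * den A z)"
    using assms by (simp add: mz_mult mult.commute flip: Im_mz[of "B ** A"]) (simp add: Im_mz)
  moreover have "Im z > 0" using assms by (simp add: upper_def)
  ultimately show ?thesis using den_pos[of A z] den_pos[of B "mz A z"] den_pos[of "B ** A" z] assms
    by (simp add: divide_eq_eq eq_divide_eq)
qed

text \<open>Reduction theory: minimal \<open>den\<close> means maximal height in the orbit.
  Completing the square bounds c, and then d, in terms of z as long as \<open>den\<close> is at most
  1, so only finitely many values of \<open>den\<close> lie below 1. The identity contributes the
  value 1, hence the least of these values is the least of all.\<close>

lemma exists_den_minimal:
  assumes "z \<in> upper"
  shows "\<exists>A\<in>SL. \<forall>B\<in>SL. den A z \<le> den B z"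
proof -
  have y: "Im z > 0" using assms by (simp add: upper_def)
  define m where "m = \<lceil>1 / Im z\<rceil>"
  define K where "K = {A \<in> SL. den A z \<le> 1}"
  define k where "k = 1 + m * \<lceil>\<bar>Re z\<bar>\<rceil>"
  have sub: "(\<lambda>A. (A$2$1, A$2$2)) ` K \<subseteq> {-m..m} \<times> {-k..k}"
  proof safe
    fix A assume "A \<in> K"
    then have "den A z \<le> 1" by (simp add: K_def)
    let ?c = "real_of_int (A$2$1)" and ?d = "real_of_int (A$2$2)"
    have "den A z = (?c * Im z)\<^sup>2 + (?c * Re z + ?d)\<^sup>2"
      by (simp add: den_def nrm_def power2_eq_square algebra_simps)
    then have "(?c * Im z)\<^sup>2 \<le> 1" "(?c * Re z + ?d)\<^sup>2 \<le> 1" using \<open>den A z \<le> 1\<close>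
      by (smt (verit) zero_le_power2)+
    then have c: "\<bar>?c * Im z\<bar> \<le> 1" and d: "\<bar>?c * Re z + ?d\<bar> \<le> 1" by (simp_all add: abs_square_le_1)
    have "\<bar>?c\<bar> \<le> 1 / Im z" using c y by (simp add: abs_mult field_simps)
    then have cm: "\<bar>A$2$1\<bar> \<le> m" unfolding m_def by linarith
    then show "A$2$1 \<in> {-m..m}" by auto
    have "\<bar>?c * Re z\<bar> \<le> real_of_int m * real_of_int \<lceil>\<bar>Re z\<bar>\<rceil>"
      unfolding abs_mult using cm by (intro mult_mono) linarith+
    then have "\<bar>?d\<bar> \<le> 1 + real_of_int (m * \<lceil>\<bar>Re z\<bar>\<rceil>)" using d by simp
    then have "\<bar>A$2$2\<bar> \<le> k" unfolding k_def by linarith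
    then show "A$2$2 \<in> {-k..k}" by auto
  qed
  have fin: "finite ((\<lambda>A. den A z) ` K)"
  proof -
    have "(\<lambda>A. den A z) ` K = (\<lambda>(c, d). (of_int c)\<^sup>2 * nrm z + 2 * of_int (c * d) * Re z + (of_int d)\<^sup>2)
        ` (\<lambda>A. (A$2$1, A$2$2)) ` K"
      by (auto simp: image_image den_def)
    moreover have "finite ((\<lambda>A. (A$2$1, A$2$2)) ` K)" using sub by (rule finite_subset) simp
    ultimately show ?thesis by simp
  qed
  have one: "den (mat 1) z = 1" by (simp add: den_def mat2_one)
  then have "mat 1 \<in> K" by (simp add: K_def)
  then have "Min ((\<lambda>A. den A z) ` K) \<in> (\<lambda>A. den A z) ` K" using fin by (intro Min_in) auto
  then obtain A where A: "A \<in> K" "den A z = Min ((\<lambda>A. den A z) ` K)" by auto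
  have le: "den A z \<le> den B z" if "B \<in> SL" for B
  proof (cases "B \<in> K")
    case True then show ?thesis using A fin by simp
  next
    case False then show ?thesis using A that by (simp add: K_def)
  qed
  show ?thesis by (rule bexI[of _ A]) (use A(1) le in \<open>auto simp: K_def\<close>)
qed

lemma Re_mz_translation: "Re (mz (mat2 1 k 0 1) z) = Re z + of_int k"
  by (simp add: Re_mz den_def)

lemma tile_covers:
  assumes "z \<in> upper" shows "\<exists>A\<in>SL. mz A z \<in> tile"
proof -
  obtain A where A: "A \<in> SL" "\<And>B. B \<in> SL \<Longrightarrow> den A z \<le> den B z" using exists_den_minimal[OF assms] by blast
  define T where "T = mat2 1 (- \<lfloor>Re (mz A z)\<rfloor>) 0 1"
  have T: "T \<in> SL" by (simp add: T_def)
  define C where "C = T ** A"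
  have C: "C \<in> SL" using T A by (simp add: C_def)
  define w where "w = mz C z"
  have w: "w \<in> upper" using C assms by (simp add: w_def)
  have "den C z = den A z" using den_mult[OF A(1) T assms] by (simp add: C_def) (simp add: den_def T_def)
  then have min: "den B w \<ge> 1" if "B \<in> SL" for B
    using A(2)[of "B ** C"] den_mult[OF C that assms] den_pos[OF C assms] that C by (simp add: w_def)
  have Re: "Re w = Re (mz A z) - of_int \<lfloor>Re (mz A z)\<rfloor>"
    using mz_mult[OF T A(1) assms] by (simp add: w_def C_def T_def Re_mz_translation)
  then have x: "0 \<le> Re w" "Re w < 1" by linarith+
  \<comment> \<open>Minimality is tested on two matrices only. The bottom rows (1, 0) and (1, -1)
    say that w lies outside the open unit discs about 0 and 1.\<close>
  have 1: "nrm w \<ge> 1" using min[of mS] by (simp add: den_def mS_def)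
  have 2: "nrm w \<ge> 2 * Re w" using min[of "mat2 0 (-1) 1 (-1)"] by (simp add: den_def)
  show ?thesis
  proof (cases "Re w \<le> 1/2")
    case True
    then have "w \<in> tile" using w x 2 by (simp add: tile_def)
    then show ?thesis using C by (auto simp: w_def)
  next
    case False
    have q: "nrm w - 2 * Re w + 1 > 0" using w by (rule nrm_1m_upper)
    \<comment> \<open>The right part of the strip is the translate of the tile by the square of
      \<open>mU\<close>; one more \<open>mU\<close> leads back to the tile, since the cube acts
      trivially.\<close>
    have "mz mU w \<in> tile" using w x 1 False q
      by (simp add: tile_def Re_mz_mU nrm_mz_mU divide_le_eq le_divide_eq divide_right_mono)
    then show ?thesis using C assms mz_mult[OF mU_SL C assms] by (intro bexI[of _ "mU ** C"]) (auto simp: w_def)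
  qed
qed

definition itile :: "complex set" where
  "itile = {z \<in> upper. 0 < Re z \<and> Re z < 1/2 \<and> 2 * Re z < nrm z}"

text \<open>The right side minus the left is at least m (p^2 + p q + q^2 - 1): the factors p^2 - 1
  and q^2 - 1 are nonnegative, so X and 1 may be replaced by the smaller m. Equality occurs at (1,
  -1), the shortest vector with nonzero entries of a reduced form.\<close>

lemma form_bound:
  fixes p q :: int and X m :: real
  assumes "p \<noteq> 0" "q \<noteq> 0" "0 \<le> m" "m \<le> 1" "m \<le> X"
  shows "X + 1 - m \<le> of_int (p * p) * X + of_int (p * q) * m + of_int (q * q)"
proof -
  have 1: "1 \<le> \<bar>p\<bar>" "1 \<le> \<bar>q\<bar>" using assms by auto
  have sq: "1 \<le> p * p" "1 \<le> q * q" using assms by (metis int_one_le_iff_zero_less not_real_square_gt_zero zero_less_mult_iff linorder_neqE_linordered_idom)+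
  have "1 * 1 \<le> \<bar>p\<bar> * \<bar>q\<bar>" using 1 by (intro mult_mono) auto
  moreover have "0 \<le> (\<bar>p\<bar> - \<bar>q\<bar>) * (\<bar>p\<bar> - \<bar>q\<bar>)" by simp
  then have "2 * (\<bar>p\<bar> * \<bar>q\<bar>) \<le> p * p + q * q" by (simp add: algebra_simps)
  moreover have "- (\<bar>p\<bar> * \<bar>q\<bar>) \<le> p * q" by (simp flip: abs_mult)
  ultimately have "0 \<le> p * p + q * q + p * q - 1" by linarith
  then have "0 \<le> of_int (p * p + q * q + p * q - 1) * m"
    using assms(3) by (intro mult_nonneg_nonneg) (simp_all only: of_int_0_le_iff)
  moreover have "(of_int (p * p) - 1) * m \<le> (of_int (p * p) - 1) * X"
    using sq assms by (intro mult_left_mono) (simp_all flip: of_int_mult)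
  moreover have "(of_int (q * q) - 1) * m \<le> (of_int (q * q) - 1) * 1"
    using sq assms by (intro mult_left_mono) (simp_all flip: of_int_mult)
  ultimately show ?thesis by (simp add: algebra_simps)
qed

text \<open>In terms of the quadratic form \<open>\<bar>p z + q\<bar>\<^sup>2\<close>: a point lies in the interior of the tile only
  if the shortest primitive vectors are \<open>\<plusminus>(1,0)\<close> and \<open>\<plusminus>(0,1)\<close>, and the two rows of \<open>A\<close> are such
  vectors as well.\<close>

lemma itile_disjoint:
  assumes z: "z \<in> itile" and A: "A \<in> SL" and w: "mz A z \<in> tile"
  shows "A = mat 1 \<or> A = - mat 1"
proof -
  obtain a b c d where abcd: "A = mat2 a b c d" by (cases A rule: mat2_cases)
  have det: "a * d - b * c = 1" using A abcd by simp
  have zu: "z \<in> upper" using z by (simp add: itile_def)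
  define X m where "X = nrm z" and "m = 2 * Re z"
  have Xm: "0 < m" "m < 1" "m < X" using z by (auto simp: itile_def X_def m_def)
  define Q where "Q p q = of_int (p * p) * X + of_int (p * q) * m + of_int (q * q)" for p q :: int
  have strict: "X < Q p q" "1 < Q p q" if "p \<noteq> 0" "q \<noteq> 0" for p q
    using form_bound[OF that, of m X] Xm by (auto simp: Q_def)
  define j where "j = den A z"
  have j: "j > 0" "j = Q c d" using den_pos[OF A zu]
    by (auto simp: j_def Q_def den_def abcd X_def m_def power2_eq_square)
  define Y l where "Y = nrm (mz A z)" and "l = 2 * Re (mz A z)"
  have Yl: "0 \<le> l" "l \<le> 1" "l \<le> Y" using w by (auto simp: tile_def Y_def l_def)
  have "Y = Q a b / j" unfolding Y_def nrm_mz j_def[symmetric]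
    by (simp add: Q_def abcd X_def m_def power2_eq_square)
  then have Y: "j * Y = Q a b" using j(1) by simp
  have "l = (2 * of_int (a * c) * X + of_int (a * d + b * c) * m + 2 * of_int (b * d)) / j"
    unfolding l_def Re_mz j_def[symmetric] by (simp add: abcd X_def m_def add_divide_distrib algebra_simps)
  then have l: "j * l = 2 * of_int (a * c) * X + of_int (a * d + b * c) * m + 2 * of_int (b * d)"
    using j(1) by simp
  \<comment> \<open>Up to the factor \<open>j\<close>, the quadratic form of the image point is the
    form \<open>Q\<close> of z written in the basis given by the rows of \<open>A\<close>.\<close>
  have comb: "j * (of_int (p * p) * Y + of_int (p * q) * l + of_int (q * q)) = Q (p * a + q * c) (p * b + q * d)" for p q
  proof -
    have "j * (of_int (p * p) * Y + of_int (p * q) * l + of_int (q * q)) =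
      of_int (p * p) * (j * Y) + of_int (p * q) * (j * l) + of_int (q * q) * j" by (simp add: algebra_simps)
    also have "\<dots> = Q (p * a + q * c) (p * b + q * d)"
      unfolding Y l unfolding j(2) Q_def by (simp add: algebra_simps)
    finally show ?thesis .
  qed
  have weak: "Q a b \<le> Q (p * a + q * c) (p * b + q * d) \<and> Q c d \<le> Q (p * a + q * c) (p * b + q * d)"
    if "p \<noteq> 0" "q \<noteq> 0" for p q
  proof -
    have "Y \<le> of_int (p * p) * Y + of_int (p * q) * l + of_int (q * q)"
      "1 \<le> of_int (p * p) * Y + of_int (p * q) * l + of_int (q * q)"
      using form_bound[OF that, of l Y] Yl by auto
    then have "j * Y \<le> j * (of_int (p * p) * Y + of_int (p * q) * l + of_int (q * q))"
      "j * 1 \<le> j * (of_int (p * p) * Y + of_int (p * q) * l + of_int (q * q))"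
      using j by (auto intro!: mult_left_mono)
    then show ?thesis using Y j unfolding comb by simp
  qed
  \<comment> \<open>By determinant 1, \<open>(d, - b)\<close> and \<open>(- c, a)\<close> are the
    coordinates of the unit vectors in the basis of the rows.\<close>
  have e1: "Q (d * a + (- b) * c) (d * b + (- b) * d) = X"
    and e2: "Q ((- c) * a + a * c) ((- c) * b + a * d) = 1"
  proof -
    have "d * a + (- b) * c = 1" "d * b + (- b) * d = 0" "(- c) * a + a * c = 0" "(- c) * b + a * d = 1"
      using det by (simp_all add: algebra_simps)
    moreover have "Q 1 0 = X" "Q 0 1 = 1" by (simp_all add: Q_def)
    ultimately show "Q (d * a + (- b) * c) (d * b + (- b) * d) = X" "Q ((- c) * a + a * c) ((- c) * b + a * d) = 1"
      by simp_all
  qed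
  \<comment> \<open>A row with two nonzero entries has a value of \<open>Q\<close> strictly above
    both X and 1. If one entry of each of the pairs \<open>(d, - b)\<close> and
    \<open>(- c, a)\<close> vanished, no such row could exist, so one pair is nonzero throughout and
    \<open>weak\<close> bounds the row by the value at a unit vector, X or 1.\<close>
  have row: "\<not> (a' \<noteq> 0 \<and> b' \<noteq> 0)" if "(a', b') = (a, b) \<or> (a', b') = (c, d)" for a' b'
  proof
    assume nz: "a' \<noteq> 0 \<and> b' \<noteq> 0"
    have "d \<noteq> 0 \<and> - b \<noteq> 0 \<or> - c \<noteq> 0 \<and> a \<noteq> 0" using nz det that by auto
    then show False using weak[of d "- b"] weak[of "- c" a] strict[of a' b'] nz that unfolding e1 e2 by auto
  qed
  have ab: "a = 0 \<or> b = 0" and cd: "c = 0 \<or> d = 0" using row by auto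
  show ?thesis
  proof (cases "b = 0")
    case True
    then have "a * d = 1" "c = 0" using det cd by auto
    then show ?thesis using True by (auto simp: abcd mat2_one zmult_eq_1_iff)
  next
    \<comment> \<open>The antidiagonal case is \<open>mS\<close> up to sign, and it would put the
      image to the left of the imaginary axis.\<close>
    case False
    then have "a = 0" "b * c = - 1" "d = 0" using det ab cd by auto
    then have "j * l = - m" using l by simp
    then show ?thesis using Xm Yl j by (metis mult_nonneg_nonneg less_imp_le neg_0_le_iff_le not_less)
  qed
qed

lemma itile_dense:
  assumes z: "z \<in> tile" and V: "open V" "z \<in> V"
  shows "\<exists>w\<in>V. w \<in> itile"
proof -
  define x y where xy: "x = Re z" "y = Im z"
  have x: "0 \<le> x" "x \<le> 1/2" and y: "y > 0" and q: "x\<^sup>2 + y\<^sup>2 - 2 * x \<ge> 0"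
    using z by (auto simp: tile_def xy upper_def nrm_def)
  \<comment> \<open>The point rises by s while its real part moves towards 1/4 by the fraction t = 2
    y s. Rising adds t + s^2 to \<open>nrm\<close>; the horizontal move lowers
    \<open>nrm z - 2 * Re z\<close> by at most t/2. All inequalities of the tile thus become
    strict.\<close>
  define f where "f s = Complex ((1 - 2 * y * s) * x + 2 * y * s / 4) (y + s)" for s :: real
  have "continuous (at 0) f" unfolding f_def Complex_eq by (intro continuous_intros) auto
  then have "(f \<longlongrightarrow> f 0) (at 0)" by (simp add: continuous_at)
  moreover have "f 0 = z" by (simp add: f_def xy)
  ultimately have "eventually (\<lambda>s. f s \<in> V) (at 0)" using V by (auto dest: topological_tendstoD)
  then have "eventually (\<lambda>s. f s \<in> V) (at_right 0)" by (simp add: eventually_at_split)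
  moreover have "eventually (\<lambda>s::real. 0 < s \<and> s < 1 / (2 * y)) (at_right 0)"
    using y by (auto simp: eventually_at_right_field intro!: exI[of _ "1 / (2 * y)"])
  ultimately have "eventually (\<lambda>s. f s \<in> V \<and> 0 < s \<and> s < 1 / (2 * y)) (at_right 0)" by (rule eventually_conj)
  then obtain s where s: "f s \<in> V" "0 < s" "s < 1 / (2 * y)"
    using eventually_happens'[OF trivial_limit_at_right_real] by blast
  define t where "t = 2 * y * s"
  have t: "0 < t" "t < 1" using s y by (auto simp: t_def field_simps)
  define x' where "x' = (1 - t) * x + t / 4"
  have x': "0 < x'" "x' < 1/2"
  proof -
    have "(1 - t) * x \<le> (1 - t) * (1/2)" using t x by (intro mult_left_mono) auto
    also have "\<dots> = 1 / 2 - t / 2" by (simp add: field_simps)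
    finally have "(1 - t) * x \<le> 1 / 2 - t / 2" .
    moreover have "0 \<le> (1 - t) * x" using t x by (intro mult_nonneg_nonneg) auto
    ultimately show "0 < x'" "x' < 1/2" using t unfolding x'_def by linarith+
  qed
  have "x' - x = t * (1/4 - x)" by (simp add: x'_def algebra_simps)
  moreover have "\<bar>1/4 - x\<bar> \<le> 1/4" using x by linarith
  then have "\<bar>t * (1/4 - x)\<bar> \<le> t * (1/4)" unfolding abs_mult using t by (intro mult_mono) auto
  ultimately have "x' - x \<le> t / 4" by simp
  then have "(x' - x) * (2 - x - x') \<le> t / 4 * (2 - x - x')" using x x' by (intro mult_right_mono) auto
  also have "\<dots> \<le> t / 4 * 2" using x x' t by (intro mult_left_mono) auto
  finally have "(x' - x) * (2 - x - x') \<le> t / 2" by simp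
  then have "x'\<^sup>2 - 2 * x' \<ge> x\<^sup>2 - 2 * x - t / 2" by (simp add: power2_eq_square algebra_simps)
  moreover have "(y + s)\<^sup>2 = y\<^sup>2 + t + s\<^sup>2" by (simp add: t_def power2_eq_square algebra_simps)
  moreover have "s\<^sup>2 \<ge> 0" by simp
  ultimately have "2 * x' < x'\<^sup>2 + (y + s)\<^sup>2" using q t by linarith
  then have "f s \<in> itile" using x' y s by (simp add: f_def itile_def upper_def nrm_def t_def x'_def)
  then show ?thesis using s by blast
qed

section \<open>Growing the polygon\<close>

text \<open>\<open>R\<close> is the set of tiles, \<open>F\<close> consists of those whose edge from
  0 to infinity is on the boundary, and \<open>Q\<close> of those whose two sides at \<rho> are. The
  new tile \<open>A ** mS\<close> does not enter \<open>F\<close>: its edge is the edge of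
  \<open>A\<close> seen from the other side.\<close>

inductive config :: "imat set \<Rightarrow> imat set \<Rightarrow> imat set \<Rightarrow> bool" where
  init3: "config {mat 1, mU, mU ** mU} {mat 1, mU, mU ** mU} {}"
| init1: "config {mat 1} {mat 1} {mat 1}"
| step3: "config R F Q \<Longrightarrow> A \<in> F \<Longrightarrow>
    config (R \<union> {A ** mS, (A ** mS) ** mU, ((A ** mS) ** mU) ** mU})
      (F - {A} \<union> {(A ** mS) ** mU, ((A ** mS) ** mU) ** mU}) Q"
| step1: "config R F Q \<Longrightarrow> A \<in> F \<Longrightarrow>
    config (insert (A ** mS) R) (F - {A}) (insert (A ** mS) Q)"

text \<open>A boundary component \<open>(False, A)\<close> is the image under \<open>A\<close> of the edge from \<open>0\<close> to \<open>\<infinity>\<close>, and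
  \<open>(True, A)\<close> the image of the path from \<open>0\<close> to \<open>\<infinity>\<close> through \<open>\<rho>\<close>.\<close>

type_synonym comp = "bool \<times> imat"

definition cset :: "comp \<Rightarrow> sphere set" where
  "cset X = act_SL (snd X) ` (if fst X then Kc else Hc)"

definition nset :: "comp \<Rightarrow> sphere set" where
  "nset X = (if fst X then act_SL (snd X) ` Kp else act_SL (snd X ** mS) ` Hp)"

definition ends :: "comp \<Rightarrow> sphere set" where
  "ends X = {act_SL (snd X) Infty, act_SL (snd X) (Pt 0)}"

text \<open>The invariant of growth. Disjointness of the outer regions keeps changes inside one of
  them away from all other components. The condition on \<open>ends\<close> guarantees that an ideal
  vertex created inside an outer region is really new, and the sums say that every ideal vertex
  belongs to exactly two components, which is the closedness of the contour.\<close>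

definition outline :: "comp set \<Rightarrow> sphere set \<Rightarrow> bool" where
  "outline I P \<longleftrightarrow> finite I \<and> snd ` I \<subseteq> SL \<and>
     (\<forall>X\<in>I. \<forall>Y\<in>I. X \<noteq> Y \<longrightarrow> nset X \<inter> nset Y = {}) \<and>
     P = UpS \<inter> (\<Inter>X\<in>I. cset X) \<and>
     (\<forall>X\<in>I. \<forall>Y\<in>I. ends X \<inter> nset Y = {}) \<and>
     (\<forall>v. (\<Sum>X\<in>I. of_bool (v \<in> ends X)) \<in> {0, 2::nat})"

lemma outlineD:
  assumes "outline I P"
  shows "finite I" "snd ` I \<subseteq> SL"
    "\<And>X Y. X \<in> I \<Longrightarrow> Y \<in> I \<Longrightarrow> X \<noteq> Y \<Longrightarrow> nset X \<inter> nset Y = {}"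
    "P = UpS \<inter> (\<Inter>X\<in>I. cset X)"
    "\<And>X Y. X \<in> I \<Longrightarrow> Y \<in> I \<Longrightarrow> ends X \<inter> nset Y = {}"
    "\<And>v. (\<Sum>X\<in>I. of_bool (v \<in> ends X)) \<in> {0, 2::nat}"
proof -
  note c = assms[unfolded outline_def]
  show "finite I" by (rule c[THEN conjunct1])
  show "snd ` I \<subseteq> SL" by (rule c[THEN conjunct2, THEN conjunct1])
  show "P = UpS \<inter> (\<Inter>X\<in>I. cset X)"
    by (rule c[THEN conjunct2, THEN conjunct2, THEN conjunct2, THEN conjunct1])
  show "\<And>v. (\<Sum>X\<in>I. of_bool (v \<in> ends X)) \<in> {0, 2::nat}"
    using c[THEN conjunct2, THEN conjunct2, THEN conjunct2, THEN conjunct2, THEN conjunct2] by (rule spec)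
  show "\<And>X Y. X \<in> I \<Longrightarrow> Y \<in> I \<Longrightarrow> X \<noteq> Y \<Longrightarrow> nset X \<inter> nset Y = {}"
    using c[THEN conjunct2, THEN conjunct2, THEN conjunct1] by simp
  show "\<And>X Y. X \<in> I \<Longrightarrow> Y \<in> I \<Longrightarrow> ends X \<inter> nset Y = {}"
    using c[THEN conjunct2, THEN conjunct2, THEN conjunct2, THEN conjunct2, THEN conjunct1] by simp
qed

lemma Hc_Hp: "Hc \<subseteq> Hp"
  by (rule UpS_subsetI) (auto simp: mem_base)

lemma cset_nset:
  assumes "A \<in> SL" shows "UpS \<subseteq> cset (b, A) \<union> nset (b, A)"
proof -
  have "UpS = act_SL A ` UpS" using assms by simp
  also have "\<dots> \<subseteq> act_SL A ` (if b then Kc \<union> Kp else Hc \<union> act_SL mS ` Hc)"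
  proof (intro image_mono)
    have "UpS \<subseteq> Kc \<union> Kp" by (rule UpS_subsetI) (auto simp: mem_base)
    then show "UpS \<subseteq> (if b then Kc \<union> Kp else Hc \<union> act_SL mS ` Hc)" using Hc_cover by auto
  qed
  also have "\<dots> \<subseteq> cset (b, A) \<union> nset (b, A)"
  proof -
    show ?thesis using assms Hc_Hp by (auto simp: cset_def nset_def act_mult)
  qed
  finally show ?thesis .
qed

lemma nset_nonempty: "A \<in> SL \<Longrightarrow> nset (b, A) \<noteq> {}"
  using one_Hp by (auto simp: nset_def)

text \<open>The component \<open>X0\<close> is replaced by \<open>W\<close> inside its own outer
  region. The added part lies in \<open>H\<close>, hence outside the outer region of every other
  component and so on its inner side; therefore the enlarged set is again an intersection of inner
  sides. \<open>m\<close> stands for the new ideal vertex and \<open>k\<close> for the number of new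
  components meeting there.\<close>

lemma outline_replace:
  assumes I: "outline I P" and X0: "X0 \<in> I" and W: "finite W" "snd ` W \<subseteq> SL"
    and Wdisj: "\<And>X Y. X \<in> W \<Longrightarrow> Y \<in> W \<Longrightarrow> X \<noteq> Y \<Longrightarrow> nset X \<inter> nset Y = {}"
    and WN: "\<And>X. X \<in> W \<Longrightarrow> nset X \<subseteq> nset X0"
    and WC: "\<And>X. X \<in> W \<Longrightarrow> cset X0 \<subseteq> cset X"
    and H: "UpS = cset X0 \<union> H" "H \<subseteq> nset X0"
    and ends: "\<And>X. X \<in> W \<Longrightarrow> ends X \<subseteq> ends X0 \<union> {m}"
    and m: "m \<in> nset X0" "\<And>X. X \<in> W \<Longrightarrow> m \<notin> nset X"
    and deg: "\<And>v. (\<Sum>X\<in>W. of_bool (v \<in> ends X)) = of_bool (v \<in> ends X0) + (if v = m then k else 0)"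
    and k: "k \<in> {0, 2::nat}"
  shows "outline (I - {X0} \<union> W) (P \<union> (H \<inter> (\<Inter>X\<in>W. cset X)))"
proof -
  note fin = outlineD(1)[OF I] and SL = outlineD(2)[OF I] and disj = outlineD(3)[OF I]
    and P = outlineD(4)[OF I] and en = outlineD(5)[OF I] and dg = outlineD(6)[OF I]
  have fresh: "W \<inter> (I - {X0}) = {}"
  proof -
    have False if "X \<in> W" "X \<in> I" "X \<noteq> X0" for X
      using WN[OF that(1)] disj[OF that(2) X0 that(3)] nset_nonempty[of "snd X" "fst X"] SL that by auto
    then show ?thesis by blast
  qed
  \<comment> \<open>\<open>m\<close> lies in the outer region of \<open>X0\<close>, which contains
    no old end; so only \<open>W\<close> contributes to the degree at \<open>m\<close>.\<close>
  have mends: "m \<notin> ends X" if "X \<in> I" for X using en[OF that X0] m by blast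
  have mN: "m \<notin> nset X" if "X \<in> I - {X0}" for X using disj[of X X0] that X0 m by blast
  show ?thesis
    unfolding outline_def
  proof (intro conjI ballI impI allI)
    show "finite (I - {X0} \<union> W)" "snd ` (I - {X0} \<union> W) \<subseteq> SL" using fin W SL by auto
    show "nset X \<inter> nset Y = {}" if XY: "X \<in> I - {X0} \<union> W" "Y \<in> I - {X0} \<union> W" "X \<noteq> Y" for X Y
    proof -
      consider "X \<in> W" "Y \<in> W" | "X \<in> W" "Y \<in> I - {X0}" | "X \<in> I - {X0}" "Y \<in> W" | "X \<in> I" "Y \<in> I"
        using XY by blast
      then show ?thesis
      proof cases
        case 2 then show ?thesis using WN disj[OF X0, of Y] by blast
      next
        case 3 then show ?thesis using WN disj[OF X0, of X] by blast
      qed (use Wdisj disj XY in auto)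
    qed
    show "P \<union> (H \<inter> (\<Inter>X\<in>W. cset X)) = UpS \<inter> (\<Inter>X\<in>I - {X0} \<union> W. cset X)"
    proof (intro equalityI subsetI)
      fix x assume "x \<in> P \<union> (H \<inter> (\<Inter>X\<in>W. cset X))"
      then show "x \<in> UpS \<inter> (\<Inter>X\<in>I - {X0} \<union> W. cset X)"
      proof
        assume "x \<in> P" then show ?thesis using WC X0 unfolding P by blast
      next
        assume x: "x \<in> H \<inter> (\<Inter>X\<in>W. cset X)"
        have "x \<in> cset Y" if "Y \<in> I - {X0}" for Y
        proof -
          have "x \<notin> nset Y" using x H(2) disj[OF X0, of Y] that by blast
          moreover have "UpS \<subseteq> cset Y \<union> nset Y" using cset_nset[of "snd Y" "fst Y"] SL that by auto
          ultimately show ?thesis using x H by blast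
        qed
        then show ?thesis using x H by blast
      qed
    next
      fix x assume "x \<in> UpS \<inter> (\<Inter>X\<in>I - {X0} \<union> W. cset X)"
      then show "x \<in> P \<union> (H \<inter> (\<Inter>X\<in>W. cset X))" using H(1) unfolding P by blast
    qed
    show "ends X \<inter> nset Y = {}" if XY: "X \<in> I - {X0} \<union> W" "Y \<in> I - {X0} \<union> W" for X Y
    proof -
      have "ends X0 \<inter> nset Y = {}" "m \<notin> nset Y" using XY(2) en[OF X0] WN[of Y] m mN en[OF X0 X0] by blast+
      moreover have "ends X \<inter> nset Y = {}" if "X \<in> I"
        using en[OF that, of Y] en[OF that X0] WN[of Y] XY(2) by blast
      ultimately show ?thesis using XY(1) ends[of X] by blast
    qed
    show "(\<Sum>X\<in>I - {X0} \<union> W. of_bool (v \<in> ends X)) \<in> {0, 2::nat}" for v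
    proof -
      have "(\<Sum>X\<in>I - {X0} \<union> W. of_bool (v \<in> ends X)) =
        (\<Sum>X\<in>I - {X0}. of_bool (v \<in> ends X)) + (of_bool (v \<in> ends X0) + (if v = m then k else 0))"
        using fin W fresh by (subst sum.union_disjoint) (auto simp: deg simp del: sum_of_bool_eq)
      also have "\<dots> = (\<Sum>X\<in>I. of_bool (v \<in> ends X)) + (if v = m then k else 0)"
        using sum.remove[OF fin X0, of "\<lambda>X. of_bool (v \<in> ends X) :: nat"] by (simp del: sum_of_bool_eq)
      finally have eq: "(\<Sum>X\<in>I - {X0} \<union> W. of_bool (v \<in> ends X)) =
         (\<Sum>X\<in>I. of_bool (v \<in> ends X)) + (if v = m then k else 0)" .
      show ?thesis
      proof (cases "v = m")
        case True
        then have "(\<Sum>X\<in>I. of_bool (v \<in> ends X)) = (0::nat)" using mends by (intro sum.neutral) auto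
        then show ?thesis unfolding eq using k True by simp
      next
        case False
        then show ?thesis unfolding eq using dg[of v] by simp
      qed
    qed
  qed
qed

definition comps :: "imat set \<Rightarrow> imat set \<Rightarrow> comp set" where
  "comps F Q = {False} \<times> F \<union> {True} \<times> Q"

lemma outline_init3:
  "outline (comps {mat 1, mU, mU ** mU} {}) (\<Union>A\<in>{mat 1, mU, mU ** mU}. act_SL A ` Dt)"
proof -
  let ?N0 = "act_SL mS ` Hp" and ?N1 = "act_SL (mU ** mS) ` Hp" and ?N2 = "act_SL ((mU ** mU) ** mS) ` Hp"
  \<comment> \<open>Rotation by \<open>mU\<close> permutes the three outer regions cyclically, and
    also the three vertices. Hence one disjointness and one check of the vertices give all the
    others.\<close>
  have rot: "act_SL mU ` ?N0 = ?N1" "act_SL mU ` ?N1 = ?N2" "act_SL mU ` ?N2 = ?N0"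
    using mU_cube by (simp_all add: matrix_mul_assoc flip: act_image_mult)
  have d12: "?N1 \<inter> ?N2 = {}" by (rule US_UUS_disjoint)
  have d01: "?N0 \<inter> ?N1 = {}"
  proof -
    have "act_SL mU ` (?N0 \<inter> ?N1) = ?N1 \<inter> ?N2" by (simp only: image_Int[OF act_inj[OF mU_SL]] rot)
    then show ?thesis using d12 by simp
  qed
  have d20: "?N2 \<inter> ?N0 = {}"
  proof -
    have "act_SL mU ` (?N2 \<inter> ?N0) = ?N0 \<inter> ?N1" by (simp only: image_Int[OF act_inj[OF mU_SL]] rot)
    then show ?thesis using d01 by simp
  qed
  let ?V = "{Infty, Pt 0, Pt 1}"
  have V: "act_SL mU ` ?V = ?V" by auto
  have v0: "?V \<inter> ?N0 = {}"
    using zero_Hp by (auto simp: mem_act_image adj_S) (auto simp: act_SL_def mS_def Hp_def)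
  have v1: "?V \<inter> ?N1 = {}" using v0 by (metis V image_Int[OF act_inj[OF mU_SL]] image_empty rot(1))
  have v2: "?V \<inter> ?N2 = {}" using v1 by (metis V image_Int[OF act_inj[OF mU_SL]] image_empty rot(2))
  have neq: "mU \<noteq> mat 1" "mU ** mU \<noteq> mat 1" "mU ** mU \<noteq> mU" "mat 1 \<noteq> mU" "mat 1 \<noteq> mU ** mU" "mU \<noteq> mU ** mU"
    by (simp_all add: mU_def mat2_one)
  have ends: "ends (False, mat 1) = {Infty, Pt 0}" "ends (False, mU) = {Pt 0, Pt 1}"
    "ends (False, mU ** mU) = {Pt 1, Infty}"
    by (simp_all add: ends_def act_mult)
  have N: "nset (False, mat 1) = ?N0" "nset (False, mU) = ?N1" "nset (False, mU ** mU) = ?N2"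
    by (simp_all add: nset_def)
  have comps: "comps {mat 1, mU, mU ** mU} {} = {(False, mat 1), (False, mU), (False, mU ** mU)}"
    by (auto simp: comps_def)
  show ?thesis
    unfolding outline_def comps
  proof (intro conjI allI)
    show "\<forall>X\<in>{(False, mat 1), (False, mU), (False, mU ** mU)}. \<forall>Y\<in>{(False, mat 1), (False, mU), (False, mU ** mU)}.
        X \<noteq> Y \<longrightarrow> nset X \<inter> nset Y = {}"
      using d01 d12 d20 by (simp add: N Int_commute)
    show "\<forall>X\<in>{(False, mat 1), (False, mU), (False, mU ** mU)}. \<forall>Y\<in>{(False, mat 1), (False, mU), (False, mU ** mU)}.
        ends X \<inter> nset Y = {}"
      using v0 v1 v2 by (auto simp: N ends)
    show "(\<Union>A\<in>{mat 1, mU, mU ** mU}. act_SL A ` Dt) =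
        UpS \<inter> (\<Inter>X\<in>{(False, mat 1), (False, mU), (False, mU ** mU)}. cset X)"
    proof -
      have "(\<Union>A\<in>{mat 1, mU, mU ** mU}. act_SL A ` Dt) = Tt" by (simp add: Tt_tiles Un_assoc)
      also have "\<dots> = UpS \<inter> Tt" using Up_subsets by blast
      finally show ?thesis by (simp add: Tt_halfplanes cset_def Int_assoc)
    qed
    show "(\<Sum>X\<in>{(False, mat 1), (False, mU), (False, mU ** mU)}. of_bool (v \<in> ends X)) \<in> {0, 2::nat}" for v
      using neq by (auto simp: ends simp del: sum_of_bool_eq)
  qed auto
qed

lemma outline_init1: "outline (comps {mat 1} {mat 1}) (\<Union>A\<in>{mat 1}. act_SL A ` Dt)"
proof -
  have N0: "Pt z \<in> act_SL mS ` Hp \<longleftrightarrow> z \<noteq> 0 \<and> 0 \<le> Im z \<and> Re z \<le> 0" for z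
  proof (cases "z = 0")
    case False
    have "act_SL mS (Pt z) = Pt (- 1 / z)" using False by (simp add: act_SL_def mS_def)
    moreover have "Re (- 1 / z) = - Re z / nrm z" "Im (- 1 / z) = Im z / nrm z"
      by (simp_all add: Re_divide Im_divide nrm_def)
    moreover have "nrm z > 0" using False nrm_nonneg[of z] nrm_eq_0[of z] by linarith
    ultimately show ?thesis using False
      by (subst mem_act_image) (auto simp: adj_S Hp_def zero_le_divide_iff divide_le_0_iff)
  qed (simp add: mem_act_image adj_S zero_Hp)
  have inf: "Infty \<notin> act_SL mS ` Hp" by (simp add: mem_act_image adj_S zero_Hp)
  have pos: "0 < Re z" if "1/2 \<le> Re z \<or> nrm z \<le> 2 * Re z" "z \<noteq> 0" for z
    using that nrm_nonneg[of z] nrm_eq_0[of z] by linarith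
  have d: "act_SL mS ` Hp \<inter> Kp = {}"
  proof -
    have "Pt z \<notin> act_SL mS ` Hp" if "Pt z \<in> Kp" for z
      using pos[of z] that unfolding N0 by (simp add: Kp_def not_le)
    moreover have "\<exists>z. p = Pt z" if "p \<in> Kp" for p using that by (auto simp: Kp_def)
    ultimately show ?thesis by (metis disjoint_iff)
  qed
  have en: "{Infty, Pt 0} \<inter> act_SL mS ` Hp = {}" "{Infty, Pt 0} \<inter> Kp = {}"
    using inf by (auto simp: N0 Kp_def)
  have N: "nset (False, mat 1) = act_SL mS ` Hp" "nset (True, mat 1) = Kp"
    by (simp_all add: nset_def)
  \<comment> \<open>The initial tile is a bigon: both of its components run between 0 and infinity,
    so that each end has degree two.\<close>
  have ends: "ends (b, mat 1) = {Infty, Pt 0}" for b by (simp add: ends_def)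
  have comps: "comps {mat 1} {mat 1} = {(False, mat 1), (True, mat 1)}"
    by (auto simp: comps_def)
  show ?thesis
    unfolding outline_def comps
  proof (intro conjI allI)
    show "(\<Union>A\<in>{mat 1}. act_SL A ` Dt) = UpS \<inter> (\<Inter>X\<in>{(False, mat 1), (True, mat 1)}. cset X)"
      using Up_subsets by (auto simp: Dt_eq cset_def)
    show "(\<Sum>X\<in>{(False, mat 1), (True, mat 1)}. of_bool (v \<in> ends X)) \<in> {0, 2::nat}" for v
      by (simp add: ends del: sum_of_bool_eq)
  qed (use d en in \<open>auto simp: N ends\<close>)
qed

lemma outline_step3:
  assumes I: "outline I P" and A: "(False, A) \<in> I"
  shows "outline (I - {(False, A)} \<union> {(False, (A ** mS) ** mU), (False, ((A ** mS) ** mU) ** mU)})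
    (P \<union> (act_SL (A ** mS) ` Dt \<union> act_SL ((A ** mS) ** mU) ` Dt \<union> act_SL (((A ** mS) ** mU) ** mU) ` Dt))"
proof -
  have ASL: "A \<in> SL" using outlineD(2)[OF I] A by (simp add: subset_iff image_iff) (metis snd_conv)
  define B where "B = A ** mS"
  have B: "B \<in> SL" using ASL by (simp add: B_def)
  have neq: "B ** mU \<noteq> (B ** mU) ** mU"
  proof
    assume "B ** mU = (B ** mU) ** mU"
    then have "adj (B ** mU) ** (B ** mU) = adj (B ** mU) ** ((B ** mU) ** mU)" by simp
    then have "mat 1 = mU" using B by (simp add: matrix_mul_assoc) (simp flip: matrix_mul_assoc)
    then show False by (simp add: mU_def mat2_one)
  qed
  let ?W = "{(False, B ** mU), (False, (B ** mU) ** mU)}"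
  \<comment> \<open>The third vertex of the added ideal triangle. Both new components end there, so
    that \<open>outline_replace\<close> is used with \<open>k = 2\<close>.\<close>
  let ?m = "act_SL B (Pt 1)" and ?H = "act_SL B ` Hc"
  have N0: "nset (False, A) = act_SL B ` Hp" by (simp add: nset_def B_def)
  have N1: "nset (False, B ** mU) = act_SL B ` act_SL (mU ** mS) ` Hp"
    "nset (False, (B ** mU) ** mU) = act_SL B ` act_SL ((mU ** mU) ** mS) ` Hp"
    using B by (simp_all add: nset_def flip: act_image_mult matrix_mul_assoc)
  \<comment> \<open>\<open>A\<close> and \<open>B ** mS\<close> agree up to sign, hence act alike:
    this describes the old edge from the side of the new tile.\<close>
  have AB: "act_SL A ` Y = act_SL B ` act_SL mS ` Y" for Y
  proof -
    have "B ** mS = - A" by (simp add: B_def)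
    then show ?thesis using act_image_mult[OF B mS_SL, of Y] by simp
  qed
  have C0: "cset (False, A) = act_SL B ` act_SL mS ` Hc" by (simp add: cset_def AB)
  have C1: "cset (False, B ** mU) = act_SL B ` act_SL mU ` Hc"
    "cset (False, (B ** mU) ** mU) = act_SL B ` act_SL (mU ** mU) ` Hc"
    using B by (simp_all add: cset_def flip: act_image_mult matrix_mul_assoc)
  have e: "ends (False, A) = {act_SL B (Pt 0), act_SL B Infty}"
  proof -
    have "B ** mS = - A" by (simp add: B_def)
    then have "act_SL A p = act_SL B (act_SL mS p)" for p using act_mult[OF B mS_SL, of p] by simp
    then show ?thesis by (simp add: ends_def)
  qed
  have e1: "ends (False, B ** mU) = {act_SL B (Pt 0), ?m}" "ends (False, (B ** mU) ** mU) = {?m, act_SL B Infty}"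
    using B by (simp_all add: ends_def act_mult)
  have "outline (I - {(False, A)} \<union> ?W) (P \<union> (?H \<inter> (\<Inter>X\<in>?W. cset X)))"
  proof (rule outline_replace[OF I A, of ?W ?H ?m 2])
    show "nset X \<inter> nset Y = {}" if "X \<in> ?W" "Y \<in> ?W" "X \<noteq> Y" for X Y
    proof -
      have "nset (False, B ** mU) \<inter> nset (False, (B ** mU) ** mU) = {}"
        unfolding N1 image_Int[OF act_inj[OF B], symmetric] US_UUS_disjoint by simp
      then show ?thesis using that by (auto simp: Int_commute)
    qed
    show "nset X \<subseteq> nset (False, A)" if "X \<in> ?W" for X
    proof -
      have "nset (False, B ** mU) \<subseteq> nset (False, A)" "nset (False, (B ** mU) ** mU) \<subseteq> nset (False, A)"
        unfolding N0 N1 by (rule image_mono[OF US_Hp], rule image_mono[OF UUS_Hp])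
      then show ?thesis using that by blast
    qed
    show "cset (False, A) \<subseteq> cset X" if "X \<in> ?W" for X
    proof -
      have "act_SL mS ` Hc \<subseteq> act_SL mU ` Hc" "act_SL mS ` Hc \<subseteq> act_SL (mU ** mU) ` Hc"
        by (rule UpS_subsetI; simp add: mem_US; smt (verit) nrm_nonneg)+
      then show ?thesis using that B by (auto simp: C0 C1 act_image_mono)
    qed
    show "UpS = cset (False, A) \<union> ?H"
      using Hc_cover B act_UpS[OF B] by (simp add: C0 flip: image_Un) (simp add: Un_commute)
    show "?H \<subseteq> nset (False, A)"
      unfolding N0 by (rule image_mono[OF Hc_Hp])
    show "?m \<in> nset (False, A)" using one_Hp by (auto simp: N0)
    show "?m \<notin> nset X" if "X \<in> ?W" for X
      using that one_Hp B by (auto simp: N1 inj_image_mem_iff[OF act_inj[OF B]])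
    show "(\<Sum>X\<in>?W. of_bool (v \<in> ends X)) = of_bool (v \<in> ends (False, A)) + (if v = ?m then 2 else (0::nat))" for v
      using neq B by (auto simp: e e1 simp del: sum_of_bool_eq)
  qed (use B in \<open>auto simp: e e1\<close>)
  moreover have "?H \<inter> (\<Inter>X\<in>?W. cset X) = act_SL B ` Tt"
    by (simp add: C1 Tt_halfplanes image_Int[OF act_inj[OF B]] Int_assoc)
  moreover have "act_SL B ` Tt = act_SL B ` Dt \<union> act_SL (B ** mU) ` Dt \<union> act_SL ((B ** mU) ** mU) ` Dt"
    using B by (simp add: Tt_tiles image_Un flip: act_image_mult matrix_mul_assoc)
  ultimately show ?thesis by (simp add: B_def)
qed

lemma outline_step1:
  assumes I: "outline I P" and A: "(False, A) \<in> I"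
  shows "outline (I - {(False, A)} \<union> {(True, A ** mS)}) (P \<union> act_SL (A ** mS) ` Dt)"
proof -
  have ASL: "A \<in> SL" using outlineD(2)[OF I] A by (simp add: subset_iff image_iff) (metis snd_conv)
  define B where "B = A ** mS"
  have B: "B \<in> SL" using ASL by (simp add: B_def)
  have BS: "B ** mS = - A" by (simp add: B_def)
  let ?W = "{(True, B)}"
  let ?m = "act_SL B (Pt 1)" and ?H = "act_SL B ` Hc"
  have N0: "nset (False, A) = act_SL B ` Hp" by (simp add: nset_def B_def)
  have N1: "nset (True, B) = act_SL B ` Kp" by (simp add: nset_def)
  have C0: "cset (False, A) = act_SL B ` act_SL mS ` Hc"
    using act_image_mult[OF B mS_SL, of Hc] by (simp add: cset_def BS)
  have C1: "cset (True, B) = act_SL B ` Kc" by (simp add: cset_def)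
  have e: "ends (False, A) = {act_SL B (Pt 0), act_SL B Infty}"
  proof -
    have "act_SL A p = act_SL B (act_SL mS p)" for p using act_mult[OF B mS_SL, of p] BS by simp
    then show ?thesis by (simp add: ends_def)
  qed
  have e1: "ends (True, B) = {act_SL B (Pt 0), act_SL B Infty}" by (auto simp: ends_def)
  have m: "?m \<in> nset (False, A)" using one_Hp by (auto simp: N0)
  text \<open>No new vertex at infinity arises; any point outside the new outer region can play the role of
    the new vertex in \<open>outline_replace\<close>.\<close>
  obtain m' where m': "m' \<in> Hp" "m' \<notin> Kp"
  proof
    show "Pt (\<i>) \<in> Hp" "Pt (\<i>) \<notin> Kp" by (simp_all add: Hp_def Kp_def nrm_def)
  qed
  have "outline (I - {(False, A)} \<union> ?W) (P \<union> (?H \<inter> (\<Inter>X\<in>?W. cset X)))"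
  proof (rule outline_replace[OF I A, of ?W ?H "act_SL B m'" 0])
    show "nset X \<subseteq> nset (False, A)" if "X \<in> ?W" for X
      using that Kp_Hp B by (auto simp: N0 N1)
    show "cset (False, A) \<subseteq> cset X" if "X \<in> ?W" for X
    proof -
      have "act_SL mS ` Hc \<subseteq> Kc"
        by (rule UpS_subsetI; simp add: mem_US mem_base; smt (verit) nrm_nonneg)+
      then show ?thesis using that B by (auto simp: C0 C1)
    qed
    show "UpS = cset (False, A) \<union> ?H"
      using Hc_cover B act_UpS[OF B] by (simp add: C0 flip: image_Un) (simp add: Un_commute)
    show "?H \<subseteq> nset (False, A)"
      unfolding N0 by (rule image_mono[OF Hc_Hp])
    show "act_SL B m' \<in> nset (False, A)" using m' by (auto simp: N0)
    show "act_SL B m' \<notin> nset X" if "X \<in> ?W" for X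
      using that m' B by (auto simp: N1)
  qed (use B in \<open>auto simp: e e1\<close>)
  moreover have "?H \<inter> (\<Inter>X\<in>?W. cset X) = act_SL B ` Dt"
    by (simp add: C1 Dt_eq image_Int[OF act_inj[OF B]])
  ultimately show ?thesis by (simp add: B_def)
qed

lemma config_outline:
  assumes "config R F Q"
  shows "finite R \<and> R \<noteq> {} \<and> F \<subseteq> R \<and> Q \<subseteq> R \<and> R \<subseteq> SL \<and> outline (comps F Q) (\<Union>A\<in>R. act_SL A ` Dt)"
  using assms
proof induction
  case init3
  then show ?case using outline_init3 by auto
next
  case init1
  then show ?case using outline_init1 by auto
next
  case (step3 R F Q A)
  let ?B = "A ** mS"
  have "outline (comps F Q - {(False, A)} \<union> {(False, ?B ** mU), (False, (?B ** mU) ** mU)})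
    ((\<Union>A\<in>R. act_SL A ` Dt) \<union> (act_SL ?B ` Dt \<union> act_SL (?B ** mU) ` Dt \<union> act_SL ((?B ** mU) ** mU) ` Dt))"
    using step3 by (intro outline_step3) (auto simp: comps_def)
  moreover have "comps F Q - {(False, A)} \<union> {(False, ?B ** mU), (False, (?B ** mU) ** mU)} =
     comps (F - {A} \<union> {?B ** mU, (?B ** mU) ** mU}) Q"
    by (auto simp: comps_def)
  moreover have "(\<Union>C\<in>R \<union> {?B, ?B ** mU, (?B ** mU) ** mU}. act_SL C ` Dt) = (\<Union>A\<in>R. act_SL A ` Dt) \<union>
      (act_SL ?B ` Dt \<union> act_SL (?B ** mU) ` Dt \<union> act_SL ((?B ** mU) ** mU) ` Dt)"
    by (simp only: UN_Un UN_insert UN_empty Un_empty_right Un_assoc)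
  ultimately have "outline (comps (F - {A} \<union> {?B ** mU, (?B ** mU) ** mU}) Q)
      (\<Union>C\<in>R \<union> {?B, ?B ** mU, (?B ** mU) ** mU}. act_SL C ` Dt)" by (simp only:)
  then show ?case using step3 by (intro conjI) auto
next
  case (step1 R F Q A)
  have "outline (comps F Q - {(False, A)} \<union> {(True, A ** mS)}) ((\<Union>A\<in>R. act_SL A ` Dt) \<union> act_SL (A ** mS) ` Dt)"
    using step1 by (intro outline_step1) (auto simp: comps_def)
  moreover have "comps F Q - {(False, A)} \<union> {(True, A ** mS)} = comps (F - {A}) (insert (A ** mS) Q)"
    by (auto simp: comps_def)
  moreover have "(\<Union>C\<in>insert (A ** mS) R. act_SL C ` Dt) = (\<Union>A\<in>R. act_SL A ` Dt) \<union> act_SL (A ** mS) ` Dt"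
    by (simp only: UN_insert Un_commute)
  ultimately have "outline (comps (F - {A}) (insert (A ** mS) Q)) (\<Union>C\<in>insert (A ** mS) R. act_SL C ` Dt)"
    by (simp only:)
  then show ?case using step1 by (intro conjI) auto
qed

section \<open>Sides and angles\<close>

definition line :: "bool \<Rightarrow> complex set" where
  "line b = {z \<in> upper. if b then Re z = 1/2 \<and> 1 \<le> nrm z \<or> nrm z = 2 * Re z \<and> 2 * Re z \<le> 1 else Re z = 0}"

definition lineS :: "comp \<Rightarrow> complex set" where
  "lineS X = mz (snd X) ` line (fst X)"

definition inner :: "comp \<Rightarrow> complex set" where
  "inner X = {z \<in> upper. Pt z \<notin> nset X}"

definition domain :: "comp set \<Rightarrow> complex set" where
  "domain I = {z \<in> upper. \<forall>X\<in>I. Pt z \<in> cset X}"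

lemma mem_mz_image: "A \<in> SL \<Longrightarrow> Y \<subseteq> upper \<Longrightarrow> z \<in> upper \<Longrightarrow> z \<in> mz A ` Y \<longleftrightarrow> mz (adj A) z \<in> Y"
proof -
  assume A: "A \<in> SL" and Y: "Y \<subseteq> upper" and z: "z \<in> upper"
  have "mz (adj A) z \<in> Y" if "z = mz A w" "w \<in> Y" for w using that A Y by auto
  moreover have "z = mz A (mz (adj A) z)" using A z by simp
  ultimately show ?thesis by blast
qed

lemma line_upper: "line b \<subseteq> upper" by (auto simp: line_def)

lemma mem_lineS: "snd X \<in> SL \<Longrightarrow> z \<in> upper \<Longrightarrow> z \<in> lineS X \<longleftrightarrow> mz (adj (snd X)) z \<in> line (fst X)"
  unfolding lineS_def by (rule mem_mz_image) (auto simp: line_upper)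

lemma mem_cset:
  "snd X \<in> SL \<Longrightarrow> z \<in> upper \<Longrightarrow> Pt z \<in> cset X \<longleftrightarrow>
    (if fst X then Re (mz (adj (snd X)) z) \<le> 1/2 \<and> 2 * Re (mz (adj (snd X)) z) \<le> nrm (mz (adj (snd X)) z)
     else 0 \<le> Re (mz (adj (snd X)) z))"
  by (simp add: cset_def mem_act_image act_Pt mem_base)

lemma mem_nset:
  assumes "snd X \<in> SL" "z \<in> upper"
  shows "Pt z \<in> nset X \<longleftrightarrow>
    (if fst X then 1/2 \<le> Re (mz (adj (snd X)) z) \<or> nrm (mz (adj (snd X)) z) \<le> 2 * Re (mz (adj (snd X)) z)
     else Re (mz (adj (snd X)) z) \<le> 0)"
proof (cases "fst X")
  case False
  have w: "mz (adj (snd X)) z \<in> upper" using assms by simp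
  have "Pt z \<in> nset X \<longleftrightarrow> act_SL (adj mS) (act_SL (adj (snd X)) (Pt z)) \<in> Hp"
    using False assms mem_act_image[OF SL_mult[OF assms(1) mS_SL]] by (simp add: nset_def) (simp add: adj_mult act_mult)
  also have "\<dots> \<longleftrightarrow> 0 \<le> Re (mz mS (mz (adj (snd X)) z))"
    using assms w by (simp add: act_Pt adj_S mem_base)
  also have "\<dots> \<longleftrightarrow> Re (mz (adj (snd X)) z) \<le> 0"
    using nrm_pos[OF w] by (auto simp: Re_mz_mS divide_le_0_iff)
  finally show ?thesis using False by simp
qed (use assms in \<open>simp add: nset_def mem_act_image act_Pt mem_base\<close>)

lemma cset_inter_nset:
  assumes "snd X \<in> SL" "z \<in> upper"
  shows "z \<in> lineS X \<longleftrightarrow> Pt z \<in> cset X \<and> Pt z \<in> nset X"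
  using assms by (auto simp: mem_lineS mem_cset mem_nset line_def)

lemma lineS_upper: "snd X \<in> SL \<Longrightarrow> lineS X \<subseteq> upper"
  using subsetD[OF line_upper] by (auto simp: lineS_def)

lemma continuous_nrm [continuous_intros]: "continuous_on S f \<Longrightarrow> continuous_on S (\<lambda>x. nrm (f x))"
  unfolding nrm_def by (intro continuous_intros)

lemma open_inner: "snd X \<in> SL \<Longrightarrow> open (inner X)"
proof -
  assume X: "snd X \<in> SL"
  have "open {z. if fst X then Re z < 1/2 \<and> 2 * Re z < nrm z else 0 < Re z}"
  proof (cases "fst X")
    case True
    have "open {z. Re z < 1/2 \<and> 2 * Re z < nrm z}"
      by (intro open_Collect_conj open_Collect_less continuous_intros)
    then show ?thesis using True by simp
  next
    case False
    then show ?thesis by (simp add: open_halfspace_Re_gt)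
  qed
  then have "open {z \<in> upper. mz (adj (snd X)) z \<in> {z. if fst X then Re z < 1/2 \<and> 2 * Re z < nrm z else 0 < Re z}}"
    using X by (intro open_mz_vimage) simp_all
  also have "{z \<in> upper. mz (adj (snd X)) z \<in> {z. if fst X then Re z < 1/2 \<and> 2 * Re z < nrm z else 0 < Re z}} = inner X"
    using X by (cases "fst X") (auto simp: inner_def mem_nset)
  finally show ?thesis .
qed

lemma open_outer: "snd X \<in> SL \<Longrightarrow> open {z \<in> upper. Pt z \<notin> cset X}"
proof -
  assume X: "snd X \<in> SL"
  have "open {z. if fst X then Re z > 1/2 \<or> 2 * Re z > nrm z else 0 > Re z}"
  proof (cases "fst X")
    case True
    have "open {z. Re z > 1/2 \<or> 2 * Re z > nrm z}"
      by (intro open_Collect_disj open_Collect_less continuous_intros)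
    then show ?thesis using True by simp
  next
    case False
    then show ?thesis by (simp add: open_halfspace_Re_lt)
  qed
  then have "open {z \<in> upper. mz (adj (snd X)) z \<in> {z. if fst X then Re z > 1/2 \<or> 2 * Re z > nrm z else 0 > Re z}}"
    using X by (intro open_mz_vimage) simp_all
  also have "{z \<in> upper. mz (adj (snd X)) z \<in> {z. if fst X then Re z > 1/2 \<or> 2 * Re z > nrm z else 0 > Re z}} = {z \<in> upper. Pt z \<notin> cset X}"
    using X by (cases "fst X") (auto simp: mem_cset not_le)
  finally show ?thesis .
qed

text \<open>A small horizontal shift leaves the inner side: to the left for the line from 0 to
  infinity, to the right for the path through \<rho>.\<close>

lemma line_accumulates:
  assumes "z \<in> line b" "open V" "z \<in> V"
  shows "\<exists>w\<in>V. w \<in> upper \<and> \<not> (if b then Re w \<le> 1/2 \<and> 2 * Re w \<le> nrm w else 0 \<le> Re w)"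
proof -
  obtain e where e: "e > 0" "ball z e \<subseteq> V" using assms(2,3) by (meson openE)
  \<comment> \<open>On the path \<open>Re z\<close> is at most 1/2, so a shift to the right by at
    most 1/2 still approaches the point 1 and crosses the circle.\<close>
  define h where "h = (if b then min (e / 2) (1/2) else - e / 2)"
  define w where "w = z + of_real h"
  have "\<bar>h\<bar> < e" using e by (auto simp: h_def)
  then have "w \<in> V" using e by (intro subsetD[OF e(2)]) (simp add: w_def dist_norm)
  moreover have w: "Re w = Re z + h" "Im w = Im z" by (simp_all add: w_def)
  moreover have "\<not> (if b then Re w \<le> 1/2 \<and> 2 * Re w \<le> nrm w else 0 \<le> Re w)"
  proof (cases b)
    case True
    have h: "0 < h" "h \<le> 1/2" using e True by (auto simp: h_def)
    have "nrm w - 2 * Re w = nrm z - 2 * Re z + h * (2 * Re z + h - 2)"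
      by (simp add: nrm_def w power2_eq_square algebra_simps)
    moreover have "h * (2 * Re z + h - 2) < 0" if "2 * Re z \<le> 1" using h that by (intro mult_pos_neg) auto
    ultimately show ?thesis using True h assms(1) w by (auto simp: line_def)
  next
    case False
    then show ?thesis using e assms(1) w by (auto simp: line_def h_def)
  qed
  ultimately show ?thesis using assms(1) line_upper by (intro bexI[of _ w]) (auto simp: upper_def)
qed

lemma lineS_not_interior:
  assumes X: "snd X \<in> SL" and z: "z \<in> lineS X" and P: "\<And>w. w \<in> P \<Longrightarrow> Pt w \<in> cset X" "P \<subseteq> upper"
  shows "z \<notin> interior P"
proof
  assume "z \<in> interior P"
  obtain z0 where z0: "z0 \<in> line (fst X)" "z = mz (snd X) z0" using z by (auto simp: lineS_def)
  define V where "V = {w \<in> upper. mz (snd X) w \<in> interior P}"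
  have "open V" unfolding V_def by (intro open_mz_vimage X) simp
  moreover have "z0 \<in> V" using z0 \<open>z \<in> interior P\<close> line_upper by (auto simp: V_def)
  ultimately obtain w where w: "w \<in> V" "w \<in> upper"
    "\<not> (if fst X then Re w \<le> 1/2 \<and> 2 * Re w \<le> nrm w else 0 \<le> Re w)"
    using line_accumulates[OF z0(1)] by blast
  have "mz (snd X) w \<in> P" using w interior_subset by (auto simp: V_def)
  then have "Pt (mz (snd X) w) \<in> cset X" by (rule P)
  then show False using w X by (simp add: mem_cset split: if_splits)
qed

text \<open>A point on the line of one component is in its outer region, hence in no other one, and
  so belongs to the domain; nearby points leave it by \<open>line_accumulates\<close>. A point of
  the domain off all lines is in the finite intersection of the open sets \<open>inner X\<close>,
  which is contained in the domain.\<close>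

lemma outline_frontier:
  assumes I: "outline I P"
  shows "frontier (domain I) \<inter> upper = (\<Union>X\<in>I. lineS X)" and "closedin (top_of_set upper) (domain I)"
proof -
  have SL: "snd X \<in> SL" if "X \<in> I" for X using outlineD(2)[OF I] that by auto
  have cl: "closedin (top_of_set upper) (domain I)"
  proof -
    have "upper - domain I = (\<Union>X\<in>I. {z \<in> upper. Pt z \<notin> cset X})" by (auto simp: domain_def)
    moreover have "open (\<Union>X\<in>I. {z \<in> upper. Pt z \<notin> cset X})" by (intro open_UN ballI open_outer SL)
    ultimately have "openin (top_of_set upper) (upper - domain I)"
      by (metis Diff_subset open_subset)
    then show ?thesis by (simp add: closedin_def domain_def subset_iff)
  qed
  then show "closedin (top_of_set upper) (domain I)" .
  have closure: "closure (domain I) \<inter> upper = domain I"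
  proof -
    obtain T where "closed T" "domain I = upper \<inter> T" using cl by (auto simp: closedin_closed)
    moreover from this have "closure (domain I) \<subseteq> T" by (intro closure_minimal) auto
    moreover have "domain I \<subseteq> closure (domain I)" by (rule closure_subset)
    ultimately show ?thesis by blast
  qed
  show "frontier (domain I) \<inter> upper = (\<Union>X\<in>I. lineS X)"
  proof (intro equalityI subsetI)
    fix z assume "z \<in> frontier (domain I) \<inter> upper"
    then have z: "z \<in> domain I" "z \<notin> interior (domain I)" "z \<in> upper"
      using closure by (auto simp: frontier_def)
    show "z \<in> (\<Union>X\<in>I. lineS X)"
    proof (rule ccontr)
      assume "z \<notin> (\<Union>X\<in>I. lineS X)"
      then have "Pt z \<notin> nset X" if "X \<in> I" for X
        using z that SL cset_inter_nset[of X z] by (auto simp: domain_def)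
      then have "z \<in> upper \<inter> (\<Inter>X\<in>I. inner X)" using z by (auto simp: inner_def)
      moreover have "open (upper \<inter> (\<Inter>X\<in>I. inner X))"
        by (intro open_Int open_upper open_INT ballI open_inner SL outlineD(1)[OF I])
      moreover have "upper \<inter> (\<Inter>X\<in>I. inner X) \<subseteq> domain I"
      proof
        fix w assume w: "w \<in> upper \<inter> (\<Inter>X\<in>I. inner X)"
        have "Pt w \<in> cset X" if "X \<in> I" for X
        proof -
          have "Pt w \<in> UpS" "Pt w \<notin> nset X" using w that by (auto simp: inner_def)
          then show ?thesis using cset_nset[OF SL[OF that], of "fst X"] by (metis UnE prod.collapse subsetD)
        qed
        then show "w \<in> domain I" using w by (simp add: domain_def)
      qed
      ultimately show False using z(2) by (metis interiorI)
    qed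
  next
    fix z assume "z \<in> (\<Union>X\<in>I. lineS X)"
    then obtain X where X: "X \<in> I" "z \<in> lineS X" by auto
    have zu: "z \<in> upper" using X lineS_upper SL by blast
    have zX: "Pt z \<in> cset X" "Pt z \<in> nset X" using cset_inter_nset[OF SL zu] X by auto
    have "Pt z \<in> cset Y" if "Y \<in> I" for Y
    proof (cases "Y = X")
      case False
      then have "Pt z \<notin> nset Y" using outlineD(3)[OF I X(1) that] zX by blast
      moreover have "Pt z \<in> UpS" using zu by simp
      ultimately show ?thesis using cset_nset[OF SL[OF that], of "fst Y"] by (metis UnE prod.collapse subsetD)
    qed (use zX in simp)
    then have "z \<in> domain I" using zu by (simp add: domain_def)
    moreover have "z \<notin> interior (domain I)"
      by (rule lineS_not_interior[OF SL[OF X(1)] X(2)]) (use X in \<open>auto simp: domain_def\<close>)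
    ultimately show "z \<in> frontier (domain I) \<inter> upper"
      using zu closure by (auto simp: frontier_def)
  qed
qed

text \<open>After multiplication by the positive \<open>den A z\<close> the condition is again
  linear in \<open>nrm z\<close>, \<open>Re z\<close> and 1; the coefficients transform like those
  of a binary quadratic form.\<close>

lemma halfplane_mz:
  assumes "A \<in> SL" "z \<in> upper"
  shows "\<alpha> * nrm (mz A z) + \<beta> * Re (mz A z) + \<gamma> \<ge> 0 \<longleftrightarrow>
    z \<in> halfplane (\<alpha> * (of_int (A$1$1))\<^sup>2 + \<beta> * of_int (A$1$1 * A$2$1) + \<gamma> * (of_int (A$2$1))\<^sup>2)
     (2 * \<alpha> * of_int (A$1$1 * A$1$2) + \<beta> * of_int (A$1$1 * A$2$2 + A$1$2 * A$2$1) + 2 * \<gamma> * of_int (A$2$1 * A$2$2))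
     (\<alpha> * (of_int (A$1$2))\<^sup>2 + \<beta> * of_int (A$1$2 * A$2$2) + \<gamma> * (of_int (A$2$2))\<^sup>2)"
proof -
  have d: "den A z > 0" using assms by (rule den_pos)
  have "\<alpha> * (p / D) + \<beta> * (q / D) + \<gamma> \<ge> 0 \<longleftrightarrow> \<alpha> * p + \<beta> * q + \<gamma> * D \<ge> 0" if "D > 0" for p q D :: real
  proof -
    have "\<alpha> * (p / D) + \<beta> * (q / D) + \<gamma> = (\<alpha> * p + \<beta> * q + \<gamma> * D) / D" using that by (simp add: field_simps)
    then show ?thesis using that by (simp add: zero_le_divide_iff)
  qed
  note * = this[OF d]
  show ?thesis
    unfolding nrm_mz Re_mz * using assms(2) by (simp add: halfplane_def den_def algebra_simps)
qed

lemma hyp_convex_mz: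
  assumes "A \<in> SL" shows "hyp_convex {z \<in> upper. \<alpha> * nrm (mz A z) + \<beta> * Re (mz A z) + \<gamma> \<ge> 0}"
proof -
  obtain \<alpha>' \<beta>' \<gamma>' where "\<And>z. z \<in> upper \<Longrightarrow> \<alpha> * nrm (mz A z) + \<beta> * Re (mz A z) + \<gamma> \<ge> 0 \<longleftrightarrow> z \<in> halfplane \<alpha>' \<beta>' \<gamma>'"
    using halfplane_mz[OF assms] by blast
  then have "{z \<in> upper. \<alpha> * nrm (mz A z) + \<beta> * Re (mz A z) + \<gamma> \<ge> 0} = halfplane \<alpha>' \<beta>' \<gamma>'"
    by (auto simp: halfplane_def)
  then show ?thesis using hyp_convex_halfplane by simp
qed

text \<open>The inner side of the path through \<rho> has an angle below \<pi> there and is an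
  intersection of two half-planes.\<close>

lemma hyp_convex_cset:
  assumes "snd X \<in> SL" shows "hyp_convex {z \<in> upper. Pt z \<in> cset X}"
proof (cases "fst X")
  case True
  have "{z \<in> upper. Pt z \<in> cset X} =
    {z \<in> upper. 0 * nrm (mz (adj (snd X)) z) + (-1) * Re (mz (adj (snd X)) z) + 1/2 \<ge> 0} \<inter>
    {z \<in> upper. 1 * nrm (mz (adj (snd X)) z) + (-2) * Re (mz (adj (snd X)) z) + 0 \<ge> 0}"
    using assms True by (auto simp: mem_cset)
  also have "hyp_convex \<dots>" by (intro hyp_convex_Int hyp_convex_mz) (simp_all add: assms)
  finally show ?thesis .
next
  case False
  have "{z \<in> upper. Pt z \<in> cset X} =
    {z \<in> upper. 0 * nrm (mz (adj (snd X)) z) + 1 * Re (mz (adj (snd X)) z) + 0 \<ge> 0}"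
    using assms False by (auto simp: mem_cset)
  also have "hyp_convex \<dots>" by (intro hyp_convex_mz) (simp add: assms)
  finally show ?thesis .
qed

lemma hyp_convex_domain:
  assumes "snd ` I \<subseteq> SL" shows "hyp_convex (domain I)"
proof -
  have "domain I = upper \<inter> (\<Inter>X\<in>I. {z \<in> upper. Pt z \<in> cset X})" by (auto simp: domain_def)
  then show ?thesis using assms by (auto intro!: hyp_convex_INT hyp_convex_cset)
qed

text \<open>An edge descriptor \<open>(c, A)\<close> stands for the free edge \<open>A{0,\<infinity>}\<close> if \<open>c = 0\<close>, for one of the
  even edges \<open>A{i,\<infinity>}\<close>, \<open>A{i,0}\<close> if \<open>c = 1, 2\<close> and for one of the odd edges \<open>A{\<rho>,\<infinity>}\<close>,
  \<open>A{\<rho>,0}\<close> if \<open>c = 3, 4\<close>.\<close>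

type_synonym desc = "nat \<times> imat"

text \<open>The base edges all start at infinity. The halves starting at 0 are reached because
  \<open>mS\<close> fixes i, \<open>mU\<close> fixes \<rho>, and both send infinity to 0.\<close>

definition dmat :: "desc \<Rightarrow> imat" where
  "dmat d = (if fst d = 2 then snd d ** mS else if fst d = 4 then snd d ** mU else snd d)"

definition dkind :: "desc \<Rightarrow> int" where
  "dkind d = (if fst d = 0 then 0 else if fst d \<le> 2 then 1 else 2)"

definition base :: "int \<Rightarrow> sphere set" where
  "base k = (if k = 0 then free_base else if k = 1 then even_base else odd_base)"

definition dedge :: "desc \<Rightarrow> sphere set" where
  "dedge d = act_SL (dmat d) ` base (dkind d)"

definition owner :: "desc \<Rightarrow> comp" where
  "owner d = (fst d \<ge> 3, snd d)"

definition rho :: complex where "rho = cis (pi / 3)"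

definition mid :: "bool \<Rightarrow> complex" where "mid b = (if b then rho else \<i>)"

definition descs :: "imat set \<Rightarrow> imat set \<Rightarrow> imat set \<Rightarrow> desc set" where
  "descs F E Q = {0} \<times> (F - E) \<union> {1, 2} \<times> E \<union> {3, 4} \<times> Q"

lemma rho_eq: "Re rho = 1/2" "Im rho = sqrt 3 / 2" "nrm rho = 1"
  by (simp_all add: rho_def cos_60 sin_60 nrm_def power_divide)

lemma rho_upper [simp]: "rho \<in> upper" and i_upper [simp]: "\<i> \<in> upper" and mid_upper [simp]: "mid b \<in> upper"
  by (simp_all add: upper_def rho_eq mid_def)

lemma upper_eqI: "z \<in> upper \<Longrightarrow> w \<in> upper \<Longrightarrow> Re z = Re w \<Longrightarrow> nrm z = nrm w \<Longrightarrow> z = w"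
  by (simp add: complex_eq_iff upper_def nrm_def power2_eq_iff_nonneg)

lemma nrm_i [simp]: "nrm \<i> = 1" by (simp add: nrm_def)

lemma mz_S_i: "mz mS \<i> = \<i>"
  by (rule upper_eqI) (simp_all add: Re_mz_mS nrm_mz_mS)

lemma mz_U_rho: "mz mU rho = rho"
  by (rule upper_eqI) (simp_all add: Re_mz_mU nrm_mz_mU rho_eq)

lemma dedge_eq:
  assumes "A \<in> SL"
  shows "dedge (0, A) = {act_SL A Infty, act_SL A (Pt 0)}"
    "dedge (Suc 0, A) = {act_SL A Infty, Pt (mz A \<i>)}"
    "dedge (2, A) = {act_SL A (Pt 0), Pt (mz A \<i>)}"
    "dedge (3, A) = {act_SL A Infty, Pt (mz A rho)}"
    "dedge (4, A) = {act_SL A (Pt 0), Pt (mz A rho)}"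
  using assms by (simp_all add: dedge_def dmat_def dkind_def base_def free_base_def even_base_def odd_base_def
      act_mult act_Pt mz_S_i mz_U_rho flip: rho_def)

lemma dmat_SL: "snd d \<in> SL \<Longrightarrow> dmat d \<in> SL"
  by (auto simp: dmat_def)

lemma side_bases:
  "side free_base = {z \<in> upper. Re z = 0}"
  "side even_base = {z \<in> upper. Re z = 0 \<and> 1 \<le> nrm z}"
  "side odd_base = {z \<in> upper. Re z = 1/2 \<and> 1 \<le> nrm z}"
proof -
  show "side free_base = {z \<in> upper. Re z = 0}"
  proof -
    have "side free_base = {z \<in> upper. Re z = Re 0 \<and> Im 0 \<le> Im z}"
      unfolding free_base_def by (rule side_Infty) simp
    also have "\<dots> = {z \<in> upper. Re z = 0}" by (intro Collect_cong) (auto simp: upper_iff)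
    finally show ?thesis .
  qed
  have "1 \<le> nrm z \<longleftrightarrow> 1 \<le> Im z" if "Re z = 0" "z \<in> upper" for z
  proof -
    have "1 \<le> nrm z \<longleftrightarrow> 1\<^sup>2 \<le> (Im z)\<^sup>2" using that by (simp add: nrm_def)
    also have "\<dots> \<longleftrightarrow> 1 \<le> Im z" using that by (intro power_mono_iff) (auto simp: upper_def)
    finally show ?thesis .
  qed
  then have "{z \<in> upper. Re z = Re \<i> \<and> Im \<i> \<le> Im z} = {z \<in> upper. Re z = 0 \<and> 1 \<le> nrm z}" by auto
  moreover have "side even_base = {z \<in> upper. Re z = Re \<i> \<and> Im \<i> \<le> Im z}"
    unfolding even_base_def by (rule side_Infty) simp
  ultimately show "side even_base = {z \<in> upper. Re z = 0 \<and> 1 \<le> nrm z}" by simp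
  have "1 \<le> nrm z \<longleftrightarrow> Im rho \<le> Im z" if "Re z = 1/2" "z \<in> upper" for z
  proof -
    have "nrm z = 1/4 + (Im z)\<^sup>2" "(Im rho)\<^sup>2 = 3/4" unfolding nrm_def rho_eq that(1) by (simp_all add: power_divide)
    then have "1 \<le> nrm z \<longleftrightarrow> (Im rho)\<^sup>2 \<le> (Im z)\<^sup>2" by (intro iffI) linarith+
    also have "\<dots> \<longleftrightarrow> Im rho \<le> Im z" using that by (intro power_mono_iff) (auto simp: upper_def rho_eq)
    finally show ?thesis .
  qed
  then have "{z \<in> upper. Re z = Re rho \<and> Im rho \<le> Im z} = {z \<in> upper. Re z = 1/2 \<and> 1 \<le> nrm z}"
    unfolding rho_eq(1) by blast
  moreover have "side odd_base = {z \<in> upper. Re z = Re rho \<and> Im rho \<le> Im z}"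
    unfolding odd_base_def rho_def[symmetric] by (rule side_Infty) (simp add: rho_eq)
  ultimately show "side odd_base = {z \<in> upper. Re z = 1/2 \<and> 1 \<le> nrm z}" by simp
qed

definition sub :: "nat \<Rightarrow> complex set" where
  "sub c = {z \<in> upper. if c = 0 then Re z = 0 else if c = 1 then Re z = 0 \<and> 1 \<le> nrm z
     else if c = 2 then Re z = 0 \<and> nrm z \<le> 1 else if c = 3 then Re z = 1/2 \<and> 1 \<le> nrm z
     else nrm z = 2 * Re z \<and> 2 * Re z \<le> 1}"

lemma sub_upper: "sub c \<subseteq> upper" by (auto simp: sub_def)

lemma mz_image_mult: "A \<in> SL \<Longrightarrow> B \<in> SL \<Longrightarrow> Y \<subseteq> upper \<Longrightarrow> mz (A ** B) ` Y = mz A ` mz B ` Y"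
  by (force simp: mz_mult)

lemma mz_S_sub: "mz mS ` sub 1 = sub 2"
proof -
  have "z \<in> mz mS ` sub 1 \<longleftrightarrow> z \<in> sub 2" if z: "z \<in> upper" for z
  proof -
    have "z \<in> mz mS ` sub 1 \<longleftrightarrow> mz (adj mS) z \<in> sub 1" using z sub_upper by (intro mem_mz_image) auto
    also have "mz (adj mS) z = mz mS z" by (simp add: adj_S mz_def mS_def)
    also have "mz mS z \<in> sub 1 \<longleftrightarrow> z \<in> sub 2"
      using z nrm_pos[OF z] by (auto simp: sub_def Re_mz_mS nrm_mz_mS field_simps)
    finally show ?thesis .
  qed
  moreover have "mz mS ` sub 1 \<subseteq> upper" using subsetD[OF sub_upper] by auto
  ultimately show ?thesis using sub_upper by blast
qed

lemma mz_U_sub: "mz mU ` sub 3 = sub 4"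
proof -
  have "z \<in> mz mU ` sub 3 \<longleftrightarrow> z \<in> sub 4" if z: "z \<in> upper" for z
  proof -
    have "z \<in> mz mU ` sub 3 \<longleftrightarrow> mz (adj mU) z \<in> sub 3" using z sub_upper by (intro mem_mz_image) auto
    also have "mz (adj mU) z \<in> sub 3 \<longleftrightarrow> z \<in> sub 4"
    proof -
      have q: "nrm z > 0" by (rule nrm_pos[OF z])
      have "(nrm z - Re z) / nrm z = 1/2 \<longleftrightarrow> nrm z = 2 * Re z"
        "1 \<le> (nrm z - 2 * Re z + 1) / nrm z \<longleftrightarrow> 2 * Re z \<le> 1"
        using q by (auto simp: field_simps)
      then show ?thesis using z by (simp add: sub_def Re_mz_adjU nrm_mz_adjU)
    qed
    finally show ?thesis .
  qed
  moreover have "mz mU ` sub 3 \<subseteq> upper" using subsetD[OF sub_upper] by auto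
  ultimately show ?thesis using sub_upper by blast
qed

lemma side_base: "side (act_SL A ` base k) = mz A ` side (base k)" if "A \<in> SL"
  using that side_act[of A] by (simp add: base_def free_base_def even_base_def odd_base_def)

lemma side_dedge:
  assumes "A \<in> SL" "c \<le> 4" shows "side (dedge (c, A)) = mz A ` sub c"
proof -
  have b: "side (base 0) = sub 0" "side (base 1) = sub 1" "side (base 2) = sub 3"
    by (auto simp: base_def side_bases sub_def)
  consider "c = 0" | "c = 1" | "c = 2" | "c = 3" | "c = 4" using assms(2) by linarith
  then show ?thesis
  proof cases
    case 3
    then have "side (dedge (c, A)) = mz (A ** mS) ` sub 1"
      unfolding dedge_def using assms by (subst side_base) (auto simp: dmat_def dkind_def b)
    then show ?thesis using assms 3 by (simp only: mz_image_mult[OF assms(1) mS_SL sub_upper] mz_S_sub)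
  next
    case 5
    then have "side (dedge (c, A)) = mz (A ** mU) ` sub 3"
      unfolding dedge_def using assms by (subst side_base) (auto simp: dmat_def dkind_def b)
    then show ?thesis using assms 5 by (simp only: mz_image_mult[OF assms(1) mU_SL sub_upper] mz_U_sub)
  qed (use assms b in \<open>simp_all add: dedge_def side_base dmat_def dkind_def\<close>)
qed

lemma sub_line: "c \<le> 4 \<Longrightarrow> sub c \<subseteq> line (c \<ge> 3)"
  "line False = sub 0" "line False = sub 1 \<union> sub 2" "line True = sub 3 \<union> sub 4"
  "sub 1 \<inter> sub 2 \<subseteq> {\<i>}" "sub 3 \<inter> sub 4 \<subseteq> {rho}"
  by (auto simp: sub_def line_def rho_eq intro!: upper_eqI)

lemma sub_nonempty: "c \<le> 4 \<Longrightarrow> sub c \<noteq> {}"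
proof -
  have "\<i> \<in> sub 0 \<inter> sub 1 \<inter> sub 2" "rho \<in> sub 3 \<inter> sub 4" by (auto simp: sub_def rho_eq )
  moreover assume "c \<le> 4"
  then have "c = 0 \<or> c = 1 \<or> c = 2 \<or> c = 3 \<or> c = 4" by linarith
  ultimately show ?thesis by blast
qed

text \<open>The correction factor depends on \<open>A\<close> and z but not on p, so quotients of
  directions at z, and with them angles, are invariant. A real p keeps numerator and denominator of
  the direction away from 0.\<close>

lemma dir_mz:
  assumes A: "A \<in> SL" and z: "z \<in> upper" and p: "p \<in> Bd"
  shows "direction (mz A z) (act_SL A p) =
    direction z p * ((of_int (A$2$1) * cnj z + of_int (A$2$2)) / (of_int (A$2$1) * z + of_int (A$2$2)))"
proof -
  obtain a b c d where abcd: "A = mat2 a b c d" by (cases A rule: mat2_cases)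
  define a' b' c' d' :: complex where c: "a' = of_int a" "b' = of_int b" "c' = of_int c" "d' = of_int d"
  have "of_int (a * d - b * c) = (1 :: complex)" using A abcd by simp
  then have det: "a' * d' - b' * c' = 1" by (simp add: c)
  define D D' where D: "D = c' * z + d'" "D' = c' * cnj z + d'"
  have "D \<noteq> 0" using lin_int_nonzero[OF A z] by (simp add: D c abcd)
  then have nz: "D \<noteq> 0" "D' \<noteq> 0"
  proof -
    have "D' = cnj D" by (simp add: D c)
    then show "D' \<noteq> 0" using \<open>D \<noteq> 0\<close> by simp
  qed
  have cz: "cnj (mz A z) = (a' * cnj z + b') / D'" by (simp add: mz_def abcd c D)
  have mz: "mz A z = (a' * z + b') / D" by (simp add: mz_def abcd c D)
  have diff: "(a' * w + b') * D - (a' * z + b') * (c' * w + d') = w - z"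
    if "D = c' * z + d'" for w z D :: complex
  proof -
    have "(a' * w + b') * D - (a' * z + b') * (c' * w + d') = (a' * d' - b' * c') * (w - z)"
      unfolding that by (simp add: algebra_simps)
    then show ?thesis using det by simp
  qed
  show ?thesis
  proof (cases p)
    case Infty
    show ?thesis
    proof (cases "c = 0")
      case True
      then show ?thesis using nz by (simp add: Infty act_SL_def abcd D c)
    next
      case False
      then have c0: "c' \<noteq> 0" by (simp add: c)
      have "a' / c' - (a' * z + b') / D = (a' * d' - b' * c') / (c' * D)"
        using c0 nz by (simp add: field_simps D)
      moreover have "a' / c' - (a' * cnj z + b') / D' = (a' * d' - b' * c') / (c' * D')"
        using c0 nz by (simp add: field_simps D)
      ultimately have "direction (mz A z) (act_SL A p) = (1 / (c' * D)) / (1 / (c' * D'))"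
      proof -
        have "act_SL A p = Pt (a' / c')" using False c0 by (simp add: Infty act_SL_def abcd c)
        moreover assume "a' / c' - (a' * z + b') / D = (a' * d' - b' * c') / (c' * D)"
          "a' / c' - (a' * cnj z + b') / D' = (a' * d' - b' * c') / (c' * D')"
        ultimately show ?thesis by (simp only: direction.simps cz det) (simp only: mz det)
      qed
      then show ?thesis using c0 nz by (simp add: Infty abcd D flip: c)
    qed
  next
    case (Pt w)
    then have w: "w \<in> \<real>" using p by simp
    have wz: "w - cnj z \<noteq> 0" "w - z \<noteq> 0" using w z by (auto simp: complex_is_Real_iff upper_def complex_eq_iff)
    show ?thesis
    proof (cases "c' * w + d' = 0")
      case True
      then have "D = c' * (z - w)" "D' = c' * (cnj z - w)" by (auto simp: D algebra_simps eq_neg_iff_add_eq_0)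
      then have "(w - z) * D' = (w - cnj z) * D"
        by (simp only:) (simp add: ring_distribs ac_simps)
      then have "(w - z) / (w - cnj z) * (D' / D) = 1" using nz wz by simp
      then show ?thesis using True by (simp add: Pt act_SL_def abcd D flip: c)
    next
      case False
      define W where "W = c' * w + d'"
      have "(a' * w + b') / W - (a' * z + b') / D = (w - z) / (W * D)"
        using False nz diff[where w = w and z = z and D = D] D by (simp add: W_def[symmetric] diff_frac_eq)
      moreover have "(a' * w + b') / W - (a' * cnj z + b') / D' = (w - cnj z) / (W * D')"
        using False nz diff[where w = w and z = "cnj z" and D = D'] D by (simp add: W_def[symmetric] diff_frac_eq)
      moreover have "act_SL A p = Pt ((a' * w + b') / W)"
        using False by (simp add: Pt act_SL_def abcd W_def flip: c)
      ultimately have "direction (mz A z) (act_SL A p) = ((w - z) / (W * D)) / ((w - cnj z) / (W * D'))"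
        by (simp only: direction.simps cz) (simp only: mz)
      also have "\<dots> = (w - z) / (w - cnj z) * (D' / D)"
        using nz False by (simp add: W_def[symmetric])
      finally show ?thesis by (simp add: Pt abcd D flip: c)
    qed
  qed
qed

section \<open>The special polygon\<close>

lemma angle_mz:
  assumes "A \<in> SL" "z \<in> upper" "p \<in> Bd" "q \<in> Bd"
  shows "angle (mz A z) (act_SL A p) (act_SL A q) = angle z p q"
proof -
  let ?k = "(of_int (A$2$1) * cnj z + of_int (A$2$2)) / (of_int (A$2$1) * z + of_int (A$2$2)) :: complex"
  have nz: "of_int (A$2$1) * z + of_int (A$2$2) \<noteq> (0::complex)" by (rule lin_int_nonzero[OF assms(1,2)])
  moreover have "of_int (A$2$1) * cnj z + of_int (A$2$2) = cnj (of_int (A$2$1) * z + of_int (A$2$2))" by simp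
  ultimately have "?k \<noteq> 0" by (metis complex_cnj_zero_iff divide_eq_0_iff)
  then show ?thesis unfolding angle_def dir_mz[OF assms(1,2,3)] dir_mz[OF assms(1,2,4)] by simp
qed

lemma angle_i: "angle \<i> Infty (Pt 0) = pi" "angle \<i> (Pt 0) Infty = pi"
  using Arg_cis[of pi] by (simp_all add: angle_def)

lemma angle_rho: "angle rho Infty (Pt 0) = 2 * pi / 3" "angle rho (Pt 0) Infty = 2 * pi / 3"
proof -
  have d: "direction rho (Pt 0) = cis (2 * pi / 3)"
    by (simp add: rho_def cis_cnj cis_divide)
  have inv: "1 / cis (2 * pi / 3) = cis (- (2 * pi / 3))" by (simp add: cis_inverse[symmetric] inverse_eq_divide)
  have "2 * pi / 3 \<in> {- pi<..pi}" "- (2 * pi / 3) \<in> {- pi<..pi}"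
    using pi_gt_zero by (simp, simp, linarith)
  then have arg: "Arg (cis (2 * pi / 3)) = 2 * pi / 3" "Arg (cis (- (2 * pi / 3))) = - (2 * pi / 3)"
    by (simp_all only: Arg_cis)
  show "angle rho Infty (Pt 0) = 2 * pi / 3" "angle rho (Pt 0) Infty = 2 * pi / 3"
    unfolding angle_def d direction.simps(1) inv div_by_1 arg by simp_all
qed

text \<open>The two points lie in different orbits. If C moves i to \<rho>, then comparison of
  imaginary parts gives 1/n = sqrt 3 / 2 with an integer n, hence 3 n^2 = 4.\<close>

lemma Im_mz_i_rho: "mz A \<i> \<noteq> mz B rho" if "A \<in> SL" "B \<in> SL"
proof
  assume "mz A \<i> = mz B rho"
  then have "mz (adj B ** A) \<i> = rho" using that by (simp add: mz_mult)
  moreover define C where "C = adj B ** A"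
  moreover have "C \<in> SL" using that by (simp add: C_def)
  ultimately have "1 / den C \<i> = sqrt 3 / 2" using Im_mz[of C \<i>] by (simp add: rho_eq)
  moreover have "den C \<i> = of_int ((C$2$1)\<^sup>2 + (C$2$2)\<^sup>2)" by (simp add: den_def)
  ultimately have n: "1 / of_int ((C$2$1)\<^sup>2 + (C$2$2)\<^sup>2) = sqrt 3 / 2" by simp
  define n where "n = (C$2$1)\<^sup>2 + (C$2$2)\<^sup>2"
  have "n \<noteq> 0" using n by (auto simp: n_def)
  then have "of_int n * sqrt 3 = 2" using n by (simp add: n_def[symmetric] field_simps)
  then have "(of_int n * sqrt 3)\<^sup>2 = 2\<^sup>2" by simp
  then have "of_int (3 * n\<^sup>2) = (of_int 4 :: real)" by (simp add: power_mult_distrib)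
  then have "3 * n\<^sup>2 = 4" by (simp only: of_int_eq_iff)
  then show False by presburger
qed

lemma base_UpS: "A \<in> SL \<Longrightarrow> act_SL A ` free_base \<inter> UpS = {}"
  "A \<in> SL \<Longrightarrow> act_SL A ` even_base \<inter> UpS = {Pt (mz A \<i>)}"
  "A \<in> SL \<Longrightarrow> act_SL A ` odd_base \<inter> UpS = {Pt (mz A rho)}"
proof -
  assume A: "A \<in> SL"
  have *: "act_SL A ` Y \<inter> UpS = act_SL A ` (Y \<inter> UpS)" for Y
    using A act_UpS by (metis act_inj image_Int)
  have "free_base \<inter> UpS = {}" "even_base \<inter> UpS = {Pt \<i>}" "odd_base \<inter> UpS = {Pt rho}"
    by (auto simp: free_base_def even_base_def odd_base_def upper_def simp flip: rho_def)
       (auto simp: rho_eq upper_def)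
  then show "act_SL A ` free_base \<inter> UpS = {}" "act_SL A ` even_base \<inter> UpS = {Pt (mz A \<i>)}"
    "act_SL A ` odd_base \<inter> UpS = {Pt (mz A rho)}"
    using A unfolding * by (simp_all add: act_Pt)
qed

lemma copy_of_iff: "copy_of b e \<longleftrightarrow> (\<exists>A\<in>SL. e = act_SL A ` b)"
  by (auto simp: copy_of_def PSL_carrier act_cls)

text \<open>The vertices of an edge in the open half-plane reveal its kind: there is none, or one in
  the orbit of i, or one in the orbit of \<rho>, and these orbits are distinct.\<close>

lemma copy_of_dedge:
  assumes "snd d \<in> SL"
  shows "copy_of free_base (dedge d) \<longleftrightarrow> dkind d = 0"
    "copy_of even_base (dedge d) \<longleftrightarrow> dkind d = 1"
    "copy_of odd_base (dedge d) \<longleftrightarrow> dkind d = 2"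
proof -
  have dm: "dmat d \<in> SL" using assms by (rule dmat_SL)
  have k: "dkind d = 0 \<or> dkind d = 1 \<or> dkind d = 2" by (auto simp: dkind_def)
  have U: "dedge d \<inter> UpS = (if dkind d = 0 then {} else if dkind d = 1 then {Pt (mz (dmat d) \<i>)} else {Pt (mz (dmat d) rho)})"
    using k base_UpS[OF dm] by (auto simp: dedge_def base_def)
  have 0: "copy_of free_base e \<Longrightarrow> e \<inter> UpS = {}" for e using base_UpS by (auto simp: copy_of_iff)
  have 1: "copy_of even_base e \<Longrightarrow> \<exists>B\<in>SL. e \<inter> UpS = {Pt (mz B \<i>)}" for e using base_UpS by (auto simp: copy_of_iff)
  have 2: "copy_of odd_base e \<Longrightarrow> \<exists>B\<in>SL. e \<inter> UpS = {Pt (mz B rho)}" for e using base_UpS by (auto simp: copy_of_iff)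
  have i_rho: "mz (dmat d) rho \<noteq> mz B \<i>" if "B \<in> SL" for B
    using Im_mz_i_rho[OF that dm] by simp
  have c: "copy_of (base (dkind d)) (dedge d)" using dm by (auto simp: copy_of_iff dedge_def)
  show "copy_of free_base (dedge d) \<longleftrightarrow> dkind d = 0"
    using k c 0[of "dedge d"] U by (auto simp: base_def split: if_splits)
  show "copy_of even_base (dedge d) \<longleftrightarrow> dkind d = 1"
    using k c 1[of "dedge d"] U i_rho by (auto simp: base_def split: if_splits)
  show "copy_of odd_base (dedge d) \<longleftrightarrow> dkind d = 2"
    using k c 2[of "dedge d"] U Im_mz_i_rho[OF dm] Im_mz_i_rho[OF dm, symmetric] by (auto simp: base_def split: if_splits)
qed

text \<open>\<open>E\<close> collects the boundary tiles whose edge from 0 to infinity is to be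
  broken at the image of i.\<close>

locale polygon_data =
  fixes R F Q E :: "imat set"
  assumes config: "config R F Q" and EF: "E \<subseteq> F"
begin

abbreviation "I \<equiv> comps F Q"
abbreviation "P \<equiv> domain I"
abbreviation "D \<equiv> descs F E Q"

lemma R: "finite R" "R \<noteq> {}" "F \<subseteq> R" "Q \<subseteq> R" "R \<subseteq> SL" "outline I (\<Union>A\<in>R. act_SL A ` Dt)"
  using config_outline[OF config] by auto

lemma D_SL: "d \<in> D \<Longrightarrow> snd d \<in> SL"
proof -
  have "F \<subseteq> SL" "E \<subseteq> SL" "Q \<subseteq> SL" using R(3-5) EF by blast+
  then show "d \<in> D \<Longrightarrow> snd d \<in> SL" by (auto simp: descs_def)
qed

lemma D_fst: "d \<in> D \<Longrightarrow> fst d \<le> 4"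
  by (auto simp: descs_def)

lemma I_SL: "X \<in> I \<Longrightarrow> snd X \<in> SL"
  using outlineD(2)[OF R(6)] by auto

lemma owner_I: "d \<in> D \<Longrightarrow> owner d \<in> I"
  using EF by (auto simp: descs_def owner_def comps_def)

lemma finite_D: "finite D"
proof -
  have "finite F" "finite E" "finite Q" 
    using finite_subset[OF R(3,1)] finite_subset[OF R(4,1)] finite_subset[OF EF] by auto
  then show ?thesis by (simp add: descs_def)
qed

lemma P_tiles: "Pt ` P = (\<Union>A\<in>R. act_SL A ` Dt)"
  unfolding outlineD(4)[OF R(6)] by (auto simp: domain_def UpS_def)

lemma side_D: "d \<in> D \<Longrightarrow> side (dedge d) = mz (snd d) ` sub (fst d)"
  using side_dedge[of "snd d" "fst d"] D_SL D_fst by simp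

lemma side_lineS: "d \<in> D \<Longrightarrow> side (dedge d) \<subseteq> lineS (owner d)"
  using sub_line(1)[of "fst d"] D_fst by (auto simp: side_D lineS_def owner_def)

lemma side_nonempty: "d \<in> D \<Longrightarrow> side (dedge d) \<noteq> {}"
  using sub_nonempty[of "fst d"] D_fst by (simp add: side_D)

lemma lineS_nset: "X \<in> I \<Longrightarrow> z \<in> lineS X \<Longrightarrow> Pt z \<in> nset X"
  using cset_inter_nset[of X z] lineS_upper[of X] I_SL by blast

lemma sides_disjoint:
  assumes "d \<in> D" "d' \<in> D" "owner d \<noteq> owner d'"
  shows "side (dedge d) \<inter> side (dedge d') = {}"
  using outlineD(3)[OF R(6) owner_I[OF assms(1)] owner_I[OF assms(2)] assms(3)]
    side_lineS[OF assms(1)] side_lineS[OF assms(2)] lineS_nset owner_I assms by blast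

lemma same_owner:
  assumes "d \<in> D" "d' \<in> D" "owner d = owner d'" "d \<noteq> d'"
  obtains A where "A \<in> E" "d = (1, A)" "d' = (2, A)" | A where "A \<in> E" "d = (2, A)" "d' = (1, A)"
    | A where "A \<in> Q" "d = (3, A)" "d' = (4, A)" | A where "A \<in> Q" "d = (4, A)" "d' = (3, A)"
proof -
  have "(\<exists>A\<in>E. d = (1, A) \<and> d' = (2, A) \<or> d = (2, A) \<and> d' = (1, A)) \<or>
     (\<exists>A\<in>Q. d = (3, A) \<and> d' = (4, A) \<or> d = (4, A) \<and> d' = (3, A))"
    using assms by (auto simp: descs_def owner_def)
  then show thesis using that by blast
qed

lemma Bd_vs_upper: "p \<in> Bd \<Longrightarrow> z \<in> upper \<Longrightarrow> act_SL A p \<noteq> Pt z"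
  using act_Bd[of p A] upper_not_real[of z] by auto

lemma E_SL: "A \<in> E \<Longrightarrow> A \<in> SL" and Q_SL: "A \<in> Q \<Longrightarrow> A \<in> SL"
  using R EF by auto

lemma dedge_neq:
  assumes "A \<in> SL" shows "dedge (Suc 0, A) \<noteq> dedge (2, A)" "dedge (3, A) \<noteq> dedge (4, A)"
  using assms Bd_vs_upper[of Infty "mz A \<i>" A] Bd_vs_upper[of Infty "mz A rho" A]
  by (auto simp: dedge_eq doubleton_eq_iff)

text \<open>Edges of different components have disjoint nonempty sides, and the two halves of one
  component have different ideal vertices.\<close>

lemma inj_dedge: "inj_on dedge D"
proof (rule inj_onI)
  fix d d' assume d: "d \<in> D" "d' \<in> D" and eq: "dedge d = dedge d'"
  show "d = d'"
  proof (rule ccontr)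
    assume neq: "d \<noteq> d'"
    show False
    proof (cases "owner d = owner d'")
      case False
      then show False using sides_disjoint[OF d] side_nonempty[OF d(1)] eq by simp
    next
      case True
      show False
        by (rule same_owner[OF d True neq]) (use eq dedge_neq dedge_neq[symmetric] E_SL Q_SL in auto)
    qed
  qed
qed

lemma D_cases:
  assumes "d \<in> D"
  obtains A where "d = (0, A)" "A \<in> F - E" "A \<in> SL" | A where "d = (1, A)" "A \<in> E" "A \<in> SL"
    | A where "d = (2, A)" "A \<in> E" "A \<in> SL" | A where "d = (3, A)" "A \<in> Q" "A \<in> SL"
    | A where "d = (4, A)" "A \<in> Q" "A \<in> SL"
  using assms D_SL[OF assms] by (auto simp: descs_def)

lemma vertex_cases:
  assumes "d \<in> D" "v \<in> dedge d"
  shows "v \<in> ends (owner d) \<and> v \<in> Bd \<or> v = Pt (mz (snd d) (mid (fst d \<ge> 3))) \<and> fst d \<noteq> 0"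
  using assms(1)
  by (cases rule: D_cases) (use assms(2) act_Bd in \<open>auto simp: dedge_eq ends_def owner_def mid_def\<close>)

lemma mid_lineS: "X \<in> I \<Longrightarrow> mz (snd X) (mid (fst X)) \<in> lineS X"
  by (auto simp: lineS_def line_def mid_def rho_eq)

text \<open>An ideal vertex lies on exactly one edge of each component ending there, so its degree
  is the one recorded by \<open>outline\<close>. A vertex in the half-plane is the midpoint of one
  broken component; by disjointness of the outer regions, the edges there are just its two
  halves.\<close>

lemma card_at_vertex:
  assumes "v \<in> \<Union>(dedge ` D)"
  shows "card {e \<in> dedge ` D. v \<in> e} = 2"
proof -
  obtain d where d: "d \<in> D" "v \<in> dedge d" using assms by auto
  have "{e \<in> dedge ` D. v \<in> e} = dedge ` {d \<in> D. v \<in> dedge d}" by auto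
  then have c: "card {e \<in> dedge ` D. v \<in> e} = card {d \<in> D. v \<in> dedge d}"
    using inj_dedge by (metis (no_types, lifting) card_image inj_on_subset mem_Collect_eq subsetI)
  show ?thesis
  proof (cases "v \<in> Bd")
    case True
    have vertex: "v \<in> ends (owner e)" if "e \<in> D" "v \<in> dedge e" for e
      using vertex_cases[OF that] True upper_not_real[of "mz (snd e) (mid (fst e \<ge> 3))"] D_SL[OF that(1)] by auto
    have "bij_betw owner {d \<in> D. v \<in> dedge d} {X \<in> I. v \<in> ends X}"
      unfolding bij_betw_def
    proof
      show "inj_on owner {d \<in> D. v \<in> dedge d}"
      proof (rule inj_onI)
        fix e e' assume e: "e \<in> {d \<in> D. v \<in> dedge d}" "e' \<in> {d \<in> D. v \<in> dedge d}" "owner e = owner e'"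
        have notmid: "v \<noteq> Pt (mz A z)" if "A \<in> SL" "z \<in> upper" for A z
          using True upper_not_real[of "mz A z"] that by auto
        show "e = e'"
        proof (rule ccontr)
          assume neq: "e \<noteq> e'"
          show False
            by (rule same_owner[OF _ _ e(3) neq]) (use e notmid E_SL Q_SL in \<open>auto simp: dedge_eq Bd_vs_upper\<close>)
        qed
      qed
      show "owner ` {d \<in> D. v \<in> dedge d} = {X \<in> I. v \<in> ends X}"
      proof (intro equalityI subsetI)
        fix X assume "X \<in> owner ` {d \<in> D. v \<in> dedge d}"
        then show "X \<in> {X \<in> I. v \<in> ends X}" using owner_I vertex by auto
      next
        fix X assume X: "X \<in> {X \<in> I. v \<in> ends X}"
        then have A: "snd X \<in> SL" by (auto intro: I_SL)
        have v: "v = act_SL (snd X) Infty \<or> v = act_SL (snd X) (Pt 0)" using X by (auto simp: ends_def)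
        have "\<exists>d\<in>D. v \<in> dedge d \<and> owner d = X"
        proof (cases X)
          case (Pair b A)
          then have ASL: "A \<in> SL" using A by simp
          have v: "v = act_SL A Infty \<or> v = act_SL A (Pt 0)" using v Pair by simp
          consider "b" "A \<in> Q" | "\<not> b" "A \<in> E" | "\<not> b" "A \<in> F - E" using X Pair by (auto simp: comps_def)
          then show ?thesis
          proof cases
            case 1
            then have "(3, A) \<in> D" "(4, A) \<in> D" by (auto simp: descs_def)
            note D = this
            show ?thesis using v
            proof
              assume "v = act_SL A Infty"
              then show ?thesis using ASL 1 Pair D by (intro bexI[of _ "(3, A)"]) (auto simp: dedge_eq owner_def)
            next
              assume "v = act_SL A (Pt 0)"
              then show ?thesis using ASL 1 Pair D by (intro bexI[of _ "(4, A)"]) (auto simp: dedge_eq owner_def)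
            qed
          next
            case 2
            then have "(Suc 0, A) \<in> D" "(2, A) \<in> D" by (auto simp: descs_def)
            note D = this
            show ?thesis using v
            proof
              assume "v = act_SL A Infty"
              then show ?thesis using ASL 2 Pair D by (intro bexI[of _ "(Suc 0, A)"]) (auto simp: dedge_eq owner_def)
            next
              assume "v = act_SL A (Pt 0)"
              then show ?thesis using ASL 2 Pair D by (intro bexI[of _ "(2, A)"]) (auto simp: dedge_eq owner_def)
            qed
          next
            case 3
            then have "(0, A) \<in> D" by (auto simp: descs_def)
            then show ?thesis using v ASL 3 Pair
              by (intro bexI[of _ "(0, A)"]) (auto simp: dedge_eq owner_def)
          qed
        qed
        then show "X \<in> owner ` {d \<in> D. v \<in> dedge d}" by auto
      qed
    qed
    then have "card {d \<in> D. v \<in> dedge d} = card {X \<in> I. v \<in> ends X}" by (rule bij_betw_same_card)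
    also have "\<dots> = (\<Sum>X\<in>I. of_bool (v \<in> ends X))"
      using outlineD(1)[OF R(6)] by (simp add: Int_def)
    also have "\<dots> = 2"
    proof -
      have "(\<Sum>X\<in>I. of_bool (v \<in> ends X)) \<noteq> (0::nat)"
        using outlineD(1)[OF R(6)] owner_I[OF d(1)] vertex[OF d] by (auto simp: card_eq_0_iff)
      then show ?thesis using outlineD(6)[OF R(6), of v] by (metis empty_iff insert_iff)
    qed
    finally show ?thesis using c by simp
  next
    case False
    have eq: "{e \<in> D. v \<in> dedge e} = {e \<in> D. owner e = owner d}"
    proof (intro equalityI subsetI)
      fix e assume e: "e \<in> {e \<in> D. v \<in> dedge e}"
      have *: "Pt z \<in> nset (owner x)" if "x \<in> D" "v \<in> dedge x" "v = Pt z" for x z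
      proof -
        have "z = mz (snd (owner x)) (mid (fst (owner x)))"
          using vertex_cases[OF that(1,2)] False that by (auto simp: owner_def)
        then show ?thesis using lineS_nset[OF owner_I[OF that(1)] mid_lineS[OF owner_I[OF that(1)]]] by simp
      qed
      obtain z where z: "v = Pt z" using vertex_cases[OF d] False by auto
      have "Pt z \<in> nset (owner e)" "Pt z \<in> nset (owner d)" using * e d z by auto
      then show "e \<in> {e \<in> D. owner e = owner d}"
        using e d outlineD(3)[OF R(6) owner_I owner_I, of e d] by blast
    next
      fix e assume e: "e \<in> {e \<in> D. owner e = owner d}"
      have vm: "v = Pt (mz (snd d) (mid (fst d \<ge> 3)))" "fst d \<noteq> 0" using vertex_cases[OF d] False by auto
      have "e \<in> D" "snd e = snd d" "(fst e \<ge> 3) = (fst d \<ge> 3)" using e by (auto simp: owner_def)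
      moreover have "fst e \<noteq> 0" using vm(2) e d(1) by (auto simp: owner_def descs_def)
      ultimately show "e \<in> {e \<in> D. v \<in> dedge e}"
        using vm(1) by (cases rule: D_cases[OF \<open>e \<in> D\<close>]) (auto simp: dedge_eq mid_def)
    qed
    have "fst d \<noteq> 0" using vertex_cases[OF d] False by auto
    then have "card {e \<in> D. owner e = owner d} = 2"
    proof (cases rule: D_cases[OF d(1)])
      case (2 A)
      then have "{e \<in> D. owner e = owner d} = {(1, A), (2, A)}" by (auto simp: owner_def descs_def)
      then show ?thesis by simp
    next
      case (3 A)
      then have "{e \<in> D. owner e = owner d} = {(1, A), (2, A)}" by (auto simp: owner_def descs_def)
      then show ?thesis by simp
    next
      case (4 A)
      then have "{e \<in> D. owner e = owner d} = {(3, A), (4, A)}" by (auto simp: owner_def descs_def)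
      then show ?thesis by simp
    next
      case (5 A)
      then have "{e \<in> D. owner e = owner d} = {(3, A), (4, A)}" by (auto simp: owner_def descs_def)
      then show ?thesis by simp
    qed simp
    then show ?thesis using c eq by simp
  qed
qed

lemma open_itile: "open itile"
proof -
  have "itile = upper \<inter> {z. 0 < Re z \<and> Re z < 1/2 \<and> 2 * Re z < nrm z}" by (auto simp: itile_def)
  moreover have "open {z. 0 < Re z \<and> Re z < 1/2 \<and> 2 * Re z < nrm z}"
    by (intro open_Collect_conj open_Collect_less continuous_intros)
  ultimately show ?thesis using open_upper by (metis open_Int)
qed

lemma itile_tile: "itile \<subseteq> tile" by (auto simp: itile_def tile_def)

lemma interior_P: "interior P \<noteq> {}"
proof -
  obtain A where A: "A \<in> R" "A \<in> SL" using R by auto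
  let ?V = "{z \<in> upper. mz (adj A) z \<in> itile}"
  have "open ?V" using A open_itile by (intro open_mz_vimage) simp_all
  moreover have "?V \<subseteq> P"
  proof
    fix z assume z: "z \<in> ?V"
    then have "Pt z \<in> act_SL A ` Dt" using A itile_tile by (auto simp: mem_act_image act_Pt Dt_def)
    then have "Pt z \<in> Pt ` P" using A P_tiles by blast
    then show "z \<in> P" by auto
  qed
  moreover have "Complex (1/4) 1 \<in> itile" by (simp add: itile_def upper_def nrm_def power2_eq_square)
  then have "mz A (Complex (1/4) 1) \<in> ?V" using A by (auto simp: itile_def)
  ultimately show ?thesis using interior_maximal by blast
qed

lemma sides_union: "(\<Union>e\<in>dedge ` D. side e) = (\<Union>X\<in>I. lineS X)"
proof (intro equalityI subsetI)
  fix z assume "z \<in> (\<Union>e\<in>dedge ` D. side e)"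
  then show "z \<in> (\<Union>X\<in>I. lineS X)" using side_lineS owner_I by blast
next
  fix z assume "z \<in> (\<Union>X\<in>I. lineS X)"
  then obtain b A where X: "(b, A) \<in> I" "z \<in> lineS (b, A)" by auto
  then obtain w where w: "w \<in> line b" "z = mz A w" by (auto simp: lineS_def)
  have "\<exists>c. (c, A) \<in> D \<and> w \<in> sub c"
  proof -
    consider "b" "A \<in> Q" | "\<not> b" "A \<in> E" | "\<not> b" "A \<in> F - E" using X by (auto simp: comps_def)
    then show ?thesis
    proof cases
      case 1
      then have "(3, A) \<in> D" "(4, A) \<in> D" by (auto simp: descs_def)
      then show ?thesis using w 1 sub_line(4) by auto
    next
      case 2
      then have "(1, A) \<in> D" "(2, A) \<in> D" by (auto simp: descs_def)
      then show ?thesis using w 2 sub_line(3) by auto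
    next
      case 3
      then have "(0, A) \<in> D" by (auto simp: descs_def)
      then show ?thesis using w 3 sub_line(2) by auto
    qed
  qed
  then obtain c where "(c, A) \<in> D" "w \<in> sub c" by blast
  then have "z \<in> side (dedge (c, A))" using w by (simp add: side_D)
  then show "z \<in> (\<Union>e\<in>dedge ` D. side e)" using \<open>(c, A) \<in> D\<close> by blast
qed

lemma polygon: "convex_hyp_polygon P (dedge ` D)"
  unfolding convex_hyp_polygon_def
proof (intro conjI ballI impI)
  show "P \<subseteq> upper" by (auto simp: domain_def)
  show "closedin (top_of_set upper) P" by (rule outline_frontier(2)[OF R(6)])
  show "interior P \<noteq> {}" by (rule interior_P)
  show "hyp_convex P" by (rule hyp_convex_domain[OF outlineD(2)[OF R(6)]])
  show "finite (dedge ` D)" using finite_D by simp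
  show "frontier P \<inter> upper = (\<Union>e\<in>dedge ` D. side e)"
    unfolding sides_union by (rule outline_frontier(1)[OF R(6)])
  show "card {e \<in> dedge ` D. v \<in> e} = 2" if "v \<in> \<Union>(dedge ` D)" for v using that by (rule card_at_vertex)
  show "\<exists>p\<in>upper_closure. \<exists>q\<in>upper_closure. p \<noteq> q \<and> e = {p, q}" if "e \<in> dedge ` D" for e
  proof -
    obtain d where d: "d \<in> D" "e = dedge d" using \<open>e \<in> dedge ` D\<close> by auto
    have cl: "act_SL A p \<in> upper_closure" if "p \<in> Bd" for A p
      using act_Bd[OF that, of A] by (auto simp: upper_closure_def Bd_def complex_is_Real_iff)
    have cl': "Pt (mz A z) \<in> upper_closure" if "A \<in> SL" "z \<in> upper" for A z
      using mz_upper[OF that] by (auto simp: upper_closure_def upper_def)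
    have neq: "act_SL A p \<noteq> Pt (mz A z)" if "A \<in> SL" "z \<in> upper" "p \<in> Bd" for A p z
      using Bd_vs_upper[OF that(3), of "mz A z" A] that by simp
    have pair: "\<exists>p\<in>upper_closure. \<exists>q\<in>upper_closure. p \<noteq> q \<and> {x, y} = {p, q}"
      if "x \<in> upper_closure" "y \<in> upper_closure" "x \<noteq> y" for x y using that by blast
    show ?thesis unfolding d(2)
      by (cases rule: D_cases[OF d(1)])
        (auto simp: dedge_eq Bd_vs_upper intro!: pair cl cl')
  qed
  show "Pt ` (side e \<inter> side e') \<subseteq> e \<inter> e'" if ee: "e \<in> dedge ` D" "e' \<in> dedge ` D" "e \<noteq> e'" for e e'
  proof -
    obtain d d' where d: "d \<in> D" "e = dedge d" "d' \<in> D" "e' = dedge d'" using ee(1,2) by blast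
    show ?thesis
    proof (cases "owner d = owner d'")
      case False
      then show ?thesis using sides_disjoint[OF d(1,3)] d by simp
    next
      case True
      have i: "mz A ` sub 1 \<inter> mz A ` sub 2 \<subseteq> {mz A \<i>}" "mz A ` sub 3 \<inter> mz A ` sub 4 \<subseteq> {mz A rho}" if "A \<in> SL" for A
      proof -
        have "inj_on (mz A) upper" using that by (metis inj_onI mz_adj(2))
        then have "mz A ` sub 1 \<inter> mz A ` sub 2 = mz A ` (sub 1 \<inter> sub 2)" "mz A ` sub 3 \<inter> mz A ` sub 4 = mz A ` (sub 3 \<inter> sub 4)"
          using sub_upper by (simp_all add: inj_on_image_Int)
        then show "mz A ` sub 1 \<inter> mz A ` sub 2 \<subseteq> {mz A \<i>}" "mz A ` sub 3 \<inter> mz A ` sub 4 \<subseteq> {mz A rho}"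
          using sub_line(5,6) by auto
      qed
      have "d \<noteq> d'" using ee(3) d by auto
      then show ?thesis
      proof (rule same_owner[OF d(1,3) True])
        fix A assume *: "A \<in> E" "d = (1, A)" "d' = (2, A)"
        then show ?thesis using i(1)[OF E_SL[OF *(1)]] d E_SL[OF *(1)]
          by (simp add: side_D) (auto simp: dedge_eq)
      next
        fix A assume *: "A \<in> E" "d = (2, A)" "d' = (1, A)"
        then show ?thesis using i(1)[OF E_SL[OF *(1)]] d E_SL[OF *(1)]
          by (simp add: side_D) (auto simp: dedge_eq)
      next
        fix A assume *: "A \<in> Q" "d = (3, A)" "d' = (4, A)"
        then show ?thesis using i(2)[OF Q_SL[OF *(1)]] d Q_SL[OF *(1)]
          by (simp add: side_D) (auto simp: dedge_eq)
      next
        fix A assume *: "A \<in> Q" "d = (4, A)" "d' = (3, A)"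
        then show ?thesis using i(2)[OF Q_SL[OF *(1)]] d Q_SL[OF *(1)]
          by (simp add: side_D) (auto simp: dedge_eq)
      qed
    qed
  qed
qed

definition partner :: "(imat \<Rightarrow> imat) \<Rightarrow> desc \<Rightarrow> desc" where
  "partner \<tau> d = (if fst d = 0 then (0, \<tau> (snd d)) else if fst d = 1 then (2, snd d)
     else if fst d = 2 then (1, snd d) else if fst d = 3 then (4, snd d) else (3, snd d))"

lemma special:
  assumes \<tau>: "\<And>A. A \<in> F - E \<Longrightarrow> \<tau> A \<in> F - E \<and> \<tau> A \<noteq> A \<and> \<tau> (\<tau> A) = A"
    and \<sigma>: "\<And>d. d \<in> D \<Longrightarrow> \<sigma> (dedge d) = dedge (partner \<tau> d)"
  shows "special_polygon P (dedge ` D) \<sigma>"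
proof -
  have pD: "partner \<tau> d \<in> D" if "d \<in> D" for d
    using that \<tau> by (cases rule: D_cases) (auto simp: partner_def descs_def)
  have pp: "partner \<tau> (partner \<tau> d) = d" if "d \<in> D" for d
    using that \<tau> by (cases rule: D_cases) (auto simp: partner_def)
  have pk: "dkind (partner \<tau> d) = dkind d" if "d \<in> D" for d
    using that by (cases rule: D_cases) (auto simp: partner_def dkind_def)
  have pn: "partner \<tau> d \<noteq> d" if "d \<in> D" for d
    using that \<tau> by (cases rule: D_cases) (auto simp: partner_def)
  have sn: "\<sigma> (dedge d) \<noteq> dedge d" if "d \<in> D" for d
    using \<sigma>[OF that] pn[OF that] pD[OF that] that inj_dedge by (auto simp: inj_on_def)
  have ss: "\<sigma> (\<sigma> (dedge d)) = dedge d" if "d \<in> D" for d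
    using \<sigma> pD pp that by simp
  have adj: "adjacent_at_angle \<alpha> (dedge d) (dedge d')"
    if "A \<in> SL" "dedge d = {act_SL A p, Pt (mz A z)}" "dedge d' = {act_SL A q, Pt (mz A z)}"
      "z \<in> upper" "p \<in> Bd" "q \<in> Bd" "angle z p q = \<alpha>" for \<alpha> d d' A p q z
    unfolding adjacent_at_angle_def
    by (intro bexI[of _ "mz A z"] exI[of _ "act_SL A p"] exI[of _ "act_SL A q"])
      (use that angle_mz in \<open>auto simp: insert_commute\<close>)
  have adj1: "adjacent_at_angle pi (dedge d) (\<sigma> (dedge d))" if d: "d \<in> D" "dkind d = 1" for d
    using d(1)
  proof (cases rule: D_cases)
    case (2 A)
    then show ?thesis unfolding \<sigma>[OF d(1)]
      by (intro adj[of A _ Infty \<i> _ "Pt 0"]) (auto simp: partner_def dedge_eq angle_i)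
  next
    case (3 A)
    then show ?thesis unfolding \<sigma>[OF d(1)]
      by (intro adj[of A _ "Pt 0" \<i> _ Infty]) (auto simp: partner_def dedge_eq angle_i)
  qed (use d in \<open>auto simp: dkind_def\<close>)
  have adj2: "adjacent_at_angle (2 * pi / 3) (dedge d) (\<sigma> (dedge d))" if d: "d \<in> D" "dkind d = 2" for d
    using d(1)
  proof (cases rule: D_cases)
    case (4 A)
    then show ?thesis unfolding \<sigma>[OF d(1)]
      by (intro adj[of A _ Infty rho _ "Pt 0"]) (auto simp: partner_def dedge_eq angle_rho)
  next
    case (5 A)
    then show ?thesis unfolding \<sigma>[OF d(1)]
      by (intro adj[of A _ "Pt 0" rho _ Infty]) (auto simp: partner_def dedge_eq angle_rho)
  qed (use d in \<open>auto simp: dkind_def\<close>)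
  have cp: "copy_of free_base (dedge d) \<longleftrightarrow> dkind d = 0" "copy_of even_base (dedge d) \<longleftrightarrow> dkind d = 1"
    "copy_of odd_base (dedge d) \<longleftrightarrow> dkind d = 2"
    "copy_of free_base (\<sigma> (dedge d)) \<longleftrightarrow> dkind d = 0" "copy_of even_base (\<sigma> (dedge d)) \<longleftrightarrow> dkind d = 1"
    "copy_of odd_base (\<sigma> (dedge d)) \<longleftrightarrow> dkind d = 2" if "d \<in> D" for d
    using copy_of_dedge[OF D_SL[OF that]] copy_of_dedge[OF D_SL[OF pD[OF that]]] pk[OF that] \<sigma>[OF that] by simp_all
  have mem: "\<sigma> (dedge d) \<in> dedge ` D" if "d \<in> D" for d using \<sigma> pD that by simp
  have dk: "dkind d = 0 \<or> dkind d = 1 \<or> dkind d = 2" for d by (auto simp: dkind_def)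
  show ?thesis
    unfolding special_polygon_def
  proof (intro conjI ballI impI)
    show "convex_hyp_polygon P (dedge ` D)" by (rule polygon)
  next
    fix e assume e: "e \<in> dedge ` D"
    then obtain d where d: "d \<in> D" "e = dedge d" by auto
    show "\<sigma> e \<in> dedge ` D" "\<sigma> (\<sigma> e) = e" using d mem ss by auto
    show "copy_of free_base e \<or> copy_of even_base e \<or> copy_of odd_base e" using d cp dk by auto
    show "\<sigma> e \<noteq> e" using d sn by simp
    show "copy_of free_base (\<sigma> e)" if "copy_of free_base e" using that d cp by simp
    show "\<exists>s'\<in>dedge ` D. s' \<noteq> e \<and> copy_of even_base s' \<and> \<sigma> e = s' \<and> \<sigma> s' = e \<and> adjacent_at_angle pi e s'"
      if "copy_of even_base e"
      using that d cp sn ss adj1 mem by (intro bexI[of _ "\<sigma> e"]) auto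
    show "\<exists>s'\<in>dedge ` D. s' \<noteq> e \<and> copy_of odd_base s' \<and> \<sigma> e = s' \<and> \<sigma> s' = e \<and> adjacent_at_angle (2 * pi / 3) e s'"
      if "copy_of odd_base e"
      using that d cp sn ss adj2 mem by (intro bexI[of _ "\<sigma> e"]) auto
  qed
qed

lemma mem_P: "z \<in> P \<longleftrightarrow> z \<in> upper \<and> (\<exists>A\<in>R. mz (adj A) z \<in> tile)"
proof -
  have "z \<in> P \<longleftrightarrow> Pt z \<in> (\<Union>A\<in>R. act_SL A ` Dt)" unfolding P_tiles[symmetric] by auto
  also have "\<dots> \<longleftrightarrow> z \<in> upper \<and> (\<exists>A\<in>R. mz (adj A) z \<in> tile)"
  proof (cases "z \<in> upper")
    case True
    then show ?thesis using R(5) by (auto simp: mem_act_image act_Pt Dt_def subset_iff)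
  next
    case False
    have "act_SL A ` Dt \<subseteq> UpS" if "A \<in> R" for A using that R(5) Up_subsets(3) act_subset_Up by blast
    then have "Pt z \<notin> act_SL A ` Dt" if "A \<in> R" for A using that False by (metis Pt_UpS subsetD)
    then show ?thesis using False by blast
  qed
  finally show ?thesis .
qed

text \<open>Covering follows from \<open>tile_covers\<close> and a representative of the right
  coset. For disjointness, a point common to two translates of the interior is moved slightly into
  an open tile, where \<open>itile_disjoint\<close> leaves no choice but a sign.\<close>

lemma fundamental:
  assumes G: "G = cls ` X" "X \<subseteq> SL" and X: "\<And>A. A \<in> X \<Longrightarrow> adj A \<in> X" "\<And>A. A \<in> X \<Longrightarrow> - A \<in> X"
    and ex: "\<And>A. A \<in> SL \<Longrightarrow> \<exists>B\<in>R. A ** adj B \<in> X"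
    and uniq: "\<And>A B g h. A \<in> R \<Longrightarrow> B \<in> R \<Longrightarrow> g \<in> X \<Longrightarrow> h \<in> X \<Longrightarrow> g ** A = h ** B \<Longrightarrow> A = B"
  shows "fundamental_domain G P"
  unfolding fundamental_domain_def
proof
  have P_upper: "P \<subseteq> upper" by (auto simp: domain_def)
  show "(\<Union>g\<in>G. act g ` Pt ` P) = Pt ` upper"
  proof (intro equalityI subsetI)
    fix p assume "p \<in> (\<Union>g\<in>G. act g ` Pt ` P)"
    then obtain A z where "A \<in> X" "z \<in> P" "p = act_SL A (Pt z)" using G by (auto simp: act_cls subset_iff)
    then show "p \<in> Pt ` upper" using G P_upper by (auto simp: act_Pt subset_iff)
  next
    fix p assume "p \<in> Pt ` upper"
    then obtain z where z: "z \<in> upper" "p = Pt z" by auto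
    obtain A where A: "A \<in> SL" "mz A z \<in> tile" using tile_covers[OF z(1)] by blast
    \<comment> \<open>\<open>B\<close> represents the coset of \<open>A\<close> inverse: then
      \<open>B ** A\<close> is inverse to an element of the group and moves z into the tile of
      \<open>B\<close>.\<close>
    obtain B where B: "B \<in> R" "adj A ** adj B \<in> X" using ex[of "adj A"] A by auto
    have BSL: "B \<in> SL" using B R by auto
    let ?g = "adj A ** adj B"
    have g: "?g \<in> SL" using A BSL by simp
    let ?w = "mz (B ** A) z"
    have "mz (adj B) ?w = mz A z" using A BSL z by (simp add: mz_mult)
    then have "?w \<in> P" unfolding mem_P using A B BSL z by (intro conjI bexI[of _ B]) simp_all
    moreover have "act_SL ?g (Pt ?w) = p"
    proof -
      have "?g = adj (B ** A)" by (simp add: adj_mult)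
      then show ?thesis using z A BSL by (simp add: act_Pt)
    qed
    ultimately have "p \<in> act (cls ?g) ` Pt ` P" using g by (force simp: act_cls)
    then show "p \<in> (\<Union>g\<in>G. act g ` Pt ` P)" using B G by blast
  qed
  show "\<forall>g\<in>G. \<forall>h\<in>G. g \<noteq> h \<longrightarrow> act g ` Pt ` interior P \<inter> act h ` Pt ` interior P = {}"
  proof (intro ballI impI)
    fix g' h' assume gh: "g' \<in> G" "h' \<in> G" "g' \<noteq> h'"
    obtain g h where g: "g \<in> X" "g' = cls g" and h: "h \<in> X" "h' = cls h" using gh G by auto
    have gSL: "g \<in> SL" "h \<in> SL" using g h G by auto
    show "act g' ` Pt ` interior P \<inter> act h' ` Pt ` interior P = {}"
    proof (rule ccontr)
      assume "act g' ` Pt ` interior P \<inter> act h' ` Pt ` interior P \<noteq> {}"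
      then obtain z w where zw: "z \<in> interior P" "w \<in> interior P" "act_SL g (Pt z) = act_SL h (Pt w)"
        using g h gSL by (auto simp: act_cls)
      have up: "z \<in> upper" "w \<in> upper" using zw interior_subset P_upper by blast+
      let ?k = "adj h ** g"
      have k: "?k \<in> SL" using gSL by simp
      have "mz g z = mz h w" using zw(3) gSL up by (simp add: act_Pt)
      then have kz: "mz ?k z = w" using gSL up by (simp add: mz_mult)
      have "z \<in> P" using zw interior_subset by blast
      then obtain A where A: "A \<in> R" "mz (adj A) z \<in> tile" by (auto simp: mem_P)
      have ASL: "A \<in> SL" using A R by auto
      let ?V = "{x \<in> upper. mz (?k ** A) x \<in> interior P}"
      have "open ?V" using k ASL by (intro open_mz_vimage) simp_all
      moreover have "mz (adj A) z \<in> ?V"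
        using up k ASL kz zw by (simp add: mz_mult[OF k ASL])
      \<comment> \<open>\<open>?V\<close> is open and contains a point of the closed tile, hence
        also a point of the open one. This point is carried by \<open>?k ** A\<close> into some tile
        \<open>B\<close>, so that \<open>?C\<close> maps it from the open tile into the
        tile.\<close>
      ultimately obtain x where x: "x \<in> ?V" "x \<in> itile" using itile_dense[OF A(2)] by blast
      have "mz (?k ** A) x \<in> P" using x interior_subset by blast
      then obtain B where B: "B \<in> R" "mz (adj B) (mz (?k ** A) x) \<in> tile" by (auto simp: mem_P)
      have BSL: "B \<in> SL" using B R by auto
      let ?C = "adj B ** (?k ** A)"
      have "mz ?C x \<in> tile" using B x k ASL BSL by (simp add: mz_mult[of "adj B" "?k ** A"])
      then have C: "?C = mat 1 \<or> ?C = - mat 1" using itile_disjoint[OF x(2)] k ASL BSL by simp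
      have "h ** (B ** ?C) = g ** A"
      proof -
        have "h ** (B ** ?C) = h ** ((B ** adj B) ** (adj h ** (g ** A)))" by (simp only: matrix_mul_assoc)
        also have "\<dots> = (h ** adj h) ** (g ** A)" using BSL by (simp add: matrix_mul_assoc)
        also have "\<dots> = g ** A" using gSL by simp
        finally show ?thesis .
      qed
      with C have gA: "g ** A = h ** B \<or> g ** A = (- h) ** B" by auto
      then have AB: "A = B" using uniq[OF A(1) B(1) g(1)] h(1) X(2)[OF h(1)] by blast
      have canc: "x = y" if "x ** A = y ** A" for x y :: imat
      proof -
        have "(x ** A) ** adj A = (y ** A) ** adj A" using that by simp
        then show ?thesis using ASL by (simp flip: matrix_mul_assoc)
      qed
      have "g = h \<or> g = - h" using gA canc unfolding AB by blast
      then show False using gh(3) g h by auto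
    qed
  qed
qed

end

section \<open>Cosets and keys\<close>

lemma adj_mS: "adj mS = - mS" and adj_mU: "adj mU = - (mU ** mU)" and adj_one [simp]: "adj (mat 1) = mat 1"
  by (simp_all add: mS_def mU_def mat2_one)

lemma mU_cube': "mU ** (mU ** (mU ** mU)) = - mU"
  by (simp add: mU_def)

text \<open>\<open>X\<close> is the full preimage of the group in \<open>SL\<close>. The group
  axioms come out of \<open>key_iff\<close>: equality of keys is an equivalence relation, and the
  identity, inverses and products correspond to its three properties.\<close>

locale coset_key =
  fixes X :: "imat set" and key :: "imat \<Rightarrow> int"
  assumes X_SL: "X \<subseteq> SL"
    and X_minus: "A \<in> X \<Longrightarrow> - A \<in> X"
    and key_iff: "A \<in> SL \<Longrightarrow> B \<in> SL \<Longrightarrow> key A = key B \<longleftrightarrow> A ** adj B \<in> X"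
    and finite_key: "finite (key ` SL)"
begin

definition G :: "imat set set" where "G = cls ` X"

lemma mem_X: "A \<in> SL \<Longrightarrow> A \<in> X \<longleftrightarrow> key A = key (mat 1)"
proof -
  assume "A \<in> SL"
  moreover have "adj (mat 1) = mat 1" by (simp add: mat2_one)
  ultimately show ?thesis using key_iff[of A "mat 1"] by simp
qed

lemma one_X: "mat 1 \<in> X"
  by (simp add: mem_X)

lemma X_mult_adj: "A \<in> X \<Longrightarrow> B \<in> X \<Longrightarrow> A ** adj B \<in> X"
  using mem_X[of A] mem_X[of B] key_iff[of A B] X_SL by auto

lemma X_adj: "A \<in> X \<Longrightarrow> adj A \<in> X"
  using X_mult_adj[OF one_X, of A] by simp

lemma X_mult: "A \<in> X \<Longrightarrow> B \<in> X \<Longrightarrow> A ** B \<in> X"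
  using X_mult_adj[OF _ X_adj, of A B] by simp

lemma cls_G: "cls A \<in> G \<longleftrightarrow> A \<in> X"
  using X_minus by (auto simp: G_def cls_eq_iff)

lemma G_subgroup: "subgroup G PSL2Z"
proof (rule PSL.subgroupI)
  show "G \<subseteq> carrier PSL2Z" using X_SL by (auto simp: G_def)
  show "G \<noteq> {}" using one_X by (auto simp: G_def)
  show "inv\<^bsub>PSL2Z\<^esub> a \<in> G" if "a \<in> G" for a
    using that X_adj X_SL by (auto simp: G_def subset_iff)
  show "a \<otimes>\<^bsub>PSL2Z\<^esub> b \<in> G" if "a \<in> G" "b \<in> G" for a b
    using that X_mult X_SL by (auto simp: G_def subset_iff)
qed

lemma key_minus [simp]: "A \<in> SL \<Longrightarrow> key (- A) = key A"
  using key_iff[of "- A" A] X_minus[OF one_X] by simp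

lemma key_mult_right: "A \<in> SL \<Longrightarrow> B \<in> SL \<Longrightarrow> C \<in> SL \<Longrightarrow> key (A ** C) = key (B ** C) \<longleftrightarrow> key A = key B"
  by (simp add: key_iff adj_mult matrix_mul_assoc) (simp add: key_iff flip: matrix_mul_assoc)

definition coset :: "imat \<Rightarrow> imat set set" where
  "coset A = G #>\<^bsub>PSL2Z\<^esub> cls A"

lemma coset_eq_iff:
  assumes "A \<in> SL" "B \<in> SL"
  shows "coset A = coset B \<longleftrightarrow> key A = key B"
proof -
  have "coset A = coset B \<longleftrightarrow> cls A \<otimes>\<^bsub>PSL2Z\<^esub> inv\<^bsub>PSL2Z\<^esub> cls B \<in> G"
    unfolding coset_def
    using assms PSL.repr_independence[OF _ _ G_subgroup] PSL.rcos_self[OF _ G_subgroup]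
      subgroup.rcos_module[OF G_subgroup PSL.is_group] subgroup.rcos_module_imp[OF G_subgroup PSL.is_group]
    by (metis cls_carrier)
  then show ?thesis using assms by (simp add: cls_G key_iff)
qed

lemma edges_G: "edges G = coset ` SL"
  by (auto simp: edges_def RCOSETS_def coset_def PSL_carrier)

lemma coset_one: "coset (mat 1) = G"
  unfolding coset_def cls_one[symmetric]
  using PSL.coset_mult_one G_subgroup by (simp add: subgroup.subset)

lemma coset_mult: "A \<in> SL \<Longrightarrow> B \<in> SL \<Longrightarrow> coset A #>\<^bsub>PSL2Z\<^esub> cls B = coset (A ** B)"
  unfolding coset_def using PSL.coset_mult_assoc[of G "cls A" "cls B"] G_subgroup
  by (simp add: subgroup.subset)

lemma finite_edges: "finite (edges G)"
proof -
  have "edges G = (\<lambda>k. coset (SOME A. A \<in> SL \<and> key A = k)) ` key ` SL"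
  proof -
    have "coset (SOME B. B \<in> SL \<and> key B = key A) = coset A" if "A \<in> SL" for A
      using someI_ex[of "\<lambda>B. B \<in> SL \<and> key B = key A"] that coset_eq_iff by blast
    then show ?thesis by (simp add: edges_G image_image)
  qed
  then show ?thesis using finite_key by simp
qed

lemma G0_eq: "G0 = {cls (mat 1), cls mS}"
proof -
  have "generate PSL2Z {cls mS} = {cls (mat 1), cls mS}"
  proof (rule PSL.generateI[symmetric])
    show "subgroup {cls (mat 1), cls mS} PSL2Z"
    proof (rule PSL.subgroupI)
      show "inv\<^bsub>PSL2Z\<^esub> a \<in> {cls (mat 1), cls mS}" if "a \<in> {cls (mat 1), cls mS}" for a
        using that by (auto simp: adj_mS)
    qed (auto simp: mS_mS)
    show "{cls (mat 1), cls mS} \<subseteq> H" if "subgroup H PSL2Z" "{cls mS} \<subseteq> H" for H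
      using that subgroup.one_closed[OF that(1)] by (auto simp: cls_one)
  qed auto
  then show ?thesis by (simp add: G0_def mS_def)
qed

lemma G1_eq: "G1 = {cls (mat 1), cls mU, cls (mU ** mU)}"
proof -
  have "generate PSL2Z {cls mU} = {cls (mat 1), cls mU, cls (mU ** mU)}"
  proof (rule PSL.generateI[symmetric])
    show "subgroup {cls (mat 1), cls mU, cls (mU ** mU)} PSL2Z"
    proof (rule PSL.subgroupI)
      show "inv\<^bsub>PSL2Z\<^esub> a \<in> {cls (mat 1), cls mU, cls (mU ** mU)}"
        if "a \<in> {cls (mat 1), cls mU, cls (mU ** mU)}" for a
        using that by (auto simp: adj_mU adj_mult mU_cube' simp flip: matrix_mul_assoc)
    qed (auto simp: mU_cube mU_cube' simp flip: matrix_mul_assoc)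
    show "{cls (mat 1), cls mU, cls (mU ** mU)} \<subseteq> H" if "subgroup H PSL2Z" "{cls mU} \<subseteq> H" for H
    proof -
      have "cls mU \<otimes>\<^bsub>PSL2Z\<^esub> cls mU \<in> H" using that by (intro subgroup.m_closed) auto
      then show ?thesis using that subgroup.one_closed[OF that(1)] by (auto simp: cls_one)
    qed
  qed auto
  then show ?thesis by (simp add: G1_def u_class_def mU_def)
qed

lemma orbit0: "A \<in> SL \<Longrightarrow> right_orbit G0 (coset A) = {coset A, coset (A ** mS)}"
  by (simp add: right_orbit_def G0_eq coset_mult)

lemma orbit1: "A \<in> SL \<Longrightarrow> right_orbit G1 (coset A) = {coset A, coset (A ** mU), coset ((A ** mU) ** mU)}"
  by (simp add: right_orbit_def G1_eq coset_mult matrix_mul_assoc)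

end

section \<open>The congruence subgroups\<close>

text \<open>Conjugation by the permutation matrix exchanges the lower and the upper series.\<close>

definition swap :: "imat \<Rightarrow> imat" where
  "swap A = mat2 (A$2$2) (A$2$1) (A$1$2) (A$1$1)"

lemma swap_mat2 [simp]: "swap (mat2 a b c d) = mat2 d c b a"
  by (simp add: swap_def)

lemma swap_swap [simp]: "swap (swap A) = A"
  by (cases A rule: mat2_cases) simp

lemma swap_SL [simp]: "swap A \<in> SL \<longleftrightarrow> A \<in> SL"
  by (cases A rule: mat2_cases) (simp add: mult.commute)

lemma swap_image_SL: "swap ` SL = SL"
proof -
  have "A \<in> swap ` SL" if "A \<in> SL" for A
    using that by (intro image_eqI[of _ _ "swap A"]) auto
  then show ?thesis by auto
qed

lemma swap_mult: "swap (A ** B) = swap A ** swap B"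
  by (cases A rule: mat2_cases, cases B rule: mat2_cases) (simp add: algebra_simps)

lemma swap_adj: "swap (adj A) = adj (swap A)"
  by (cases A rule: mat2_cases) simp

lemma swap_minus: "swap (- A) = - swap A"
  by (cases A rule: mat2_cases) simp

lemma coset_key_swap:
  assumes "coset_key X key"
  shows "coset_key (swap ` X) (key \<circ> swap)"
proof -
  interpret coset_key X key by fact
  have im: "A \<in> swap ` X \<longleftrightarrow> swap A \<in> X" for A
    by (metis image_iff swap_swap)
  show ?thesis
  proof
    show "swap ` X \<subseteq> SL" using X_SL by auto
    show "- A \<in> swap ` X" if "A \<in> swap ` X" for A
      using that X_minus by (simp add: im swap_minus)
    show "(key \<circ> swap) A = (key \<circ> swap) B \<longleftrightarrow> A ** adj B \<in> swap ` X" if "A \<in> SL" "B \<in> SL" for A B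
      using that by (simp add: im swap_mult swap_adj key_iff)
    show "finite ((key \<circ> swap) ` SL)" using finite_key swap_image_SL by (simp flip: image_image add: comp_def)
  qed
qed

definition X0 :: "nat \<Rightarrow> imat set" where
  "X0 N = {A \<in> SL. int N dvd A$2$1}"

text \<open>Only the bottom row is constrained. Given that c is divisible by N, determinant 1 makes
  a congruent to 1 or -1 together with d.\<close>

definition X1 :: "nat \<Rightarrow> imat set" where
  "X1 N = {A \<in> SL. int N dvd A$2$1 \<and> (int N dvd A$2$2 - 1 \<or> int N dvd A$2$2 + 1)}"

definition XP :: "nat \<Rightarrow> imat set" where
  "XP N = {A \<in> SL. mat_cong N A (mat 1) \<or> mat_cong N A (- mat 1)}"

lemma mat_cong_mat2: "mat_cong N (mat2 a b c d) (mat2 a' b' c' d') \<longleftrightarrow>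
   [a = a'] (mod int N) \<and> [b = b'] (mod int N) \<and> [c = c'] (mod int N) \<and> [d = d'] (mod int N)"
  by (simp add: mat_cong_def forall_2)

lemma X0_eq:
  fixes N defines "F \<equiv> {mat2 a b 0 a' | a a' b. [a * a' = 1] (mod int N)}"
  shows "{A \<in> SL. \<exists>B\<in>F. mat_cong N A B \<or> mat_cong N A (- B)} = X0 N"
proof (intro equalityI subsetI)
    fix A assume "A \<in> X0 N"
    obtain a b c d where A: "A = mat2 a b c d" by (cases A rule: mat2_cases)
    with \<open>A \<in> X0 N\<close> have *: "a * d - b * c = 1" "int N dvd c" by (auto simp: X0_def)
    have "a * d - 1 = b * c" using * by simp
    then have "int N dvd a * d - 1" using *(2) by (metis dvd_mult)
    then have "mat2 a b 0 d \<in> F" by (auto simp: F_def cong_iff_dvd_diff)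
    moreover have "mat_cong N A (mat2 a b 0 d)" using * by (simp add: A mat_cong_mat2 cong_0_iff)
    ultimately show "A \<in> {A \<in> SL. \<exists>B\<in>F. mat_cong N A B \<or> mat_cong N A (- B)}"
      using \<open>A \<in> X0 N\<close> by (auto simp: X0_def)
  next
    fix A assume "A \<in> {A \<in> SL. \<exists>B\<in>F. mat_cong N A B \<or> mat_cong N A (- B)}"
    then obtain a b d where "A \<in> SL" "mat_cong N A (mat2 a b 0 d) \<or> mat_cong N A (- mat2 a b 0 d)"
      unfolding F_def by blast
    then show "A \<in> X0 N"
      by (cases A rule: mat2_cases) (auto simp: X0_def mat_cong_mat2 cong_0_iff)
  qed

lemma Gamma_lower0_eq: "Gamma_lower0 N = cls ` X0 N"
  unfolding Gamma_lower0_def reduces_into_def X0_eq ..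

lemma X1_eq:
  fixes N defines "F \<equiv> {mat2 1 b 0 1 | b. True}"
  shows "{A \<in> SL. \<exists>B\<in>F. mat_cong N A B \<or> mat_cong N A (- B)} = X1 N"
proof (intro equalityI subsetI)
    fix A assume AX: "A \<in> X1 N"
    obtain a b c d where A: "A = mat2 a b c d" by (cases A rule: mat2_cases)
    with AX have *: "a * d - b * c = 1" "int N dvd c" "int N dvd d - 1 \<or> int N dvd d + 1"
      by (auto simp: X1_def)
    have "a - 1 = b * c - a * (d - 1)" "a + 1 = a * (d + 1) - b * c"
      using *(1) by (simp_all add: algebra_simps)
    then have "int N dvd d - 1 \<Longrightarrow> int N dvd a - 1" "int N dvd d + 1 \<Longrightarrow> int N dvd a + 1"
      using *(2) by simp_all
    then have "mat_cong N A (mat2 1 b 0 1) \<or> mat_cong N A (- mat2 1 (- b) 0 1)"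
      using * by (auto simp: A mat_cong_mat2 cong_iff_dvd_diff)
    moreover have "mat2 1 b 0 1 \<in> F" "mat2 1 (- b) 0 1 \<in> F" by (auto simp: F_def)
    ultimately show "A \<in> {A \<in> SL. \<exists>B\<in>F. mat_cong N A B \<or> mat_cong N A (- B)}"
      using AX by (auto simp only: X1_def mem_Collect_eq)
  next
    fix A assume "A \<in> {A \<in> SL. \<exists>B\<in>F. mat_cong N A B \<or> mat_cong N A (- B)}"
    then obtain b where "A \<in> SL" "mat_cong N A (mat2 1 b 0 1) \<or> mat_cong N A (- mat2 1 b 0 1)"
      unfolding F_def by blast
    then show "A \<in> X1 N"
      by (cases A rule: mat2_cases) (auto simp: X1_def mat_cong_mat2 cong_iff_dvd_diff)
  qed

lemma Gamma_lower1_eq: "Gamma_lower1 N = cls ` X1 N"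
  unfolding Gamma_lower1_def reduces_into_def X1_eq ..

lemma mat_cong_swap: "mat_cong N (swap A) B \<longleftrightarrow> mat_cong N A (swap B)"
  by (cases A rule: mat2_cases, cases B rule: mat2_cases) (auto simp: mat_cong_mat2)

lemma reduces_into_swap:
  assumes "Y = {A \<in> SL. \<exists>B\<in>F. mat_cong N A B \<or> mat_cong N A (- B)}"
  shows "reduces_into N (swap ` F) = cls ` swap ` Y"
proof -
  have "A \<in> SL \<and> (\<exists>B\<in>swap ` F. mat_cong N A B \<or> mat_cong N A (- B)) \<longleftrightarrow> swap A \<in> Y" for A
    by (auto simp: assms mat_cong_swap swap_minus)
  then have "{A \<in> SL. \<exists>B\<in>swap ` F. mat_cong N A B \<or> mat_cong N A (- B)} = {A. swap A \<in> Y}"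
    by blast
  also have "\<dots> = swap ` Y" by (force intro: image_eqI[where f = swap, OF swap_swap[symmetric]])
  finally show ?thesis by (simp add: reduces_into_def)
qed

lemma Gamma_upper0_eq: "Gamma_upper0 N = cls ` swap ` X0 N"
proof -
  have "{mat2 a 0 b a' | a a' b. [a * a' = 1] (mod int N)} =
    swap ` {mat2 a b 0 a' | a a' b. [a * a' = 1] (mod int N)}"
  proof (intro equalityI subsetI)
    fix A assume "A \<in> {mat2 a 0 b a' | a a' b. [a * a' = 1] (mod int N)}"
    then obtain a b a' where "A = swap (mat2 a' b 0 a)" "[a' * a = 1] (mod int N)"
      by (auto simp: mult.commute)
    then show "A \<in> swap ` {mat2 a b 0 a' | a a' b. [a * a' = 1] (mod int N)}" by blast
  qed (auto simp: mult.commute)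
  then show ?thesis
    unfolding Gamma_upper0_def by (simp only: reduces_into_swap[OF X0_eq[symmetric]])
qed

lemma Gamma_upper1_eq: "Gamma_upper1 N = cls ` swap ` X1 N"
proof -
  have "{mat2 1 0 b 1 | b. True} = swap ` {mat2 1 b 0 1 | b. True}"
    by (auto simp: image_iff) (metis swap_mat2)
  then show ?thesis
    unfolding Gamma_upper1_def by (simp only: reduces_into_swap[OF X1_eq[symmetric]])
qed

lemma Gamma_principal_eq: "Gamma_principal N = cls ` XP N"
  by (simp add: Gamma_principal_def reduces_into_def XP_def mat2_one)

text \<open>A point \<open>(c : d)\<close> of the projective line over \<open>\<int>/N\<close> is determined by \<open>g = gcd c N\<close> and the
  residue of \<open>d / (c / g)\<close> modulo \<open>N / g\<close>; any Bezout coefficient \<open>u\<close> with \<open>u c \<equiv> g\<close> modulo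
  \<open>N\<close> serves as the inverse of \<open>c / g\<close>.\<close>

definition key0 :: "nat \<Rightarrow> imat \<Rightarrow> int" where
  "key0 N A = (let g = gcd (A$2$1) (int N)
    in g * int N + (fst (bezout_coefficients (A$2$1) (int N)) * A$2$2) mod (int N div g))"

text \<open>A coset is determined by the residues of the bottom row up to a common sign. They are
  written as digits in base N, and the minimum over both signs selects one of the two codes;
  \<open>keyP\<close> does the same with all four entries.\<close>

definition key1 :: "nat \<Rightarrow> imat \<Rightarrow> int" where
  "key1 N A = min (A$2$1 mod int N * int N + A$2$2 mod int N)
    ((- A$2$1) mod int N * int N + (- A$2$2) mod int N)"

definition keyP :: "nat \<Rightarrow> imat \<Rightarrow> int" where
  "keyP N A = min
    (((A$1$1 mod int N * int N + A$1$2 mod int N) * int N + A$2$1 mod int N) * int N + A$2$2 mod int N)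
    ((((- A$1$1) mod int N * int N + (- A$1$2) mod int N) * int N + (- A$2$1) mod int N) * int N
      + (- A$2$2) mod int N)"

section \<open>The keys are complete invariants of the cosets\<close>

lemma bezout_unit:
  fixes c u N :: int
  assumes N: "N > 0" and u: "[u * c = gcd c N] (mod N)"
  shows "[u * (c div gcd c N) = 1] (mod (N div gcd c N))"
proof -
  let ?g = "gcd c N"
  have g: "?g > 0" using N by simp
  have "?g * (N div ?g) dvd ?g * (u * (c div ?g) - 1)"
    using u by (simp add: cong_iff_dvd_diff right_diff_distrib mult.left_commute[of ?g])
  then show ?thesis using g N unfolding cong_iff_dvd_diff by (simp only: dvd_mult_cancel_left) auto
qed

lemma bezout_cong: "[fst (bezout_coefficients c N) * c = gcd c N] (mod (N::int))"
proof -
  have "fst (bezout_coefficients c N) * c - gcd c N = - snd (bezout_coefficients c N) * N"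
    using bezout_coefficients_fst_snd[of c N] by simp
  then show ?thesis by (simp add: cong_iff_dvd_diff)
qed

lemma codivisor_bounds:
  fixes h N :: int
  assumes "h > 0" "h dvd N" "N > 0"
  shows "0 < N div h" "N div h \<le> N"
proof -
  obtain n where "N = h * n" using assms(2) by blast
  then have "n > 0" "N div h = n" using assms by (auto simp: zero_less_mult_iff)
  then show "0 < N div h" "N div h \<le> N" using assms \<open>N = h * n\<close> by simp_all
qed

text \<open>Any two Bezout coefficients are inverses of the same unit modulo \<open>N div g\<close>,
  hence congruent there. The coefficient found by Euclid's algorithm in the program may therefore
  replace the one of \<open>bezout_coefficients\<close>.\<close>

lemma key0_eq:
  assumes N: "N > 0" and u: "[u * A$2$1 = gcd (A$2$1) (int N)] (mod int N)"
  shows "key0 N A = gcd (A$2$1) (int N) * int N + (u * A$2$2) mod (int N div gcd (A$2$1) (int N))"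
proof -
  let ?c = "A$2$1" and ?n = "int N div gcd (A$2$1) (int N)"
  let ?v = "fst (bezout_coefficients ?c (int N))" and ?x = "?c div gcd ?c (int N)"
  have v: "[?v * ?x = 1] (mod ?n)" and u': "[u * ?x = 1] (mod ?n)"
    using N u bezout_unit bezout_cong by simp_all
  have "[?v * (u * ?x) = ?v * 1] (mod ?n)" using u' by (rule cong_mult[OF cong_refl])
  moreover have "[u * (?v * ?x) = u * 1] (mod ?n)" using v by (rule cong_mult[OF cong_refl])
  ultimately have "[?v = u] (mod ?n)"
    unfolding cong_def by (simp add: mult.left_commute)
  then have "[?v * A$2$2 = u * A$2$2] (mod ?n)" by (rule cong_mult[OF _ cong_refl])
  then show ?thesis by (simp add: key0_def Let_def cong_def)
qed

lemma pair_code_inject: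
  fixes x y x' y' N :: int
  assumes "0 \<le> y" "y < N" "0 \<le> y'" "y' < N"
  shows "x * N + y = x' * N + y' \<longleftrightarrow> x = x' \<and> y = y'"
proof
  assume *: "x * N + y = x' * N + y'"
  have "(x * N + y) div N = x" "(x' * N + y') div N = x'" using assms by auto
  with * show "x = x' \<and> y = y'" by auto
qed auto

text \<open>The congruence says that the two bottom rows define the same point of the projective
  line over Z/N. It forces equal gcds with N, because \<open>gcd c N\<close> divides c' d and is
  coprime to d. After division by this gcd, the remaining c's are units, and multiplication by their
  inverses \<open>u\<close>, \<open>u'\<close> gives the equality of residues.\<close>

lemma key0_iff:
  assumes N: "N > 0" and A: "A \<in> SL" and B: "B \<in> SL"
  shows "key0 N A = key0 N B \<longleftrightarrow> [A$2$1 * B$2$2 = B$2$1 * A$2$2] (mod int N)"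
proof -
  let ?N = "int N"
  define c d c' d' where cd: "c = A$2$1" "d = A$2$2" "c' = B$2$1" "d' = B$2$2"
  have cop: "coprime c d" "coprime c' d'"
  proof -
    have "A$1$1 * d - A$1$2 * c = 1" "B$1$1 * d' - B$1$2 * c' = 1"
      using A B by (simp_all add: SL_iff det_2 cd)
    then show "coprime c d" "coprime c' d'"
      by (metis coprimeI dvd_diff dvd_mult)+
  qed
  define g g' where g: "g = gcd c ?N" "g' = gcd c' ?N"
  have bez: "\<exists>u. [u * e = gcd e ?N] (mod ?N)" for e
    using bezout_cong by blast
  obtain u where u: "[u * c = g] (mod ?N)" using bez g by blast
  obtain u' where u': "[u' * c' = g'] (mod ?N)" using bez g by blast
  have pos: "g > 0" "g' > 0" "g dvd ?N" "g' dvd ?N" using N by (auto simp: g)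
  have key: "key0 N A = g * ?N + (u * d) mod (?N div g)" "key0 N B = g' * ?N + (u' * d') mod (?N div g')"
    using key0_eq[OF N, of u A] key0_eq[OF N, of u' B] u u' by (simp_all add: cd g)
  have small: "0 \<le> e mod (?N div h) \<and> e mod (?N div h) < ?N" if "h > 0" "h dvd ?N" for e h
  proof -
    have "0 < ?N div h" "?N div h \<le> ?N" using that N codivisor_bounds[of h ?N] by simp_all
    then show ?thesis using pos_mod_bound[of "?N div h" e] pos_mod_sign[of "?N div h" e] by linarith
  qed
  have keyiff: "key0 N A = key0 N B \<longleftrightarrow> g = g' \<and> (u * d) mod (?N div g) = (u' * d') mod (?N div g')"
    unfolding key using small pos by (intro pair_code_inject) auto
  have main: "(u * d) mod (?N div g) = (u' * d') mod (?N div g) \<longleftrightarrow> [c * d' = c' * d] (mod ?N)" if "g = g'"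
  proof -
    define n x x' where n: "n = ?N div g" "x = c div g" "x' = c' div g"
    have g_dvd: "g dvd c" "g dvd c'" by (simp add: g(1), simp add: that g(2))
    have gx: "c = g * x" "c' = g * x'" "?N = g * n" using g_dvd pos by (simp_all add: n)
    have ux: "[u * x = 1] (mod n)" "[u' * x' = 1] (mod n)"
      using bezout_unit[of ?N u c] bezout_unit[of ?N u' c'] N u u' that by (auto simp: n g)
    have "[c * d' = c' * d] (mod ?N) \<longleftrightarrow> g * n dvd g * (x * d' - x' * d)"
      unfolding gx(3) cong_iff_dvd_diff by (simp add: gx algebra_simps)
    also have "\<dots> \<longleftrightarrow> [x * d' = x' * d] (mod n)" using pos by (simp add: cong_iff_dvd_diff)
    also have "\<dots> \<longleftrightarrow> [u * d = u' * d'] (mod n)"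
    proof
      assume "[x * d' = x' * d] (mod n)"
      then have "[(u * u') * (x * d') = (u * u') * (x' * d)] (mod n)" by (rule cong_mult[OF cong_refl])
      moreover have "[(u * x) * (u' * d') = 1 * (u' * d')] (mod n)" using ux(1) by (rule cong_mult[OF _ cong_refl])
      moreover have "[(u' * x') * (u * d) = 1 * (u * d)] (mod n)" using ux(2) by (rule cong_mult[OF _ cong_refl])
      ultimately show "[u * d = u' * d'] (mod n)"
        by (simp add: ac_simps) (metis cong_sym cong_trans)
    next
      assume "[u * d = u' * d'] (mod n)"
      then have "[(x * x') * (u * d) = (x * x') * (u' * d')] (mod n)" by (rule cong_mult[OF cong_refl])
      moreover have "[(u * x) * (x' * d) = 1 * (x' * d)] (mod n)" using ux(1) by (rule cong_mult[OF _ cong_refl])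
      moreover have "[(u' * x') * (x * d') = 1 * (x * d')] (mod n)" using ux(2) by (rule cong_mult[OF _ cong_refl])
      ultimately show "[x * d' = x' * d] (mod n)"
        by (simp add: ac_simps) (metis cong_sym cong_trans)
    qed
    finally show ?thesis by (simp add: n cong_def)
  qed
  have dvd: "gcd e ?N dvd e'" if "[e * f' = e' * f] (mod ?N)" "coprime e f" for e f e' f'
  proof -
    have "gcd e ?N dvd e' * f" using that(1) by (metis cong_dvd_iff cong_dvd_modulus dvd_mult2 gcd_dvd1 gcd_dvd2)
    moreover have "coprime (gcd e ?N) f" using that(2) by (metis coprime_divisors dvd_refl gcd_dvd1)
    ultimately show ?thesis by (metis coprime_dvd_mult_left_iff)
  qed
  have gg: "g = g'" if "[c * d' = c' * d] (mod ?N)"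
  proof -
    have "g dvd c'" "g' dvd c"
      using dvd[OF that cop(1)] dvd[OF cong_sym[OF that] cop(2)] by (simp_all add: g)
    then have "g dvd g'" "g' dvd g" using pos by (simp_all add: g)
    then show ?thesis using pos by (simp add: zdvd_antisym_nonneg)
  qed
  show ?thesis using keyiff main gg by (auto simp: cd)
qed

lemma coset_key0: assumes "N > 0" shows "coset_key (X0 N) (key0 N)"
proof
  show "key0 N A = key0 N B \<longleftrightarrow> A ** adj B \<in> X0 N" if "A \<in> SL" "B \<in> SL" for A B
    using that key0_iff[OF assms that]
    using SL_mult[OF that(1) adj_SL[THEN iffD2, OF that(2)]] that unfolding X0_def
    by (cases A rule: mat2_cases, cases B rule: mat2_cases)
      (simp add: cong_iff_dvd_diff algebra_simps del: mat2_SL)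
  have "key0 N ` SL \<subseteq> {0..int N * int N + int N}"
  proof safe
    fix A :: imat
    let ?g = "gcd (A$2$1) (int N)"
    let ?e = "(fst (bezout_coefficients (A$2$1) (int N)) * A$2$2) mod (int N div ?g)"
    have g: "0 < ?g" "?g \<le> int N" "?g dvd int N" using assms by (auto simp: zdvd_imp_le)
    then have *: "0 < int N div ?g" "int N div ?g \<le> int N" using assms codivisor_bounds[of ?g "int N"] by simp_all
    have "0 \<le> ?e" "?e \<le> int N"
      using pos_mod_bound[OF *(1)] order.strict_implies_order[THEN order.trans, OF pos_mod_bound *(2), OF *(1)] pos_mod_sign[OF *(1)] by simp_all
    moreover have "?g * int N \<le> int N * int N" using g by (intro mult_right_mono) auto
    ultimately show "key0 N A \<in> {0..int N * int N + int N}"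
      using g unfolding key0_def Let_def atLeastAtMost_iff by (intro conjI add_nonneg_nonneg add_mono) (assumption | simp)+
  qed
  then show "finite (key0 N ` SL)" by (rule finite_subset) simp
qed (auto simp: X0_def)

lemma mod_uminus_inject: "(- a) mod N = (- b) mod N \<longleftrightarrow> a mod N = b mod (N::int)"
  using cong_minus_minus_iff[of a b N] by (simp add: cong_def)

text \<open>\<open>y\<close> and \<open>y'\<close> are the codes of the negatives of the objects
  coded by \<open>x\<close> and \<open>x'\<close>. The hypotheses make the two pairs of codes either
  equal or disjoint as sets, and then comparing their minima suffices.\<close>

lemma min_code_eq_iff:
  fixes x y x' y' :: int
  assumes "x = x' \<longleftrightarrow> y = y'" "x = y' \<longleftrightarrow> y = x'"
  shows "min x y = min x' y' \<longleftrightarrow> x = x' \<or> x = y'"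
  using assms by (auto simp: min_def split: if_splits)

lemma key1_iff:
  assumes N: "N > 0"
  shows "key1 N A = key1 N B \<longleftrightarrow>
    [A$2$1 = B$2$1] (mod int N) \<and> [A$2$2 = B$2$2] (mod int N) \<or>
    [A$2$1 = - B$2$1] (mod int N) \<and> [A$2$2 = - B$2$2] (mod int N)"
  unfolding key1_def cong_def using N mod_uminus_inject[of _ "int N" "- _"]
  by (subst min_code_eq_iff) (auto simp: pair_code_inject mod_uminus_inject)

lemma keyP_iff:
  assumes N: "N > 0"
  shows "keyP N A = keyP N B \<longleftrightarrow> mat_cong N A B \<or> mat_cong N A (- B)"
  unfolding keyP_def mat_cong_def cong_def forall_2 using N mod_uminus_inject[of _ "int N" "- _"]
  by (subst min_code_eq_iff) (auto simp: pair_code_inject mod_uminus_inject)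

lemma finite_min_code: "finite ((\<lambda>A::imat. min (h (f A)) (h (g A))) ` SL)"
  if "finite (range f \<union> range g)" for f g :: "imat \<Rightarrow> 'a" and h :: "'a \<Rightarrow> int"
proof (rule finite_subset)
  show "(\<lambda>A. min (h (f A)) (h (g A))) ` SL \<subseteq> h ` (range f \<union> range g)"
    by (auto simp: min_def)
qed (use that in auto)

lemma coset_key1: assumes "N > 0" shows "coset_key (X1 N) (key1 N)"
proof
  show "key1 N A = key1 N B \<longleftrightarrow> A ** adj B \<in> X1 N" if A: "A \<in> SL" and B: "B \<in> SL" for A B
  proof -
    obtain a b c d where Am: "A = mat2 a b c d" by (cases A rule: mat2_cases)
    obtain a' b' c' d' where Bm: "B = mat2 a' b' c' d'" by (cases B rule: mat2_cases)
    have det: "a * d - b * c = 1" "a' * d' - b' * c' = 1" using A B by (simp_all add: Am Bm)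
    \<comment> \<open>The bottom row of \<open>A ** adj B\<close>, that is, the coordinates of the
      bottom row of \<open>A\<close> with respect to the rows of \<open>B\<close>.\<close>
    define p q where pq: "p = c * d' - d * c'" "q = d * a' - c * b'"
    have cd: "c = p * a' + q * c'" "d = p * b' + q * d'"
    proof -
      have "p * a' + q * c' = c * (a' * d' - b' * c')" "p * b' + q * d' = d * (a' * d' - b' * c')"
        by (simp_all add: pq algebra_simps)
      then show "c = p * a' + q * c'" "d = p * b' + q * d'" by (simp_all add: det)
    qed
    \<comment> \<open>To be used with the two signs \<open>e = 1\<close> and
      \<open>e = - 1\<close>.\<close>
    have "int N dvd c - e * c' \<and> int N dvd d - e * d' \<longleftrightarrow> int N dvd p \<and> int N dvd q - e" for e
    proof safe
      assume *: "int N dvd c - e * c'" "int N dvd d - e * d'"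
      have "p = (c - e * c') * d' - (d - e * d') * c'"
        "q - e * (a' * d' - b' * c') = (d - e * d') * a' - (c - e * c') * b'" by (simp_all add: pq algebra_simps)
      then show "int N dvd p" "int N dvd q - e" using * by (simp_all add: det)
    next
      assume *: "int N dvd p" "int N dvd q - e"
      have "c - e * c' = p * a' + (q - e) * c'" "d - e * d' = p * b' + (q - e) * d'"
        using cd by (simp_all add: algebra_simps)
      then show "int N dvd c - e * c'" "int N dvd d - e * d'" using * by simp_all
    qed
    note * = this[of 1] this[of "-1"]
    have "A ** adj B \<in> X1 N \<longleftrightarrow> int N dvd p \<and> (int N dvd q - 1 \<or> int N dvd q + 1)"
      using SL_mult[OF A adj_SL[THEN iffD2, OF B]] unfolding X1_def
      by (simp add: Am Bm pq algebra_simps del: mat2_SL)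
    then show ?thesis
      using * by (auto simp add: key1_iff[OF assms] Am Bm cong_iff_dvd_diff)
  qed
  have "finite (range (\<lambda>A::imat. (A$2$1 mod int N, A$2$2 mod int N)) \<union>
      range (\<lambda>A::imat. ((- A$2$1) mod int N, (- A$2$2) mod int N)))"
    by (rule finite_subset[of _ "{0..int N} \<times> {0..int N}"]) (use assms in \<open>auto intro!: less_imp_le[OF pos_mod_bound]\<close>)
  from finite_min_code[OF this, of "\<lambda>(x, y). x * int N + y"]
  show "finite (key1 N ` SL)" by (simp add: key1_def[abs_def])
qed (auto simp: X1_def dvd_diff_commute minus_diff_commute add.commute)

lemma mat_cong_mult_right:
  assumes "mat_cong N A B" shows "mat_cong N (A ** C) (B ** C)"
  using assms unfolding mat_cong_def matrix_matrix_mult_def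
  by (auto intro!: cong_sum cong_mult)

lemma mat_cong_minus: "mat_cong N (- A) (- B) \<longleftrightarrow> mat_cong N A B"
  by (simp add: mat_cong_def cong_minus_minus_iff)

lemma coset_keyP: assumes "N > 0" shows "coset_key (XP N) (keyP N)"
proof
  show "keyP N A = keyP N B \<longleftrightarrow> A ** adj B \<in> XP N" if A: "A \<in> SL" and B: "B \<in> SL" for A B
  proof -
    have "mat_cong N A C \<longleftrightarrow> mat_cong N (A ** adj B) (C ** adj B)" for C
    proof
      assume "mat_cong N (A ** adj B) (C ** adj B)"
      then have "mat_cong N ((A ** adj B) ** B) ((C ** adj B) ** B)" by (rule mat_cong_mult_right)
      then show "mat_cong N A C" using B by (simp flip: matrix_mul_assoc)
    qed (rule mat_cong_mult_right)
    then show ?thesis using A B by (simp add: keyP_iff[OF assms] XP_def)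
  qed
  show "- A \<in> XP N" if "A \<in> XP N" for A
    using that mat_cong_minus[of N A "- mat 1"] mat_cong_minus[of N A "mat 1"] by (auto simp: XP_def)
  have "finite (range (\<lambda>A::imat. (A$1$1 mod int N, A$1$2 mod int N, A$2$1 mod int N, A$2$2 mod int N)) \<union>
      range (\<lambda>A::imat. ((- A$1$1) mod int N, (- A$1$2) mod int N, (- A$2$1) mod int N, (- A$2$2) mod int N)))"
    by (rule finite_subset[of _ "{0..int N} \<times> {0..int N} \<times> {0..int N} \<times> {0..int N}"])
      (use assms in \<open>auto intro!: less_imp_le[OF pos_mod_bound]\<close>)
  from finite_min_code[OF this, of "\<lambda>(w, x, y, z). ((w * int N + x) * int N + y) * int N + z"]
  show "finite (keyP N ` SL)" by (simp add: keyP_def[abs_def])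
qed (auto simp: XP_def)

section \<open>A calculus for programs with cost\<close>

text \<open>Total correctness with the cost handed to the postcondition. The language is
  deterministic, so the existential form behaves like a weakest precondition, and the rules for
  loop-free programs are equivalences usable by the simplifier.\<close>

definition wp :: "com \<Rightarrow> memory \<Rightarrow> (nat \<Rightarrow> memory \<Rightarrow> bool) \<Rightarrow> bool" where
  "wp c s Q \<longleftrightarrow> (\<exists>n t. exec c s n t \<and> Q n t)"

definition upd :: "nat \<Rightarrow> int \<Rightarrow> int \<Rightarrow> memory \<Rightarrow> memory" where
  "upd a i x s = s(a := (s a)(i := x))"

lemma upd_apply [simp]: "upd a i x s b = (if b = a then (s a)(i := x) else s b)"
  by (simp add: upd_def)

lemma wp_Skip: "wp Skip s Q \<longleftrightarrow> Q 1 s"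
proof
  assume "wp Skip s Q"
  then obtain n t where "exec Skip s n t" "Q n t" by (auto simp: wp_def)
  then show "Q 1 s" by (cases rule: exec.cases) auto
qed (use exec.Skip in \<open>unfold wp_def, blast\<close>)

lemma wp_Store: "wp (Store a i e) s Q \<longleftrightarrow> Q (1 + acost i + acost e) (upd a (aval i s) (aval e s) s)"
proof
  assume "wp (Store a i e) s Q"
  then obtain n t where "exec (Store a i e) s n t" "Q n t" by (auto simp: wp_def)
  then show "Q (1 + acost i + acost e) (upd a (aval i s) (aval e s) s)"
    by (cases rule: exec.cases) (auto simp: upd_def)
qed (use exec.Store in \<open>unfold wp_def upd_def, blast\<close>)

lemma wp_Seq: "wp (Seq c1 c2) s Q \<longleftrightarrow> wp c1 s (\<lambda>m s'. wp c2 s' (\<lambda>n. Q (m + n)))"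
proof
  assume "wp (Seq c1 c2) s Q"
  then obtain n t where "exec (Seq c1 c2) s n t" "Q n t" by (auto simp: wp_def)
  then show "wp c1 s (\<lambda>m s'. wp c2 s' (\<lambda>n. Q (m + n)))"
    by (cases rule: exec.cases) (auto simp: wp_def)
qed (auto simp: wp_def intro: exec.Seq)

lemma wp_Cond: "wp (Cond b c1 c2) s Q \<longleftrightarrow>
  (if bval b s then wp c1 s (\<lambda>n. Q (1 + bcost b + n)) else wp c2 s (\<lambda>n. Q (1 + bcost b + n)))"
proof
  assume "wp (Cond b c1 c2) s Q"
  then obtain n t where "exec (Cond b c1 c2) s n t" "Q n t" by (auto simp: wp_def)
  then show "if bval b s then wp c1 s (\<lambda>n. Q (1 + bcost b + n)) else wp c2 s (\<lambda>n. Q (1 + bcost b + n))"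
    by (cases rule: exec.cases) (auto simp: wp_def)
next
  assume "if bval b s then wp c1 s (\<lambda>n. Q (1 + bcost b + n)) else wp c2 s (\<lambda>n. Q (1 + bcost b + n))"
  then show "wp (Cond b c1 c2) s Q"
    using exec.CondTrue exec.CondFalse unfolding wp_def by (cases "bval b s"; simp only: if_True if_False; blast)
qed

text \<open>Used as a congruence rule, it excludes the continuation from simplification until it is
  reached.\<close>

lemma wp_cong: "c = c' \<Longrightarrow> s = s' \<Longrightarrow> wp c s Q = wp c' s' Q"
  by simp

lemmas wp_simps = wp_Skip wp_Store wp_Seq wp_Cond

lemma wp_mono: "wp c s Q \<Longrightarrow> (\<And>n t. Q n t \<Longrightarrow> Q' n t) \<Longrightarrow> wp c s Q'"
  by (auto simp: wp_def)

text \<open>The invariant carries the number of iterations made so far. \<open>C\<close> bounds the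
  cost of one pass and \<open>B\<close> secures termination; the cost estimate refers to the actual
  count at exit, which the invariant can bound more conveniently.\<close>

lemma wp_While:
  assumes "I k s"
    and step: "\<And>m s. I m s \<Longrightarrow> bval b s \<Longrightarrow> wp c s (\<lambda>n t. n \<le> C \<and> I (Suc m) t)"
    and bound: "\<And>m s. I m s \<Longrightarrow> bval b s \<Longrightarrow> m < B"
  shows "wp (While b c) s (\<lambda>n t. \<exists>m\<ge>k. I m t \<and> \<not> bval b t \<and> n \<le> (m - k) * (1 + bcost b + C) + (1 + bcost b))"
  using assms(1)
proof (induction "B - k" arbitrary: k s rule: less_induct)
  case less
  show ?case
  proof (cases "bval b s")
    case True
    obtain n1 s1 where 1: "exec c s n1 s1" "n1 \<le> C" "I (Suc k) s1"
      using step[OF less.prems True] by (auto simp: wp_def)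
    have "B - Suc k < B - k" using bound[OF less.prems True] by simp
    from less.hyps[OF this 1(3)] obtain n2 s2 m where 2: "exec (While b c) s1 n2 s2" "m \<ge> Suc k" "I m s2"
      "\<not> bval b s2" "n2 \<le> (m - Suc k) * (1 + bcost b + C) + (1 + bcost b)"
      by (auto simp: wp_def)
    have "exec (While b c) s (1 + bcost b + n1 + n2) s2" using True 1(1) 2(1) by (rule exec.WhileTrue)
    moreover have "m - k = Suc (m - Suc k)" using 2(2) by simp
    then have "1 + bcost b + n1 + n2 \<le> (m - k) * (1 + bcost b + C) + (1 + bcost b)"
      using 1(2) 2(5) by simp
    ultimately show ?thesis using 2 unfolding wp_def by (metis Suc_leD)
  next
    case False
    then show ?thesis using less.prems exec.WhileFalse[OF False, of c] unfolding wp_def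
      by (intro exI[of _ "1 + bcost b"] exI[of _ s] conjI exI[of _ k]) simp_all
  qed
qed

section \<open>Programs that compute the keys\<close>

abbreviation V :: "nat \<Rightarrow> aexp" where "V a \<equiv> Cell a (Const 0)"
abbreviation Assign :: "nat \<Rightarrow> aexp \<Rightarrow> com" where "Assign a \<equiv> Store a (Const 0)"
abbreviation Minus :: "aexp \<Rightarrow> aexp" where "Minus e \<equiv> Mul (Const (- 1)) e"

fun Block :: "com list \<Rightarrow> com" where
  "Block [] = Skip"
| "Block [c] = c"
| "Block (c # cs) = Seq c (Block cs)"

lemma wp_Block:
  "wp (Block [c]) s Q = wp c s Q"
  "wp (Block (c # d # cs)) s Q \<longleftrightarrow> wp c s (\<lambda>m s'. wp (Block (d # cs)) s' (\<lambda>n. Q (m + n)))"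
  by (simp_all add: wp_Seq)

text \<open>Conventions: array 0 holds \<open>N\<close>; arrays 20 to 23 a matrix register, 24 the key of its
  content, 25 to 31 auxiliary values; 32 the number of tiles found, 33 a counter, 34 the table
  from keys to tile numbers plus 1, 35 to 38 the matrices of the tiles, 39 and 10 the tiles
  equivalent to the right translates by \<open>S\<close> and \<open>u\<close>, 40 marks the tiles with an interior edge;
  41 to 51 are working storage.\<close>

definition regs :: "memory \<Rightarrow> imat" where
  "regs s = mat2 (s 20 0) (s 21 0) (s 22 0) (s 23 0)"

definition key_prog :: "nat \<Rightarrow> com \<Rightarrow> (imat \<Rightarrow> int) \<Rightarrow> nat \<Rightarrow> bool" where
  "key_prog N kp key K \<longleftrightarrow> (\<forall>s. s 0 0 = int N \<longrightarrow>
     wp kp s (\<lambda>n t. n \<le> K \<and> t 24 0 = key (regs s) \<and> (\<forall>a. a < 24 \<or> 30 < a \<longrightarrow> t a = s a)))"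

definition code2 :: "aexp \<Rightarrow> aexp \<Rightarrow> aexp" where
  "code2 e f = Add (Mul e (V 0)) (Rem f (V 0))"

definition min_prog :: "aexp \<Rightarrow> aexp \<Rightarrow> com" where
  "min_prog e f = Block [Assign 25 e, Assign 26 f,
     Cond (Less (V 26) (V 25)) (Assign 24 (V 26)) (Assign 24 (V 25))]"

definition key1_prog :: "nat \<Rightarrow> nat \<Rightarrow> com" where
  "key1_prog c d = min_prog (code2 (Rem (V c) (V 0)) (V d)) (code2 (Rem (Minus (V c)) (V 0)) (Minus (V d)))"

definition keyP_prog :: com where
  "keyP_prog = min_prog
     (code2 (code2 (code2 (Rem (V 20) (V 0)) (V 21)) (V 22)) (V 23))
     (code2 (code2 (code2 (Rem (Minus (V 20)) (V 0)) (Minus (V 21))) (Minus (V 22))) (Minus (V 23)))"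

definition euclid_body :: com where
  "euclid_body = Block [Assign 29 (Quot (V 25) (V 26)), Assign 30 (Rem (V 25) (V 26)),
     Assign 25 (V 26), Assign 26 (V 30),
     Assign 30 (Add (V 27) (Minus (Mul (V 29) (V 28)))), Assign 27 (V 28), Assign 28 (V 30)]"

definition key0_prog :: "nat \<Rightarrow> nat \<Rightarrow> com" where
  "key0_prog c d = Seq (Block [Assign 25 (V 0), Assign 26 (Rem (V c) (V 0)), Assign 27 (Const 0), Assign 28 (Const 1)])
     (Seq (While (Less (Const 0) (V 26)) euclid_body)
       (Assign 24 (Add (Mul (V 25) (V 0)) (Rem (Mul (V 27) (V d)) (Quot (V 0) (V 25))))))"

text \<open>The second expression is evaluated after array 25 has been overwritten; the hypothesis
  gives its value in that state.\<close>

lemma wp_min_prog: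
  assumes "aval f (upd 25 0 (aval e s) s) = y"
  shows "wp (min_prog e f) s (\<lambda>n t. n \<le> acost e + acost f + 20 \<and> t 24 0 = min (aval e s) y \<and>
    (\<forall>a. a < 24 \<or> 30 < a \<longrightarrow> t a = s a))"
  using assms unfolding min_prog_def by (simp add: wp_simps)

lemma key1_prog_lower: "key_prog N (key1_prog 22 23) (key1 N) 100"
  unfolding key_prog_def
proof (intro allI impI)
  fix s :: memory assume s: "s 0 0 = int N"
  show "wp (key1_prog 22 23) s (\<lambda>n t. n \<le> 100 \<and> t 24 0 = key1 N (regs s) \<and> (\<forall>a. a < 24 \<or> 30 < a \<longrightarrow> t a = s a))"
    unfolding key1_prog_def by (rule wp_mono, rule wp_min_prog, rule refl) (use s in \<open>simp add: key1_def code2_def regs_def\<close>)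
qed

lemma key1_prog_upper: "key_prog N (key1_prog 21 20) (key1 N \<circ> swap) 100"
  unfolding key_prog_def
proof (intro allI impI)
  fix s :: memory assume s: "s 0 0 = int N"
  show "wp (key1_prog 21 20) s (\<lambda>n t. n \<le> 100 \<and> t 24 0 = (key1 N \<circ> swap) (regs s) \<and> (\<forall>a. a < 24 \<or> 30 < a \<longrightarrow> t a = s a))"
    unfolding key1_prog_def by (rule wp_mono, rule wp_min_prog, rule refl) (use s in \<open>simp add: key1_def code2_def regs_def\<close>)
qed

lemma keyP_prog: "key_prog N keyP_prog (keyP N) 100"
  unfolding key_prog_def
proof (intro allI impI)
  fix s :: memory assume s: "s 0 0 = int N"
  show "wp keyP_prog s (\<lambda>n t. n \<le> 100 \<and> t 24 0 = keyP N (regs s) \<and> (\<forall>a. a < 24 \<or> 30 < a \<longrightarrow> t a = s a))"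
    unfolding keyP_prog_def by (rule wp_mono, rule wp_min_prog, rule refl) (use s in \<open>simp add: keyP_def code2_def regs_def\<close>)
qed

text \<open>The product \<open>r0 r1\<close> of two consecutive remainders is at least halved by every step, so that
  \<open>2\<^sup>m r0 r1 \<le> N\<^sup>2\<close> after \<open>m\<close> steps.\<close>

definition euclid_inv :: "nat \<Rightarrow> int \<Rightarrow> memory \<Rightarrow> nat \<Rightarrow> memory \<Rightarrow> bool" where
  "euclid_inv N c s m t \<longleftrightarrow> (\<forall>a. a < 24 \<or> 30 < a \<longrightarrow> t a = s a) \<and>
     0 \<le> t 26 0 \<and> t 26 0 < t 25 0 \<and> gcd (t 25 0) (t 26 0) = gcd c (int N) \<and>
     [t 27 0 * c = t 25 0] (mod int N) \<and> [t 28 0 * c = t 26 0] (mod int N) \<and>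
     2 ^ m * (t 25 0 * t 26 0) \<le> int N * int N \<and> (2::int) ^ m \<le> 2 * (int N * int N)"

lemma euclid_step:
  assumes "euclid_inv N c s m t" "0 < t 26 0"
  shows "wp euclid_body t (\<lambda>n t'. n \<le> 50 \<and> euclid_inv N c s (Suc m) t')"
proof -
  define r0 r1 u0 u1 where r: "r0 = t 25 0" "r1 = t 26 0" "u0 = t 27 0" "u1 = t 28 0"
  define q where "q = r0 div r1"
  have inv: "0 < r1" "r1 < r0" "gcd r0 r1 = gcd c (int N)" "[u0 * c = r0] (mod int N)" "[u1 * c = r1] (mod int N)"
    "2 ^ m * (r0 * r1) \<le> int N * int N" "(2::int) ^ m \<le> 2 * (int N * int N)"
    and frame: "\<And>a. a < 24 \<or> 30 < a \<Longrightarrow> t a = s a"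
    using assms by (auto simp: euclid_inv_def r)
  have 1: "0 \<le> r0 mod r1" "r0 mod r1 < r1" using inv by auto
  have 2: "gcd r1 (r0 mod r1) = gcd c (int N)" using inv(3) gcd_red_int[of r0 r1] by simp
  have mod: "r0 mod r1 = r0 - q * r1" by (simp add: q_def minus_div_mult_eq_mod)
  have "[u0 * c - q * (u1 * c) = r0 - q * r1] (mod int N)"
    using inv by (intro cong_diff cong_mult cong_refl)
  then have 3: "[(u0 - q * u1) * c = r0 mod r1] (mod int N)" by (simp add: mod algebra_simps)
  \<comment> \<open>With quotient at least 1 the old remainder is at least \<open>r1\<close> plus
    the new one, and the new one is smaller than \<open>r1\<close>; hence it is at most half of
    \<open>r0\<close>.\<close>
  have "q \<ge> 1" using inv by (simp add: q_def pos_imp_zdiv_pos_iff int_one_le_iff_zero_less)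
  then have "r1 \<le> q * r1" using inv mult_right_mono[of 1 q r1] by simp
  then have "2 * (r0 mod r1) \<le> r0" using 1(2) mod by linarith
  then have "r1 * (2 * (r0 mod r1)) \<le> r1 * r0" 
    using mult_left_mono[of "2 * (r0 mod r1)" r0 r1] inv(1) by simp
  then have "2 ^ m * (r1 * (2 * (r0 mod r1))) \<le> 2 ^ m * (r1 * r0)" by (rule mult_left_mono) simp
  then have 4: "2 ^ Suc m * (r1 * (r0 mod r1)) \<le> int N * int N"
    using inv(6) by (simp add: algebra_simps)
  \<comment> \<open>The bound on the product says nothing once the second remainder is 0. Before the
    step the product is at least 1, which bounds the power of 2 by \<open>N\<close> squared; the
    spare factor 2 in the invariant carries this past the last step.\<close>
  have "1 * 1 \<le> r0 * r1" using inv by (intro mult_mono) auto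
  then have "2 ^ m * 1 \<le> 2 ^ m * (r0 * r1)" by (intro mult_left_mono) auto
  then have "(2::int) ^ m \<le> int N * int N" using inv(6) by linarith
  then have 5: "(2::int) ^ Suc m \<le> 2 * (int N * int N)" by simp
  show ?thesis unfolding euclid_body_def
    using 1 2 3 4 5 inv frame
    by (simp add: wp_simps euclid_inv_def r[symmetric] q_def[symmetric] cong: wp_cong del: power_Suc)
qed

text \<open>\<open>sel\<close> is the identity for the lower series and \<open>swap\<close> for the
  upper one, so that one proof serves both. \<open>L\<close> bounds the number of divisions.\<close>

lemma key0_prog:
  assumes N: "N > 0" and L: "2 * (int N * int N) < 2 ^ L"
    and c: "c \<in> {20..23}" and d: "d \<in> {20..23}" and sel: "\<And>s. sel (regs s) $ 2 $ 1 = s c 0 \<and> sel (regs s) $ 2 $ 2 = s d 0"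
  shows "key_prog N (key0_prog c d) (key0 N \<circ> sel) (60 * L + 100)"
  unfolding key_prog_def
proof (intro allI impI)
  fix s :: memory assume s: "s 0 0 = int N"
  have cd: "c < 24" "d < 24" using c d by auto
  \<comment> \<open>The remainders start with \<open>N\<close> and c modulo \<open>N\<close>, with
    coefficients 0 and 1. The first remainder is at most \<open>N\<close> and the second below it,
    so their product starts below \<open>N\<close> squared.\<close>
  define s1 where "s1 = upd 28 0 1 (upd 27 0 0 (upd 26 0 (s c 0 mod int N) (upd 25 0 (int N) s)))"
  have inv0: "euclid_inv N (s c 0) s 0 s1"
  proof -
    have "[s c 0 = s c 0 mod int N] (mod int N)" by (simp add: cong_def)
    moreover have "gcd (int N) (s c 0 mod int N) = gcd (s c 0) (int N)" by (metis gcd.commute gcd_red_int)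
    moreover have "int N * (s c 0 mod int N) \<le> int N * int N" using N by (intro mult_left_mono) (auto simp: less_imp_le)
    moreover have "(1::int) \<le> int N * int N" using N by (metis int_one_le_iff_zero_less of_nat_0_less_iff zero_less_mult_iff)
    ultimately show ?thesis using N by (simp add: euclid_inv_def s1_def cong_def)
  qed
  have "wp (While (Less (Const 0) (V 26)) euclid_body) s1
      (\<lambda>n t. \<exists>m\<ge>0. euclid_inv N (s c 0) s m t \<and> \<not> bval (Less (Const 0) (V 26)) t \<and>
         n \<le> (m - 0) * (1 + bcost (Less (Const 0) (V 26)) + 50) + (1 + bcost (Less (Const 0) (V 26))))"
  proof (rule wp_While[where I = "euclid_inv N (s c 0) s" and B = L, OF inv0])
    show "wp euclid_body t (\<lambda>n t'. n \<le> 50 \<and> euclid_inv N (s c 0) s (Suc m) t')"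
      if "euclid_inv N (s c 0) s m t" "bval (Less (Const 0) (V 26)) t" for m t
      using that by (intro euclid_step) auto
    show "m < L" if "euclid_inv N (s c 0) s m t" for m t
    proof -
      have "(2::int) ^ m < 2 ^ L" using that L unfolding euclid_inv_def by linarith
      then show ?thesis by simp
    qed
  qed
  then have while: "wp (While (Less (Const 0) (V 26)) euclid_body) s1
      (\<lambda>n t. (\<forall>a. a < 24 \<or> 30 < a \<longrightarrow> t a = s a) \<and> t 25 0 = gcd (s c 0) (int N) \<and>
        [t 27 0 * s c 0 = gcd (s c 0) (int N)] (mod int N) \<and> n \<le> 60 * L + 10)"
  proof (rule wp_mono)
    fix n t assume "\<exists>m\<ge>0. euclid_inv N (s c 0) s m t \<and> \<not> bval (Less (Const 0) (V 26)) t \<and>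
         n \<le> (m - 0) * (1 + bcost (Less (Const 0) (V 26)) + 50) + (1 + bcost (Less (Const 0) (V 26)))"
    then obtain m where inv: "euclid_inv N (s c 0) s m t" "\<not> 0 < t 26 0" and n: "n \<le> m * 55 + 5"
      by auto
    have "(2::int) ^ m < 2 ^ L" using inv(1) L unfolding euclid_inv_def by linarith
    then have "m < L" by simp
    then have "n \<le> 60 * L + 10" using n by linarith
    moreover have "t 26 0 = 0" "t 25 0 > 0" using inv by (auto simp: euclid_inv_def)
    ultimately show "(\<forall>a. a < 24 \<or> 30 < a \<longrightarrow> t a = s a) \<and> t 25 0 = gcd (s c 0) (int N) \<and>
        [t 27 0 * s c 0 = gcd (s c 0) (int N)] (mod int N) \<and> n \<le> 60 * L + 10"
      using inv(1) by (auto simp: euclid_inv_def)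
  qed
  show "wp (key0_prog c d) s (\<lambda>n t. n \<le> 60 * L + 100 \<and> t 24 0 = (key0 N \<circ> sel) (regs s) \<and> (\<forall>a. a < 24 \<or> 30 < a \<longrightarrow> t a = s a))"
    unfolding key0_prog_def wp_Seq
  proof (rule wp_mono)
    show "wp (Block [Assign 25 (V 0), Assign 26 (Rem (V c) (V 0)), Assign 27 (Const 0), Assign 28 (Const 1)]) s
      (\<lambda>n t. n \<le> 20 \<and> t = s1)"
      using cd s by (simp add: wp_simps s1_def)
  next
    fix k :: nat and t assume "k \<le> 20 \<and> t = s1"
    then have k: "k \<le> 20" "t = s1" by auto
    show "wp (While (Less (Const 0) (V 26)) euclid_body) t (\<lambda>m s'.
       wp (Assign 24 (Add (Mul (V 25) (V 0)) (Rem (Mul (V 27) (V d)) (Quot (V 0) (V 25))))) s'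
        (\<lambda>n t::memory. k + (m + n::nat) \<le> 60 * L + 100 \<and> t 24 0 = (key0 N \<circ> sel) (regs s) \<and> (\<forall>a. a < 24 \<or> 30 < a \<longrightarrow> t a = s a)))"
      unfolding k(2)
    proof (rule wp_mono[OF while])
      fix n t assume t: "(\<forall>a. a < 24 \<or> 30 < a \<longrightarrow> t a = s a) \<and> t 25 0 = gcd (s c 0) (int N) \<and>
        [t 27 0 * s c 0 = gcd (s c 0) (int N)] (mod int N) \<and> n \<le> 60 * L + 10"
      then have "t 0 = s 0" "t d = s d" using cd by simp_all
      moreover have "key0 N (sel (regs s)) = gcd (s c 0) (int N) * int N + (t 27 0 * s d 0) mod (int N div gcd (s c 0) (int N))"
        using key0_eq[OF N, of "t 27 0" "sel (regs s)"] t sel[of s] by simp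
      ultimately show "wp (Assign 24 (Add (Mul (V 25) (V 0)) (Rem (Mul (V 27) (V d)) (Quot (V 0) (V 25))))) t
        (\<lambda>na t::memory. k + (n + na::nat) \<le> 60 * L + 100 \<and> t 24 0 = (key0 N \<circ> sel) (regs s) \<and> (\<forall>a. a < 24 \<or> 30 < a \<longrightarrow> t a = s a))"
        using t k(1) s unfolding wp_Store by simp
    qed
  qed
qed

section \<open>Exploring the cosets\<close>

definition mem :: "memory \<Rightarrow> int \<Rightarrow> imat" where
  "mem s k = mat2 (s 35 k) (s 36 k) (s 37 k) (s 38 k)"

text \<open>The table stores the tile number plus 1, because 0 is the initial content of every cell
  and can thus mean an unknown key.\<close>

definition push :: com where
  "push = Block [Store 35 (V 32) (V 20), Store 36 (V 32) (V 21), Store 37 (V 32) (V 22), Store 38 (V 32) (V 23),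
     Store 34 (V 24) (Add (V 32) (Const 1)), Assign 32 (Add (V 32) (Const 1))]"

definition mulU :: com where
  "mulU = Block [Assign 31 (V 20), Assign 20 (Minus (V 21)), Assign 21 (Add (V 31) (V 21)),
     Assign 31 (V 22), Assign 22 (Minus (V 23)), Assign 23 (Add (V 31) (V 23))]"

definition loadS :: com where
  "loadS = Block [Assign 20 (Cell 36 (V 33)), Assign 21 (Minus (Cell 35 (V 33))),
     Assign 22 (Cell 38 (V 33)), Assign 23 (Minus (Cell 37 (V 33)))]"

text \<open>Stated as a rule with bounds and a frame condition in the premise, so that the
  verification of larger programs does not meet the exact cost or nested updates.\<close>

lemma wp_push:
  assumes "\<And>n t. n \<le> 40 \<Longrightarrow> (\<And>a. a < 32 \<or> a = 33 \<or> 38 < a \<Longrightarrow> t a = s a) \<Longrightarrow> t 32 0 = s 32 0 + 1 \<Longrightarrow>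
    t 34 = (s 34)(s 24 0 := s 32 0 + 1) \<Longrightarrow> mem t = (mem s)(s 32 0 := regs s) \<Longrightarrow> Q n t"
  shows "wp push s Q"
  unfolding push_def
  by (simp add: wp_simps cong: wp_cong) (rule assms; auto simp: mem_def regs_def fun_eq_iff)

lemma wp_mulU:
  assumes "\<And>n t. n \<le> 40 \<Longrightarrow> (\<And>a. a < 20 \<or> 23 < a \<and> a < 31 \<or> 31 < a \<Longrightarrow> t a = s a) \<Longrightarrow> regs t = regs s ** mU \<Longrightarrow> Q n t"
  shows "wp mulU s Q"
  unfolding mulU_def
  by (simp add: wp_simps cong: wp_cong) (rule assms; auto simp: mU_def regs_def)

lemma wp_loadS:
  assumes "\<And>n t. n \<le> 40 \<Longrightarrow> (\<And>a. a < 20 \<or> 23 < a \<Longrightarrow> t a = s a) \<Longrightarrow> regs t = mem s (s 33 0) ** mS \<Longrightarrow> Q n t"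
  shows "wp loadS s Q"
  unfolding loadS_def
  by (simp add: wp_simps cong: wp_cong) (rule assms; auto simp: mS_def regs_def mem_def)

definition link_cycle :: com where
  "link_cycle = Block [Store 10 (V 41) (Add (V 41) (Const 1)),
     Store 10 (Add (V 41) (Const 1)) (Add (V 41) (Const 2)), Store 10 (Add (V 41) (Const 2)) (V 41)]"

text \<open>One test decides the size of the orbit under \<open>mU\<close>. Known cosets come in
  full orbits, so if \<open>B\<close> was new and \<open>B ** mU\<close> is known after
  \<open>B\<close> has been entered, the two cosets coincide; otherwise all three cosets are
  new.\<close>

definition add_group :: "com \<Rightarrow> com" where
  "add_group kp = Block [Assign 41 (V 32), push, mulU, kp,
     Cond (Equal (Cell 34 (V 24)) (Const 0))
       (Block [push, mulU, kp, push, link_cycle])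
       (Store 10 (V 41) (V 41))]"

text \<open>The list of tiles is also the queue of the search: array 33 points to the tile to be
  extended next, and array 39 is completed along with it.\<close>

definition explore_body :: "com \<Rightarrow> com" where
  "explore_body kp = Block [loadS, kp,
     Cond (Equal (Cell 34 (V 24)) (Const 0))
       (Block [Store 40 (V 33) (Const 1), Store 40 (V 32) (Const 1), Store 39 (V 33) (V 32), add_group kp])
       (Store 39 (V 33) (Add (Cell 34 (V 24)) (Const (- 1)))),
     Assign 33 (Add (V 33) (Const 1))]"

definition explore :: "com \<Rightarrow> com" where
  "explore kp = Seq (Block [Assign 20 (Const 1), Assign 23 (Const 1), kp, add_group kp])
     (While (Less (V 33) (V 32)) (explore_body kp))"

locale coset_program = coset_key X key for X key +
  fixes N :: nat and kp :: com and K :: nat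
  assumes kp: "key_prog N kp key K"
begin

lemma wp_kp:
  assumes "\<And>n t. n \<le> K \<Longrightarrow> t 24 0 = key (regs s) \<Longrightarrow> (\<And>a. a < 24 \<or> 30 < a \<Longrightarrow> t a = s a) \<Longrightarrow> Q n t"
    and "s 0 0 = int N"
  shows "wp kp s Q"
proof (rule wp_mono)
  show "wp kp s (\<lambda>n t. n \<le> K \<and> t 24 0 = key (regs s) \<and> (\<forall>a. a < 24 \<or> 30 < a \<longrightarrow> t a = s a))"
    using kp assms(2) by (simp add: key_prog_def)
qed (rule assms(1), auto)

definition tabs :: "memory \<Rightarrow> bool" where
  "tabs s \<longleftrightarrow> 0 \<le> s 32 0 \<and> (\<forall>k\<in>{0..<s 32 0}. mem s k \<in> SL \<and> s 34 (key (mem s k)) = k + 1) \<and>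
     (\<forall>A\<in>SL. s 34 (key A) \<noteq> 0 \<longrightarrow> (\<exists>k\<in>{0..<s 32 0}. key (mem s k) = key A))"

definition u_table :: "memory \<Rightarrow> bool" where
  "u_table s \<longleftrightarrow> (\<forall>k\<in>{0..<s 32 0}. s 10 k \<in> {0..<s 32 0} \<and> key (mem s (s 10 k)) = key (mem s k ** mU))"

lemma tabsD:
  assumes "tabs s" "k \<in> {0..<s 32 0}"
  shows "mem s k \<in> SL" "s 34 (key (mem s k)) = k + 1" "s 34 (key (mem s k)) \<noteq> 0"
  using assms(1)[unfolded tabs_def, THEN conjunct2, THEN conjunct1, rule_format, OF assms(2)] assms(2) by auto

lemma tabs_known: "tabs s \<Longrightarrow> A \<in> SL \<Longrightarrow> s 34 (key A) \<noteq> 0 \<longleftrightarrow> (\<exists>k\<in>{0..<s 32 0}. key (mem s k) = key A)"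
proof
  assume s: "tabs s" "A \<in> SL"
  show "s 34 (key A) \<noteq> 0 \<Longrightarrow> (\<exists>k\<in>{0..<s 32 0}. key (mem s k) = key A)"
    using s(1)[unfolded tabs_def, THEN conjunct2, THEN conjunct2] s(2) by simp
  assume "\<exists>k\<in>{0..<s 32 0}. key (mem s k) = key A"
  then obtain k where k: "k \<in> {0..<s 32 0}" "key (mem s k) = key A" by blast
  then show "s 34 (key A) \<noteq> 0" using tabsD(3)[OF s(1) k(1)] by simp
qed

lemma tabs_key_inj:
  assumes "tabs s" "j \<in> {0..<s 32 0}" "k \<in> {0..<s 32 0}" "key (mem s j) = key (mem s k)"
  shows "j = k"
  using tabsD(2)[OF assms(1,2)] tabsD(2)[OF assms(1,3)] unfolding assms(4) by simp

lemma u_tableD: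
  assumes "u_table s" "k \<in> {0..<s 32 0}"
  shows "s 10 k \<in> {0..<s 32 0}" "key (mem s (s 10 k)) = key (mem s k ** mU)"
  using assms by (simp_all add: u_table_def)

text \<open>The table of \<open>mU\<close> gives one direction. Applying it twice more gives the
  other, since the cube of \<open>mU\<close> does not change keys.\<close>

lemma known_U_iff:
  assumes "tabs s" "u_table s" "A \<in> SL"
  shows "s 34 (key (A ** mU)) \<noteq> 0 \<longleftrightarrow> s 34 (key A) \<noteq> 0"
proof -
  have step: "s 34 (key (B ** mU)) \<noteq> 0" if B: "s 34 (key B) \<noteq> 0" "B \<in> SL" for B
  proof -
    obtain k where k: "k \<in> {0..<s 32 0}" "key (mem s k) = key B" using tabs_known[OF assms(1) B(2)] B(1) by blast
    have "key (mem s k ** mU) = key (B ** mU)" using k B tabsD(1)[OF assms(1) k(1)] by (simp add: key_mult_right)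
    then show ?thesis using tabsD(3)[OF assms(1) u_tableD(1)[OF assms(2) k(1)]] u_tableD(2)[OF assms(2) k(1)] by simp
  qed
  show ?thesis
  proof
    assume "s 34 (key (A ** mU)) \<noteq> 0"
    from step[OF this] have "s 34 (key ((A ** mU) ** mU)) \<noteq> 0" using assms(3) by simp
    from step[OF this] have "s 34 (key (((A ** mU) ** mU) ** mU)) \<noteq> 0" using assms(3) by simp
    then show "s 34 (key A) \<noteq> 0" using assms(3) by simp
  qed (use step assms in auto)
qed

lemma tabs_push:
  assumes "tabs s" "B \<in> SL" "s 34 (key B) = 0"
    and t: "t 32 0 = s 32 0 + 1" "t 34 = (s 34)(key B := s 32 0 + 1)" "mem t = (mem s)(s 32 0 := B)"
  shows "tabs t"
  unfolding tabs_def
proof (intro conjI ballI impI)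
  show "0 \<le> t 32 0" using assms by (simp add: tabs_def)
next
  fix k assume "k \<in> {0..<t 32 0}"
  then have "k \<in> {0..<s 32 0} \<or> k = s 32 0" using t by auto
  moreover have "key (mem s k) \<noteq> key B" if "k \<in> {0..<s 32 0}"
    using tabsD(3)[OF assms(1) that] assms(3) by metis
  ultimately show "mem t k \<in> SL" "t 34 (key (mem t k)) = k + 1"
    using tabsD[OF assms(1), of k] assms(2) t by auto
next
  fix A assume A: "A \<in> SL" "t 34 (key A) \<noteq> 0"
  show "\<exists>k\<in>{0..<t 32 0}. key (mem t k) = key A"
  proof (cases "key A = key B")
    case True
    then show ?thesis using t assms(1) by (intro bexI[of _ "s 32 0"]) (auto simp: tabs_def)
  next
    case False
    then obtain k where "k \<in> {0..<s 32 0}" "key (mem s k) = key A"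
      using A t tabs_known[OF assms(1) A(1)] by auto
    then show ?thesis using t by (intro bexI[of _ k]) auto
  qed
qed

definition added :: "memory \<Rightarrow> memory \<Rightarrow> imat \<Rightarrow> bool" where
  "added s t B \<longleftrightarrow>
     t 32 0 = s 32 0 + 1 \<and> mem t = (mem s)(s 32 0 := B) \<and> t 10 = (s 10)(s 32 0 := s 32 0) \<and> key (B ** mU) = key B \<or>
     t 32 0 = s 32 0 + 3 \<and> mem t = (mem s)(s 32 0 := B, s 32 0 + 1 := B ** mU, s 32 0 + 2 := (B ** mU) ** mU) \<and>
       t 10 = (s 10)(s 32 0 := s 32 0 + 1, s 32 0 + 1 := s 32 0 + 2, s 32 0 + 2 := s 32 0)"

lemma wp_add_group:
  assumes s: "s 0 0 = int N" "tabs s" "u_table s" "regs s = B" "B \<in> SL" "s 24 0 = key B" "s 34 (key B) = 0"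
    and Q: "\<And>n t. n \<le> 2 * K + 300 \<Longrightarrow> (\<And>a. a < 10 \<or> 10 < a \<and> a < 20 \<or> a = 33 \<or> a = 39 \<or> a = 40 \<or> 41 < a \<Longrightarrow> t a = s a) \<Longrightarrow>
      tabs t \<Longrightarrow> u_table t \<Longrightarrow> added s t B \<Longrightarrow> Q n t"
  shows "wp (add_group kp) s Q"
proof -
  define n where "n = s 32 0"
  have n0: "0 \<le> n" using s by (simp add: tabs_def n_def)
  have Q': "Q m t" if m: "m \<le> 2 * K + 300" and fr: "\<And>a. a < 10 \<or> 10 < a \<and> a < 20 \<or> a = 33 \<or> a = 39 \<or> a = 40 \<or> 41 < a \<Longrightarrow> t a = s a"
    and tt: "tabs t" and ad: "added s t B" for m t
  proof (rule Q[OF m fr tt _ ad])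
    show "u_table t" unfolding u_table_def
    proof
      fix k assume k: "k \<in> {0..<t 32 0}"
      have sk: "s 10 k \<in> {0..<s 32 0}" "key (mem s (s 10 k)) = key (mem s k ** mU)" if "k < n"
        using u_tableD[OF s(3), of k] k that by (auto simp: n_def)
      have *: "mem t (t 10 k) = mem s (s 10 k)" "mem t k = mem s k" "t 10 k = s 10 k" "s 10 k \<in> {0..<s 32 0}"
        "key (mem s (s 10 k)) = key (mem s k ** mU)" if "k < n"
        using sk[OF that] that ad by (auto simp: added_def n_def)
      show "t 10 k \<in> {0..<t 32 0} \<and> key (mem t (t 10 k)) = key (mem t k ** mU)"
      proof (cases "k < n")
        case True
        then show ?thesis using * ad by (auto simp: added_def)
      next
        case False
        then show ?thesis using k ad n0 s(5) by (auto simp: added_def n_def[symmetric])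
      qed
    qed
  qed
  define s0 where "s0 = upd 41 0 n s"
  have s0: "tabs s0" "s0 32 = s 32" "s0 0 0 = int N" "regs s0 = B" "s0 24 0 = key B" "s0 34 = s 34" "mem s0 = mem s" "s0 10 = s 10"
    using s by (simp_all add: s0_def tabs_def mem_def[abs_def] regs_def)
  show ?thesis
    unfolding add_group_def wp_Block wp_Store
    apply (simp only: aval.simps n_def[symmetric] s0_def[symmetric])
  proof (rule wp_push, rule wp_mulU, rule wp_kp)
    fix n1 :: nat and t1 and n2 :: nat and t2
    assume n1: "n1 \<le> 40" and f1: "\<And>a. a < 32 \<or> a = 33 \<or> 38 < a \<Longrightarrow> t1 a = s0 a" and t1: "t1 32 0 = s0 32 0 + 1"
      "t1 34 = (s0 34)(s0 24 0 := s0 32 0 + 1)" "mem t1 = (mem s0)(s0 32 0 := regs s0)"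
      and n2: "n2 \<le> 40" and f2: "\<And>a. a < 20 \<or> 23 < a \<and> a < 31 \<or> 31 < a \<Longrightarrow> t2 a = t1 a" and r2: "regs t2 = regs t1 ** mU"
    show "t2 0 0 = int N" using f2 f1 s0 by simp
    fix n3 :: nat and t3
    assume n3: "n3 \<le> K" and k3: "t3 24 0 = key (regs t2)" and f3: "\<And>a. a < 24 \<or> 30 < a \<Longrightarrow> t3 a = t2 a"
    have tabs1: "tabs t1" using tabs_push[of s0 B t1] s0 t1 s by simp
    have r1: "regs t1 = B" using s0 f1 by (simp add: regs_def)
    have m23: "mem t2 = mem t1" "mem t3 = mem t1" using f2 f3 by (auto simp: mem_def fun_eq_iff)
    have k3': "t3 24 0 = key (B ** mU)" using k3 r2 r1 by simp
    have t34: "t3 34 = t1 34" "t3 32 = t1 32" "t3 41 = s0 41" "t3 10 = s 10" using f2 f3 f1 s0 by auto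
    have tabs3: "tabs t3" using tabs1 m23 t34 by (simp add: tabs_def)
    have r3: "regs t3 = B ** mU" using f3 r2 r1 by (simp add: regs_def)
    have n41: "s0 41 0 = n" by (simp add: s0_def)
    \<comment> \<open>Before the group was started no coset in the orbit of \<open>B\<close> was
      known, and only the key of \<open>B\<close> has been entered since.\<close>
    have known: "t3 34 (key (B ** mU)) \<noteq> 0 \<longleftrightarrow> key (B ** mU) = key B"
    proof -
      have "s 34 (key (B ** mU)) = 0" using known_U_iff[OF s(2,3,5)] s(7) by simp
      then show ?thesis using t1 t34 s0 n0 by (auto simp: n_def)
    qed
    show "wp (Cond (Equal (Cell 34 (V 24)) (Const 0))
       (Block [push, mulU, kp, push, link_cycle])
       (Store 10 (V 41) (V 41))) t3 (\<lambda>m. Q (1 + acost (Const 0) + acost (V 32) + (n1 + (n2 + (n3 + m)))))"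
    proof (cases "key (B ** mU) = key B")
      case True
      then have "bval (Equal (Cell 34 (V 24)) (Const 0)) t3 = False" using known k3' by simp
      moreover have "Q (1 + acost (Const 0) + acost (V 32) + (n1 + (n2 + (n3 + (1 + bcost (Equal (Cell 34 (V 24)) (Const 0)) + (1 + acost (V 41) + acost (V 41)))))))
         (upd 10 (t3 41 0) (t3 41 0) t3)"
      proof (rule Q')
        show "tabs (upd 10 (t3 41 0) (t3 41 0) t3)" using tabs3 by (simp add: tabs_def mem_def[abs_def])
        show "added s (upd 10 (t3 41 0) (t3 41 0) t3) B"
          using True t34 t1 s0 n41 m23 by (simp add: added_def mem_def[abs_def] n_def)
      qed (use n1 n2 n3 f1 f2 f3 in \<open>auto simp: s0_def\<close>)
      ultimately show ?thesis by (simp only: wp_Block wp_Cond if_False wp_Store aval.simps)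
    next
      case False
      then have b: "bval (Equal (Cell 34 (V 24)) (Const 0)) t3 = True" using known k3' by simp
      have new3: "t3 34 (key (B ** mU)) = 0" using known False by simp
      have BU: "B ** mU \<in> SL" "(B ** mU) ** mU \<in> SL" using s by auto
      show ?thesis
        unfolding wp_Block wp_Cond b if_True
      proof (rule wp_push, rule wp_mulU, rule wp_kp, rule wp_push)
        fix n4 :: nat and t4 and n5 :: nat and t5
        assume n4: "n4 \<le> 40" and f4: "\<And>a. a < 32 \<or> a = 33 \<or> 38 < a \<Longrightarrow> t4 a = t3 a" and t4: "t4 32 0 = t3 32 0 + 1"
          "t4 34 = (t3 34)(t3 24 0 := t3 32 0 + 1)" "mem t4 = (mem t3)(t3 32 0 := regs t3)"
          and n5: "n5 \<le> 40" and f5: "\<And>a. a < 20 \<or> 23 < a \<and> a < 31 \<or> 31 < a \<Longrightarrow> t5 a = t4 a" and r5: "regs t5 = regs t4 ** mU"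
        show "t5 0 0 = int N" using f5 f4 f3 f2 f1 s0 by simp
        fix n6 :: nat and t6 and n7 :: nat and t7
        assume n6: "n6 \<le> K" and k6: "t6 24 0 = key (regs t5)" and f6: "\<And>a. a < 24 \<or> 30 < a \<Longrightarrow> t6 a = t5 a"
          and n7: "n7 \<le> 40" and f7: "\<And>a. a < 32 \<or> a = 33 \<or> 38 < a \<Longrightarrow> t7 a = t6 a" and t7: "t7 32 0 = t6 32 0 + 1"
          "t7 34 = (t6 34)(t6 24 0 := t6 32 0 + 1)" "mem t7 = (mem t6)(t6 32 0 := regs t6)"
        have tabs4: "tabs t4" using tabs_push[OF tabs3 BU(1) new3, of t4] t4 k3' r3 by simp
        have m56: "mem t5 = mem t4" "mem t6 = mem t4" using f5 f6 by (auto simp: mem_def fun_eq_iff)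
        have r4: "regs t4 = B ** mU" using f4 r3 by (simp add: regs_def)
        have r6: "regs t6 = (B ** mU) ** mU" using f6 r5 r4 by (simp add: regs_def)
        have k6': "t6 24 0 = key ((B ** mU) ** mU)" using k6 r5 r4 by simp
        have t6: "t6 34 = t4 34" "t6 32 = t4 32" using f5 f6 by auto
        have tabs6: "tabs t6" using tabs4 m56 t6 by (simp add: tabs_def)
        have "s 34 (key ((B ** mU) ** mU)) = 0"
          using known_U_iff[OF s(2,3) BU(1)] known_U_iff[OF s(2,3,5)] s(7) by simp
        moreover have "key ((B ** mU) ** mU) \<noteq> key (B ** mU)" using False s(5) by (simp add: key_mult_right)
        \<comment> \<open>If the square of \<open>mU\<close> fixed the coset, then so would
          \<open>mU\<close>, whose cube fixes it.\<close>
        moreover have "key ((B ** mU) ** mU) \<noteq> key B"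
        proof
          assume "key ((B ** mU) ** mU) = key B"
          then have "key (((B ** mU) ** mU) ** mU) = key (B ** mU)" using s(5) by (simp add: key_mult_right del: mult_mU_cube)
          then show False using False s(5) by simp
        qed
        ultimately have new6: "t6 34 (key ((B ** mU) ** mU)) = 0"
          using t6 t4 t34 t1 s0 k3' by simp
        have tabs7: "tabs t7" using tabs_push[OF tabs6 BU(2) new6, of t7] t7 k6' r6 by simp
        have m7: "mem t7 = (mem s)(n := B, n + 1 := B ** mU, n + 2 := (B ** mU) ** mU)"
          using t7(3) m56 t4(3) m23 t1(3) s0 r3 r1 r6 t6 t4(1) t34 t1(1) by (simp add: n_def add.commute)
        have n41': "t7 41 0 = n" using f7 f6 f5 f4 t34 n41 by simp
        have t7n: "t7 32 0 = n + 3" using t7 t6 t4 t34 t1 s0 by (simp add: n_def)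
        have t710: "t7 10 = s 10" using f7 f6 f5 f4 t34 by simp
        let ?t = "upd 10 (n + 2) n (upd 10 (n + 1) (n + 2) (upd 10 n (n + 1) t7))"
        have fr: "t7 a = s a" if "a < 10 \<or> 10 < a \<and> a < 20 \<or> a = 33 \<or> a = 39 \<or> a = 40 \<or> 41 < a" for a
        proof -
          have "t7 a = t3 a" using that f7 f6 f5 f4 by auto
          also have "\<dots> = s0 a" using that f3 f2 f1 by auto
          finally show ?thesis using that by (auto simp: s0_def)
        qed
        have fin: "Q m ?t" if "m \<le> 2 * K + 300" for m
        proof (rule Q'[OF that])
          show "tabs ?t" using tabs7 by (simp add: tabs_def mem_def[abs_def])
          have "mem ?t = mem t7" by (simp add: mem_def[abs_def])
          then show "added s ?t B"
            using t7n t710 m7 by (simp add: added_def n_def)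
        qed (use fr in auto)
        show "wp link_cycle t7
          (\<lambda>n. Q (1 + acost (Const 0) + acost (V 32) + (n1 + (n2 + (n3 + (1 + bcost (Equal (Cell 34 (V 24)) (Const 0)) +
             (n4 + (n5 + (n6 + (n7 + n))))))))))"
          using n1 n2 n3 n4 n5 n6 n7 n41' fin unfolding link_cycle_def by (simp add: wp_simps cong: wp_cong)
      qed
    qed
  qed
qed

end

context coset_program
begin

definition tiles :: "memory \<Rightarrow> imat set" where "tiles s = mem s ` {0..<s 32 0}"
definition bdry :: "memory \<Rightarrow> imat set" where "bdry s = mem s ` {k \<in> {0..<s 32 0}. s 40 k = 0}"
definition odds :: "memory \<Rightarrow> imat set" where "odds s = mem s ` {k \<in> {0..<s 32 0}. s 10 k = k}"

text \<open>An interior edge occurs twice, as the edge of a tile and of the tile beyond it, and both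
  occurrences are marked. Hence a marked tile never has an unknown coset beyond its edge, and never
  is glued to an unmarked one.\<close>

definition marked :: "memory \<Rightarrow> bool" where
  "marked s \<longleftrightarrow> (\<forall>k\<in>{0..<s 32 0}. s 40 k \<noteq> 0 \<longrightarrow> (\<exists>l\<in>{0..<s 32 0}. s 40 l \<noteq> 0 \<and>
     (mem s l = mem s k ** mS \<or> mem s l = - (mem s k ** mS))))"

definition explored :: "memory \<Rightarrow> nat \<Rightarrow> memory \<Rightarrow> bool" where
  "explored s0 i s \<longleftrightarrow> s 0 0 = int N \<and> s 33 0 = int i \<and> 0 < s 32 0 \<and> mem s 0 = mat 1 \<and>
     tabs s \<and> u_table s \<and> config (tiles s) (bdry s) (odds s) \<and> marked s \<and>
     (\<forall>k\<ge>s 32 0. s 40 k = 0) \<and> int i \<le> s 32 0 \<and>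
     (\<forall>k\<in>{0..<int i}. s 39 k \<in> {0..<s 32 0} \<and> key (mem s (s 39 k)) = key (mem s k ** mS)) \<and>
     (\<forall>a. a < 10 \<or> 10 < a \<and> a < 20 \<or> 41 < a \<longrightarrow> s a = s0 a)"

lemma mem_inj: "tabs s \<Longrightarrow> inj_on (mem s) {0..<s 32 0}"
  by (intro inj_onI) (metis tabs_key_inj)

text \<open>This bounds the search from outside: the program does not know the index, but different
  tiles lie in different cosets.\<close>

lemma number_of_tiles: "tabs s \<Longrightarrow> nat (s 32 0) \<le> card (edges G)"
proof -
  assume s: "tabs s"
  have "inj_on (\<lambda>k. coset (mem s k)) {0..<s 32 0}"
    by (intro inj_onI) (metis tabs_key_inj[OF s] coset_eq_iff tabsD(1)[OF s])
  moreover have "(\<lambda>k. coset (mem s k)) ` {0..<s 32 0} \<subseteq> edges G"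
    using tabsD(1)[OF s] by (auto simp: edges_G)
  ultimately have "card {0..<s 32 0} \<le> card (edges G)" using finite_edges by (rule card_inj_on_le)
  then show ?thesis by simp
qed

lemma added_cases:
  assumes "added s t B"
  obtains "t 32 0 = s 32 0 + 1" "mem t = (mem s)(s 32 0 := B)" "t 10 = (s 10)(s 32 0 := s 32 0)"
  | "t 32 0 = s 32 0 + 3" "mem t = (mem s)(s 32 0 := B, s 32 0 + 1 := B ** mU, s 32 0 + 2 := (B ** mU) ** mU)"
    "t 10 = (s 10)(s 32 0 := s 32 0 + 1, s 32 0 + 1 := s 32 0 + 2, s 32 0 + 2 := s 32 0)"
  using assms by (auto simp: added_def)

lemma added_old: "added s t B \<Longrightarrow> k < s 32 0 \<Longrightarrow> mem t k = mem s k \<and> t 10 k = s 10 k"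
  by (auto simp: added_def)

lemma added_new: "added s t B \<Longrightarrow> s 32 0 < t 32 0 \<and> mem t (s 32 0) = B"
  by (auto simp: added_def)

lemma added_image:
  assumes "added s t B" "0 \<le> s 32 0"
  shows "mem t ` {k \<in> {0..<s 32 0}. P k} = mem s ` {k \<in> {0..<s 32 0}. P k}"
  using added_old[OF assms(1)] by (intro image_cong) auto

lemma config_init:
  assumes "added s t (mat 1)" "s 32 0 = 0" "\<And>k. t 40 k = 0"
  shows "config (tiles t) (bdry t) (odds t)"
  using assms(1)
proof (cases rule: added_cases)
  case 1
  have eq: "{0..<1::int} = {0}" by auto
  have "tiles t = {mat 1}" "bdry t = {mat 1}" "odds t = {mat 1}"
    using 1 assms by (auto simp: tiles_def bdry_def odds_def eq)
  then show ?thesis by (simp add: config.init1)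
next
  case 2
  have eq: "{0..<3::int} = {0, 1, 2}" by auto
  have "tiles t = {mat 1, mU, mU ** mU}" "bdry t = {mat 1, mU, mU ** mU}" "odds t = {}"
    using 2 assms by (auto simp: tiles_def bdry_def odds_def eq)
  then show ?thesis by (simp add: config.init3)
qed

text \<open>One executed extension is one step of \<open>config\<close>. Array 10 records which one:
  a tile fixed by it was added alone and contributes an odd vertex. Of the new tiles the first is
  marked, so it stays out of the boundary.\<close>

lemma config_added:
  assumes s: "config (tiles s) (bdry s) (odds s)" "tabs s" "\<forall>k\<ge>s 32 0. s 40 k = 0"
    and i: "i \<in> {0..<s 32 0}" "s 40 i = 0"
    and t: "added s t (mem s i ** mS)" "t 40 = (s 40)(i := 1, s 32 0 := 1)"
  shows "config (tiles t) (bdry t) (odds t)"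
proof -
  define n where "n = s 32 0"
  have n: "0 \<le> n" using i by (simp add: n_def)
  define A where "A = mem s i"
  have A: "A \<in> bdry s" using i by (auto simp: bdry_def A_def)
  have old: "mem t ` {k \<in> {0..<n}. P k} = mem s ` {k \<in> {0..<n}. P k}" for P
    using added_image[OF t(1)] n by (simp add: n_def)
  have oldb: "mem t ` {k \<in> {0..<n}. t 40 k = 0} = bdry s - {A}"
  proof -
    have "{k \<in> {0..<n}. t 40 k = 0} = {k \<in> {0..<n}. s 40 k = 0} - {i}" using t(2) i by (auto simp: n_def)
    then have "mem t ` {k \<in> {0..<n}. t 40 k = 0} = mem s ` ({k \<in> {0..<n}. s 40 k = 0} - {i})"
      using added_old[OF t(1)] by (auto simp: n_def intro!: image_cong)
    also have "\<dots> = mem s ` {k \<in> {0..<n}. s 40 k = 0} - mem s ` {i}"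
      using mem_inj[OF s(2)] i by (intro inj_on_image_set_diff[of _ "{0..<n}"]) (auto simp: n_def)
    finally show ?thesis by (simp add: bdry_def n_def A_def)
  qed
  have oldt: "mem t ` {0..<n} = tiles s" using added_old[OF t(1)] by (auto simp: tiles_def n_def intro!: image_cong)
  have oldo: "mem t ` {k \<in> {0..<n}. t 10 k = k} = odds s"
  proof -
    have "{k \<in> {0..<n}. t 10 k = k} = {k \<in> {0..<n}. s 10 k = k}" using added_old[OF t(1)] by (auto simp: n_def)
    then show ?thesis using old[of "\<lambda>k. s 10 k = k"] by (simp add: odds_def n_def)
  qed
  have t40: "t 40 n = 1" "t 40 (n + 1) = 0" "t 40 (n + 2) = 0"
    using t(2) s(3) i by (auto simp: n_def)
  show ?thesis
    using t(1)
  proof (cases rule: added_cases)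
    case 1
    have R: "{0..<t 32 0} = insert n {0..<n}" using 1 n by (auto simp: n_def)
    have F: "{k \<in> {0..<t 32 0}. t 40 k = 0} = {k \<in> {0..<n}. t 40 k = 0}" unfolding R using t40 by auto
    have Q: "{k \<in> {0..<t 32 0}. t 10 k = k} = insert n {k \<in> {0..<n}. t 10 k = k}" unfolding R using 1 by (auto simp: n_def)
    have m: "mem t n = A ** mS" using 1 by (simp add: n_def A_def)
    have "tiles t = insert (A ** mS) (tiles s)" "bdry t = bdry s - {A}" "odds t = insert (A ** mS) (odds s)"
      unfolding tiles_def[of t] bdry_def[of t] odds_def[of t] F Q unfolding R image_insert oldb oldt oldo m by simp_all
    then show ?thesis using config.step1[OF s(1) A] by simp
  next
    case 2
    have R: "{0..<t 32 0} = insert n (insert (n + 1) (insert (n + 2) {0..<n}))" using 2 n by (auto simp: n_def)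
    have F: "{k \<in> {0..<t 32 0}. t 40 k = 0} = insert (n + 1) (insert (n + 2) {k \<in> {0..<n}. t 40 k = 0})"
      unfolding R using t40 by auto
    have Q: "{k \<in> {0..<t 32 0}. t 10 k = k} = {k \<in> {0..<n}. t 10 k = k}" unfolding R using 2 by (auto simp: n_def)
    have m: "mem t n = A ** mS" "mem t (n + 1) = (A ** mS) ** mU" "mem t (n + 2) = ((A ** mS) ** mU) ** mU"
      using 2 by (simp_all add: n_def A_def)
    have "tiles t = tiles s \<union> {A ** mS, (A ** mS) ** mU, ((A ** mS) ** mU) ** mU}"
      "bdry t = bdry s - {A} \<union> {(A ** mS) ** mU, ((A ** mS) ** mU) ** mU}" "odds t = odds s"
      unfolding tiles_def[of t] bdry_def[of t] odds_def[of t] F Q unfolding R image_insert oldb oldt oldo m by auto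
    then show ?thesis using config.step3[OF s(1) A] by simp
  qed
qed

lemma marked_added:
  assumes s: "marked s" "tabs s"
    and i: "i \<in> {0..<s 32 0}"
    and t: "added s t (mem s i ** mS)" "t 40 = (s 40)(i := 1, s 32 0 := 1)"
    and z: "\<forall>k\<ge>s 32 0. s 40 k = 0"
  shows "marked t"
  unfolding marked_def
proof (intro ballI impI)
  fix k assume k: "k \<in> {0..<t 32 0}" "t 40 k \<noteq> 0"
  note nw = added_new[OF t(1)] and od = added_old[OF t(1)]
  have "k = s 32 0 \<or> k = i \<or> k \<in> {0..<s 32 0} \<and> s 40 k \<noteq> 0"
    using k t(2) z by (cases "k < s 32 0") (auto split: if_splits)
  then consider "k = s 32 0" | "k = i" | "k \<in> {0..<s 32 0}" "s 40 k \<noteq> 0" by blast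
  then show "\<exists>l\<in>{0..<t 32 0}. t 40 l \<noteq> 0 \<and> (mem t l = mem t k ** mS \<or> mem t l = - (mem t k ** mS))"
  proof cases
    case 1
    have "mem t k ** mS = - mem t i" using 1 nw od[of i] i by simp
    then show ?thesis using i nw t(2) by (intro bexI[of _ i]) auto
  next
    case 2
    then show ?thesis using i nw od[of i] t(2) by (intro bexI[of _ "s 32 0"]) auto
  next
    case 3
    then obtain l where l: "l \<in> {0..<s 32 0}" "s 40 l \<noteq> 0" "mem s l = mem s k ** mS \<or> mem s l = - (mem s k ** mS)"
      using s(1) unfolding marked_def by blast
    then show ?thesis using 3 od[of l] od[of k] nw t(2) by (intro bexI[of _ l]) auto
  qed
qed

lemma explored_start:
  assumes s: "s 0 0 = int N" "\<And>a j. a \<noteq> 0 \<Longrightarrow> s a j = 0"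
  shows "wp (Block [Assign 20 (Const 1), Assign 23 (Const 1), kp, add_group kp]) s
    (\<lambda>n t. n \<le> 3 * K + 400 \<and> explored s 0 t)"
proof -
  define s1 where "s1 = upd 23 0 1 (upd 20 0 1 s)"
  have r1: "regs s1 = mat 1" using s by (simp add: s1_def regs_def mat2_one)
  show ?thesis
    unfolding wp_Block wp_Store
    apply (simp only: aval.simps s1_def[symmetric])
  proof (rule wp_kp, rule wp_add_group)
    show "s1 0 0 = int N" using s by (simp add: s1_def)
    fix n t assume n: "n \<le> K" and k: "t 24 0 = key (regs s1)" and f: "\<And>a. a < 24 \<or> 30 < a \<Longrightarrow> t a = s1 a"
    show "t 0 0 = int N" using f s by (simp add: s1_def)
    have t0: "t 32 0 = 0" "t 34 = s 34" using f s by (simp_all add: s1_def)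
    show "tabs t" "u_table t" using t0 s(2) by (auto simp: tabs_def u_table_def)
    show "regs t = mat 1" using f r1 by (simp add: regs_def)
    show "mat 1 \<in> SL" by simp
    show "t 24 0 = key (mat 1)" using k r1 by simp
    show "t 34 (key (mat 1)) = 0" using t0 s(2) by simp
    fix m t'
    assume m: "m \<le> 2 * K + 300" and f': "\<And>a. a < 10 \<or> 10 < a \<and> a < 20 \<or> a = 33 \<or> a = 39 \<or> a = 40 \<or> 41 < a \<Longrightarrow> t' a = t a"
      and tt: "tabs t'" "u_table t'" and ad: "added t t' (mat 1)"
    have z40: "t' 40 j = 0" for j using f' f s by (simp add: s1_def)
    have "explored s 0 t'"
      unfolding explored_def
    proof (intro conjI)
      show "t' 0 0 = int N" "t' 33 0 = int 0" using f' f s by (simp_all add: s1_def)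
      show "0 < t' 32 0" "mem t' 0 = mat 1" using added_new[OF ad] t0 by simp_all
      show "config (tiles t') (bdry t') (odds t')" by (rule config_init[OF ad t0(1) z40])
      show "marked t'" using z40 by (simp add: marked_def)
      show "\<forall>a. a < 10 \<or> 10 < a \<and> a < 20 \<or> 41 < a \<longrightarrow> t' a = s a" using f' f by (auto simp: s1_def)
    qed (use tt z40 added_new[OF ad] t0 in auto)
    then show "1 + acost (Const 0) + acost (Const 1) + (1 + acost (Const 0) + acost (Const 1) + (n + m)) \<le> 3 * K + 400 \<and> explored s 0 t'"
      using n m by simp
  qed
qed

lemma explore_step:
  assumes e: "explored s0 i s" and i: "int i < s 32 0"
  shows "wp (explore_body kp) s (\<lambda>n t. n \<le> 3 * K + 500 \<and> explored s0 (Suc i) t)"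
  unfolding explore_body_def wp_Block
proof (rule wp_loadS, rule wp_kp)
  have e1: "s 0 0 = int N" "s 33 0 = int i" "0 < s 32 0" "mem s 0 = mat 1" "tabs s" "u_table s"
    "config (tiles s) (bdry s) (odds s)" "marked s" "\<forall>k\<ge>s 32 0. s 40 k = 0"
    and S: "\<And>k. k \<in> {0..<int i} \<Longrightarrow> s 39 k \<in> {0..<s 32 0} \<and> key (mem s (s 39 k)) = key (mem s k ** mS)"
    and fr: "\<And>a. a < 10 \<or> 10 < a \<and> a < 20 \<or> 41 < a \<Longrightarrow> s a = s0 a"
    using e unfolding explored_def by blast+
  have iin: "int i \<in> {0..<s 32 0}" using i by simp
  define B where "B = mem s (int i) ** mS"
  have B: "B \<in> SL" using tabsD(1)[OF e1(5) iin] by (simp add: B_def)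
  fix n1 :: nat and t1
  assume n1: "n1 \<le> 40" and f1: "\<And>a. a < 20 \<or> 23 < a \<Longrightarrow> t1 a = s a" and r1: "regs t1 = mem s (s 33 0) ** mS"
  show "t1 0 0 = int N" using f1 e1 by simp
  fix n2 :: nat and t2
  assume n2: "n2 \<le> K" and k2: "t2 24 0 = key (regs t1)" and f2: "\<And>a. a < 24 \<or> 30 < a \<Longrightarrow> t2 a = t1 a"
  have f: "t2 a = s a" if "a < 20 \<or> 30 < a" for a using f1 f2 that by auto
  have r2: "regs t2 = B" using f2 r1 e1(2) by (simp add: regs_def B_def)
  have k2': "t2 24 0 = key B" using k2 r1 e1(2) by (simp add: B_def)
  have same: "tabs t2 = tabs s" "u_table t2 = u_table s" "mem t2 = mem s"
    using f by (simp_all add: tabs_def u_table_def mem_def[abs_def])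
  let ?D = "Block [Store 40 (V 33) (Const 1), Store 40 (V 32) (Const 1), Store 39 (V 33) (V 32), add_group kp]"
  let ?C = "Cond (Equal (Cell 34 (V 24)) (Const 0)) ?D (Store 39 (V 33) (Add (Cell 34 (V 24)) (Const (- 1))))"
  have main: "wp ?C t2 (\<lambda>n t. n \<le> 2 * K + 400 \<and> explored s0 (Suc i) (upd 33 0 (t 33 0 + 1) t))"
  proof (cases "s 34 (key B) = 0")
    case False
    then have b: "\<not> bval (Equal (Cell 34 (V 24)) (Const 0)) t2" using f k2' by simp
    define j where "j = s 34 (key B) - 1"
    obtain l where l: "l \<in> {0..<s 32 0}" "key (mem s l) = key B" using tabs_known[OF e1(5) B] False by blast
    have jl: "j = l" using tabsD(2)[OF e1(5) l(1)] l(2) by (simp add: j_def)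
    let ?t = "upd 33 0 (int i + 1) (upd 39 (int i) j t2)"
    have "explored s0 (Suc i) ?t"
      unfolding explored_def
    proof (intro conjI)
      show "?t 0 0 = int N" "?t 33 0 = int (Suc i)" "0 < ?t 32 0" "mem ?t 0 = mat 1"
        using f e1 by (simp_all add: mem_def)
      have m: "mem ?t = mem s" using same(3) by (simp add: mem_def[abs_def])
      show "tabs ?t" "u_table ?t" using e1 f by (simp_all add: tabs_def u_table_def mem_def[abs_def])
      show "config (tiles ?t) (bdry ?t) (odds ?t)" using e1(7) f m by (simp add: tiles_def bdry_def odds_def)
      show "marked ?t" using e1(8) f m by (simp add: marked_def)
      show "\<forall>k\<ge>?t 32 0. ?t 40 k = 0" using e1(9) f by simp
      show "int (Suc i) \<le> ?t 32 0" using i f by simp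
      show "\<forall>k\<in>{0..<int (Suc i)}. ?t 39 k \<in> {0..<?t 32 0} \<and> key (mem ?t (?t 39 k)) = key (mem ?t k ** mS)"
      proof
        fix k assume "k \<in> {0..<int (Suc i)}"
        then have "k \<in> {0..<int i} \<or> k = int i" by auto
        then show "?t 39 k \<in> {0..<?t 32 0} \<and> key (mem ?t (?t 39 k)) = key (mem ?t k ** mS)"
          using S[of k] l jl f unfolding m by (auto simp: B_def)
      qed
      show "\<forall>a. a < 10 \<or> 10 < a \<and> a < 20 \<or> 41 < a \<longrightarrow> ?t a = s0 a" using f fr by auto
    qed
    then show ?thesis using b k2' f e1(2) by (simp add: wp_Cond wp_Store j_def)
  next
    case True
    then have b: "bval (Equal (Cell 34 (V 24)) (Const 0)) t2" using f k2' by simp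
    \<comment> \<open>A marked tile has the tile beyond its edge, equal to \<open>B\<close> up to
      sign, in the list; the key of \<open>B\<close> would be known.\<close>
    have unmarked: "s 40 (int i) = 0"
    proof (rule ccontr)
      assume "s 40 (int i) \<noteq> 0"
      then obtain l where l: "l \<in> {0..<s 32 0}" "mem s l = B \<or> mem s l = - B"
        using e1(8) iin unfolding marked_def B_def by blast
      then have "key (mem s l) = key B" using B by auto
      then show False using True tabsD(3)[OF e1(5) l(1)] by simp
    qed
    define t3 where "t3 = upd 39 (int i) (s 32 0) (upd 40 (s 32 0) 1 (upd 40 (int i) 1 t2))"
    have f3: "t3 a = s a" if "a < 20 \<or> 30 < a \<and> a \<noteq> 39 \<and> a \<noteq> 40" for a using f that by (auto simp: t3_def)
    have same3: "tabs t3 = tabs s" "u_table t3 = u_table s" "mem t3 = mem s"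
      using f3 by (simp_all add: tabs_def u_table_def mem_def[abs_def])
    have "wp (add_group kp) t3 (\<lambda>n t. n \<le> 2 * K + 300 \<and> explored s0 (Suc i) (upd 33 0 (t 33 0 + 1) t))"
    proof (rule wp_add_group)
      show "t3 0 0 = int N" "tabs t3" "u_table t3" using f3 e1 same3 by simp_all
      show "regs t3 = B" using r2 by (simp add: t3_def regs_def)
      show "B \<in> SL" by (rule B)
      show "t3 24 0 = key B" using k2' by (simp add: t3_def)
      show "t3 34 (key B) = 0" using True f3 by simp
      fix n t4
      assume n: "n \<le> 2 * K + 300" and f4: "\<And>a. a < 10 \<or> 10 < a \<and> a < 20 \<or> a = 33 \<or> a = 39 \<or> a = 40 \<or> 41 < a \<Longrightarrow> t4 a = t3 a"
        and t4: "tabs t4" "u_table t4" and ad3: "added t3 t4 B"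
      have ad: "added s t4 (mem s (int i) ** mS)" using ad3 same3(3) f3 by (simp add: added_def B_def)
      have t40: "t4 40 = (s 40)(int i := 1, s 32 0 := 1)" using f4 f by (simp add: t3_def)
      have t33: "t4 33 0 = int i" using f4 f3 e1(2) by simp
      note nw = added_new[OF ad] and od = added_old[OF ad]
      let ?t = "upd 33 0 (int i + 1) t4"
      have m: "mem ?t = mem t4" by (simp add: mem_def[abs_def])
      have "explored s0 (Suc i) ?t"
        unfolding explored_def
      proof (intro conjI)
        show "?t 0 0 = int N" "?t 33 0 = int (Suc i)" using f4 f3 e1(1) by simp_all
        show "0 < ?t 32 0" "int (Suc i) \<le> ?t 32 0" using nw e1(3) i by simp_all
        show "mem ?t 0 = mat 1" using od[of 0] e1(3,4) by (simp add: m)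
        show "tabs ?t" "u_table ?t" using t4 m by (simp_all add: tabs_def u_table_def)
        have "config (tiles t4) (bdry t4) (odds t4)" by (rule config_added[OF e1(7,5,9) iin unmarked ad t40])
        then show "config (tiles ?t) (bdry ?t) (odds ?t)" using m by (simp add: tiles_def bdry_def odds_def)
        have "marked t4" by (rule marked_added[OF e1(8,5) iin ad t40 e1(9)])
        then show "marked ?t" using m by (simp add: marked_def)
        show "\<forall>k\<ge>?t 32 0. ?t 40 k = 0" using e1(9) nw i by (auto simp: t40)
        show "\<forall>k\<in>{0..<int (Suc i)}. ?t 39 k \<in> {0..<?t 32 0} \<and> key (mem ?t (?t 39 k)) = key (mem ?t k ** mS)"
        proof
          fix k assume "k \<in> {0..<int (Suc i)}"
          then consider "k \<in> {0..<int i}" | "k = int i" by fastforce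
          then show "?t 39 k \<in> {0..<?t 32 0} \<and> key (mem ?t (?t 39 k)) = key (mem ?t k ** mS)"
          proof cases
            case 1
            then have "?t 39 k = s 39 k" using f4 f by (simp add: t3_def)
            then show ?thesis using S[OF 1] od[of "s 39 k"] od[of k] nw 1 i by (auto simp: m)
          next
            case 2
            then have "?t 39 k = s 32 0" using f4 by (simp add: t3_def)
            then show ?thesis using nw od[of k] 2 i e1(3) by (simp add: m)
          qed
        qed
        show "\<forall>a. a < 10 \<or> 10 < a \<and> a < 20 \<or> 41 < a \<longrightarrow> ?t a = s0 a"
        proof (intro allI impI)
          fix a :: nat assume a: "a < 10 \<or> 10 < a \<and> a < 20 \<or> 41 < a"
          have "t4 a = t3 a" using a by (intro f4) auto
          moreover have "t3 a = s a" using a by (intro f3) auto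
          ultimately show "?t a = s0 a" using fr[OF a] a by auto
        qed
      qed
      then show "n \<le> 2 * K + 300 \<and> explored s0 (Suc i) (upd 33 0 (t4 33 0 + 1) t4)" using n t33 by simp
    qed
    then have "wp (add_group kp) t3 (\<lambda>n t. n \<le> c + 2 * K \<and> explored s0 (Suc i) (upd 33 0 (t 33 0 + 1) t))" if "300 \<le> c" for c
      by (rule wp_mono) (use that in auto)
    moreover have "t2 33 0 = int i" "t2 32 0 = s 32 0" using f e1(2) by simp_all
    ultimately show ?thesis unfolding wp_Cond using b
      by (simp add: wp_Seq wp_Store t3_def[symmetric] add.assoc[symmetric] flip: add_Suc)
  qed
  show "wp ?C t2 (\<lambda>m s'. wp (Assign 33 (Add (V 33) (Const 1))) s' (\<lambda>n t. n1 + (n2 + (m + n)) \<le> 3 * K + 500 \<and> explored s0 (Suc i) t))"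
    using main by (rule wp_mono) (use n1 n2 in \<open>simp add: wp_Store\<close>)
qed

definition found :: "memory \<Rightarrow> bool" where
  "found t \<longleftrightarrow> 0 < t 32 0 \<and> t 32 0 = int (card (edges G)) \<and> mem t 0 = mat 1 \<and>
     tabs t \<and> u_table t \<and> config (tiles t) (bdry t) (odds t) \<and> marked t \<and>
     (\<forall>A\<in>SL. \<exists>k\<in>{0..<t 32 0}. key (mem t k) = key A) \<and>
     (\<forall>k\<in>{0..<t 32 0}. t 39 k \<in> {0..<t 32 0} \<and> key (mem t (t 39 k)) = key (mem t k ** mS))"

lemma found_bij:
  assumes "tabs t" "\<forall>A\<in>SL. \<exists>k\<in>{0..<t 32 0}. key (mem t k) = key A"
  shows "bij_betw (\<lambda>k. coset (mem t k)) {0..<t 32 0} (edges G)"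
  unfolding bij_betw_def
proof
  show "inj_on (\<lambda>k. coset (mem t k)) {0..<t 32 0}"
    by (intro inj_onI) (metis tabs_key_inj[OF assms(1)] coset_eq_iff tabsD(1)[OF assms(1)])
  show "(\<lambda>k. coset (mem t k)) ` {0..<t 32 0} = edges G"
  proof (intro equalityI subsetI)
    fix x assume "x \<in> edges G"
    then obtain A where A: "A \<in> SL" "x = coset A" by (auto simp: edges_G)
    then obtain k where k: "k \<in> {0..<t 32 0}" "key (mem t k) = key A" using assms(2) by blast
    then have "x = coset (mem t k)" using A tabsD(1)[OF assms(1) k(1)] by (simp add: coset_eq_iff)
    then show "x \<in> (\<lambda>k. coset (mem t k)) ` {0..<t 32 0}" using k by blast
  qed (use tabsD(1)[OF assms(1)] in \<open>auto simp: edges_G\<close>)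
qed

lemma wp_explore:
  assumes s: "s 0 0 = int N" "\<And>a j. a \<noteq> 0 \<Longrightarrow> s a j = 0"
  shows "wp (explore kp) s (\<lambda>n t. n \<le> card (edges G) * (10 * K + 2000) \<and> found t \<and>
    (\<forall>a. a < 10 \<or> 10 < a \<and> a < 20 \<or> 41 < a \<longrightarrow> t a = s a))"
proof -
  let ?W = "While (Less (V 33) (V 32)) (explore_body kp)"
  have loop: "wp ?W t (\<lambda>n t'. \<exists>m\<ge>0. explored s m t' \<and> \<not> bval (Less (V 33) (V 32)) t' \<and>
      n \<le> (m - 0) * (1 + bcost (Less (V 33) (V 32)) + (3 * K + 500)) + (1 + bcost (Less (V 33) (V 32))))"
    if t: "explored s 0 t" for t
  proof (rule wp_While[where I = "explored s" and B = "card (edges G)", OF t])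
    fix m t assume e: "explored s m t" and b: "bval (Less (V 33) (V 32)) t"
    have "t 33 0 = int m" using e unfolding explored_def by blast
    then have lt: "int m < t 32 0" using b by simp
    show "wp (explore_body kp) t (\<lambda>n t. n \<le> 3 * K + 500 \<and> explored s (Suc m) t)"
      by (rule explore_step[OF e lt])
    have "tabs t" using e unfolding explored_def by blast
    from number_of_tiles[OF this] show "m < card (edges G)" using lt by linarith
  qed
  have final: "found t \<and> m \<le> card (edges G) \<and> 1 \<le> card (edges G) \<and> (\<forall>a. a < 10 \<or> 10 < a \<and> a < 20 \<or> 41 < a \<longrightarrow> t a = s a)"
    if e: "explored s m t" and b: "\<not> bval (Less (V 33) (V 32)) t" for m t
  proof -
    have e1: "t 33 0 = int m" "0 < t 32 0" "mem t 0 = mat 1" "tabs t" "u_table t"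
      "config (tiles t) (bdry t) (odds t)" "marked t" "int m \<le> t 32 0"
      and S: "\<And>k. k \<in> {0..<int m} \<Longrightarrow> t 39 k \<in> {0..<t 32 0} \<and> key (mem t (t 39 k)) = key (mem t k ** mS)"
      and fr: "\<forall>a. a < 10 \<or> 10 < a \<and> a < 20 \<or> 41 < a \<longrightarrow> t a = s a"
      using e unfolding explored_def by blast+
    have m: "int m = t 32 0" using e1 b by simp
    \<comment> \<open>At exit the cosets found include that of the identity and are closed under
      \<open>mS\<close> and \<open>mU\<close>, since every tile has been treated; by
      \<open>SL_induct\<close> these are all cosets.\<close>
    have all: "\<exists>k\<in>{0..<t 32 0}. key (mem t k) = key A" if "A \<in> SL" for A
    proof (rule SL_induct[where P = "\<lambda>A. \<exists>k\<in>{0..<t 32 0}. key (mem t k) = key A", OF that])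
      show "\<exists>k\<in>{0..<t 32 0}. key (mem t k) = key (mat 1)" using e1 by (intro bexI[of _ 0]) auto
    next
      fix A assume A: "A \<in> SL" "\<exists>k\<in>{0..<t 32 0}. key (mem t k) = key A"
      then obtain k where k: "k \<in> {0..<t 32 0}" "key (mem t k) = key A" by blast
      show "\<exists>k\<in>{0..<t 32 0}. key (mem t k) = key (- A)" using A by simp
      have kSL: "mem t k \<in> SL" by (rule tabsD(1)[OF e1(4) k(1)])
      have "key (mem t (t 39 k)) = key (A ** mS)" using S[of k] k m A kSL by (simp add: key_mult_right)
      then show "\<exists>k\<in>{0..<t 32 0}. key (mem t k) = key (A ** mS)" using S[of k] k m by auto
      have "key (mem t (t 10 k)) = key (A ** mU)" using u_tableD[OF e1(5) k(1)] k A kSL by (simp add: key_mult_right)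
      then show "\<exists>k\<in>{0..<t 32 0}. key (mem t k) = key (A ** mU)" using u_tableD[OF e1(5) k(1)] by auto
    qed
    have "card {0..<t 32 0} = card (edges G)" using bij_betw_same_card[OF found_bij[OF e1(4)]] all by blast
    then have n: "t 32 0 = int (card (edges G))" using e1(2) by simp
    have "found t" unfolding found_def using e1 S all n m by auto
    then show ?thesis using fr n m e1(2) by simp
  qed
  have "wp (Block [Assign 20 (Const 1), Assign 23 (Const 1), kp, add_group kp]) s
    (\<lambda>n t. wp ?W t (\<lambda>n' t'. n + n' \<le> card (edges G) * (10 * K + 2000) \<and> found t' \<and>
      (\<forall>a. a < 10 \<or> 10 < a \<and> a < 20 \<or> 41 < a \<longrightarrow> t' a = s a)))"
  proof (rule wp_mono[OF explored_start[where s = s, OF s]])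
    fix n t assume "n \<le> 3 * K + 400 \<and> explored s 0 t"
    then have n: "n \<le> 3 * K + 400" and t: "explored s 0 t" by auto
    show "wp ?W t (\<lambda>n' t'. n + n' \<le> card (edges G) * (10 * K + 2000) \<and> found t' \<and>
      (\<forall>a. a < 10 \<or> 10 < a \<and> a < 20 \<or> 41 < a \<longrightarrow> t' a = s a))"
    proof (rule wp_mono[OF loop[OF t]])
      fix n' t'
      assume "\<exists>m\<ge>0. explored s m t' \<and> \<not> bval (Less (V 33) (V 32)) t' \<and>
        n' \<le> (m - 0) * (1 + bcost (Less (V 33) (V 32)) + (3 * K + 500)) + (1 + bcost (Less (V 33) (V 32)))"
      then obtain m where m: "explored s m t'" "\<not> bval (Less (V 33) (V 32)) t'"
        and "n' \<le> (m - 0) * (1 + bcost (Less (V 33) (V 32)) + (3 * K + 500)) + (1 + bcost (Less (V 33) (V 32)))"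
        by blast
      then have n': "n' \<le> m * (3 * K + 506) + 6" by (simp add: algebra_simps)
      note f = final[OF m]
      \<comment> \<open>The cost of the start and of the last test is charged to one coset, the
        index being at least 1.\<close>
      have "n + n' \<le> m * (3 * K + 506) + 1 * (3 * K + 406)" using n n' by simp
      also have "\<dots> \<le> card (edges G) * (3 * K + 506) + card (edges G) * (3 * K + 406)"
        using f by (intro add_mono mult_right_mono) auto
      also have "\<dots> = card (edges G) * (6 * K + 912)" by (simp add: algebra_simps)
      also have "\<dots> \<le> card (edges G) * (10 * K + 2000)" by (intro mult_left_mono) auto
      finally show "n + n' \<le> card (edges G) * (10 * K + 2000) \<and> found t' \<and>
        (\<forall>a. a < 10 \<or> 10 < a \<and> a < 20 \<or> 41 < a \<longrightarrow> t' a = s a)" using f by blast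
    qed
  qed
  then have "wp (Seq (Block [Assign 20 (Const 1), Assign 23 (Const 1), kp, add_group kp]) ?W) s
    (\<lambda>n t. n \<le> card (edges G) * (10 * K + 2000) \<and> found t \<and> (\<forall>a. a < 10 \<or> 10 < a \<and> a < 20 \<or> 41 < a \<longrightarrow> t a = s a))"
    by (simp only: wp_Seq)
  then show ?thesis by (simp only: explore_def)
qed

end

section \<open>Numbering the vertices\<close>

text \<open>An orbit consists of x, f x and f (f x). So x takes the label of an earlier member of
  its orbit if there is one, and otherwise a fresh label from cell \<open>c\<close> of array 1,
  which ends up holding the number of orbits. For an involution f the second test merely meets x
  itself.\<close>

definition labels_body :: "nat \<Rightarrow> nat \<Rightarrow> int \<Rightarrow> com" where
  "labels_body f l c = Block [Assign 43 (Cell f (V 42)), Assign 44 (Cell f (V 43)),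
     Cond (Less (V 43) (V 42)) (Store l (V 42) (Cell l (V 43)))
       (Cond (Less (V 44) (V 42)) (Store l (V 42) (Cell l (V 44)))
         (Block [Store l (V 42) (Cell 1 (Const c)), Store 1 (Const c) (Add (Cell 1 (Const c)) (Const 1))])),
     Assign 42 (Add (V 42) (Const 1))]"

definition labels :: "nat \<Rightarrow> nat \<Rightarrow> int \<Rightarrow> com" where
  "labels f l c = Seq (Assign 42 (Const 0)) (While (Less (V 42) (V 32)) (labels_body f l c))"

definition labelling :: "(int \<Rightarrow> 'a) \<Rightarrow> int \<Rightarrow> (int \<Rightarrow> int) \<Rightarrow> int \<Rightarrow> bool" where
  "labelling g k l c \<longleftrightarrow> 0 \<le> c \<and> (\<forall>x\<in>{0..<k}. l x \<in> {0..<c}) \<and> (\<forall>v\<in>{0..<c}. \<exists>x\<in>{0..<k}. l x = v) \<and>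
     (\<forall>x\<in>{0..<k}. \<forall>y\<in>{0..<k}. l x = l y \<longleftrightarrow> g x = g y)"

lemma labelling_old:
  assumes "labelling g k l c" "0 \<le> k" "j \<in> {0..<k}" "g j = g k"
  shows "labelling g (k + 1) (l(k := l j)) c"
  unfolding labelling_def
proof (intro conjI ballI)
  note h = assms(1)[unfolded labelling_def]
  have lc: "l x \<in> {0..<c}" if "x \<in> {0..<k}" for x using h that by blast
  show "0 \<le> c" using h by blast
  show "(l(k := l j)) x \<in> {0..<c}" if "x \<in> {0..<k + 1}" for x
    using that lc[of x] lc[OF assms(3)] by (cases "x = k") auto
  show "\<exists>x\<in>{0..<k + 1}. (l(k := l j)) x = v" if "v \<in> {0..<c}" for v
  proof -
    obtain x where "x \<in> {0..<k}" "l x = v" using h \<open>v \<in> {0..<c}\<close> by blast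
    then show ?thesis by (intro bexI[of _ x]) auto
  qed
  have e: "l x = l y \<longleftrightarrow> g x = g y" if "x \<in> {0..<k}" "y \<in> {0..<k}" for x y using h that by blast
  show "(l(k := l j)) x = (l(k := l j)) y \<longleftrightarrow> g x = g y" if "x \<in> {0..<k + 1}" "y \<in> {0..<k + 1}" for x y
  proof -
    have "x = k \<or> x \<in> {0..<k}" "y = k \<or> y \<in> {0..<k}" using that by auto
    then show ?thesis using e[of j y] e[of x j] e[of x y] assms(3,4) by (cases "x = k"; cases "y = k") auto
  qed
qed

lemma labelling_new:
  assumes "labelling g k l c" "0 \<le> k" "\<And>j. j \<in> {0..<k} \<Longrightarrow> g j \<noteq> g k"
  shows "labelling g (k + 1) (l(k := c)) (c + 1)"
  unfolding labelling_def
proof (intro conjI ballI)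
  have r: "{0..<k + 1} = insert k {0..<k}" using assms(2) by auto
  note h = assms(1)[unfolded labelling_def]
  have c: "0 \<le> c" and lc: "l x \<in> {0..<c}" if "x \<in> {0..<k}" for x using h that by blast+
  show c0: "0 \<le> c + 1" using h by simp
  show "(l(k := c)) x \<in> {0..<c + 1}" if "x \<in> {0..<k + 1}" for x
  proof (cases "x = k")
    case False
    then show ?thesis using lc[of x] that by auto
  qed (use h in simp)
  show "\<exists>x\<in>{0..<k + 1}. (l(k := c)) x = v" if "v \<in> {0..<c + 1}" for v
  proof (cases "v = c")
    case True then show ?thesis using assms(2) by (intro bexI[of _ k]) auto
  next
    case False
    then have "v \<in> {0..<c}" using that by auto
    then obtain x where "x \<in> {0..<k}" "l x = v" using h by blast
    then show ?thesis by (intro bexI[of _ x]) auto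
  qed
  show "(l(k := c)) x = (l(k := c)) y \<longleftrightarrow> g x = g y" if "x \<in> {0..<k + 1}" "y \<in> {0..<k + 1}" for x y
  proof -
    have e: "l x = l y \<longleftrightarrow> g x = g y" if "x \<in> {0..<k}" "y \<in> {0..<k}" for x y using h that by blast
    have lne: "l x \<noteq> c" if "x \<in> {0..<k}" for x using lc[OF that] by auto
    have "x = k \<or> x \<in> {0..<k}" "y = k \<or> y \<in> {0..<k}" using that r by auto
    then show ?thesis using e[of x y] assms(3)[of x] assms(3)[of y] lne[of x] lne[of y]
      by (cases "x = k"; cases "y = k") (auto dest: sym)
  qed
qed

lemma wp_labels:
  assumes n: "0 \<le> s 32 0" "s 32 0 = n"
    and z: "s 1 c = 0"
    and f: "\<And>x. x \<in> {0..<n} \<Longrightarrow> s f x \<in> {0..<n}"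
    and g: "\<And>x y. x \<in> {0..<n} \<Longrightarrow> y \<in> {0..<n} \<Longrightarrow> g x = g y \<longleftrightarrow> y = x \<or> y = s f x \<or> y = s f (s f x)"
    and arr: "f \<notin> {1, l, 42, 43, 44}" "l \<notin> {1, 32, 42, 43, 44}"
  shows "wp (labels f l c) s (\<lambda>m t. m \<le> nat n * 100 + 20 \<and> labelling g n (t l) (t 1 c) \<and>
     (\<forall>j. j \<noteq> c \<longrightarrow> t 1 j = s 1 j) \<and> (\<forall>a. a \<notin> {1, l, 42, 43, 44} \<longrightarrow> t a = s a))"
proof -
  define I where "I = (\<lambda>k t. t 42 0 = int k \<and> int k \<le> n \<and> labelling g (int k) (t l) (t 1 c) \<and>
     (\<forall>j. j \<noteq> c \<longrightarrow> t 1 j = s 1 j) \<and> (\<forall>a. a \<notin> {1, l, 42, 43, 44} \<longrightarrow> t a = s a))"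
  let ?s = "upd 42 0 0 s"
  have arr': "Suc 0 \<noteq> l" "Suc 0 \<noteq> f" using arr by auto
  have I0: "I 0 ?s" using n z arr by (auto simp: I_def labelling_def)
  have "wp (While (Less (V 42) (V 32)) (labels_body f l c)) ?s (\<lambda>m t. \<exists>k\<ge>0. I k t \<and> \<not> bval (Less (V 42) (V 32)) t \<and>
      m \<le> (k - 0) * (1 + bcost (Less (V 42) (V 32)) + 80) + (1 + bcost (Less (V 42) (V 32))))"
  proof (rule wp_While[where I = I and B = "nat n", OF I0])
    fix k t assume I: "I k t" and b: "bval (Less (V 42) (V 32)) t"
    have t: "t 42 0 = int k" "labelling g (int k) (t l) (t 1 c)" "\<And>j. j \<noteq> c \<Longrightarrow> t 1 j = s 1 j"
      and fr: "\<And>a. a \<notin> {1, l, 42, 43, 44} \<Longrightarrow> t a = s a" using I by (auto simp: I_def)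
    have "t 32 = s 32" using fr[of 32] arr by auto
    then have kn: "int k < n" using b t n by simp
    then show "k < nat n" by simp
    have tf: "t f = s f" using fr[of f] arr by auto
    define x y where "x = s f (int k)" and "y = s f x"
    have kin: "int k \<in> {0..<n}" using kn by simp
    have xin: "x \<in> {0..<n}" and yin: "y \<in> {0..<n}" using f[OF kin] f by (simp_all add: x_def y_def)
    have gx: "g x = g (int k)" "g y = g (int k)"
      using g[OF kin xin] g[OF kin yin] by (auto simp: x_def y_def)
    have step: "I (Suc k) (upd 42 0 (int k + 1) t')"
      if "labelling g (int k + 1) (t' l) (t' 1 c)" "\<And>j. j \<noteq> c \<Longrightarrow> t' 1 j = t 1 j" "\<And>a. a \<notin> {1, l, 42, 43, 44} \<Longrightarrow> t' a = t a" for t'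
      using that fr t(3) kn arr by (auto simp: I_def add.commute)
    show "wp (labels_body f l c) t (\<lambda>n t. n \<le> 80 \<and> I (Suc k) t)"
    proof (cases "x < int k")
      case True
      have "I (Suc k) (upd 42 0 (int k + 1) (upd l (int k) (t l x) (upd 44 0 y (upd 43 0 x t))))"
        using labelling_old[OF t(2), of x] True xin gx arr by (intro step) auto
      then show ?thesis using True t(1) tf arr unfolding labels_body_def
        by (simp add: wp_simps x_def[symmetric] y_def[symmetric] cong: wp_cong)
    next
      case False
      show ?thesis
      proof (cases "y < int k")
        case True
        have "I (Suc k) (upd 42 0 (int k + 1) (upd l (int k) (t l y) (upd 44 0 y (upd 43 0 x t))))"
          using labelling_old[OF t(2), of y] True yin gx arr by (intro step) auto
        then show ?thesis using True False t(1) tf arr unfolding labels_body_def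
          by (simp add: wp_simps x_def[symmetric] y_def[symmetric] cong: wp_cong)
      next
        case nf: False
        have "g j \<noteq> g (int k)" if "j \<in> {0..<int k}" for j
          using g[OF kin, of j] that nf False kn by (auto simp: x_def y_def)
        then have "I (Suc k) (upd 42 0 (int k + 1) (upd 1 c (t 1 c + 1) (upd l (int k) (t 1 c) (upd 44 0 y (upd 43 0 x t)))))"
          using labelling_new[OF t(2)] arr by (intro step) auto
        then show ?thesis using nf False t(1) tf arr arr' unfolding labels_body_def
          by (simp add: wp_simps x_def[symmetric] y_def[symmetric] cong: wp_cong)
      qed
    qed
  qed
  then have "wp (While (Less (V 42) (V 32)) (labels_body f l c)) ?s (\<lambda>m t. 3 + m \<le> nat n * 100 + 20 \<and> labelling g n (t l) (t 1 c) \<and>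
     (\<forall>j. j \<noteq> c \<longrightarrow> t 1 j = s 1 j) \<and> (\<forall>a. a \<notin> {1, l, 42, 43, 44} \<longrightarrow> t a = s a))"
  proof (rule wp_mono)
    fix m t assume "\<exists>k\<ge>0. I k t \<and> \<not> bval (Less (V 42) (V 32)) t \<and>
      m \<le> (k - 0) * (1 + bcost (Less (V 42) (V 32)) + 80) + (1 + bcost (Less (V 42) (V 32)))"
    then obtain k where I: "I k t" and b: "\<not> t 42 0 < t 32 0" and m: "m \<le> k * 86 + 6" by auto
    have fr: "\<And>a. a \<notin> {1, l, 42, 43, 44} \<Longrightarrow> t a = s a" and k: "t 42 0 = int k" "int k \<le> n" using I by (auto simp: I_def)
    have "t 32 = s 32" using fr[of 32] arr by auto
    then have "int k = n" using b k n by simp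
    then show "3 + m \<le> nat n * 100 + 20 \<and> labelling g n (t l) (t 1 c) \<and>
     (\<forall>j. j \<noteq> c \<longrightarrow> t 1 j = s 1 j) \<and> (\<forall>a. a \<notin> {1, l, 42, 43, 44} \<longrightarrow> t a = s a)"
      using I m by (auto simp: I_def)
  qed
  then show ?thesis by (simp add: labels_def wp_Seq wp_Store)
qed

section \<open>Neighbour lists\<close>

text \<open>The table \<open>pos\<close>, addressed by the pair of vertices in base n, holds the
  place of the neighbour in the list plus 1, or 0 if it is not yet listed. Repeated neighbours are
  thus recognized in constant time, and only their multiplicity grows.\<close>

definition neigh_body :: "int \<Rightarrow> nat \<Rightarrow> nat \<Rightarrow> nat \<Rightarrow> nat \<Rightarrow> nat \<Rightarrow> nat \<Rightarrow> com" where
  "neigh_body m la lb cnt nb mlt pos = Block [Assign 43 (Cell la (V 42)), Assign 44 (Cell lb (V 42)),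
     Assign 47 (Add (Mul (V 43) (V 32)) (V 44)),
     Cond (Equal (Cell pos (V 47)) (Const 0))
       (Block [Assign 48 (Add (Mul (Const m) (V 43)) (Cell cnt (V 43))),
          Store nb (V 48) (V 44), Store mlt (V 48) (Const 1),
          Store cnt (V 43) (Add (Cell cnt (V 43)) (Const 1)), Store pos (V 47) (Cell cnt (V 43))])
       (Block [Assign 48 (Add (Mul (Const m) (V 43)) (Add (Cell pos (V 47)) (Const (- 1)))),
          Store mlt (V 48) (Add (Cell mlt (V 48)) (Const 1))]),
     Assign 42 (Add (V 42) (Const 1))]"

definition neigh :: "int \<Rightarrow> nat \<Rightarrow> nat \<Rightarrow> nat \<Rightarrow> nat \<Rightarrow> nat \<Rightarrow> nat \<Rightarrow> com" where
  "neigh m la lb cnt nb mlt pos = Seq (Assign 42 (Const 0))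
     (While (Less (V 42) (V 32)) (neigh_body m la lb cnt nb mlt pos))"

definition fibre :: "(int \<Rightarrow> int) \<Rightarrow> (int \<Rightarrow> int) \<Rightarrow> int \<Rightarrow> int \<Rightarrow> int \<Rightarrow> int set" where
  "fibre la lb k v w = {x \<in> {0..<k}. la x = v \<and> lb x = w}"

definition neighbours :: "(int \<Rightarrow> int) \<Rightarrow> (int \<Rightarrow> int) \<Rightarrow> int \<Rightarrow> int \<Rightarrow> int set" where
  "neighbours la lb k v = lb ` {x \<in> {0..<k}. la x = v}"

definition lists_ok :: "int \<Rightarrow> (int \<Rightarrow> int) \<Rightarrow> (int \<Rightarrow> int) \<Rightarrow> int \<Rightarrow> (int \<Rightarrow> int) \<Rightarrow> (int \<Rightarrow> int) \<Rightarrow> (int \<Rightarrow> int) \<Rightarrow> bool" where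
  "lists_ok m la lb k cnt nb mlt \<longleftrightarrow> (\<forall>v. 0 \<le> cnt v \<and>
     bij_betw (\<lambda>j. nb (m * v + j)) {0..<cnt v} (neighbours la lb k v) \<and>
     (\<forall>j\<in>{0..<cnt v}. mlt (m * v + j) = int (card (fibre la lb k v (nb (m * v + j))))))"

definition pos_ok :: "int \<Rightarrow> int \<Rightarrow> (int \<Rightarrow> int) \<Rightarrow> (int \<Rightarrow> int) \<Rightarrow> int \<Rightarrow> (int \<Rightarrow> int) \<Rightarrow> (int \<Rightarrow> int) \<Rightarrow> (int \<Rightarrow> int) \<Rightarrow> bool" where
  "pos_ok n m la lb k cnt nb pos \<longleftrightarrow> (\<forall>v\<in>{0..<n}. \<forall>w\<in>{0..<n}.
     (w \<notin> neighbours la lb k v \<longrightarrow> pos (v * n + w) = 0) \<and>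
     (w \<in> neighbours la lb k v \<longrightarrow> pos (v * n + w) - 1 \<in> {0..<cnt v} \<and> nb (m * v + (pos (v * n + w) - 1)) = w))"

lemma pair_index_inject:
  fixes i j v w m :: int
  assumes "0 \<le> i" "i < m" "0 \<le> j" "j < m" "m * v + i = m * w + j"
  shows "v = w \<and> i = j"
  using pair_code_inject[of i m j v w] assms by (simp add: mult.commute)

text \<open>A vertex with at most \<open>m\<close> edges has at most \<open>m\<close> neighbours, so
  the blocks of \<open>m\<close> cells reserved for the vertices never overlap.\<close>

lemma lists_count:
  assumes L: "lists_ok m la lb k cnt nb mlt" and w: "\<And>v. card {x \<in> {0..<n}. la x = v} \<le> nat m" and k: "k \<le> n"
  shows "cnt v = int (card (neighbours la lb k v))" "cnt v \<le> m \<or> cnt v = 0"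
proof -
  have fin: "finite {x \<in> {0..<n}. la x = v}" by (rule finite_subset[of _ "{0..<n}"]) auto
  have "card {0..<cnt v} = card (neighbours la lb k v)"
    using L unfolding lists_ok_def by (metis bij_betw_same_card)
  moreover have "0 \<le> cnt v" using L unfolding lists_ok_def by blast
  ultimately show c: "cnt v = int (card (neighbours la lb k v))" by simp
  have "{x \<in> {0..<k}. la x = v} \<subseteq> {x \<in> {0..<n}. la x = v}" using k by auto
  then have "card (neighbours la lb k v) \<le> card {x \<in> {0..<n}. la x = v}"
    unfolding neighbours_def by (metis (no_types, lifting) card_image_le card_mono fin finite_subset order.trans)
  then show "cnt v \<le> m \<or> cnt v = 0" using w[of v] c by linarith
qed

lemma neighbours_Suc:
  assumes "0 \<le> k"
  shows "neighbours la lb (k + 1) v = (if v = la k then insert (lb k) (neighbours la lb k v) else neighbours la lb k v)"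
    "fibre la lb (k + 1) v w = (if v = la k \<and> w = lb k then insert k (fibre la lb k v w) else fibre la lb k v w)"
proof -
  have "{0..<k + 1} = insert k {0..<k}" using assms by auto
  then show "neighbours la lb (k + 1) v = (if v = la k then insert (lb k) (neighbours la lb k v) else neighbours la lb k v)"
    "fibre la lb (k + 1) v w = (if v = la k \<and> w = lb k then insert k (fibre la lb k v w) else fibre la lb k v w)"
    by (auto simp: neighbours_def fibre_def)
qed

lemma neighbours_0: "neighbours la lb 0 v = {}"
  by (simp add: neighbours_def)

lemma finite_neighbours: "finite (neighbours la lb k v)"
  unfolding neighbours_def by (rule finite_imageI, rule finite_subset[of _ "{0..<k}"]) auto

lemma finite_fibre: "finite (fibre la lb k v w)" "k \<notin> fibre la lb k v w"
  by (auto simp: fibre_def intro: finite_subset[of _ "{0..<k}"])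

lemma fibre_empty: "w \<notin> neighbours la lb k v \<Longrightarrow> fibre la lb k v w = {}"
  by (auto simp: fibre_def neighbours_def)

lemma lists_old:
  assumes L: "lists_ok m la lb k cnt nb mlt" and k: "0 \<le> k" and le: "\<And>v. cnt v \<le> m"
    and old: "lb k \<in> neighbours la lb k (la k)" and j: "j \<in> {0..<cnt (la k)}" "nb (m * la k + j) = lb k"
  shows "lists_ok m la lb (k + 1) cnt nb (mlt(m * la k + j := mlt (m * la k + j) + 1))"
  unfolding lists_ok_def
proof (intro allI conjI ballI)
  fix v
  have Lv: "0 \<le> cnt v" "bij_betw (\<lambda>j. nb (m * v + j)) {0..<cnt v} (neighbours la lb k v)"
    "\<And>j. j \<in> {0..<cnt v} \<Longrightarrow> mlt (m * v + j) = int (card (fibre la lb k v (nb (m * v + j))))" for v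
    using L unfolding lists_ok_def by blast+
  show "0 \<le> cnt v" by (rule Lv)
  have "neighbours la lb (k + 1) v = neighbours la lb k v" using old by (auto simp: neighbours_Suc[OF k])
  then show "bij_betw (\<lambda>j. nb (m * v + j)) {0..<cnt v} (neighbours la lb (k + 1) v)" using Lv(2) by simp
  fix i assume i: "i \<in> {0..<cnt v}"
  show "(mlt(m * la k + j := mlt (m * la k + j) + 1)) (m * v + i) = int (card (fibre la lb (k + 1) v (nb (m * v + i))))"
  proof (cases "v = la k \<and> i = j")
    case True
    then show ?thesis using Lv(3)[OF j(1)] j finite_fibre by (simp add: neighbours_Suc[OF k])
  next
    case False
    have "m * v + i \<noteq> m * la k + j"
      using pair_index_inject[of i m j v "la k"] i j le[of v] le[of "la k"] False by auto
    moreover have "\<not> (v = la k \<and> nb (m * v + i) = lb k)"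
    proof
      assume a: "v = la k \<and> nb (m * v + i) = lb k"
      then have "i = j" using Lv(2)[of "la k"] i j unfolding bij_betw_def inj_on_def by auto
      then show False using a False by simp
    qed
    ultimately show ?thesis using Lv(3)[OF i] by (auto simp: neighbours_Suc[OF k])
  qed
qed

lemma lists_new:
  assumes L: "lists_ok m la lb k cnt nb mlt" and k: "0 \<le> k" and le: "\<And>v. cnt v \<le> m" "cnt (la k) < m"
    and new: "lb k \<notin> neighbours la lb k (la k)"
  shows "lists_ok m la lb (k + 1) (cnt(la k := cnt (la k) + 1)) (nb(m * la k + cnt (la k) := lb k))
    (mlt(m * la k + cnt (la k) := 1))"
  unfolding lists_ok_def
proof (intro allI conjI ballI)
  fix v
  let ?i = "m * la k + cnt (la k)"
  let ?nb = "nb(?i := lb k)" and ?cnt = "cnt(la k := cnt (la k) + 1)"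
  have Lv: "0 \<le> cnt v" "bij_betw (\<lambda>j. nb (m * v + j)) {0..<cnt v} (neighbours la lb k v)"
    "\<And>j. j \<in> {0..<cnt v} \<Longrightarrow> mlt (m * v + j) = int (card (fibre la lb k v (nb (m * v + j))))" for v
    using L unfolding lists_ok_def by blast+
  show "0 \<le> ?cnt v" using Lv(1)[of v] Lv(1)[of "la k"] by simp
  have ne: "m * v + i \<noteq> ?i" if "i \<in> {0..<cnt v}" for v i
    using pair_index_inject[of i m "cnt (la k)" v "la k"] that le(1)[of v] le(2) Lv(1)[of "la k"] by auto
  have old: "bij_betw (\<lambda>j. ?nb (m * v + j)) {0..<cnt v} (neighbours la lb k v)" for v
    using Lv(2)[of v] ne by (subst bij_betw_cong[where g = "\<lambda>j. nb (m * v + j)"]) auto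
  show "bij_betw (\<lambda>j. ?nb (m * v + j)) {0..<?cnt v} (neighbours la lb (k + 1) v)"
  proof (cases "v = la k")
    case True
    have r: "{0..<cnt v + 1} = insert (cnt v) {0..<cnt v}" using Lv(1)[of v] by auto
    have "bij_betw (\<lambda>j. ?nb (m * v + j)) ({0..<cnt v} \<union> {cnt v}) (neighbours la lb k v \<union> {lb k})"
      using new True by (intro bij_betw_combine old) (auto simp: bij_betw_def)
    then show ?thesis using True by (simp add: neighbours_Suc[OF k] r[unfolded True])
  next
    case False
    then show ?thesis using old[of v] by (simp add: neighbours_Suc[OF k])
  qed
  fix i assume i: "i \<in> {0..<?cnt v}"
  show "(mlt(?i := 1)) (m * v + i) = int (card (fibre la lb (k + 1) v (?nb (m * v + i))))"
  proof (cases "v = la k \<and> i = cnt (la k)")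
    case True
    then show ?thesis using fibre_empty[OF new] by (simp add: neighbours_Suc[OF k])
  next
    case False
    then have i': "i \<in> {0..<cnt v}" using i by (auto split: if_splits)
    have "nb (m * v + i) \<in> neighbours la lb k v" using Lv(2)[of v] i' by (auto simp: bij_betw_def)
    then have "\<not> (v = la k \<and> nb (m * v + i) = lb k)" using new by auto
    then show ?thesis using Lv(3)[OF i'] ne[OF i'] by (auto simp: neighbours_Suc[OF k])
  qed
qed

lemma pos_new:
  assumes P: "pos_ok n m la lb k cnt nb pos" and k: "0 \<le> k" and c: "\<And>v. 0 \<le> cnt v" "\<And>v. cnt v \<le> m" "cnt (la k) < m"
    and r: "la k \<in> {0..<n}" "lb k \<in> {0..<n}" and new: "lb k \<notin> neighbours la lb k (la k)"
  shows "pos_ok n m la lb (k + 1) (cnt(la k := cnt (la k) + 1)) (nb(m * la k + cnt (la k) := lb k))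
    (pos(la k * n + lb k := cnt (la k) + 1))"
  unfolding pos_ok_def
proof (intro ballI)
  fix v w assume vw: "v \<in> {0..<n}" "w \<in> {0..<n}"
  let ?i = "m * la k + cnt (la k)"
  have ne: "m * v + i \<noteq> ?i" if "i \<in> {0..<cnt v}" for i
    using pair_index_inject[of i m "cnt (la k)" v "la k"] that c(2)[of v] c(3) c(1)[of "la k"] by auto
  have Pv: "w \<notin> neighbours la lb k v \<Longrightarrow> pos (v * n + w) = 0"
    "w \<in> neighbours la lb k v \<Longrightarrow> pos (v * n + w) - 1 \<in> {0..<cnt v} \<and> nb (m * v + (pos (v * n + w) - 1)) = w"
    using P vw unfolding pos_ok_def by blast+
  have idx: "v * n + w = la k * n + lb k \<longleftrightarrow> v = la k \<and> w = lb k"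
    using vw r by (intro pair_code_inject) auto
  show "(w \<notin> neighbours la lb (k + 1) v \<longrightarrow> (pos(la k * n + lb k := cnt (la k) + 1)) (v * n + w) = 0) \<and>
    (w \<in> neighbours la lb (k + 1) v \<longrightarrow> (pos(la k * n + lb k := cnt (la k) + 1)) (v * n + w) - 1 \<in> {0..<(cnt(la k := cnt (la k) + 1)) v} \<and>
      (nb(?i := lb k)) (m * v + ((pos(la k * n + lb k := cnt (la k) + 1)) (v * n + w) - 1)) = w)"
  proof (cases "v = la k \<and> w = lb k")
    case True
    then show ?thesis using c by (simp add: neighbours_Suc[OF k])
  next
    case False
    then have same: "(pos(la k * n + lb k := cnt (la k) + 1)) (v * n + w) = pos (v * n + w)" using idx by auto
    have "w \<in> neighbours la lb (k + 1) v \<longleftrightarrow> w \<in> neighbours la lb k v" using False by (auto simp: neighbours_Suc[OF k])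
    then show ?thesis unfolding same using Pv ne[of "pos (v * n + w) - 1"] by auto
  qed
qed

lemma pos_old:
  assumes P: "pos_ok n m la lb k cnt nb pos" and k: "0 \<le> k" and old: "lb k \<in> neighbours la lb k (la k)"
  shows "pos_ok n m la lb (k + 1) cnt nb pos"
proof -
  have "neighbours la lb (k + 1) v = neighbours la lb k v" for v using old by (auto simp: neighbours_Suc[OF k])
  then show ?thesis using P by (simp add: pos_ok_def)
qed

lemma wp_neigh:
  assumes n: "0 \<le> n" "s 32 0 = n" and m: "0 < m"
    and z: "\<And>j. s cnt j = 0" "\<And>j. s pos j = 0"
    and r: "\<And>x. x \<in> {0..<n} \<Longrightarrow> s la x \<in> {0..<n} \<and> s lb x \<in> {0..<n}"
    and w: "\<And>v. card {x \<in> {0..<n}. s la x = v} \<le> nat m"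
    and arr: "distinct [32, la, lb, cnt, nb, mlt, pos, 42, 43, 44, 47, 48]"
  shows "wp (neigh m la lb cnt nb mlt pos) s (\<lambda>c t. c \<le> nat n * 150 + 20 \<and>
     lists_ok m (s la) (s lb) n (t cnt) (t nb) (t mlt) \<and> (\<forall>a. a \<notin> {cnt, nb, mlt, pos, 42, 43, 44, 47, 48} \<longrightarrow> t a = s a))"
proof -
  \<comment> \<open>The reversed list supplies every inequality between array numbers in the other
    orientation as well, for the simplifier.\<close>
  have "distinct (rev [32, la, lb, cnt, nb, mlt, pos, 42, 43, 44, 47, 48])" using arr by (simp only: distinct_rev)
  note ne = arr[simplified] this[simplified]
  let ?la = "s la" and ?lb = "s lb"
  define I where "I = (\<lambda>k t. t 42 0 = int k \<and> int k \<le> n \<and> lists_ok m ?la ?lb (int k) (t cnt) (t nb) (t mlt) \<and>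
     pos_ok n m ?la ?lb (int k) (t cnt) (t nb) (t pos) \<and> (\<forall>a. a \<notin> {cnt, nb, mlt, pos, 42, 43, 44, 47, 48} \<longrightarrow> t a = s a))"
  let ?s = "upd 42 0 0 s"
  have I0: "I 0 ?s" using n z by (simp add: I_def lists_ok_def pos_ok_def neighbours_0 bij_betw_def ne)
  have "wp (While (Less (V 42) (V 32)) (neigh_body m la lb cnt nb mlt pos)) ?s (\<lambda>c t. \<exists>k\<ge>0. I k t \<and> \<not> bval (Less (V 42) (V 32)) t \<and>
      c \<le> (k - 0) * (1 + bcost (Less (V 42) (V 32)) + 120) + (1 + bcost (Less (V 42) (V 32))))"
  proof (rule wp_While[where I = I and B = "nat n", OF I0])
    fix k t assume I: "I k t" and b: "bval (Less (V 42) (V 32)) t"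
    have t: "t 42 0 = int k" and L: "lists_ok m ?la ?lb (int k) (t cnt) (t nb) (t mlt)"
      and P: "pos_ok n m ?la ?lb (int k) (t cnt) (t nb) (t pos)"
      and fr: "\<And>a. a \<notin> {cnt, nb, mlt, pos, 42, 43, 44, 47, 48} \<Longrightarrow> t a = s a" using I by (auto simp: I_def)
    have t32: "t 32 = s 32" "t la = s la" "t lb = s lb" by (rule fr; simp add: ne)+
    then have kn: "int k < n" using b t n by simp
    then show "k < nat n" by simp
    have kin: "int k \<in> {0..<n}" using kn by simp
    define v x where vx: "v = ?la (int k)" "x = ?lb (int k)"
    have vr: "v \<in> {0..<n}" "x \<in> {0..<n}" using r[OF kin] by (simp_all add: vx)
    have le: "t cnt u \<le> m" for u using lists_count(2)[OF L w, of u] kn m by auto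
    have c0: "0 \<le> t cnt u" for u using L unfolding lists_ok_def by blast
    have step: "I (Suc k) (upd 42 0 (int k + 1) t')"
      if "lists_ok m ?la ?lb (int k + 1) (t' cnt) (t' nb) (t' mlt)" "pos_ok n m ?la ?lb (int k + 1) (t' cnt) (t' nb) (t' pos)"
        "\<And>a. a \<notin> {cnt, nb, mlt, pos, 42, 43, 44, 47, 48} \<Longrightarrow> t' a = t a" for t'
      using that fr kn by (simp add: I_def add.commute ne)
    have Pv: "x \<notin> neighbours ?la ?lb (int k) v \<longrightarrow> t pos (v * n + x) = 0"
      "x \<in> neighbours ?la ?lb (int k) v \<longrightarrow> t pos (v * n + x) - 1 \<in> {0..<t cnt v} \<and> t nb (m * v + (t pos (v * n + x) - 1)) = x"
      using P vr unfolding pos_ok_def by blast+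
    show "wp (neigh_body m la lb cnt nb mlt pos) t (\<lambda>n t. n \<le> 120 \<and> I (Suc k) t)"
    proof (cases "x \<in> neighbours ?la ?lb (int k) v")
      case True
      define j where "j = t pos (v * n + x) - 1"
      have j: "j \<in> {0..<t cnt v}" "t nb (m * v + j) = x" "t pos (v * n + x) = j + 1" using Pv(2) True by (auto simp: j_def)
      then have nz: "t pos (v * n + x) \<noteq> 0" by auto
      have "I (Suc k) (upd 42 0 (int k + 1) (upd mlt (m * v + j) (t mlt (m * v + j) + 1) (upd 48 0 (m * v + j)
        (upd 47 0 (v * n + x) (upd 44 0 x (upd 43 0 v t))))))"
        using lists_old[OF L, of j] pos_old[OF P] True le j by (intro step) (simp_all add: vx ne)
      then show ?thesis using nz j(3) t t32 n unfolding neigh_body_def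
        by (simp add: wp_simps vx[symmetric] ne cong: wp_cong)
    next
      case False
      \<comment> \<open>The current edge is one more edge at v and leads to a neighbour not yet
        listed, so the neighbours listed so far do not exhaust the edges at v.\<close>
      have lt: "t cnt v < m"
      proof -
        have c: "t cnt v = int (card (neighbours ?la ?lb (int k) v))" using lists_count(1)[OF L w] kn by simp
        have "card (insert x (neighbours ?la ?lb (int k) v)) = card (neighbours ?la ?lb (int k) v) + 1"
          using False finite_neighbours by simp
        moreover have "insert x (neighbours ?la ?lb (int k) v) \<subseteq> ?lb ` {x \<in> {0..<n}. ?la x = v}"
          using kn kin by (auto simp: neighbours_def vx)
        moreover have "finite {x \<in> {0..<n}. ?la x = v}" by (rule finite_subset[of _ "{0..<n}"]) auto
        ultimately have "card (neighbours ?la ?lb (int k) v) + 1 \<le> card {x \<in> {0..<n}. ?la x = v}"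
          by (metis (no_types, lifting) card_image_le card_mono finite_imageI order.trans)
        then show ?thesis using w[of v] c m by linarith
      qed
      have "I (Suc k) (upd 42 0 (int k + 1) (upd pos (v * n + x) (t cnt v + 1) (upd cnt v (t cnt v + 1)
        (upd mlt (m * v + t cnt v) 1 (upd nb (m * v + t cnt v) x (upd 48 0 (m * v + t cnt v)
        (upd 47 0 (v * n + x) (upd 44 0 x (upd 43 0 v t)))))))))"
        using lists_new[OF L] pos_new[OF P] False le lt c0 vr by (intro step) (simp_all add: vx ne)
      then show ?thesis using Pv(1) False t t32 n unfolding neigh_body_def
        by (simp add: wp_simps vx[symmetric] ne cong: wp_cong)
    qed
  qed
  then have "wp (While (Less (V 42) (V 32)) (neigh_body m la lb cnt nb mlt pos)) ?s (\<lambda>c t. 3 + c \<le> nat n * 150 + 20 \<and>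
     lists_ok m ?la ?lb n (t cnt) (t nb) (t mlt) \<and> (\<forall>a. a \<notin> {cnt, nb, mlt, pos, 42, 43, 44, 47, 48} \<longrightarrow> t a = s a))"
  proof (rule wp_mono)
    fix c t assume "\<exists>k\<ge>0. I k t \<and> \<not> bval (Less (V 42) (V 32)) t \<and>
      c \<le> (k - 0) * (1 + bcost (Less (V 42) (V 32)) + 120) + (1 + bcost (Less (V 42) (V 32)))"
    then obtain k where I: "I k t" and b: "\<not> t 42 0 < t 32 0" and c: "c \<le> k * 126 + 6" by auto
    have fr: "\<And>a. a \<notin> {cnt, nb, mlt, pos, 42, 43, 44, 47, 48} \<Longrightarrow> t a = s a" and k: "t 42 0 = int k" "int k \<le> n"
      using I by (auto simp: I_def)
    have "t 32 = s 32" by (rule fr) (simp add: ne)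
    then have "int k = n" using b k n by simp
    then show "3 + c \<le> nat n * 150 + 20 \<and> lists_ok m ?la ?lb n (t cnt) (t nb) (t mlt) \<and>
       (\<forall>a. a \<notin> {cnt, nb, mlt, pos, 42, 43, 44, 47, 48} \<longrightarrow> t a = s a)"
      using I c by (auto simp: I_def)
  qed
  then show ?thesis by (simp add: neigh_def wp_Seq wp_Store)
qed

section \<open>The edges of the polygon\<close>

text \<open>The descriptor \<open>(c, A)\<close>, where \<open>A\<close> is the matrix of the tile \<open>k\<close>, is encoded by \<open>5 k + c\<close>.\<close>

definition valid_desc :: "memory \<Rightarrow> int \<Rightarrow> bool" where
  "valid_desc s d \<longleftrightarrow>
     d mod 5 = 0 \<and> s 40 (d div 5) = 0 \<and> s 39 (d div 5) \<noteq> d div 5 \<or>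
     0 < d mod 5 \<and> d mod 5 < 3 \<and> s 40 (d div 5) = 0 \<and> s 39 (d div 5) = d div 5 \<or>
     2 < d mod 5 \<and> s 10 (d div 5) = d div 5"

abbreviation Or :: "bexp \<Rightarrow> bexp \<Rightarrow> bexp" where "Or b c \<equiv> Neg (Conj (Neg b) (Neg c))"

definition valid_test :: bexp where
  "valid_test = Or (Conj (Equal (V 44) (Const 0)) (Conj (Equal (Cell 40 (V 43)) (Const 0)) (Neg (Equal (Cell 39 (V 43)) (V 43)))))
     (Or (Conj (Conj (Less (Const 0) (V 44)) (Less (V 44) (Const 3)))
            (Conj (Equal (Cell 40 (V 43)) (Const 0)) (Equal (Cell 39 (V 43)) (V 43))))
        (Conj (Less (Const 2) (V 44)) (Equal (Cell 10 (V 43)) (V 43))))"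

text \<open>Array 50 leads from edge numbers to descriptor codes and array 49 back. The way back is
  needed because the partner of an edge is first computed as a code.\<close>

definition compact_body :: com where
  "compact_body = Block [Assign 43 (Quot (V 42) (Const 5)), Assign 44 (Rem (V 42) (Const 5)),
     Cond valid_test (Block [Store 49 (V 42) (V 11), Store 50 (V 11) (V 42), Assign 11 (Add (V 11) (Const 1))]) Skip,
     Assign 42 (Add (V 42) (Const 1))]"

definition compact_prog :: com where
  "compact_prog = Seq (Block [Assign 42 (Const 0), Assign 51 (Mul (Const 5) (V 32))])
     (While (Less (V 42) (V 51)) compact_body)"

definition compacted :: "(int \<Rightarrow> bool) \<Rightarrow> int \<Rightarrow> int \<Rightarrow> (int \<Rightarrow> int) \<Rightarrow> (int \<Rightarrow> int) \<Rightarrow> bool" where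
  "compacted Q k E ep dd \<longleftrightarrow> 0 \<le> E \<and> E \<le> k \<and> bij_betw dd {0..<E} {d \<in> {0..<k}. Q d} \<and> (\<forall>e\<in>{0..<E}. ep (dd e) = e)"

lemma compacted_step:
  assumes c: "compacted Q k E ep dd" and k: "0 \<le> k"
  shows "Q k \<Longrightarrow> compacted Q (k + 1) (E + 1) (ep(k := E)) (dd(E := k))"
    and "\<not> Q k \<Longrightarrow> compacted Q (k + 1) E ep dd"
proof -
  have h: "0 \<le> E" "E \<le> k" "bij_betw dd {0..<E} {d \<in> {0..<k}. Q d}" "\<And>e. e \<in> {0..<E} \<Longrightarrow> ep (dd e) = e"
    using c unfolding compacted_def by blast+
  have r: "{0..<k + 1} = insert k {0..<k}" "{0..<E + 1} = insert E {0..<E}" using k h by auto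
  {
    assume Q: "Q k"
    have "bij_betw (dd(E := k)) {0..<E} {d \<in> {0..<k}. Q d}"
      using h(3) by (subst bij_betw_cong[where g = dd]) auto
    then have "bij_betw (dd(E := k)) ({0..<E} \<union> {E}) ({d \<in> {0..<k}. Q d} \<union> {k})"
      by (rule bij_betw_combine) (auto simp: bij_betw_def)
    moreover have "{0..<E} \<union> {E} = {0..<E + 1}" "{d \<in> {0..<k}. Q d} \<union> {k} = {d \<in> {0..<k + 1}. Q d}"
      using Q unfolding r by auto
    ultimately have b: "bij_betw (dd(E := k)) {0..<E + 1} {d \<in> {0..<k + 1}. Q d}" by simp
    have "(ep(k := E)) ((dd(E := k)) e) = e" if "e \<in> {0..<E + 1}" for e
    proof (cases "e = E")
      case False
      then have e: "e \<in> {0..<E}" using that by auto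
      then have "dd e \<in> {d \<in> {0..<k}. Q d}" using h(3) by (auto simp: bij_betw_def)
      then show ?thesis using h(4)[OF e] False by auto
    qed simp
    then show "compacted Q (k + 1) (E + 1) (ep(k := E)) (dd(E := k))" using b h unfolding compacted_def by auto
  }
  assume "\<not> Q k"
  then have "{d \<in> {0..<k + 1}. Q d} = {d \<in> {0..<k}. Q d}" unfolding r by auto
  then show "compacted Q (k + 1) E ep dd" using h unfolding compacted_def by auto
qed

lemma wp_compact:
  assumes n: "0 \<le> n" "s 32 0 = n" and z: "s 11 0 = 0"
  shows "wp compact_prog s (\<lambda>c t. c \<le> nat n * 700 + 40 \<and> compacted (valid_desc s) (5 * n) (t 11 0) (t 49) (t 50) \<and>
     (\<forall>a. a \<notin> {11, 42, 43, 44, 49, 50, 51} \<longrightarrow> t a = s a))"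
proof -
  define I where "I = (\<lambda>k t. t 42 0 = int k \<and> int k \<le> 5 * n \<and> t 51 0 = 5 * n \<and>
     compacted (valid_desc s) (int k) (t 11 0) (t 49) (t 50) \<and> (\<forall>a. a \<notin> {11, 42, 43, 44, 49, 50, 51} \<longrightarrow> t a = s a))"
  let ?s = "upd 51 0 (5 * n) (upd 42 0 0 s)"
  have I0: "I 0 ?s" using n z by (auto simp: I_def compacted_def bij_betw_def)
  have "wp (While (Less (V 42) (V 51)) compact_body) ?s (\<lambda>c t. \<exists>k\<ge>0. I k t \<and> \<not> bval (Less (V 42) (V 51)) t \<and>
      c \<le> (k - 0) * (1 + bcost (Less (V 42) (V 51)) + 130) + (1 + bcost (Less (V 42) (V 51))))"
  proof (rule wp_While[where I = I and B = "nat (5 * n)", OF I0])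
    fix k t assume I: "I k t" and b: "bval (Less (V 42) (V 51)) t"
    have t: "t 42 0 = int k" "t 51 0 = 5 * n" and C: "compacted (valid_desc s) (int k) (t 11 0) (t 49) (t 50)"
      and fr: "\<And>a. a \<notin> {11, 42, 43, 44, 49, 50, 51} \<Longrightarrow> t a = s a" using I by (auto simp: I_def)
    have kn: "int k < 5 * n" using b t by simp
    then show "k < nat (5 * n)" by simp
    have same: "t 40 = s 40" "t 39 = s 39" "t 10 = s 10" by (auto intro!: fr)
    let ?t = "upd 44 0 (int k mod 5) (upd 43 0 (int k div 5) t)"
    have test: "bval valid_test ?t \<longleftrightarrow> valid_desc s (int k)"
      using same by (auto simp: valid_test_def valid_desc_def)
    have step: "I (Suc k) (upd 42 0 (int k + 1) t')"
      if "compacted (valid_desc s) (int k + 1) (t' 11 0) (t' 49) (t' 50)" "\<And>a. a \<notin> {11, 42, 43, 44, 49, 50} \<Longrightarrow> t' a = t a" for t'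
      using that fr t kn by (auto simp: I_def add.commute)
    have bc: "bcost valid_test \<le> 80" by (simp add: valid_test_def)
    show "wp compact_body t (\<lambda>n t. n \<le> 130 \<and> I (Suc k) t)"
    proof (cases "valid_desc s (int k)")
      case True
      have "I (Suc k) (upd 42 0 (int k + 1) (upd 11 0 (t 11 0 + 1) (upd 50 (t 11 0) (int k) (upd 49 (int k) (t 11 0) ?t))))"
        using compacted_step(1)[OF C _ True] by (intro step) auto
      then show ?thesis using test True t bc unfolding compact_body_def
        by (simp add: wp_simps cong: wp_cong)
    next
      case False
      have "I (Suc k) (upd 42 0 (int k + 1) ?t)"
        using compacted_step(2)[OF C _ False] by (intro step) auto
      then show ?thesis using test False t bc unfolding compact_body_def
        by (simp add: wp_simps cong: wp_cong)
    qed
  qed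
  then have "wp (While (Less (V 42) (V 51)) compact_body) ?s (\<lambda>c t. 9 + c \<le> nat n * 700 + 40 \<and>
     compacted (valid_desc s) (5 * n) (t 11 0) (t 49) (t 50) \<and> (\<forall>a. a \<notin> {11, 42, 43, 44, 49, 50, 51} \<longrightarrow> t a = s a))"
  proof (rule wp_mono)
    fix c t assume "\<exists>k\<ge>0. I k t \<and> \<not> bval (Less (V 42) (V 51)) t \<and>
      c \<le> (k - 0) * (1 + bcost (Less (V 42) (V 51)) + 130) + (1 + bcost (Less (V 42) (V 51)))"
    then obtain k where I: "I k t" and b: "\<not> t 42 0 < t 51 0" and c: "c \<le> k * 136 + 6" by auto
    then have k: "int k = 5 * n" by (auto simp: I_def)
    then have "k = 5 * nat n" using n by linarith
    then show "9 + c \<le> nat n * 700 + 40 \<and>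
       compacted (valid_desc s) (5 * n) (t 11 0) (t 49) (t 50) \<and> (\<forall>a. a \<notin> {11, 42, 43, 44, 49, 50, 51} \<longrightarrow> t a = s a)"
      using I c k by (auto simp: I_def)
  qed
  then show ?thesis using n by (simp add: compact_prog_def wp_Seq wp_Store)
qed

definition fill_body :: com where
  "fill_body = Block [Assign 47 (Cell 50 (V 42)), Assign 43 (Quot (V 47) (Const 5)), Assign 44 (Rem (V 47) (Const 5)),
     Cond (Equal (V 44) (Const 0)) (Block [Store 12 (V 42) (Const 0), Assign 48 (Mul (Const 5) (Cell 39 (V 43)))])
       (Block [Cond (Less (V 44) (Const 3)) (Store 12 (V 42) (Const 1)) (Store 12 (V 42) (Const 2)),
          Cond (Equal (Rem (V 44) (Const 2)) (Const 1)) (Assign 48 (Add (V 47) (Const 1))) (Assign 48 (Add (V 47) (Const (- 1))))]),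
     Store 17 (V 42) (Cell 49 (V 48)),
     Cond (Equal (V 44) (Const 2))
       (Block [Store 13 (V 42) (Cell 36 (V 43)), Store 14 (V 42) (Minus (Cell 35 (V 43))),
          Store 15 (V 42) (Cell 38 (V 43)), Store 16 (V 42) (Minus (Cell 37 (V 43)))])
       (Cond (Equal (V 44) (Const 4))
         (Block [Store 13 (V 42) (Minus (Cell 36 (V 43))), Store 14 (V 42) (Add (Cell 35 (V 43)) (Cell 36 (V 43))),
            Store 15 (V 42) (Minus (Cell 38 (V 43))), Store 16 (V 42) (Add (Cell 37 (V 43)) (Cell 38 (V 43)))])
         (Block [Store 13 (V 42) (Cell 35 (V 43)), Store 14 (V 42) (Cell 36 (V 43)),
            Store 15 (V 42) (Cell 37 (V 43)), Store 16 (V 42) (Cell 38 (V 43))])),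
     Assign 42 (Add (V 42) (Const 1))]"

definition fill :: com where
  "fill = Seq (Assign 42 (Const 0)) (While (Less (V 42) (V 11)) fill_body)"

definition desc_of :: "memory \<Rightarrow> int \<Rightarrow> desc" where
  "desc_of s d = (nat (d mod 5), mem s (d div 5))"

text \<open>A free edge is glued to the free edge of the tile in the coset beyond it. The codes 1, 2
  and 3, 4 belong to the two halves of a broken component, which are glued to each other.\<close>

definition partner_code :: "memory \<Rightarrow> int \<Rightarrow> int" where
  "partner_code s d = (if d mod 5 = 0 then 5 * s 39 (d div 5) else if d mod 5 mod 2 = 1 then d + 1 else d - 1)"

definition filled :: "memory \<Rightarrow> memory \<Rightarrow> int \<Rightarrow> bool" where
  "filled s t e \<longleftrightarrow> t 12 e = dkind (desc_of s (s 50 e)) \<and> edge_matrix t e = dmat (desc_of s (s 50 e)) \<and>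
     t 17 e = s 49 (partner_code s (s 50 e))"

lemma filled_cong: "(\<And>a. a \<in> {12, 13, 14, 15, 16, 17} \<Longrightarrow> t a e = t' a e) \<Longrightarrow> filled s t e = filled s t' e"
  by (simp add: filled_def edge_matrix_def)

lemma fill_body_correct:
  assumes "t 42 0 = e" and same: "\<And>a. a \<in> {35, 36, 37, 38, 39, 49, 50} \<Longrightarrow> t a = s a"
  shows "wp fill_body t (\<lambda>n t'. n \<le> 120 \<and> filled s t' e \<and> t' 42 0 = e + 1 \<and>
     (\<forall>a\<in>{12, 13, 14, 15, 16, 17}. \<forall>j. j \<noteq> e \<longrightarrow> t' a j = t a j) \<and> (\<forall>a. a \<notin> {12, 13, 14, 15, 16, 17, 42, 43, 44, 47, 48} \<longrightarrow> t' a = t a))"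
proof -
  define d where "d = s 50 e"
  define c where "c = d mod 5"
  define k where "k = d div 5"
  have "c = 0 \<or> c = 1 \<or> c = 2 \<or> c = 3 \<or> c = 4" unfolding c_def by presburger
  then show ?thesis
    unfolding fill_body_def
    by (elim disjE)
      (simp_all add: wp_simps assms d_def[symmetric] c_def[symmetric] k_def[symmetric] filled_def desc_of_def
        partner_code_def dkind_def dmat_def edge_matrix_def mem_def mS_def mU_def cong: wp_cong)
qed

lemma wp_fill:
  assumes E: "0 \<le> s 11 0" "s 11 0 \<le> B"
  shows "wp fill s (\<lambda>c t. c \<le> nat B * 130 + 20 \<and> (\<forall>e\<in>{0..<s 11 0}. filled s t e) \<and>
     (\<forall>a. a \<notin> {12, 13, 14, 15, 16, 17, 42, 43, 44, 47, 48} \<longrightarrow> t a = s a))"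
proof -
  define I where "I = (\<lambda>k t. t 42 0 = int k \<and> int k \<le> s 11 0 \<and> (\<forall>e\<in>{0..<int k}. filled s t e) \<and>
     (\<forall>a. a \<notin> {12, 13, 14, 15, 16, 17, 42, 43, 44, 47, 48} \<longrightarrow> t a = s a))"
  let ?s = "upd 42 0 0 s"
  have I0: "I 0 ?s" using E by (auto simp: I_def)
  have "wp (While (Less (V 42) (V 11)) fill_body) ?s (\<lambda>c t. \<exists>k\<ge>0. I k t \<and> \<not> bval (Less (V 42) (V 11)) t \<and>
      c \<le> (k - 0) * (1 + bcost (Less (V 42) (V 11)) + 120) + (1 + bcost (Less (V 42) (V 11))))"
  proof (rule wp_While[where I = I and B = "nat (s 11 0)", OF I0])
    fix k t assume I: "I k t" and b: "bval (Less (V 42) (V 11)) t"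
    have t: "t 42 0 = int k" and F: "\<And>e. e \<in> {0..<int k} \<Longrightarrow> filled s t e"
      and fr: "\<And>a. a \<notin> {12, 13, 14, 15, 16, 17, 42, 43, 44, 47, 48} \<Longrightarrow> t a = s a" using I by (auto simp: I_def)
    have kE: "int k < s 11 0" using b t fr[of 11] by simp
    then show "k < nat (s 11 0)" by simp
    show "wp fill_body t (\<lambda>n t. n \<le> 120 \<and> I (Suc k) t)"
    proof (rule wp_mono)
      show "wp fill_body t (\<lambda>n t'. n \<le> 120 \<and> filled s t' (int k) \<and> t' 42 0 = int k + 1 \<and>
        (\<forall>a\<in>{12, 13, 14, 15, 16, 17}. \<forall>j. j \<noteq> int k \<longrightarrow> t' a j = t a j) \<and> (\<forall>a. a \<notin> {12, 13, 14, 15, 16, 17, 42, 43, 44, 47, 48} \<longrightarrow> t' a = t a))"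
        by (rule fill_body_correct[where t = t, OF t]) (auto intro!: fr)
      fix n :: nat and t' assume *: "n \<le> 120 \<and> filled s t' (int k) \<and> t' 42 0 = int k + 1 \<and>
        (\<forall>a\<in>{12, 13, 14, 15, 16, 17}. \<forall>j. j \<noteq> int k \<longrightarrow> t' a j = t a j) \<and> (\<forall>a. a \<notin> {12, 13, 14, 15, 16, 17, 42, 43, 44, 47, 48} \<longrightarrow> t' a = t a)"
      have "filled s t' e" if "e \<in> {0..<int (Suc k)}" for e
      proof (cases "e = int k")
        case False
        then have "filled s t e" using F[of e] that by simp
        moreover have "t' a e = t a e" if "a \<in> {12, 13, 14, 15, 16, 17}" for a using * False that by auto
        ultimately show ?thesis using filled_cong[of t' e t s] by blast
      qed (use * in simp)
      then show "n \<le> 120 \<and> I (Suc k) t'" using * fr kE by (auto simp: I_def)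
    qed
  qed
  then have "wp (While (Less (V 42) (V 11)) fill_body) ?s (\<lambda>c t. 3 + c \<le> nat B * 130 + 20 \<and> (\<forall>e\<in>{0..<s 11 0}. filled s t e) \<and>
     (\<forall>a. a \<notin> {12, 13, 14, 15, 16, 17, 42, 43, 44, 47, 48} \<longrightarrow> t a = s a))"
  proof (rule wp_mono)
    fix c t assume "\<exists>k\<ge>0. I k t \<and> \<not> bval (Less (V 42) (V 11)) t \<and>
      c \<le> (k - 0) * (1 + bcost (Less (V 42) (V 11)) + 120) + (1 + bcost (Less (V 42) (V 11)))"
    then obtain k where I: "I k t" and b: "\<not> t 42 0 < t 11 0" and c: "c \<le> k * 126 + 6" by auto
    have "t 11 = s 11" using I by (auto simp: I_def)
    then have k: "int k = s 11 0" using I b by (auto simp: I_def)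
    then have "k \<le> nat B" using E by linarith
    then show "3 + c \<le> nat B * 130 + 20 \<and> (\<forall>e\<in>{0..<s 11 0}. filled s t e) \<and>
       (\<forall>a. a \<notin> {12, 13, 14, 15, 16, 17, 42, 43, 44, 47, 48} \<longrightarrow> t a = s a)"
      using I c k by (auto simp: I_def)
  qed
  then show ?thesis by (simp add: fill_def wp_Seq wp_Store)
qed

section \<open>The graph\<close>

definition vertex_of :: "(int \<Rightarrow> 'a) \<Rightarrow> int \<Rightarrow> (int \<Rightarrow> int) \<Rightarrow> int \<Rightarrow> 'a" where
  "vertex_of g n l v = g (SOME x. x \<in> {0..<n} \<and> l x = v)"

lemma vertex_of_label:
  assumes "labelling g n l c" "x \<in> {0..<n}"
  shows "vertex_of g n l (l x) = g x"
proof -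
  define y where "y = (SOME y. y \<in> {0..<n} \<and> l y = l x)"
  have "y \<in> {0..<n} \<and> l y = l x" unfolding y_def by (rule someI[of _ x]) (use assms in simp)
  then show ?thesis using assms unfolding vertex_of_def y_def[symmetric] labelling_def by blast
qed

lemma labellingD:
  assumes "labelling g n l c"
  shows "0 \<le> c" "x \<in> {0..<n} \<Longrightarrow> l x \<in> {0..<c}" "v \<in> {0..<c} \<Longrightarrow> \<exists>x\<in>{0..<n}. l x = v"
    "x \<in> {0..<n} \<Longrightarrow> y \<in> {0..<n} \<Longrightarrow> l x = l y \<longleftrightarrow> g x = g y"
  using assms unfolding labelling_def by blast+

lemma vertex_of_bij:
  assumes L: "labelling g n l c"
  shows "bij_betw (vertex_of g n l) {0..<c} (g ` {0..<n})"
  unfolding bij_betw_def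
proof
  show "inj_on (vertex_of g n l) {0..<c}"
    by (intro inj_onI) (metis labellingD(3,4)[OF L] vertex_of_label[OF L])
  show "vertex_of g n l ` {0..<c} = g ` {0..<n}"
  proof (intro equalityI subsetI)
    fix y assume "y \<in> vertex_of g n l ` {0..<c}"
    then obtain v where v: "v \<in> {0..<c}" "y = vertex_of g n l v" by blast
    then obtain x where "x \<in> {0..<n}" "l x = v" using labellingD(3)[OF L] by blast
    then show "y \<in> g ` {0..<n}" using v vertex_of_label[OF L] by blast
  next
    fix y assume "y \<in> g ` {0..<n}"
    then obtain x where "x \<in> {0..<n}" "y = g x" by blast
    then show "y \<in> vertex_of g n l ` {0..<c}"
      using vertex_of_label[OF L] labellingD(2)[OF L] by (metis imageI)
  qed
qed

lemma labelling_le: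
  assumes L: "labelling g n l c" and n: "0 \<le> n"
  shows "c \<le> n"
proof -
  have "{0..<c} \<subseteq> l ` {0..<n}" using labellingD(3)[OF L] by blast
  then have "card {0..<c} \<le> card {0..<n}" by (metis card_image_le card_mono finite_atLeastLessThan_int finite_imageI order.trans)
  then show ?thesis using n by simp
qed

text \<open>Transfers the lists from numbers to edges and orbits. The maps \<open>oa\<close> and
  \<open>ob\<close> are arbitrary, so that both types of vertices are covered by exchanging their
  roles.\<close>

lemma neighbour_lists:
  assumes \<epsilon>: "bij_betw \<epsilon> {0..<n} W"
    and La: "labelling (\<lambda>x. oa (\<epsilon> x)) n la ca" and Lb: "labelling (\<lambda>x. ob (\<epsilon> x)) n lb cb"
    and L: "lists_ok m la lb n cnt nb mlt" and v: "v \<in> {0..<ca}"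
  defines "A \<equiv> vertex_of (\<lambda>x. oa (\<epsilon> x)) n la" and "B \<equiv> vertex_of (\<lambda>x. ob (\<epsilon> x)) n lb"
  shows "bij_betw (\<lambda>j. B (nb (m * v + j))) {0..<cnt v} {w \<in> ob ` W. {x \<in> W. oa x = A v \<and> ob x = w} \<noteq> {}}"
    and "j \<in> {0..<cnt v} \<Longrightarrow> nb (m * v + j) \<in> {0..<cb} \<and>
      mlt (m * v + j) = int (card {x \<in> W. oa x = A v \<and> ob x = B (nb (m * v + j))})"
proof -
  have W: "W = \<epsilon> ` {0..<n}" and inj: "inj_on \<epsilon> {0..<n}" using \<epsilon> by (auto simp: bij_betw_def)
  have A: "A (la x) = oa (\<epsilon> x)" "la x \<in> {0..<ca}" if "x \<in> {0..<n}" for x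
    using vertex_of_label[OF La that] labellingD(2)[OF La that] by (simp_all add: A_def)
  have B: "B (lb x) = ob (\<epsilon> x)" "lb x \<in> {0..<cb}" if "x \<in> {0..<n}" for x
    using vertex_of_label[OF Lb that] labellingD(2)[OF Lb that] by (simp_all add: B_def)
  have injA: "inj_on A {0..<ca}" and injB: "inj_on B {0..<cb}"
    using vertex_of_bij[OF La] vertex_of_bij[OF Lb] by (simp_all add: bij_betw_def A_def B_def)
  have oa: "oa (\<epsilon> x) = A v \<longleftrightarrow> la x = v" if "x \<in> {0..<n}" for x
    using A[OF that] inj_on_eq_iff[OF injA _ v, of "la x"] by simp
  have ob: "ob (\<epsilon> x) = B w \<longleftrightarrow> lb x = w" if "x \<in> {0..<n}" "w \<in> {0..<cb}" for x w
    using B[OF that(1)] inj_on_eq_iff[OF injB _ that(2), of "lb x"] by simp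
  have lists: "bij_betw (\<lambda>j. nb (m * v + j)) {0..<cnt v} (neighbours la lb n v)"
    "\<And>j. j \<in> {0..<cnt v} \<Longrightarrow> mlt (m * v + j) = int (card (fibre la lb n v (nb (m * v + j))))"
    using L unfolding lists_ok_def by blast+
  have nbs: "neighbours la lb n v \<subseteq> {0..<cb}" using B by (auto simp: neighbours_def)
  have "B ` neighbours la lb n v = {w \<in> ob ` W. {x \<in> W. oa x = A v \<and> ob x = w} \<noteq> {}}"
  proof (intro equalityI subsetI)
    fix w assume "w \<in> B ` neighbours la lb n v"
    then obtain x where x: "x \<in> {0..<n}" "la x = v" "w = ob (\<epsilon> x)" using B by (auto simp: neighbours_def)
    then show "w \<in> {w \<in> ob ` W. {x \<in> W. oa x = A v \<and> ob x = w} \<noteq> {}}" using oa W by blast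
  next
    fix w assume "w \<in> {w \<in> ob ` W. {x \<in> W. oa x = A v \<and> ob x = w} \<noteq> {}}"
    then obtain x where x: "x \<in> {0..<n}" "oa (\<epsilon> x) = A v" "ob (\<epsilon> x) = w" using W by blast
    then have "lb x \<in> neighbours la lb n v" "w = B (lb x)" using oa B by (auto simp: neighbours_def)
    then show "w \<in> B ` neighbours la lb n v" by blast
  qed
  then have "bij_betw B (neighbours la lb n v) {w \<in> ob ` W. {x \<in> W. oa x = A v \<and> ob x = w} \<noteq> {}}"
    using inj_on_subset[OF injB nbs] by (simp add: bij_betw_def)
  from bij_betw_trans[OF lists(1) this]
  show "bij_betw (\<lambda>j. B (nb (m * v + j))) {0..<cnt v} {w \<in> ob ` W. {x \<in> W. oa x = A v \<and> ob x = w} \<noteq> {}}"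
    by (simp add: comp_def)
  assume j: "j \<in> {0..<cnt v}"
  then have "nb (m * v + j) \<in> neighbours la lb n v" using lists(1) by (auto simp: bij_betw_def)
  then have r: "nb (m * v + j) \<in> {0..<cb}" using nbs by blast
  have "{x \<in> W. oa x = A v \<and> ob x = B (nb (m * v + j))} = \<epsilon> ` fibre la lb n v (nb (m * v + j))"
    using oa ob[OF _ r] unfolding W fibre_def by auto
  moreover have "inj_on \<epsilon> (fibre la lb n v (nb (m * v + j)))"
    by (rule inj_on_subset[OF inj]) (auto simp: fibre_def)
  ultimately have "card {x \<in> W. oa x = A v \<and> ob x = B (nb (m * v + j))} = card (fibre la lb n v (nb (m * v + j)))"
    by (simp add: card_image)
  then show "nb (m * v + j) \<in> {0..<cb} \<and> mlt (m * v + j) = int (card {x \<in> W. oa x = A v \<and> ob x = B (nb (m * v + j))})"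
    using r lists(2)[OF j] by simp
qed

lemma card_label_fibre:
  assumes L: "labelling g n l c"
    and g: "\<And>x y. x \<in> {0..<n} \<Longrightarrow> y \<in> {0..<n} \<Longrightarrow> g x = g y \<longleftrightarrow> y = x \<or> y = f x \<or> y = f (f x)"
  shows "card {x \<in> {0..<n}. l x = v} \<le> 3"
    and "(\<And>x. x \<in> {0..<n} \<Longrightarrow> f (f x) = x) \<Longrightarrow> card {x \<in> {0..<n}. l x = v} \<le> 2"
proof -
  have sub: "{y \<in> {0..<n}. l y = v} \<subseteq> {x, f x, f (f x)}" if x: "x \<in> {0..<n}" "l x = v" for x
  proof
    fix y assume "y \<in> {y \<in> {0..<n}. l y = v}"
    then show "y \<in> {x, f x, f (f x)}" using x labellingD(4)[OF L x(1), of y] g[OF x(1), of y] by simp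
  qed
  have c3: "card {x, y, z} \<le> 3" and c2: "card {x, y} \<le> 2" for x y z :: int
    by (simp_all add: card_insert_if)
  show "card {x \<in> {0..<n}. l x = v} \<le> 3"
  proof (cases "{x \<in> {0..<n}. l x = v} = {}")
    case False
    then obtain x where "x \<in> {0..<n}" "l x = v" by blast
    from card_mono[OF _ sub[OF this]] c3[of x "f x" "f (f x)"] show ?thesis by simp
  qed (metis card.empty zero_le)
  assume ff: "\<And>x. x \<in> {0..<n} \<Longrightarrow> f (f x) = x"
  show "card {x \<in> {0..<n}. l x = v} \<le> 2"
  proof (cases "{x \<in> {0..<n}. l x = v} = {}")
    case False
    then obtain x where x: "x \<in> {0..<n}" "l x = v" by blast
    then have "{y \<in> {0..<n}. l y = v} \<subseteq> {x, f x}" using sub[OF x] ff by auto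
    from card_mono[OF _ this] c2[of x "f x"] show ?thesis by simp
  qed (metis card.empty zero_le)
qed

context coset_program
begin

section \<open>The tables of the search as a description of the graph\<close>

definition edge_at :: "memory \<Rightarrow> int \<Rightarrow> imat set set" where
  "edge_at s k = coset (mem s k)"

lemma foundD:
  assumes "found s"
  shows "0 < s 32 0" "s 32 0 = int (card (edges G))" "mem s 0 = mat 1" "tabs s" "u_table s"
    "config (tiles s) (bdry s) (odds s)" "marked s" "A \<in> SL \<Longrightarrow> \<exists>k\<in>{0..<s 32 0}. key (mem s k) = key A"
    "k \<in> {0..<s 32 0} \<Longrightarrow> s 39 k \<in> {0..<s 32 0}"
    "k \<in> {0..<s 32 0} \<Longrightarrow> key (mem s (s 39 k)) = key (mem s k ** mS)"
    "k \<in> {0..<s 32 0} \<Longrightarrow> s 10 k \<in> {0..<s 32 0}"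
    "k \<in> {0..<s 32 0} \<Longrightarrow> key (mem s (s 10 k)) = key (mem s k ** mU)"
    "k \<in> {0..<s 32 0} \<Longrightarrow> mem s k \<in> SL"
  using assms u_tableD tabsD(1) unfolding found_def by blast+

lemma found_cong:
  assumes "found s" "\<And>a. a = 10 \<or> 32 \<le> a \<and> a \<le> 40 \<Longrightarrow> t a = s a"
  shows "found t"
proof -
  have "mem t = mem s" by (simp add: mem_def fun_eq_iff assms(2))
  moreover have "t 10 = s 10" "t 32 = s 32" "t 34 = s 34" "t 39 = s 39" "t 40 = s 40" by (simp_all add: assms(2))
  ultimately have "found t = found s"
    unfolding found_def tabs_def u_table_def tiles_def bdry_def odds_def marked_def by (simp only:)
  then show ?thesis using assms(1) by blast
qed

lemma found_edges:
  assumes s: "found s"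
  shows "bij_betw (edge_at s) {0..<s 32 0} (edges G)"
  using found_bij[OF foundD(4)[OF s]] foundD(8)[OF s] unfolding edge_at_def by blast

lemma edge_at_eq:
  assumes s: "found s" and "j \<in> {0..<s 32 0}" "k \<in> {0..<s 32 0}"
  shows "edge_at s j = edge_at s k \<longleftrightarrow> j = k"
  using found_edges[OF s] assms(2,3) by (meson bij_betw_def inj_on_eq_iff)

lemma edge_at_S:
  assumes s: "found s" and k: "k \<in> {0..<s 32 0}"
  shows "edge_at s (s 39 k) = coset (mem s k ** mS)" "s 39 (s 39 k) = k"
proof -
  note S = foundD(9)[OF s k] foundD(10)[OF s k] and M = foundD(13)[OF s]
  show "edge_at s (s 39 k) = coset (mem s k ** mS)"
    unfolding edge_at_def using coset_eq_iff[OF M[OF S(1)], of "mem s k ** mS"] M[OF k] S(2) by simp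
  have "key (mem s (s 39 (s 39 k))) = key (mem s (s 39 k) ** mS)" by (rule foundD(10)[OF s S(1)])
  also have "\<dots> = key ((mem s k ** mS) ** mS)"
    using key_mult_right[of "mem s (s 39 k)" "mem s k ** mS" mS] S M[OF S(1)] M[OF k] by simp
  also have "\<dots> = key (mem s k)" using M[OF k] by simp
  finally show "s 39 (s 39 k) = k" using tabs_key_inj[OF foundD(4)[OF s]] foundD(9)[OF s S(1)] k by blast
qed

lemma edge_at_U:
  assumes s: "found s" and k: "k \<in> {0..<s 32 0}"
  shows "edge_at s (s 10 k) = coset (mem s k ** mU)" "edge_at s (s 10 (s 10 k)) = coset ((mem s k ** mU) ** mU)"
    "s 10 (s 10 (s 10 k)) = k"
proof -
  note M = foundD(13)[OF s] and S = foundD(11)[OF s] and K = foundD(12)[OF s]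
  have k2: "key (mem s (s 10 (s 10 k))) = key ((mem s k ** mU) ** mU)"
    using K[OF S[OF k]] key_mult_right[of "mem s (s 10 k)" "mem s k ** mU" mU] K[OF k] M[OF S[OF k]] M[OF k] by simp
  show "edge_at s (s 10 k) = coset (mem s k ** mU)"
    unfolding edge_at_def using coset_eq_iff[OF M[OF S[OF k]], of "mem s k ** mU"] M[OF k] K[OF k] by simp
  show "edge_at s (s 10 (s 10 k)) = coset ((mem s k ** mU) ** mU)"
    unfolding edge_at_def using coset_eq_iff[OF M[OF S[OF S[OF k]]], of "(mem s k ** mU) ** mU"] M[OF k] k2 by simp
  have "key (mem s (s 10 (s 10 (s 10 k)))) = key (((mem s k ** mU) ** mU) ** mU)"
    using K[OF S[OF S[OF k]]] key_mult_right[of "mem s (s 10 (s 10 k))" "(mem s k ** mU) ** mU" mU] k2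
      M[OF S[OF S[OF k]]] M[OF k] by simp
  also have "\<dots> = key (mem s k)" using M[OF k] by simp
  finally show "s 10 (s 10 (s 10 k)) = k"
    using tabs_key_inj[OF foundD(4)[OF s]] S[OF S[OF S[OF k]]] k by blast
qed

lemma orbit0_edge:
  assumes s: "found s" and k: "k \<in> {0..<s 32 0}"
  shows "right_orbit G0 (edge_at s k) = {edge_at s k, edge_at s (s 39 k)}"
  using orbit0[OF foundD(13)[OF s k]] edge_at_S(1)[OF s k] by (simp add: edge_at_def)

lemma orbit1_edge:
  assumes s: "found s" and k: "k \<in> {0..<s 32 0}"
  shows "right_orbit G1 (edge_at s k) = {edge_at s k, edge_at s (s 10 k), edge_at s (s 10 (s 10 k))}"
  using orbit1[OF foundD(13)[OF s k]] edge_at_U(1,2)[OF s k] by (simp add: edge_at_def)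

text \<open>Written with the same three alternatives as \<open>orbit1_eq\<close>, so that
  \<open>wp_labels\<close> serves both types of vertices; here \<open>s 39\<close> is an
  involution.\<close>

lemma orbit0_eq:
  assumes s: "found s" and x: "x \<in> {0..<s 32 0}" and y: "y \<in> {0..<s 32 0}"
  shows "right_orbit G0 (edge_at s x) = right_orbit G0 (edge_at s y) \<longleftrightarrow> y = x \<or> y = s 39 x \<or> y = s 39 (s 39 x)"
proof -
  note r = foundD(9)[OF s x] foundD(9)[OF s y]
  note e = edge_at_eq[OF s x y] edge_at_eq[OF s r(1) y] edge_at_eq[OF s x r(2)] edge_at_eq[OF s r]
  show ?thesis unfolding orbit0_edge[OF s x] orbit0_edge[OF s y] doubleton_eq_iff e
    using edge_at_S(2)[OF s x] edge_at_S(2)[OF s y] by metis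
qed

lemma orbit1_eq:
  assumes s: "found s" and x: "x \<in> {0..<s 32 0}" and y: "y \<in> {0..<s 32 0}"
  shows "right_orbit G1 (edge_at s x) = right_orbit G1 (edge_at s y) \<longleftrightarrow> y = x \<or> y = s 10 x \<or> y = s 10 (s 10 x)"
proof
  note r = foundD(11)[OF s x] foundD(11)[OF s foundD(11)[OF s x]]
  assume "right_orbit G1 (edge_at s x) = right_orbit G1 (edge_at s y)"
  then have "edge_at s y \<in> {edge_at s x, edge_at s (s 10 x), edge_at s (s 10 (s 10 x))}"
    unfolding orbit1_edge[OF s x] orbit1_edge[OF s y] by blast
  then show "y = x \<or> y = s 10 x \<or> y = s 10 (s 10 x)"
    using edge_at_eq[OF s y x] edge_at_eq[OF s y r(1)] edge_at_eq[OF s y r(2)] by blast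
next
  assume "y = x \<or> y = s 10 x \<or> y = s 10 (s 10 x)"
  moreover have "right_orbit G1 (edge_at s (s 10 z)) = right_orbit G1 (edge_at s z)" if z: "z \<in> {0..<s 32 0}" for z
    unfolding orbit1_edge[OF s z] orbit1_edge[OF s foundD(11)[OF s z]] edge_at_U(3)[OF s z] by blast
  ultimately show "right_orbit G1 (edge_at s x) = right_orbit G1 (edge_at s y)"
    using x foundD(11)[OF s x] by metis
qed

lemma graph_output_found:
  assumes t: "found t" and n: "t 1 2 = t 32 0" "t 1 3 = 0"
    and L0: "labelling (\<lambda>x. right_orbit G0 (edge_at t x)) (t 32 0) (t 8) (t 1 0)"
    and L1: "labelling (\<lambda>x. right_orbit G1 (edge_at t x)) (t 32 0) (t 9) (t 1 1)"
    and l0: "lists_ok 2 (t 8) (t 9) (t 32 0) (t 2) (t 3) (t 4)"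
    and l1: "lists_ok 3 (t 9) (t 8) (t 32 0) (t 5) (t 6) (t 7)"
  shows "graph_output G t"
proof -
  let ?A = "vertex_of (\<lambda>x. right_orbit G0 (edge_at t x)) (t 32 0) (t 8)"
  let ?B = "vertex_of (\<lambda>x. right_orbit G1 (edge_at t x)) (t 32 0) (t 9)"
  note \<epsilon> = found_edges[OF t]
  have im: "edge_at t ` {0..<t 32 0} = edges G" using \<epsilon> by (simp add: bij_betw_def)
  show ?thesis
    unfolding graph_output_def
  proof (rule exI[of _ ?A], rule exI[of _ ?B], rule exI[of _ "edge_at t"], intro conjI)
    show "bij_betw ?A {0..<t 1 0} (vertices0 G)"
      using vertex_of_bij[OF L0] by (simp add: vertices0_def im[symmetric] image_image)
    show "bij_betw ?B {0..<t 1 1} (vertices1 G)"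
      using vertex_of_bij[OF L1] by (simp add: vertices1_def im[symmetric] image_image)
    show "bij_betw (edge_at t) {0..<t 1 2} (edges G)" using \<epsilon> n by simp
    show "t 1 3 \<in> {0..<t 1 2}" using n foundD(1)[OF t] by simp
    show "edge_at t (t 1 3) = G" using n foundD(3)[OF t] coset_one by (simp add: edge_at_def)
    show "\<forall>v\<in>{0..<t 1 0}.
         bij_betw (\<lambda>j. ?B (t 3 (2 * v + j))) {0..<t 2 v} {w \<in> vertices1 G. joining G (?A v) w \<noteq> {}} \<and>
         (\<forall>j\<in>{0..<t 2 v}. t 3 (2 * v + j) \<in> {0..<t 1 1} \<and>
            t 4 (2 * v + j) = int (card (joining G (?A v) (?B (t 3 (2 * v + j))))))"
    proof
      fix v assume v: "v \<in> {0..<t 1 0}"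
      note nl = neighbour_lists[OF \<epsilon> L0 L1 l0 v]
      show "bij_betw (\<lambda>j. ?B (t 3 (2 * v + j))) {0..<t 2 v} {w \<in> vertices1 G. joining G (?A v) w \<noteq> {}} \<and>
         (\<forall>j\<in>{0..<t 2 v}. t 3 (2 * v + j) \<in> {0..<t 1 1} \<and>
            t 4 (2 * v + j) = int (card (joining G (?A v) (?B (t 3 (2 * v + j))))))"
        unfolding joining_def vertices1_def using nl by blast
    qed
    show "\<forall>w\<in>{0..<t 1 1}.
         bij_betw (\<lambda>j. ?A (t 6 (3 * w + j))) {0..<t 5 w} {v \<in> vertices0 G. joining G v (?B w) \<noteq> {}} \<and>
         (\<forall>j\<in>{0..<t 5 w}. t 6 (3 * w + j) \<in> {0..<t 1 0} \<and>
            t 7 (3 * w + j) = int (card (joining G (?A (t 6 (3 * w + j))) (?B w))))"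
    proof
      fix w assume w: "w \<in> {0..<t 1 1}"
      note nl = neighbour_lists[OF \<epsilon> L1 L0 l1 w]
      have c: "joining G v w = {x \<in> edges G. right_orbit G1 x = w \<and> right_orbit G0 x = v}" for v w
        by (auto simp: joining_def)
      show "bij_betw (\<lambda>j. ?A (t 6 (3 * w + j))) {0..<t 5 w} {v \<in> vertices0 G. joining G v (?B w) \<noteq> {}} \<and>
         (\<forall>j\<in>{0..<t 5 w}. t 6 (3 * w + j) \<in> {0..<t 1 0} \<and>
            t 7 (3 * w + j) = int (card (joining G (?A (t 6 (3 * w + j))) (?B w))))"
        unfolding c vertices0_def using nl by blast
    qed
    show "\<forall>x\<in>{0..<t 1 2}.
         t 8 x \<in> {0..<t 1 0} \<and> ?A (t 8 x) = right_orbit G0 (edge_at t x) \<and>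
         t 9 x \<in> {0..<t 1 1} \<and> ?B (t 9 x) = right_orbit G1 (edge_at t x) \<and>
         (card (right_orbit G1 (edge_at t x)) = 3 \<longrightarrow>
            t 10 x \<in> {0..<t 1 2} \<and> edge_at t (t 10 x) = edge_at t x #>\<^bsub>PSL2Z\<^esub> u_class)"
    proof
      fix x assume "x \<in> {0..<t 1 2}"
      then have x: "x \<in> {0..<t 32 0}" by (simp only: n)
      have "edge_at t (t 10 x) = edge_at t x #>\<^bsub>PSL2Z\<^esub> u_class"
        using edge_at_U(1)[OF t x] coset_mult[OF foundD(13)[OF t x] mU_SL]
        by (simp add: edge_at_def u_class_def mU_def)
      then show "t 8 x \<in> {0..<t 1 0} \<and> ?A (t 8 x) = right_orbit G0 (edge_at t x) \<and>
         t 9 x \<in> {0..<t 1 1} \<and> ?B (t 9 x) = right_orbit G1 (edge_at t x) \<and>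
         (card (right_orbit G1 (edge_at t x)) = 3 \<longrightarrow>
            t 10 x \<in> {0..<t 1 2} \<and> edge_at t (t 10 x) = edge_at t x #>\<^bsub>PSL2Z\<^esub> u_class)"
        using labellingD(2)[OF L0 x] labellingD(2)[OF L1 x] vertex_of_label[OF L0 x] vertex_of_label[OF L1 x]
          foundD(11)[OF t x] n by simp
    qed
  qed
qed

section \<open>Correctness of the polygon\<close>

text \<open>For these boundary tiles \<open>A\<close> the group contains the rotation by \<pi> about
  \<open>A\<close> i, up to sign the conjugate of \<open>mS\<close> by \<open>A\<close>. It
  exchanges the two halves of the edge, which therefore has to be broken there.\<close>

definition inner_fixed :: "memory \<Rightarrow> imat set" where
  "inner_fixed t = mem t ` {k \<in> {0..<t 32 0}. t 40 k = 0 \<and> t 39 k = k}"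

definition glue :: "memory \<Rightarrow> imat \<Rightarrow> imat" where
  "glue t A = mem t (t 39 (inv_into {0..<t 32 0} (mem t) A))"

lemma glue_mem: "found t \<Longrightarrow> k \<in> {0..<t 32 0} \<Longrightarrow> glue t (mem t k) = mem t (t 39 k)"
  using inv_into_f_f[OF mem_inj[OF foundD(4)]] by (simp add: glue_def)

lemma mem_eq: "found t \<Longrightarrow> j \<in> {0..<t 32 0} \<Longrightarrow> k \<in> {0..<t 32 0} \<Longrightarrow> mem t j = mem t k \<longleftrightarrow> j = k"
  by (rule inj_on_eq_iff[OF mem_inj[OF foundD(4)]])

lemma free_boundary:
  assumes t: "found t"
  shows "bdry t - inner_fixed t = mem t ` {k \<in> {0..<t 32 0}. t 40 k = 0 \<and> t 39 k \<noteq> k}"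
proof -
  have "bdry t - inner_fixed t = mem t ` ({k \<in> {0..<t 32 0}. t 40 k = 0} - {k \<in> {0..<t 32 0}. t 40 k = 0 \<and> t 39 k = k})"
    unfolding bdry_def inner_fixed_def
    by (rule inj_on_image_set_diff[symmetric, OF mem_inj[OF foundD(4)[OF t]]]) auto
  also have "{k \<in> {0..<t 32 0}. t 40 k = 0} - {k \<in> {0..<t 32 0}. t 40 k = 0 \<and> t 39 k = k} =
    {k \<in> {0..<t 32 0}. t 40 k = 0 \<and> t 39 k \<noteq> k}" by blast
  finally show ?thesis .
qed

text \<open>If the partner were marked, the tile beyond its edge would be listed and marked too. But
  that tile has the key of tile k, so it is tile k, which is unmarked.\<close>

lemma glued_boundary:
  assumes t: "found t" and k: "k \<in> {0..<t 32 0}" "t 40 k = 0"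
  shows "t 40 (t 39 k) = 0"
proof (rule ccontr)
  assume "t 40 (t 39 k) \<noteq> 0"
  note r = foundD(9)[OF t k(1)] and M = foundD(13)[OF t]
  obtain l where l: "l \<in> {0..<t 32 0}" "t 40 l \<noteq> 0" "mem t l = mem t (t 39 k) ** mS \<or> mem t l = - (mem t (t 39 k) ** mS)"
    using foundD(7)[OF t] r \<open>t 40 (t 39 k) \<noteq> 0\<close> unfolding marked_def by blast
  have "key (mem t l) = key (mem t (t 39 k) ** mS)" using l(3) M[OF r] by auto
  also have "\<dots> = key (mem t k)" using foundD(10)[OF t r] edge_at_S(2)[OF t k(1)] by simp
  finally have "l = k" using tabs_key_inj[OF foundD(4)[OF t] l(1) k(1)] by blast
  then show False using l(2) k(2) by simp
qed

lemma div_mod_5: "(5 * k + c) div 5 = k" "(5 * k + c) mod 5 = c" if "0 \<le> c" "c < 5" for k c :: int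
  using that by auto

lemma valid_desc_iff:
  assumes "0 \<le> c" "c < 5"
  shows "valid_desc t (5 * k + c) \<longleftrightarrow> c = 0 \<and> t 40 k = 0 \<and> t 39 k \<noteq> k \<or>
    0 < c \<and> c < 3 \<and> t 40 k = 0 \<and> t 39 k = k \<or> 2 < c \<and> t 10 k = k"
  unfolding valid_desc_def div_mod_5[OF assms] ..

lemma desc_of_bij:
  assumes t: "found t"
  shows "bij_betw (desc_of t) {d \<in> {0..<5 * t 32 0}. valid_desc t d} (descs (bdry t) (inner_fixed t) (odds t))"
  unfolding bij_betw_def
proof
  let ?n = "t 32 0"
  have rng: "d div 5 \<in> {0..<?n}" if "d \<in> {0..<5 * ?n}" for d using that by auto
  show "inj_on (desc_of t) {d \<in> {0..<5 * ?n}. valid_desc t d}"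
  proof (rule inj_onI)
    fix d d' assume d: "d \<in> {d \<in> {0..<5 * ?n}. valid_desc t d}" "d' \<in> {d \<in> {0..<5 * ?n}. valid_desc t d}" "desc_of t d = desc_of t d'"
    have "d mod 5 = d' mod 5" using d(3) by (auto simp: desc_of_def)
    moreover have "d div 5 = d' div 5" using d mem_eq[OF t rng rng, of d d'] by (auto simp: desc_of_def)
    ultimately show "d = d'" by (metis div_mult_mod_eq)
  qed
  show "desc_of t ` {d \<in> {0..<5 * ?n}. valid_desc t d} = descs (bdry t) (inner_fixed t) (odds t)"
  proof (intro equalityI subsetI)
    fix x assume "x \<in> desc_of t ` {d \<in> {0..<5 * ?n}. valid_desc t d}"
    then obtain d where d: "d \<in> {0..<5 * ?n}" "valid_desc t d" "x = desc_of t d" by blast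
    define k where "k = d div 5"
    define c where "c = d mod 5"
    have k: "k \<in> {0..<?n}" using rng[OF d(1)] by (simp add: k_def)
    have c: "0 \<le> c" "c < 5" by (simp_all add: c_def)
    have x: "x = (nat c, mem t k)" by (simp add: d(3) desc_of_def k_def c_def)
    have "c = 0 \<and> t 40 k = 0 \<and> t 39 k \<noteq> k \<or> 0 < c \<and> c < 3 \<and> t 40 k = 0 \<and> t 39 k = k \<or> 2 < c \<and> t 10 k = k"
      using d(2) unfolding valid_desc_def k_def c_def .
    then consider "c = 0" "t 40 k = 0" "t 39 k \<noteq> k" | "c = 1 \<or> c = 2" "t 40 k = 0" "t 39 k = k" | "c = 3 \<or> c = 4" "t 10 k = k"
      using c by linarith
    then show "x \<in> descs (bdry t) (inner_fixed t) (odds t)"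
    proof cases
      case 1
      then have "mem t k \<in> bdry t - inner_fixed t" unfolding free_boundary[OF t] using k by (intro imageI) simp
      then show ?thesis using 1 by (simp add: x descs_def)
    next
      case 2
      then have "mem t k \<in> inner_fixed t" unfolding inner_fixed_def using k by (intro imageI) simp
      then show ?thesis using 2 by (auto simp: x descs_def)
    next
      case 3
      then have "mem t k \<in> odds t" unfolding odds_def using k by (intro imageI) simp
      then show ?thesis using 3 by (auto simp: x descs_def)
    qed
  next
    fix x assume x: "x \<in> descs (bdry t) (inner_fixed t) (odds t)"
    have "\<exists>k c. k \<in> {0..<?n} \<and> 0 \<le> c \<and> c < 5 \<and> x = (nat c, mem t k) \<and> valid_desc t (5 * k + c)"
      using x unfolding descs_def free_boundary[OF t] unfolding inner_fixed_def odds_def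
    proof (elim UnE)
      assume "x \<in> {0} \<times> mem t ` {k \<in> {0..<?n}. t 40 k = 0 \<and> t 39 k \<noteq> k}"
      then obtain k where "k \<in> {0..<?n}" "t 40 k = 0" "t 39 k \<noteq> k" "x = (0, mem t k)" by blast
      then show ?thesis using valid_desc_iff[of 0 t k] by (intro exI[of _ k] exI[of _ 0]) simp
    next
      assume "x \<in> {1, 2} \<times> mem t ` {k \<in> {0..<?n}. t 40 k = 0 \<and> t 39 k = k}"
      then obtain k c where k: "k \<in> {0..<?n}" "t 40 k = 0" "t 39 k = k" "x = (c, mem t k)" and c: "c = 1 \<or> c = 2" by blast
      from c have "0 \<le> int c" "int c < 5" "valid_desc t (5 * k + int c)"
        using valid_desc_iff[of "int c" t k] k by (elim disjE; simp)+
      then show ?thesis using k by (intro exI[of _ k] exI[of _ "int c"]) simp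
    next
      assume "x \<in> {3, 4} \<times> mem t ` {k \<in> {0..<?n}. t 10 k = k}"
      then obtain k c where k: "k \<in> {0..<?n}" "t 10 k = k" "x = (c, mem t k)" and c: "c = 3 \<or> c = 4" by blast
      from c have "0 \<le> int c" "int c < 5" "valid_desc t (5 * k + int c)"
        using valid_desc_iff[of "int c" t k] k by (elim disjE; simp)+
      then show ?thesis using k by (intro exI[of _ k] exI[of _ "int c"]) simp
    qed
    then obtain k c where k: "k \<in> {0..<?n}" "0 \<le> c" "c < 5" "x = (nat c, mem t k)" "valid_desc t (5 * k + c)" by blast
    have "5 * k + c \<in> {0..<5 * ?n}" using k by auto
    moreover have "x = desc_of t (5 * k + c)" unfolding desc_of_def div_mod_5[OF k(2,3)] by (rule k(4))
    ultimately show "x \<in> desc_of t ` {d \<in> {0..<5 * ?n}. valid_desc t d}" using k(5) by blast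
  qed
qed

lemma partner_code_correct:
  assumes t: "found t" and pd: "polygon_data (tiles t) (bdry t) (odds t) (inner_fixed t)"
    and d: "d \<in> {0..<5 * t 32 0}" "valid_desc t d"
  shows "partner_code t d \<in> {0..<5 * t 32 0}" "valid_desc t (partner_code t d)"
    "desc_of t (partner_code t d) = polygon_data.partner (glue t) (desc_of t d)"
proof -
  let ?n = "t 32 0"
  define k where "k = d div 5"
  define c where "c = d mod 5"
  have dk: "d = 5 * k + c" by (simp add: k_def c_def)
  have k: "k \<in> {0..<?n}" using d(1) by (auto simp: k_def)
  have c: "c = 0 \<or> c = 1 \<or> c = 2 \<or> c = 3 \<or> c = 4" unfolding c_def by presburger
  note p = polygon_data.partner_def[OF pd]
  note S = foundD(9)[OF t k]
  have *: "partner_code t d \<in> {0..<5 * ?n} \<and> valid_desc t (partner_code t d) \<and>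
    desc_of t (partner_code t d) = polygon_data.partner (glue t) (desc_of t d)"
  proof (cases "c = 0")
    case True
    then have v: "t 40 k = 0" "t 39 k \<noteq> k" using d(2) unfolding dk valid_desc_def by auto
    have "partner_code t d = 5 * t 39 k" using True by (simp add: partner_code_def dk)
    moreover have "valid_desc t (5 * t 39 k)"
      using glued_boundary[OF t k v(1)] edge_at_S(2)[OF t k] v(2) by (auto simp: valid_desc_def)
    ultimately show ?thesis using True S glue_mem[OF t k] by (auto simp: p desc_of_def dk)
  next
    case False
    have "d = 5 * k + 1 \<or> d = 5 * k + 2 \<or> d = 5 * k + 3 \<or> d = 5 * k + 4" using c False dk by auto
    then show ?thesis
    proof (elim disjE)
      assume e: "d = 5 * k + 1"
      then have "partner_code t d = 5 * k + 2" by (simp add: partner_code_def div_mod_5)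
      then show ?thesis using d(2) k valid_desc_iff[of 1 t k] valid_desc_iff[of 2 t k] valid_desc_iff[of 3 t k] valid_desc_iff[of 4 t k]
        unfolding e by (simp add: p desc_of_def div_mod_5)
    next
      assume e: "d = 5 * k + 2"
      then have "partner_code t d = 5 * k + 1" by (simp add: partner_code_def div_mod_5)
      then show ?thesis using d(2) k valid_desc_iff[of 1 t k] valid_desc_iff[of 2 t k] valid_desc_iff[of 3 t k] valid_desc_iff[of 4 t k]
        unfolding e by (simp add: p desc_of_def div_mod_5)
    next
      assume e: "d = 5 * k + 3"
      then have "partner_code t d = 5 * k + 4" by (simp add: partner_code_def div_mod_5)
      then show ?thesis using d(2) k valid_desc_iff[of 1 t k] valid_desc_iff[of 2 t k] valid_desc_iff[of 3 t k] valid_desc_iff[of 4 t k]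
        unfolding e by (simp add: p desc_of_def div_mod_5)
    next
      assume e: "d = 5 * k + 4"
      then have "partner_code t d = 5 * k + 3" by (simp add: partner_code_def div_mod_5)
      then show ?thesis using d(2) k valid_desc_iff[of 1 t k] valid_desc_iff[of 2 t k] valid_desc_iff[of 3 t k] valid_desc_iff[of 4 t k]
        unfolding e by (simp add: p desc_of_def div_mod_5)
    qed
  qed
  then show "partner_code t d \<in> {0..<5 * ?n}" "valid_desc t (partner_code t d)"
    "desc_of t (partner_code t d) = polygon_data.partner (glue t) (desc_of t d)" by blast+
qed

text \<open>Array 50 and \<open>desc_of\<close> number the descriptors bijectively, and
  \<open>dedge\<close> is injective on them. The involution on descriptors can thus be carried over
  to edges, and array 17 is its form on edge numbers.\<close>

lemma polygon_output_found:
  assumes t: "found t" and C: "compacted (valid_desc t) (5 * t 32 0) (t 11 0) (t 49) (t 50)"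
    and fl: "\<And>e. e \<in> {0..<t 11 0} \<Longrightarrow> filled t t e"
  shows "polygon_output G t"
proof -
  let ?n = "t 32 0" and ?E = "t 11 0" and ?V = "{d \<in> {0..<5 * t 32 0}. valid_desc t d}"
  let ?D = "descs (bdry t) (inner_fixed t) (odds t)"
  have pd: "polygon_data (tiles t) (bdry t) (odds t) (inner_fixed t)"
    using foundD(6)[OF t] by unfold_locales (auto simp: inner_fixed_def bdry_def)
  interpret pd: polygon_data "tiles t" "bdry t" "odds t" "inner_fixed t" by (rule pd)
  define \<delta> where "\<delta> e = desc_of t (t 50 e)" for e
  have bd: "bij_betw (t 50) {0..<?E} ?V" and ep: "\<And>e. e \<in> {0..<?E} \<Longrightarrow> t 49 (t 50 e) = e"
    using C unfolding compacted_def by blast+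
  have b\<delta>: "bij_betw \<delta> {0..<?E} ?D"
    using bij_betw_trans[OF bd desc_of_bij[OF t]] by (simp add: \<delta>_def[abs_def] comp_def)
  have \<delta>D: "\<delta> e \<in> ?D" if "e \<in> {0..<?E}" for e using b\<delta> that by (auto simp: bij_betw_def)
  have pe: "polygon_edge t e = dedge (\<delta> e)" if "e \<in> {0..<?E}" for e
    using fl[OF that] by (simp add: polygon_edge_def filled_def dedge_def base_def \<delta>_def)
  have im: "polygon_edge t ` {0..<?E} = dedge ` ?D"
  proof -
    have "polygon_edge t ` {0..<?E} = dedge ` \<delta> ` {0..<?E}" unfolding image_image by (rule image_cong) (simp_all add: pe)
    then show ?thesis using b\<delta> by (simp add: bij_betw_def)
  qed
  have inj: "inj_on (polygon_edge t) {0..<?E}"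
  proof -
    have "inj_on (dedge \<circ> \<delta>) {0..<?E}"
      using b\<delta> pd.inj_dedge by (intro comp_inj_on) (simp_all add: bij_betw_def)
    then show ?thesis by (rule inj_on_cong[THEN iffD2, rotated]) (simp add: pe)
  qed
  have partner: "t 17 e \<in> {0..<?E} \<and> \<delta> (t 17 e) = pd.partner (glue t) (\<delta> e)" if e: "e \<in> {0..<?E}" for e
  proof -
    have d: "t 50 e \<in> ?V" using bd e by (auto simp: bij_betw_def)
    note pc = partner_code_correct[OF t pd, of "t 50 e"]
    have "partner_code t (t 50 e) \<in> ?V" using d pc by blast
    then have "partner_code t (t 50 e) \<in> t 50 ` {0..<?E}" using bd by (simp only: bij_betw_def)
    then obtain e' where e': "e' \<in> {0..<?E}" "t 50 e' = partner_code t (t 50 e)" by (metis imageE)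
    have "t 17 e = t 49 (partner_code t (t 50 e))" using fl[OF e] by (simp add: filled_def)
    then have "t 17 e = e'" using ep[OF e'(1)] e'(2) by simp
    then show ?thesis using e' pc(3) d by (simp add: \<delta>_def)
  qed
  define \<sigma> where "\<sigma> x = dedge (pd.partner (glue t) (inv_into ?D dedge x))" for x
  have \<sigma>: "\<sigma> (dedge d) = dedge (pd.partner (glue t) d)" if "d \<in> ?D" for d
    using inv_into_f_f[OF pd.inj_dedge that] by (simp add: \<sigma>_def)
  have special: "special_polygon (domain (comps (bdry t) (odds t))) (dedge ` ?D) \<sigma>"
  proof (rule pd.special[where \<tau> = "glue t"])
    fix A assume "A \<in> bdry t - inner_fixed t"
    then obtain k where k: "k \<in> {0..<?n}" "t 40 k = 0" "t 39 k \<noteq> k" "A = mem t k"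
      unfolding free_boundary[OF t] by blast
    note S = foundD(9)[OF t k(1)]
    have "glue t A = mem t (t 39 k)" "glue t (glue t A) = A"
      using glue_mem[OF t k(1)] glue_mem[OF t S] edge_at_S(2)[OF t k(1)] k(4) by simp_all
    moreover have "t 39 k \<in> {k \<in> {0..<?n}. t 40 k = 0 \<and> t 39 k \<noteq> k}"
      using S glued_boundary[OF t k(1,2)] edge_at_S(2)[OF t k(1)] k(3) by simp
    moreover have "mem t (t 39 k) \<noteq> A" using mem_eq[OF t S k(1)] k by simp
    ultimately show "glue t A \<in> bdry t - inner_fixed t \<and> glue t A \<noteq> A \<and> glue t (glue t A) = A"
      unfolding free_boundary[OF t] by simp
  qed (rule \<sigma>)
  have fund: "fundamental_domain G (domain (comps (bdry t) (odds t)))"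
  proof (rule pd.fundamental[OF G_def X_SL X_adj X_minus])
    fix A assume A: "A \<in> SL"
    obtain k where k: "k \<in> {0..<?n}" "key (mem t k) = key A" using foundD(8)[OF t A] by blast
    then have "A ** adj (mem t k) \<in> X" using key_iff[OF A foundD(13)[OF t k(1)]] by simp
    then show "\<exists>B\<in>tiles t. A ** adj B \<in> X" using k(1) by (auto simp: tiles_def)
  next
    fix A B g h assume *: "A \<in> tiles t" "B \<in> tiles t" "g \<in> X" "h \<in> X" "g ** A = h ** B"
    obtain j k where jk: "j \<in> {0..<?n}" "A = mem t j" "k \<in> {0..<?n}" "B = mem t k" using * by (auto simp: tiles_def)
    have kg: "key (f ** mem t i) = key (mem t i)" if "f \<in> X" "i \<in> {0..<?n}" for f i
    proof -
      have f: "f \<in> SL" and M: "mem t i \<in> SL" using that X_SL foundD(13)[OF t] by auto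
      then have "(f ** mem t i) ** adj (mem t i) = f" by (simp add: matrix_mul_assoc[symmetric])
      then show ?thesis using key_iff[OF SL_mult[OF f M] M] that by simp
    qed
    have "key (mem t j) = key (mem t k)" using kg[OF *(3) jk(1)] kg[OF *(4) jk(3)] *(5) jk by simp
    then show "A = B" using tabs_key_inj[OF foundD(4)[OF t] jk(1,3)] jk by simp
  qed
  show ?thesis
    unfolding polygon_output_def
  proof (intro conjI ballI exI[of _ "domain (comps (bdry t) (odds t))"] exI[of _ \<sigma>] inj fund)
    fix e assume e: "e \<in> {0..<?E}"
    show "t 12 e \<in> {0, 1, 2}" using fl[OF e] by (auto simp: filled_def dkind_def)
    have "snd (\<delta> e) \<in> SL" by (rule pd.D_SL[OF \<delta>D[OF e]])
    then show "edge_matrix t e \<in> carrier SL2Z"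
      using fl[OF e] by (auto simp: filled_def \<delta>_def dmat_def)
    show "t 17 e \<in> {0..<?E}" using partner[OF e] by blast
    show "\<sigma> (polygon_edge t e) = polygon_edge t (t 17 e)"
      using partner[OF e] pe[OF e] pe[of "t 17 e"] \<sigma>[OF \<delta>D[OF e]] by simp
  next
    show "special_polygon (domain (comps (bdry t) (odds t))) (polygon_edge t ` {0..<?E}) \<sigma>"
      using special im by simp
  qed
qed

end

section \<open>The algorithm\<close>

text \<open>Arrays 45 and 46 are separate \<open>pos\<close> tables for the two types of vertices,
  both still 0 when first used. Cell 3 of array 1 is never written: its initial 0 is the
  distinguished edge, since tile 0 has the identity as matrix.\<close>

definition main :: "com \<Rightarrow> com" where
  "main kp = Seq (explore kp) (Seq (labels 39 8 0) (Seq (labels 10 9 1) (Seq (neigh 2 8 9 2 3 4 45)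
     (Seq (neigh 3 9 8 5 6 7 46) (Seq compact_prog (Seq fill (Store 1 (Const 2) (V 32))))))))"

context coset_program
begin

lemma wp_main:
  assumes s: "s 0 0 = int N" "\<And>a j. a \<noteq> 0 \<Longrightarrow> s a j = 0"
  shows "wp (main kp) s (\<lambda>c t. c \<le> index G * (10 * K + 5000) \<and> graph_output G t \<and> polygon_output G t)"
proof -
  let ?e = "card (edges G)"
  have ie: "index G = ?e" by (simp add: index_def edges_def)
  show ?thesis
    unfolding main_def wp_Seq ie
  proof (rule wp_mono[OF wp_explore[where s = s, OF s]])
    fix c1 t1
    assume "c1 \<le> ?e * (10 * K + 2000) \<and> found t1 \<and> (\<forall>a. a < 10 \<or> 10 < a \<and> a < 20 \<or> 41 < a \<longrightarrow> t1 a = s a)"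
    then have c1: "c1 \<le> ?e * (10 * K + 2000)" and F1: "found t1"
      and f1: "\<And>a. a < 10 \<or> 10 < a \<and> a < 20 \<or> 41 < a \<Longrightarrow> t1 a = s a" by blast+
    define n where "n = t1 32 0"
    have n: "0 \<le> n" "n = int ?e" "0 < ?e" using foundD(1,2)[OF F1] by (simp_all add: n_def)
    let ?g0 = "\<lambda>x. right_orbit G0 (edge_at t1 x)" and ?g1 = "\<lambda>x. right_orbit G1 (edge_at t1 x)"
    show "wp (labels 39 8 0) t1 (\<lambda>c2 t2. wp (labels 10 9 1) t2 (\<lambda>c3 t3. wp (neigh 2 8 9 2 3 4 45) t3 (\<lambda>c4 t4.
      wp (neigh 3 9 8 5 6 7 46) t4 (\<lambda>c5 t5. wp compact_prog t5 (\<lambda>c6 t6. wp fill t6 (\<lambda>c7 t7.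
      wp (Store 1 (Const 2) (V 32)) t7 (\<lambda>c8 t8. c1 + (c2 + (c3 + (c4 + (c5 + (c6 + (c7 + c8)))))) \<le> ?e * (10 * K + 5000) \<and>
        graph_output G t8 \<and> polygon_output G t8)))))))"
    proof (rule wp_mono[OF wp_labels[where n = n and g = ?g0]])
      show "0 \<le> t1 32 0" "t1 32 0 = n" using n by (simp_all add: n_def)
      show "t1 1 0 = 0" using f1[of 1] s(2) by simp
      show "t1 39 x \<in> {0..<n}" if "x \<in> {0..<n}" for x using foundD(9)[OF F1] that unfolding n_def .
      show "?g0 x = ?g0 y \<longleftrightarrow> y = x \<or> y = t1 39 x \<or> y = t1 39 (t1 39 x)" if "x \<in> {0..<n}" "y \<in> {0..<n}" for x y
        by (rule orbit0_eq[OF F1 that[unfolded n_def]])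
      show "(39::nat) \<notin> {1, 8, 42, 43, 44}" "(8::nat) \<notin> {1, 32, 42, 43, 44}" by simp_all
      fix c2 t2
      assume "c2 \<le> nat n * 100 + 20 \<and> labelling ?g0 n (t2 8) (t2 1 0) \<and>
        (\<forall>j. j \<noteq> 0 \<longrightarrow> t2 1 j = t1 1 j) \<and> (\<forall>a. a \<notin> {1, 8, 42, 43, 44} \<longrightarrow> t2 a = t1 a)"
      then have c2: "c2 \<le> nat n * 100 + 20" and L0: "labelling ?g0 n (t2 8) (t2 1 0)"
        and o2: "\<And>j. j \<noteq> 0 \<Longrightarrow> t2 1 j = t1 1 j" and f2: "\<And>a. a \<notin> {1, 8, 42, 43, 44} \<Longrightarrow> t2 a = t1 a" by blast+
      have t2: "t2 32 = t1 32" "t2 10 = t1 10" by (simp_all add: f2)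
      show "wp (labels 10 9 1) t2 (\<lambda>c3 t3. wp (neigh 2 8 9 2 3 4 45) t3 (\<lambda>c4 t4.
        wp (neigh 3 9 8 5 6 7 46) t4 (\<lambda>c5 t5. wp compact_prog t5 (\<lambda>c6 t6. wp fill t6 (\<lambda>c7 t7.
        wp (Store 1 (Const 2) (V 32)) t7 (\<lambda>c8 t8. c1 + (c2 + (c3 + (c4 + (c5 + (c6 + (c7 + c8)))))) \<le> ?e * (10 * K + 5000) \<and>
          graph_output G t8 \<and> polygon_output G t8))))))"
      proof (rule wp_mono[OF wp_labels[where n = n and g = ?g1]])
        show "0 \<le> t2 32 0" "t2 32 0 = n" using n t2 by (simp_all add: n_def)
        show "t2 1 1 = 0" using o2[of 1] f1[of 1] s(2) by simp
        show "t2 10 x \<in> {0..<n}" if "x \<in> {0..<n}" for x unfolding t2 using foundD(11)[OF F1] that unfolding n_def .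
        show "?g1 x = ?g1 y \<longleftrightarrow> y = x \<or> y = t2 10 x \<or> y = t2 10 (t2 10 x)" if "x \<in> {0..<n}" "y \<in> {0..<n}" for x y
          unfolding t2 by (rule orbit1_eq[OF F1 that[unfolded n_def]])
        show "(10::nat) \<notin> {1, 9, 42, 43, 44}" "(9::nat) \<notin> {1, 32, 42, 43, 44}" by simp_all
        fix c3 t3
        assume "c3 \<le> nat n * 100 + 20 \<and> labelling ?g1 n (t3 9) (t3 1 1) \<and>
          (\<forall>j. j \<noteq> 1 \<longrightarrow> t3 1 j = t2 1 j) \<and> (\<forall>a. a \<notin> {1, 9, 42, 43, 44} \<longrightarrow> t3 a = t2 a)"
        then have c3: "c3 \<le> nat n * 100 + 20" and L1: "labelling ?g1 n (t3 9) (t3 1 1)"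
          and o3: "\<And>j. j \<noteq> 1 \<Longrightarrow> t3 1 j = t2 1 j" and f3': "\<And>a. a \<notin> {1, 9, 42, 43, 44} \<Longrightarrow> t3 a = t2 a" by blast+
        have t3: "t3 8 = t2 8" "t3 1 0 = t2 1 0" using f3' o3 by simp_all
        have L0': "labelling ?g0 n (t3 8) (t3 1 0)" using L0 unfolding t3 .
        have z3: "t3 1 3 = 0" using o3[of 3] o2[of 3] f1[of 1] s(2) by simp
        have f3: "t3 a = t1 a" if "a \<notin> {1, 8, 9, 42, 43, 44}" for a using f3'[of a] f2[of a] that by simp
        have lab: "t3 8 x \<in> {0..<n}" "t3 9 x \<in> {0..<n}" if "x \<in> {0..<n}" for x
          using labellingD(2)[OF L0' that] labelling_le[OF L0' n(1)] labellingD(2)[OF L1 that] labelling_le[OF L1 n(1)] by auto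
        have w0: "card {x \<in> {0..<n}. t3 8 x = v} \<le> nat 2" for v
        proof -
          have "card {x \<in> {0..<n}. t3 8 x = v} \<le> 2"
            using edge_at_S(2)[OF F1] unfolding n_def[symmetric]
            by (intro card_label_fibre(2)[OF L0'[unfolded n_def[symmetric]], where f = "t1 39"] orbit0_eq[OF F1, folded n_def]) auto
          then show ?thesis by simp
        qed
        have w1: "card {x \<in> {0..<n}. t3 9 x = v} \<le> nat 3" for v
        proof -
          have "card {x \<in> {0..<n}. t3 9 x = v} \<le> 3"
            by (rule card_label_fibre(1)[OF L1, where f = "t1 10"]) (rule orbit1_eq[OF F1, folded n_def])
          then show ?thesis by simp
        qed
        show "wp (neigh 2 8 9 2 3 4 45) t3 (\<lambda>c4 t4.
          wp (neigh 3 9 8 5 6 7 46) t4 (\<lambda>c5 t5. wp compact_prog t5 (\<lambda>c6 t6. wp fill t6 (\<lambda>c7 t7.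
          wp (Store 1 (Const 2) (V 32)) t7 (\<lambda>c8 t8. c1 + (c2 + (c3 + (c4 + (c5 + (c6 + (c7 + c8)))))) \<le> ?e * (10 * K + 5000) \<and>
            graph_output G t8 \<and> polygon_output G t8)))))"
        proof (rule wp_mono[OF wp_neigh[where n = n]])
          show "0 \<le> n" "t3 32 0 = n" using n f3[of 32] by (simp_all add: n_def)
          show "t3 2 j = 0" "t3 45 j = 0" for j using f3[of 2] f1[of 2] f3[of 45] f1[of 45] s(2) by simp_all
          show "t3 8 x \<in> {0..<n} \<and> t3 9 x \<in> {0..<n}" if "x \<in> {0..<n}" for x using lab[OF that] by blast
          show "card {x \<in> {0..<n}. t3 8 x = v} \<le> nat 2" for v by (rule w0)
          fix c4 t4
          assume "c4 \<le> nat n * 150 + 20 \<and> lists_ok 2 (t3 8) (t3 9) n (t4 2) (t4 3) (t4 4) \<and>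
            (\<forall>a. a \<notin> {2, 3, 4, 45, 42, 43, 44, 47, 48} \<longrightarrow> t4 a = t3 a)"
          then have c4: "c4 \<le> nat n * 150 + 20" and l4: "lists_ok 2 (t3 8) (t3 9) n (t4 2) (t4 3) (t4 4)"
            and f4: "\<And>a. a \<notin> {2, 3, 4, 45, 42, 43, 44, 47, 48} \<Longrightarrow> t4 a = t3 a" by blast+
          have t4: "t4 8 = t3 8" "t4 9 = t3 9" by (simp_all add: f4)
          show "wp (neigh 3 9 8 5 6 7 46) t4 (\<lambda>c5 t5. wp compact_prog t5 (\<lambda>c6 t6. wp fill t6 (\<lambda>c7 t7.
            wp (Store 1 (Const 2) (V 32)) t7 (\<lambda>c8 t8. c1 + (c2 + (c3 + (c4 + (c5 + (c6 + (c7 + c8)))))) \<le> ?e * (10 * K + 5000) \<and>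
              graph_output G t8 \<and> polygon_output G t8))))"
          proof (rule wp_mono[OF wp_neigh[where n = n]])
            show "0 \<le> n" "t4 32 0 = n" using n f4[of 32] f3[of 32] by (simp_all add: n_def)
            show "t4 5 j = 0" "t4 46 j = 0" for j
              using f4[of 5] f3[of 5] f1[of 5] f4[of 46] f3[of 46] f1[of 46] s(2) by simp_all
            show "t4 9 x \<in> {0..<n} \<and> t4 8 x \<in> {0..<n}" if "x \<in> {0..<n}" for x using lab[OF that] t4 by simp
            show "card {x \<in> {0..<n}. t4 9 x = v} \<le> nat 3" for v unfolding t4 by (rule w1)
            fix c5 t5
            assume "c5 \<le> nat n * 150 + 20 \<and> lists_ok 3 (t4 9) (t4 8) n (t5 5) (t5 6) (t5 7) \<and>
              (\<forall>a. a \<notin> {5, 6, 7, 46, 42, 43, 44, 47, 48} \<longrightarrow> t5 a = t4 a)"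
            then have c5: "c5 \<le> nat n * 150 + 20" and l5: "lists_ok 3 (t4 9) (t4 8) n (t5 5) (t5 6) (t5 7)"
              and f5: "\<And>a. a \<notin> {5, 6, 7, 46, 42, 43, 44, 47, 48} \<Longrightarrow> t5 a = t4 a" by blast+
            show "wp compact_prog t5 (\<lambda>c6 t6. wp fill t6 (\<lambda>c7 t7.
              wp (Store 1 (Const 2) (V 32)) t7 (\<lambda>c8 t8. c1 + (c2 + (c3 + (c4 + (c5 + (c6 + (c7 + c8)))))) \<le> ?e * (10 * K + 5000) \<and>
                graph_output G t8 \<and> polygon_output G t8)))"
            proof (rule wp_mono[OF wp_compact[where n = n]])
              show "0 \<le> n" "t5 32 0 = n" using n f5[of 32] f4[of 32] f3[of 32] by (simp_all add: n_def)
              show "t5 11 0 = 0" using f5[of 11] f4[of 11] f3[of 11] f1[of 11] s(2) by simp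
              fix c6 t6
              assume "c6 \<le> nat n * 700 + 40 \<and> compacted (valid_desc t5) (5 * n) (t6 11 0) (t6 49) (t6 50) \<and>
                (\<forall>a. a \<notin> {11, 42, 43, 44, 49, 50, 51} \<longrightarrow> t6 a = t5 a)"
              then have c6: "c6 \<le> nat n * 700 + 40" and C6: "compacted (valid_desc t5) (5 * n) (t6 11 0) (t6 49) (t6 50)"
                and f6: "\<And>a. a \<notin> {11, 42, 43, 44, 49, 50, 51} \<Longrightarrow> t6 a = t5 a" by blast+
              have E6: "0 \<le> t6 11 0" "t6 11 0 \<le> 5 * n" using C6 unfolding compacted_def by blast+
              show "wp fill t6 (\<lambda>c7 t7.
                wp (Store 1 (Const 2) (V 32)) t7 (\<lambda>c8 t8. c1 + (c2 + (c3 + (c4 + (c5 + (c6 + (c7 + c8)))))) \<le> ?e * (10 * K + 5000) \<and>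
                  graph_output G t8 \<and> polygon_output G t8))"
              proof (rule wp_mono[OF wp_fill[where s = t6, OF E6]])
                fix c7 t7
                assume "c7 \<le> nat (5 * n) * 130 + 20 \<and> (\<forall>e\<in>{0..<t6 11 0}. filled t6 t7 e) \<and>
                  (\<forall>a. a \<notin> {12, 13, 14, 15, 16, 17, 42, 43, 44, 47, 48} \<longrightarrow> t7 a = t6 a)"
                then have c7: "c7 \<le> nat (5 * n) * 130 + 20" and F7: "\<And>e. e \<in> {0..<t6 11 0} \<Longrightarrow> filled t6 t7 e"
                  and f7: "\<And>a. a \<notin> {12, 13, 14, 15, 16, 17, 42, 43, 44, 47, 48} \<Longrightarrow> t7 a = t6 a" by blast+
                define t8 where "t8 = upd 1 2 (t7 32 0) t7"
                have same: "t8 a = t7 a" if "a \<noteq> 1" for a using that by (simp add: t8_def)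
                have k: "t8 a = t1 a" if "a = 10 \<or> 32 \<le> a \<and> a \<le> 40" for a
                  using that same[of a] f7[of a] f6[of a] f5[of a] f4[of a] f3[of a] by auto
                have F8: "found t8" by (rule found_cong[OF F1 k])
                have n8: "t8 32 0 = n" using k[of 32] by (simp add: n_def)
                have g: "edge_at t8 = edge_at t1" by (simp add: edge_at_def[abs_def] mem_def k)
                have t8: "t8 8 = t3 8" "t8 9 = t3 9" "t8 2 = t4 2" "t8 3 = t4 3" "t8 4 = t4 4" "t8 5 = t5 5" "t8 6 = t5 6" "t8 7 = t5 7"
                  "t8 11 = t6 11" "t8 49 = t6 49" "t8 50 = t6 50"
                  using same f7 f6 f5 f4 by simp_all
                have o8: "t8 1 j = t3 1 j" if "j \<noteq> 2" for j using that f7[of 1] f6[of 1] f5[of 1] f4[of 1] by (simp add: t8_def)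
                have l8: "t8 1 0 = t3 1 0" "t8 1 1 = t3 1 1" by (rule o8; simp)+
                have "graph_output G t8"
                proof (rule graph_output_found[OF F8])
                  show "t8 1 2 = t8 32 0" by (simp add: t8_def)
                  show "t8 1 3 = 0" using o8[of 3] z3 by simp
                  show "labelling (\<lambda>x. right_orbit G0 (edge_at t8 x)) (t8 32 0) (t8 8) (t8 1 0)"
                    unfolding g n8 t8 l8 by (rule L0')
                  show "labelling (\<lambda>x. right_orbit G1 (edge_at t8 x)) (t8 32 0) (t8 9) (t8 1 1)"
                    unfolding g n8 t8 l8 by (rule L1)
                  show "lists_ok 2 (t8 8) (t8 9) (t8 32 0) (t8 2) (t8 3) (t8 4)" unfolding n8 t8 by (rule l4)
                  show "lists_ok 3 (t8 9) (t8 8) (t8 32 0) (t8 5) (t8 6) (t8 7)" unfolding n8 t8 using l5 unfolding t4 .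
                qed
                moreover have "polygon_output G t8"
                proof (rule polygon_output_found[OF F8])
                  have "t5 10 = t8 10" "t5 39 = t8 39" "t5 40 = t8 40" using k f5 f4 f3 by simp_all
                  then have "valid_desc t5 = valid_desc t8" by (simp add: valid_desc_def[abs_def])
                  then show "compacted (valid_desc t8) (5 * t8 32 0) (t8 11 0) (t8 49) (t8 50)"
                    using C6 unfolding n8 t8 by simp
                  fix e assume "e \<in> {0..<t8 11 0}"
                  then have "filled t6 t7 e" unfolding t8 by (rule F7)
                  moreover have "t6 a = t8 a" if "a \<in> {35, 36, 37, 38, 39, 49, 50}" for a
                    using that f7[of a] same[of a] by auto
                  then have "mem t6 = mem t8" "t6 39 = t8 39" "t6 49 = t8 49" "t6 50 = t8 50" by (simp_all add: mem_def[abs_def])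
                  ultimately show "filled t8 t8 e"
                    using same[of 12] same[of 13] same[of 14] same[of 15] same[of 16] same[of 17]
                    by (simp add: filled_def edge_matrix_def desc_of_def partner_code_def)
                qed
                moreover have "c1 + (c2 + (c3 + (c4 + (c5 + (c6 + (c7 + 4)))))) \<le> ?e * (10 * K + 5000)"
                proof -
                  \<comment> \<open>The passes cost at most 1850 per tile plus fewer than 200 in
                    total, and there is at least one tile.\<close>
                  have "c2 + (c3 + (c4 + (c5 + (c6 + (c7 + 4))))) \<le> ?e * 3000"
                    using c2 c3 c4 c5 c6 c7 n(3) unfolding n(2) by (simp add: nat_mult_distrib)
                  then show ?thesis using c1 by (simp add: algebra_simps)
                qed
                ultimately show "wp (Store 1 (Const 2) (V 32)) t7 (\<lambda>c8 t8. c1 + (c2 + (c3 + (c4 + (c5 + (c6 + (c7 + c8)))))) \<le> ?e * (10 * K + 5000) \<and>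
                  graph_output G t8 \<and> polygon_output G t8)"
                  by (simp add: wp_Store t8_def)
              qed
            qed
          qed simp_all
        qed simp_all
      qed
    qed
  qed
qed

lemma constructed:
  assumes "N > 0"
  shows "\<exists>n t. exec (main kp) (input N) n t \<and> graph_output G t \<and> polygon_output G t \<and>
    real n \<le> real (index G) * real (10 * K + 5000)"
proof -
  have "wp (main kp) (input N) (\<lambda>c t. c \<le> index G * (10 * K + 5000) \<and> graph_output G t \<and> polygon_output G t)"
    by (rule wp_main) (simp_all add: input_def)
  then obtain n t where e: "exec (main kp) (input N) n t" "graph_output G t" "polygon_output G t"
    and n: "n \<le> index G * (10 * K + 5000)" unfolding wp_def by blast
  from n have "real n \<le> real (index G * (10 * K + 5000))" by (rule of_nat_mono)
  then show ?thesis using e by (intro exI[of _ n] exI[of _ t]) simp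
qed

end

section \<open>Logarithmic bounds and the five series\<close>

lemma O_P_log_affine:
  assumes "0 \<le> C" "\<And>N. N \<ge> 1 \<Longrightarrow> 0 \<le> a N" "\<And>N. N \<ge> 1 \<Longrightarrow> a N \<le> C * ln (real N) + C"
  shows "O_P_log a"
  unfolding O_P_log_def
proof (intro exI[of _ "[:C, C:]"] allI impI)
  fix N :: nat assume N: "N \<ge> 1"
  then have "0 \<le> ln (real N)" by simp
  then have "poly [:C, C:] (ln (real N)) \<ge> 0" using assms(1) by simp
  then show "\<bar>a N\<bar> \<le> \<bar>poly [:C, C:] (ln (real N))\<bar>" using assms(2,3)[OF N] by (simp add: algebra_simps)
qed

definition bits :: "nat \<Rightarrow> nat" where
  "bits N = (LEAST l. N < 2 ^ l)"

lemma bits: "N < 2 ^ bits N"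
  unfolding bits_def by (rule LeastI[of _ N]) (rule less_exp)

lemma bits_le:
  assumes "N \<ge> 1"
  shows "real (bits N) \<le> 2 * ln (real N) + 1"
proof (cases "bits N")
  case (Suc l)
  then have "\<not> N < 2 ^ l" unfolding bits_def using not_less_Least by (metis lessI)
  then have "2 ^ l \<le> real N" by (metis not_less of_nat_le_iff of_nat_numeral of_nat_power)
  then have "ln (2 ^ l) \<le> ln (real N)" using assms by (subst ln_le_cancel_iff) auto
  then have "real l * ln 2 \<le> ln (real N)" by (simp add: ln_realpow)
  \<comment> \<open>Since ln 2 is at least 1/2, the number of bits is at most twice the natural
    logarithm, plus 1.\<close>
  moreover have "real l * (1/2) \<le> real l * ln 2" using ln2_ge_two_thirds by (intro mult_left_mono) auto
  ultimately show ?thesis using Suc by simp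
qed (use assms in simp)

text \<open>The key program \<open>kp\<close> is one and the same for all levels and reads
  \<open>N\<close> from memory; only its cost bound \<open>K N\<close> depends on the level. This is
  what makes the result a single algorithm for each series.\<close>

lemma constructible:
  assumes kp: "\<And>N. N > 0 \<Longrightarrow> coset_program (Y N) (key N) N kp (K N)"
    and \<G>: "\<And>N. \<G> N = cls ` Y N"
    and K: "\<And>N. N > 0 \<Longrightarrow> real (K N) \<le> 1000 * ln (real N) + 1000"
  shows "\<exists>(c :: com) (a :: nat \<Rightarrow> real). O_P_log a \<and>
    (\<forall>N\<ge>1. \<exists>n t. exec c (input N) n t \<and>
       graph_output (\<G> N) t \<and> polygon_output (\<G> N) t \<and>
       real n \<le> real (index (\<G> N)) * a N)"
proof (intro exI[of _ "main kp"] exI[of _ "\<lambda>N. real (10 * K N + 5000)"] conjI allI impI)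
  show "O_P_log (\<lambda>N. real (10 * K N + 5000))"
  proof (rule O_P_log_affine[where C = 15000])
    fix N :: nat assume N: "N \<ge> 1"
    then have "0 \<le> ln (real N)" "real (K N) \<le> 1000 * ln (real N) + 1000" using K[of N] by simp_all
    then show "real (10 * K N + 5000) \<le> 15000 * ln (real N) + 15000" unfolding of_nat_add of_nat_mult of_nat_numeral by linarith
  qed simp_all
  fix N :: nat assume "N \<ge> 1"
  then have N: "N > 0" by simp
  interpret coset_program "Y N" "key N" N kp "K N" by (rule kp[OF N])
  show "\<exists>n t. exec (main kp) (input N) n t \<and> graph_output (\<G> N) t \<and> polygon_output (\<G> N) t \<and>
    real n \<le> real (index (\<G> N)) * real (10 * K N + 5000)"
    using constructed[OF N] unfolding \<G> G_def .
qed

lemma key0_cost: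
  assumes N: "N > 0"
  shows "2 * (int N * int N) < 2 ^ (2 * bits N + 1)"
proof -
  have b: "int N < 2 ^ bits N" using bits[of N, folded of_nat_less_iff[where 'a = int]] by simp
  have "int N * int N < 2 ^ bits N * 2 ^ bits N" by (rule mult_strict_mono[OF b b _ of_nat_0_le_iff]) (rule zero_less_power, rule zero_less_numeral)
  moreover have "(2::int) ^ (2 * bits N + 1) = 2 * (2 ^ bits N * 2 ^ bits N)" by (metis power_add mult_2 power_Suc Suc_eq_plus1)
  ultimately show ?thesis by linarith
qed

lemma key0_program:
  assumes "N > 0"
  shows "key_prog N (key0_prog 22 23) (key0 N) (60 * (2 * bits N + 1) + 100)"
    "key_prog N (key0_prog 21 20) (key0 N \<circ> swap) (60 * (2 * bits N + 1) + 100)"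
  using key0_prog[OF assms key0_cost[OF assms], of 22 23 id] key0_prog[OF assms key0_cost[OF assms], of 21 20 swap]
  by (simp_all add: regs_def)

theorem theorem3:
  fixes \<G> :: "nat \<Rightarrow> (int ^ 2 ^ 2) set set"
  assumes "\<G> \<in> {Gamma_lower0, Gamma_upper0, Gamma_lower1, Gamma_upper1, Gamma_principal}"
  shows "\<exists>(c :: com) (a :: nat \<Rightarrow> real). O_P_log a \<and>
    (\<forall>N\<ge>1. \<exists>n t. exec c (input N) n t \<and>
       graph_output (\<G> N) t \<and> polygon_output (\<G> N) t \<and>
       real n \<le> real (index (\<G> N)) * a N)"
proof -
  have K0: "real (60 * (2 * bits N + 1) + 100) \<le> 1000 * ln (real N) + 1000" if "N > 0" for N
  proof -
    have "real (bits N) \<le> 2 * ln (real N) + 1" "0 \<le> ln (real N)" using bits_le[of N] that by simp_all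
    then show ?thesis by simp
  qed
  have K1: "real 100 \<le> 1000 * ln (real N) + 1000" if "N > 0" for N :: nat
  proof -
    have "0 \<le> ln (real N)" using that by simp
    then show ?thesis by simp
  qed
  consider "\<G> = Gamma_lower0" | "\<G> = Gamma_upper0" | "\<G> = Gamma_lower1" | "\<G> = Gamma_upper1" | "\<G> = Gamma_principal"
    using assms by blast
  then show ?thesis
  proof cases
    case 1
    show ?thesis
    proof (rule constructible[where Y = "X0" and key = "key0" and kp = "key0_prog 22 23" and K = "\<lambda>N. 60 * (2 * bits N + 1) + 100"])
      show "coset_program (X0 N) (key0 N) N (key0_prog 22 23) (60 * (2 * bits N + 1) + 100)" if "N > 0" for N
        by (rule coset_program.intro[OF coset_key0[OF that] coset_program_axioms.intro[OF key0_program(1)[OF that]]])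
      show "\<G> N = cls ` X0 N" for N unfolding 1 by (rule Gamma_lower0_eq)
    qed (rule K0)
  next
    case 2
    show ?thesis
    proof (rule constructible[where Y = "\<lambda>N. swap ` X0 N" and key = "\<lambda>N. key0 N \<circ> swap" and kp = "key0_prog 21 20" and K = "\<lambda>N. 60 * (2 * bits N + 1) + 100"])
      show "coset_program (swap ` X0 N) (key0 N \<circ> swap) N (key0_prog 21 20) (60 * (2 * bits N + 1) + 100)" if "N > 0" for N
        by (rule coset_program.intro[OF coset_key_swap[OF coset_key0[OF that]] coset_program_axioms.intro[OF key0_program(2)[OF that]]])
      show "\<G> N = cls ` swap ` X0 N" for N unfolding 2 by (rule Gamma_upper0_eq)
    qed (rule K0)
  next
    case 3
    show ?thesis
    proof (rule constructible[where Y = "X1" and key = "key1" and kp = "key1_prog 22 23" and K = "\<lambda>_. 100"])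
      show "coset_program (X1 N) (key1 N) N (key1_prog 22 23) 100" if "N > 0" for N
        by (rule coset_program.intro[OF coset_key1[OF that] coset_program_axioms.intro[OF key1_prog_lower]])
      show "\<G> N = cls ` X1 N" for N unfolding 3 by (rule Gamma_lower1_eq)
    qed (rule K1)
  next
    case 4
    show ?thesis
    proof (rule constructible[where Y = "\<lambda>N. swap ` X1 N" and key = "\<lambda>N. key1 N \<circ> swap" and kp = "key1_prog 21 20" and K = "\<lambda>_. 100"])
      show "coset_program (swap ` X1 N) (key1 N \<circ> swap) N (key1_prog 21 20) 100" if "N > 0" for N
        by (rule coset_program.intro[OF coset_key_swap[OF coset_key1[OF that]] coset_program_axioms.intro[OF key1_prog_upper]])
      show "\<G> N = cls ` swap ` X1 N" for N unfolding 4 by (rule Gamma_upper1_eq)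
    qed (rule K1)
  next
    case 5
    show ?thesis
    proof (rule constructible[where Y = "XP" and key = "keyP" and kp = "keyP_prog" and K = "\<lambda>_. 100"])
      show "coset_program (XP N) (keyP N) N keyP_prog 100" if "N > 0" for N
        by (rule coset_program.intro[OF coset_keyP[OF that] coset_program_axioms.intro[OF keyP_prog]])
      show "\<G> N = cls ` XP N" for N unfolding 5 by (rule Gamma_principal_eq)
    qed (rule K1)
  qed
qed

end
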